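(* Let $\varphi\colon\mathbb{C}^n\to\mathbb{R}$ be smooth and plurisubharmonic. Then $\square^\varphi_{0,n}$ has compact resolvent on $L^2_{0,n}(\mathbb{C}^n,e^{-\varphi})$ if and only if the magnetic Schrödinger operator $-\Delta_A+V$ has compact resolvent on $L^2(\mathbb{R}^{2n})$, where, with $z_j=x_j+iy_j$, $$\Delta_A=\sum_{j=1}^n\left[\left(-\frac{\partial}{\partial x_j}-\frac{i}{2}\frac{\partial\varphi}{\partial y_j}\right)^2+\left(-\frac{\partial}{\partial y_j}+\frac{i}{2}\frac{\partial\varphi}{\partial x_j}\right)^2\right],\qquad V=2\operatorname{tr}(M_\varphi).$$ In particular, if there is $1\le q\le n$ such that $\square^\varphi_{0,q}$ has compact resolvent, then $$\lim_{z\to\infty}\int_{B(z,1)}\operatorname{tr}(M_\varphi)^2\,d\lambda=+\infty .$$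
   Context: Let $\lambda$ be Lebesgue measure on $\mathbb{C}^n\cong\mathbb{R}^{2n}$, $B(z,1)$ the Euclidean ball of radius $1$ centered at $z\in\mathbb{C}^n$; $z\to\infty$ means $|z|\to\infty$. Complex Hessian: $M_\varphi(z)=\left(\frac{\partial^2\varphi}{\partial z_j\partial\overline z_k}(z)\right)_{j,k=1}^n$, and $\operatorname{tr}$ denotes the trace. Weighted forms: $L^2_{0,q}(\mathbb{C}^n,e^{-\varphi})$ is the Hilbert space of $(0,q)$-forms $u=\sum'_{|J|=q}u_J\,d\overline z_J$ (the primed sum runs over increasing multiindices $J=(j_1,\dots,j_q)$ only, and $d\overline z_J=d\overline z_{j_1}\wedge\dots\wedge d\overline z_{j_q}$) with inner product $(u,v)_\varphi=\sum'_{|J|=q}\int_{\mathbb{C}^n}u_J\overline{v_J}\,e^{-\varphi}\,d\lambda$. The operator $\overline\partial u=\sum'_{|J|=q}\sum_{j=1}^n\frac{\partial u_J}{\partial\overline z_j}\,d\overline z_j\wedge d\overline z_J$ acts in the sense of distributions from $L^2_{0,q}(\mathbb{C}^n,e^{-\varphi})$ to $L^2_{0,q+1}(\mathbb{C}^n,e^{-\varphi})$ with maximal domain $\operatorname{dom}(\overline\partial)=\{f\in L^2_{0,q}(\mathbb{C}^n,e^{-\varphi}):\overline\partial f\in L^2_{0,q+1}(\mathbb{C}^n,e^{-\varphi})\}$ (and $\overline\partial=0$ on $(0,n)$-forms). Its Hilbert space adjoint with respect to $(\cdot,\cdot)_\varphi$ is $\overline\partial^*_\varphi$. The complex Laplacian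 is the positive self-adjoint operator $\square^\varphi_{0,q}=\overline\partial\,\overline\partial^*_\varphi+\overline\partial^*_\varphi\overline\partial$ on $L^2_{0,q}(\mathbb{C}^n,e^{-\varphi})$ with domain $\{u\in\operatorname{dom}(\overline\partial)\cap\operatorname{dom}(\overline\partial^*_\varphi):\overline\partial u\in\operatorname{dom}(\overline\partial^*_\varphi),\ \overline\partial^*_\varphi u\in\operatorname{dom}(\overline\partial)\}$. The operator $-\Delta_A+V$ is the Schrödinger operator with magnetic vector potential $A=\frac12\left(-\frac{\partial\varphi}{\partial y_1},\frac{\partial\varphi}{\partial x_1},\dots,-\frac{\partial\varphi}{\partial y_n},\frac{\partial\varphi}{\partial x_n}\right)$ and electric potential $V$; it is essentially self-adjoint on $C_c^\infty(\mathbb{R}^{2n})$, and $-\Delta_A+V$ denotes its unique self-adjoint extension in $L^2(\mathbb{R}^{2n})$. *)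

theory Defs
  imports "HOL-Analysis.Analysis" "HOL-Library.Function_Algebras"
begin

section \<open>Smooth functions and Wirtinger derivatives\<close>

primrec C_k :: "nat \<Rightarrow> ('a::euclidean_space \<Rightarrow> 'b::real_normed_vector) \<Rightarrow> bool" where
  "C_k 0 f \<longleftrightarrow> continuous_on UNIV f"
| "C_k (Suc k) f \<longleftrightarrow> (\<forall>x. f differentiable (at x)) \<and>
     (\<forall>b\<in>Basis. C_k k (\<lambda>x. frechet_derivative f (at x) b))"

definition smooth :: "('a::euclidean_space \<Rightarrow> 'b::real_normed_vector) \<Rightarrow> bool" where
  "smooth f \<longleftrightarrow> (\<forall>k. C_k k f)"

definition test_functions :: "((complex, 'n::finite) vec \<Rightarrow> complex) set" where
  "test_functions = {g. smooth g \<and> compact (closure {z. g z \<noteq> 0})}"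

definition d_x :: "'n::finite \<Rightarrow> ((complex, 'n) vec \<Rightarrow> 'b::real_normed_vector) \<Rightarrow> (complex, 'n) vec \<Rightarrow> 'b" where
  "d_x j f z = frechet_derivative f (at z) (axis j 1)"

definition d_y :: "'n::finite \<Rightarrow> ((complex, 'n) vec \<Rightarrow> 'b::real_normed_vector) \<Rightarrow> (complex, 'n) vec \<Rightarrow> 'b" where
  "d_y j f z = frechet_derivative f (at z) (axis j \<i>)"

definition d_z :: "'n::finite \<Rightarrow> ((complex, 'n) vec \<Rightarrow> complex) \<Rightarrow> (complex, 'n) vec \<Rightarrow> complex" where
  "d_z j f z = (d_x j f z - \<i> * d_y j f z) / 2"

definition d_zbar :: "'n::finite \<Rightarrow> ((complex, 'n) vec \<Rightarrow> complex) \<Rightarrow> (complex, 'n) vec \<Rightarrow> complex" where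
  "d_zbar j f z = (d_x j f z + \<i> * d_y j f z) / 2"

definition complex_hessian :: "((complex, 'n::finite) vec \<Rightarrow> real) \<Rightarrow> (complex, 'n) vec \<Rightarrow> complex^'n^'n" where
  "complex_hessian \<phi> z = (\<chi> j k. d_z j (d_zbar k (\<lambda>w. complex_of_real (\<phi> w))) z)"

text \<open>The complex Hessian of a smooth real function is Hermitian, so its trace is real and
  taking the real part only changes the type.\<close>

definition tr_hessian :: "((complex, 'n::finite) vec \<Rightarrow> real) \<Rightarrow> (complex, 'n) vec \<Rightarrow> real" where
  "tr_hessian \<phi> z = Re (trace (complex_hessian \<phi> z))"

text \<open>Upper semicontinuity together with the sub-mean value inequality on every circle in every
  complex line. For a finite-valued plurisubharmonic function the circle means are finite, so
  integrability is part of the definition.\<close>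

definition plurisubharmonic :: "((complex, 'n::finite) vec \<Rightarrow> real) \<Rightarrow> bool" where
  "plurisubharmonic \<phi> \<longleftrightarrow>
     (\<forall>c. open {z. \<phi> z < c}) \<and>
     (\<forall>z w. set_integrable lborel {0..2 * pi} (\<lambda>t. \<phi> (z + cis t *s w)) \<and>
        \<phi> z \<le> (LINT t:{0..2 * pi}|lborel. \<phi> (z + cis t *s w)) / (2 * pi))"


section \<open>Unbounded operators\<close>

text \<open>
  A Hilbert space is given by representatives: \<open>vecs\<close> is a set of functions and \<open>ip\<close> is only
  positive semidefinite, vectors at distance 0 (functions equal almost everywhere) being
  identified. The inner product is linear in the first argument. Linear combinations are formed
  with the pointwise operations on functions and with \<open>scale\<close>.

  An unbounded linear operator is its graph, with all representatives of the argument and of the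
  value included.
\<close>

record 'v hspace =
  vecs :: "'v set"
  ip :: "'v \<Rightarrow> 'v \<Rightarrow> complex"
  scale :: "complex \<Rightarrow> 'v \<Rightarrow> 'v"

definition hnorm :: "'v hspace \<Rightarrow> 'v \<Rightarrow> real" where
  "hnorm H u = sqrt (Re (ip H u u))"

definition adjoint_op :: "'v hspace \<Rightarrow> 'w hspace \<Rightarrow> ('v \<times> 'w) set \<Rightarrow> ('w \<times> 'v) set" where
  "adjoint_op H K T =
     {(v, w). v \<in> vecs K \<and> w \<in> vecs H \<and> (\<forall>(u, f)\<in>T. ip K f v = ip H u w)}"

text \<open>If \<open>T\<close> is not densely defined, \<open>adjoint_op\<close> is only a relation. Below it is used for operators
  whose domain contains all test functions.\<close>

definition self_adjoint :: "'v hspace \<Rightarrow> ('v \<times> 'v) set \<Rightarrow> bool" where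
  "self_adjoint H T \<longleftrightarrow> adjoint_op H H T = T"

text \<open>The graph of the inverse of \<open>T - \<mu>\<close>.\<close>

definition resolvent :: "'v::ab_group_add hspace \<Rightarrow> ('v \<times> 'v) set \<Rightarrow> complex \<Rightarrow> ('v \<times> 'v) set" where
  "resolvent H T \<mu> = {(w - scale H \<mu> u, u) | u w. (u, w) \<in> T}"

text \<open>For the graph of a linear relation, the bound below also yields single-valuedness
  (up to vectors of norm 0).\<close>

definition bounded_op :: "'v hspace \<Rightarrow> ('v \<times> 'v) set \<Rightarrow> bool" where
  "bounded_op H R \<longleftrightarrow>
     (\<forall>f\<in>vecs H. \<exists>u. (f, u) \<in> R) \<and>
     (\<exists>C. \<forall>(f, u)\<in>R. hnorm H u \<le> C * hnorm H f)"

definition compact_op :: "'v::ab_group_add hspace \<Rightarrow> ('v \<times> 'v) set \<Rightarrow> bool" where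
  "compact_op H R \<longleftrightarrow> bounded_op H R \<and>
     (\<forall>f u C. (\<forall>k::nat. (f k, u k) \<in> R \<and> hnorm H (f k) \<le> C) \<longrightarrow>
        (\<exists>r v. strict_mono r \<and> v \<in> vecs H \<and> (\<lambda>k. hnorm H (u (r k) - v)) \<longlonglongrightarrow> 0))"

definition resolvent_set :: "'v::ab_group_add hspace \<Rightarrow> ('v \<times> 'v) set \<Rightarrow> complex set" where
  "resolvent_set H T = {\<mu>. bounded_op H (resolvent H T \<mu>)}"

definition compact_resolvent :: "'v::ab_group_add hspace \<Rightarrow> ('v \<times> 'v) set \<Rightarrow> bool" where
  "compact_resolvent H T \<longleftrightarrow> (\<exists>\<mu>\<in>resolvent_set H T. compact_op H (resolvent H T \<mu>))"


section \<open>The weighted complex Laplacian\<close>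

text \<open>
  Increasing multiindices of length \<open>q\<close> are the sets \<open>J\<close> of indices with \<open>card J = q\<close>, the indices
  being linearly ordered. A form assigns to each point the vector of all coefficients \<open>u z $ J\<close>;
  forms of degree \<open>q\<close> vanish at the \<open>J\<close> with \<open>card J \<noteq> q\<close>. In degrees above the dimension only the
  zero form remains, so \<open>dbar\<close> is automatically 0 in top degree.
\<close>

type_synonym 'n form = "(complex, 'n) vec \<Rightarrow> (complex, 'n set) vec"

definition L2_forms :: "((complex, 'n::finite) vec \<Rightarrow> real) \<Rightarrow> nat \<Rightarrow> 'n form hspace" where
  "L2_forms \<phi> q =
     \<lparr>vecs = {u \<in> borel_measurable lborel.
        (\<forall>z J. card J \<noteq> q \<longrightarrow> u z $ J = 0) \<and>
        (\<forall>J. integrable lborel (\<lambda>z. (cmod (u z $ J))\<^sup>2 * exp (- \<phi> z)))},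
      ip = (\<lambda>u v. \<Sum>J | card J = q.
        LINT z|lborel. u z $ J * cnj (v z $ J) * complex_of_real (exp (- \<phi> z))),
      scale = (\<lambda>c u z. c *s u z)\<rparr>"

text \<open>The coefficient of \<open>dzbar_K\<close> in \<open>dzbar_j \<and> dzbar_J\<close>: moving \<open>dzbar_j\<close> to its place in
  increasing order passes the factors \<open>dzbar_k\<close> with \<open>k \<in> J\<close> and \<open>k < j\<close>.\<close>

definition wedge_coeff :: "'n::{finite,linorder} \<Rightarrow> 'n set \<Rightarrow> 'n set \<Rightarrow> complex" where
  "wedge_coeff j J K =
     (if j \<notin> J \<and> insert j J = K then (- 1) ^ card {k \<in> J. k < j} else 0)"

text \<open>\<open>f\<close> is the distributional image of the \<open>q\<close>-form \<open>u\<close>. Only the sum making up each coefficient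
  of \<open>f\<close> has to be a function, not the individual distributional derivatives of \<open>u\<close>.\<close>

definition weak_dbar :: "nat \<Rightarrow> 'n::{finite,linorder} form \<Rightarrow> 'n form \<Rightarrow> bool" where
  "weak_dbar q u f \<longleftrightarrow>
     (\<forall>K. card K = Suc q \<longrightarrow> (\<forall>g\<in>test_functions.
        (LINT z|lborel. f z $ K * g z) =
        (\<Sum>J | card J = q. \<Sum>j\<in>UNIV.
           wedge_coeff j J K * - (LINT z|lborel. u z $ J * d_zbar j g z))))"

definition dbar :: "((complex, 'n::{finite,linorder}) vec \<Rightarrow> real) \<Rightarrow> nat \<Rightarrow> ('n form \<times> 'n form) set" where
  "dbar \<phi> q = {(u, f). u \<in> vecs (L2_forms \<phi> q) \<and> f \<in> vecs (L2_forms \<phi> (Suc q)) \<and> weak_dbar q u f}"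

text \<open>The adjoint of \<open>dbar \<phi> q\<close>, taking forms of degree \<open>q + 1\<close> to forms of degree \<open>q\<close>.\<close>

definition dbar_adj :: "((complex, 'n::{finite,linorder}) vec \<Rightarrow> real) \<Rightarrow> nat \<Rightarrow> ('n form \<times> 'n form) set" where
  "dbar_adj \<phi> q = adjoint_op (L2_forms \<phi> q) (L2_forms \<phi> (Suc q)) (dbar \<phi> q)"

definition complex_laplacian ::
    "((complex, 'n::{finite,linorder}) vec \<Rightarrow> real) \<Rightarrow> nat \<Rightarrow> ('n form \<times> 'n form) set" where
  "complex_laplacian \<phi> q = {(u, a + b) | u a b.
     (\<exists>f. (u, f) \<in> dbar \<phi> q \<and> (f, b) \<in> dbar_adj \<phi> q) \<and>
     (if q = 0 then a = 0
      else \<exists>v. (u, v) \<in> dbar_adj \<phi> (q - 1) \<and> (v, a) \<in> dbar \<phi> (q - 1))}"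


section \<open>The magnetic Schroedinger operator\<close>

definition L2_functions :: "((complex, 'n::finite) vec \<Rightarrow> complex) hspace" where
  "L2_functions =
     \<lparr>vecs = {u \<in> borel_measurable lborel. integrable lborel (\<lambda>z. (cmod (u z))\<^sup>2)},
      ip = (\<lambda>u v. LINT z|lborel. u z * cnj (v z)),
      scale = (\<lambda>c u z. c * u z)\<rparr>"

definition cov_x :: "((complex, 'n::finite) vec \<Rightarrow> real) \<Rightarrow> 'n \<Rightarrow>
    ((complex, 'n) vec \<Rightarrow> complex) \<Rightarrow> (complex, 'n) vec \<Rightarrow> complex" where
  "cov_x \<phi> j u z = - d_x j u z - \<i> / 2 * complex_of_real (d_y j \<phi> z) * u z"

definition cov_y :: "((complex, 'n::finite) vec \<Rightarrow> real) \<Rightarrow> 'n \<Rightarrow>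
    ((complex, 'n) vec \<Rightarrow> complex) \<Rightarrow> (complex, 'n) vec \<Rightarrow> complex" where
  "cov_y \<phi> j u z = - d_y j u z + \<i> / 2 * complex_of_real (d_x j \<phi> z) * u z"

definition magnetic_laplacian :: "((complex, 'n::finite) vec \<Rightarrow> real) \<Rightarrow>
    ((complex, 'n) vec \<Rightarrow> complex) \<Rightarrow> (complex, 'n) vec \<Rightarrow> complex" where
  "magnetic_laplacian \<phi> u z =
     (\<Sum>j\<in>UNIV. cov_x \<phi> j (cov_x \<phi> j u) z + cov_y \<phi> j (cov_y \<phi> j u) z)"

definition schroedinger_core :: "((complex, 'n::finite) vec \<Rightarrow> real) \<Rightarrow> ((complex, 'n) vec \<Rightarrow> real) \<Rightarrow>
    (((complex, 'n) vec \<Rightarrow> complex) \<times> ((complex, 'n) vec \<Rightarrow> complex)) set" where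
  "schroedinger_core \<phi> V =
     {(u, \<lambda>z. - magnetic_laplacian \<phi> u z + complex_of_real (V z) * u z) | u. u \<in> test_functions}"

text \<open>The operator on test functions is essentially self-adjoint (for smooth \<open>\<phi>\<close> and smooth
  nonnegative \<open>V\<close>), so its self-adjoint extension is unique.\<close>

definition magnetic_schroedinger :: "((complex, 'n::finite) vec \<Rightarrow> real) \<Rightarrow> ((complex, 'n) vec \<Rightarrow> real) \<Rightarrow>
    (((complex, 'n) vec \<Rightarrow> complex) \<times> ((complex, 'n) vec \<Rightarrow> complex)) set" where
  "magnetic_schroedinger \<phi> V =
     (THE S. self_adjoint L2_functions S \<and> schroedinger_core \<phi> V \<subseteq> S)"

end

theory Submission
  imports Defs
begin

text \<open>
  Multiplication by \<open>exp (-\<phi>/2)\<close> turns the Laplacian on top degree forms into one quarter of the adjoint of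
  \<open>H = -\<Delta>\<^sub>A + V\<close> on test functions. That adjoint is the closure of \<open>H\<close> on test functions (mollification and
  Friedrichs' lemma give local approximation, cutoffs and an energy estimate with \<open>V \<ge> 0\<close> the global one), so
  it is the only self-adjoint extension, and the two compactness properties coincide.

  For the second part, suppose that the local energies \<open>\<integral>\<^bsub>B(z,1)\<^esub> tr(M)\<^sup>2\<close> stay bounded along some \<open>z\<^sub>k \<rightarrow> \<infinity>\<close>.
  Since \<open>M\<close> is positive semidefinite, \<open>tr(M)\<close> dominates the magnetic field, so a ray gauge with averaged base
  point makes the vector potential bounded in \<open>L\<^sup>2\<close> on each ball. Gauging a bump function yields forms \<open>u\<^sub>k\<close>
  with disjoint supports, constant norm and bounded form energy. If \<open>w\<^sub>k\<close> denotes the image of \<open>u\<^sub>k\<close> under a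
  compact resolvent, then along a subsequence \<open>w\<^sub>k - w\<^sub>l \<rightarrow> 0\<close>; but \<open>w\<^sub>k - w\<^sub>l\<close> together with the form energy of
  \<open>u\<^sub>k - u\<^sub>l\<close> bounds \<open>\<parallel>u\<^sub>k - u\<^sub>l\<parallel>\<close>, which does not tend to \<open>0\<close>.
\<close>

section \<open>Calculus of smooth functions\<close>

text \<open>The factor one quarter and the potential have one origin. The adjoint of
  \<open>dbar\<close> acts through \<open>dbarT j\<close>, half of
  \<open>cov (X j) - \<i> * cov (Y j)\<close>; in its square the cross terms form the commutator of
  the covariant derivatives, which up to a constant is multiplication by the magnetic field in the
  j-th complex line, and these fields add up to V = 2 tr(M).

  Nothing restricts \<phi> at infinity, and the domains are maximal: membership in the domain of the
  adjoint of \<open>dbar\<close> is tested against every element of the domain of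
  \<open>dbar\<close>. Approximation in the graph norm of H reduces this to test functions; it also
  makes the covariant derivatives converge, which yields the intermediate form in the product of
  \<open>dbar\<close> and its adjoint.

  In the second part the field is controlled only in L2, and along rays from a fixed base point the
  change of variables costs a factor t^(-2n). The bump is bounded by 1, so an L2 bound of the gauged
  potential is enough. For a form with a single coefficient the images under \<open>dbar\<close> and
  its adjoint are bounded by the covariant derivatives of that coefficient, in every degree.\<close>

definition pd :: "'a::euclidean_space \<Rightarrow> ('a \<Rightarrow> 'b::real_normed_vector) \<Rightarrow> 'a \<Rightarrow> 'b" where
  "pd b f x = frechet_derivative f (at x) b"

lemma has_derivative_pd: "(f has_derivative f') (at x) \<Longrightarrow> pd b f x = f' b"
  unfolding pd_def by (metis frechet_derivative_at)

lemma differentiable_has_derivative: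
  "f differentiable (at x) \<Longrightarrow> (f has_derivative (\<lambda>b. pd b f x)) (at x)"
  unfolding pd_def by (simp add: frechet_derivative_works[symmetric])

lemma has_derivative_pd_sum:
  fixes f :: "'a::euclidean_space \<Rightarrow> 'b::real_normed_vector"
  assumes "f differentiable (at x)"
  shows "(f has_derivative (\<lambda>v. \<Sum>b\<in>Basis. (v \<bullet> b) *\<^sub>R pd b f x)) (at x)"
proof -
  have d: "(f has_derivative (\<lambda>b. pd b f x)) (at x)"
    by (rule differentiable_has_derivative[OF assms])
  then interpret bounded_linear "\<lambda>b. pd b f x" by (rule has_derivative_bounded_linear)
  have "(\<lambda>v. pd v f x) = (\<lambda>v. \<Sum>b\<in>Basis. (v \<bullet> b) *\<^sub>R pd b f x)"
  proof
    fix v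
    have "pd v f x = pd (\<Sum>b\<in>Basis. (v \<bullet> b) *\<^sub>R b) f x" by (simp add: euclidean_representation)
    also have "\<dots> = (\<Sum>b\<in>Basis. (v \<bullet> b) *\<^sub>R pd b f x)" by (simp add: sum scaleR)
    finally show "pd v f x = (\<Sum>b\<in>Basis. (v \<bullet> b) *\<^sub>R pd b f x)" .
  qed
  with d show ?thesis by simp
qed

lemma C_k_Suc_iff:
  "C_k (Suc k) f \<longleftrightarrow> (\<forall>x. f differentiable (at x)) \<and> (\<forall>b\<in>Basis. C_k k (pd b f))"
  by (simp add: pd_def[abs_def])

declare C_k.simps(2) [simp del]

lemma C_k_SucD: "C_k (Suc k) f \<Longrightarrow> C_k k f"
proof (induction k arbitrary: f)
  case 0
  then have "f differentiable (at x)" for x by (simp add: C_k_Suc_iff)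
  then have "f differentiable_on UNIV" by (auto simp: differentiable_on_def)
  then show ?case by (simp add: differentiable_imp_continuous_on)
next
  case (Suc k)
  have d: "\<forall>x. f differentiable (at x)" and c: "\<forall>b\<in>Basis. C_k (Suc k) (pd b f)"
    using Suc.prems unfolding C_k_Suc_iff[of "Suc k"] by auto
  have "\<forall>b\<in>Basis. C_k k (pd b f)" using Suc.IH c by blast
  with d show ?case unfolding C_k_Suc_iff[of k] by blast
qed

lemma C_k_const [simp]: "C_k k (\<lambda>x::'a::euclidean_space. c)"
proof (induction k arbitrary: c)
  case (Suc k)
  have "pd b (\<lambda>x. c) = (\<lambda>x. 0)" for b :: 'a by (simp add: pd_def[abs_def])
  with Suc show ?case by (simp add: C_k_Suc_iff)
qed simp

lemma C_k_bounded_linear: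
  assumes "bounded_linear L"
  shows "C_k k L"
proof (cases k)
  case 0 then show ?thesis using assms by (simp add: linear_continuous_on)
next
  case (Suc m)
  have d: "(L has_derivative L) (at x)" for x
    using assms by (rule bounded_linear_imp_has_derivative)
  have "pd b L = (\<lambda>x. L b)" for b using has_derivative_pd[OF d] by blast
  with d show ?thesis unfolding Suc C_k_Suc_iff by (auto simp: differentiable_def)
qed

lemma C_k_linear_comp:
  assumes "bounded_linear L"
  shows "C_k k f \<Longrightarrow> C_k k (\<lambda>x. L (f x))"
proof (induction k arbitrary: f)
  case 0
  then show ?case using assms bounded_linear.continuous_on by auto
next
  case (Suc k)
  have d: "((\<lambda>x. L (f x)) has_derivative (\<lambda>b. L (pd b f x))) (at x)" for x
    using bounded_linear.has_derivative[OF assms differentiable_has_derivative] Suc.prems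
    by (auto simp: C_k_Suc_iff)
  have "pd b (\<lambda>x. L (f x)) = (\<lambda>x. L (pd b f x))" for b using has_derivative_pd[OF d] by blast
  with d Suc show ?case unfolding C_k_Suc_iff by (auto simp: differentiable_def)
qed

lemma C_k_add: "C_k k f \<Longrightarrow> C_k k g \<Longrightarrow> C_k k (\<lambda>x. f x + g x)"
proof (induction k arbitrary: f g)
  case 0
  then show ?case by (auto intro: continuous_on_add)
next
  case (Suc k)
  have d: "((\<lambda>x. f x + g x) has_derivative (\<lambda>b. pd b f x + pd b g x)) (at x)" for x
    using Suc.prems
    by (auto simp: C_k_Suc_iff intro!: has_derivative_add differentiable_has_derivative)
  have "pd b (\<lambda>x. f x + g x) = (\<lambda>x. pd b f x + pd b g x)" for b using has_derivative_pd[OF d] by blast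
  with d Suc show ?case unfolding C_k_Suc_iff by (auto simp: differentiable_def)
qed

lemma C_k_sum: "(\<And>i. i \<in> I \<Longrightarrow> C_k k (f i)) \<Longrightarrow> C_k k (\<lambda>x. \<Sum>i\<in>I. f i x)"
  by (induction I rule: infinite_finite_induct) (auto intro: C_k_add)

lemma C_k_bilinear:
  assumes "bounded_bilinear B"
  shows "C_k k f \<Longrightarrow> C_k k g \<Longrightarrow> C_k k (\<lambda>x::'d::euclidean_space. B (f x) (g x))"
proof (induction k arbitrary: f g)
  case 0
  then show ?case using bounded_bilinear.continuous_on[OF assms] by auto
next
  case (Suc k)
  have d: "((\<lambda>x. B (f x) (g x)) has_derivative (\<lambda>b. B (f x) (pd b g x) + B (pd b f x) (g x))) (at x)" for x
    using Suc.prems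
    by (auto simp: C_k_Suc_iff intro!: bounded_bilinear.FDERIV[OF assms] differentiable_has_derivative)
  have "pd b (\<lambda>x. B (f x) (g x)) = (\<lambda>x. B (f x) (pd b g x) + B (pd b f x) (g x))" for b
    using has_derivative_pd[OF d] by blast
  moreover have "\<forall>b\<in>Basis. C_k k (\<lambda>x. B (f x) (pd b g x) + B (pd b f x) (g x))"
  proof (intro ballI C_k_add)
    fix b assume "b \<in> (Basis :: 'd set)"
    then have "C_k k (pd b f)" "C_k k (pd b g)" using Suc.prems by (auto simp: C_k_Suc_iff[of k])
    then show "C_k k (\<lambda>x. B (f x) (pd b g x))" "C_k k (\<lambda>x. B (pd b f x) (g x))"
      using C_k_SucD[OF Suc.prems(1)] C_k_SucD[OF Suc.prems(2)] by (auto intro: Suc.IH)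
  qed
  ultimately show ?case unfolding C_k_Suc_iff[of k] using d by (auto simp: differentiable_def)
qed

lemma C_k_compose: "C_k k f \<Longrightarrow> C_k k g \<Longrightarrow> C_k k (\<lambda>x. f (g x))"
  for f :: "'b::euclidean_space \<Rightarrow> 'c::real_normed_vector" and g :: "'a::euclidean_space \<Rightarrow> 'b"
proof (induction k arbitrary: f)
  case 0
  then show ?case by (auto intro: continuous_on_compose2)
next
  case (Suc k)
  have d: "((\<lambda>x. f (g x)) has_derivative
      (\<lambda>b. \<Sum>i\<in>Basis. (pd b g x \<bullet> i) *\<^sub>R pd i f (g x))) (at x)" for x
    using Suc.prems
    by (intro has_derivative_compose[OF differentiable_has_derivative has_derivative_pd_sum])
       (auto simp: C_k_Suc_iff)
  have "pd b (\<lambda>x. f (g x)) = (\<lambda>x. \<Sum>i\<in>Basis. (pd b g x \<bullet> i) *\<^sub>R pd i f (g x))" for b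
    using has_derivative_pd[OF d] by blast
  moreover have "\<forall>b\<in>Basis. C_k k (\<lambda>x. \<Sum>i\<in>Basis. (pd b g x \<bullet> i) *\<^sub>R pd i f (g x))"
    using Suc.prems C_k_SucD[OF Suc.prems(2)]
    by (auto simp: C_k_Suc_iff[of k] intro!: C_k_sum Suc.IH C_k_bilinear[OF bounded_bilinear_scaleR]
        C_k_linear_comp[OF bounded_linear_inner_left])
  ultimately show ?case unfolding C_k_Suc_iff[of k] using d by (auto simp: differentiable_def)
qed

lemma smooth_differentiable: "smooth f \<Longrightarrow> f differentiable (at x)"
  unfolding smooth_def using C_k_Suc_iff by blast

lemma smooth_pd: "smooth f \<Longrightarrow> b \<in> Basis \<Longrightarrow> smooth (pd b f)"
  unfolding smooth_def using C_k_Suc_iff by blast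

lemma smooth_continuous: "smooth f \<Longrightarrow> continuous_on S f"
  unfolding smooth_def using C_k.simps(1) continuous_on_subset by blast

text \<open>Smoothness is the greatest property that implies differentiability and passes to the
  derivatives along the basis. To prove a function smooth it is enough to put it into a family
  closed under differentiation; convolutions, ray integrals and the bump are all treated in this
  way.\<close>

lemma smooth_coinduct:
  assumes "P f"
    and "\<And>f x. P f \<Longrightarrow> f differentiable (at x)"
    and "\<And>f b. P f \<Longrightarrow> b \<in> Basis \<Longrightarrow> P (pd b f)"
  shows "smooth f"
proof -
  have "\<forall>f. P f \<longrightarrow> C_k k f" for k
  proof (induction k)
    case 0
    have "f differentiable_on UNIV" if "P f" for f
      using assms(2)[OF that] by (simp add: differentiable_on_def)
    then show ?case by (simp add: differentiable_imp_continuous_on)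
  next
    case (Suc k)
    then show ?case using assms(2,3) by (auto simp: C_k_Suc_iff)
  qed
  with assms(1) show ?thesis by (simp add: smooth_def)
qed

section \<open>Closure properties of smooth functions\<close>

named_theorems smooth_intros

lemma smooth_const [smooth_intros]: "smooth (\<lambda>x. c)"
  by (simp add: smooth_def)

lemma smooth_bounded_linear: "bounded_linear L \<Longrightarrow> smooth L"
  by (simp add: smooth_def C_k_bounded_linear)

lemma smooth_ident [smooth_intros]: "smooth (\<lambda>x. x)"
  by (simp add: smooth_bounded_linear)

lemma smooth_linear_comp: "bounded_linear L \<Longrightarrow> smooth f \<Longrightarrow> smooth (\<lambda>x. L (f x))"
  by (simp add: smooth_def C_k_linear_comp)

lemma smooth_bilinear: "bounded_bilinear B \<Longrightarrow> smooth f \<Longrightarrow> smooth g \<Longrightarrow> smooth (\<lambda>x. B (f x) (g x))"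
  by (simp add: smooth_def C_k_bilinear)

lemma smooth_compose: "smooth f \<Longrightarrow> smooth g \<Longrightarrow> smooth (\<lambda>x. f (g x))"
  for f :: "'b::euclidean_space \<Rightarrow> 'c::real_normed_vector"
  by (simp add: smooth_def C_k_compose)

lemma smooth_add [smooth_intros]: "smooth f \<Longrightarrow> smooth g \<Longrightarrow> smooth (\<lambda>x. f x + g x)"
  by (simp add: smooth_def C_k_add)

lemma smooth_sum [smooth_intros]: "(\<And>i. i \<in> I \<Longrightarrow> smooth (f i)) \<Longrightarrow> smooth (\<lambda>x. \<Sum>i\<in>I. f i x)"
  by (simp add: smooth_def C_k_sum)

lemmas smooth_minus [smooth_intros] = smooth_linear_comp[OF bounded_linear_minus[OF bounded_linear_ident]]
lemmas smooth_scaleR [smooth_intros] = smooth_bilinear[OF bounded_bilinear_scaleR]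
lemmas smooth_mult [smooth_intros] = smooth_bilinear[OF bounded_bilinear_mult]
lemmas smooth_inner [smooth_intros] = smooth_bilinear[OF bounded_bilinear_inner]
lemmas smooth_of_real [smooth_intros] = smooth_linear_comp[OF bounded_linear_of_real]
lemmas smooth_cnj [smooth_intros] = smooth_linear_comp[OF bounded_linear_cnj]
lemmas smooth_Re [smooth_intros] = smooth_linear_comp[OF bounded_linear_Re]
lemmas smooth_Im [smooth_intros] = smooth_linear_comp[OF bounded_linear_Im]

lemma smooth_diff [smooth_intros]: "smooth f \<Longrightarrow> smooth g \<Longrightarrow> smooth (\<lambda>x. f x - g x)"
  using smooth_add[OF _ smooth_minus, of f g] by simp

lemma smooth_power [smooth_intros]: "smooth f \<Longrightarrow> smooth (\<lambda>x. f x ^ n)"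
  for f :: "'a::euclidean_space \<Rightarrow> 'b::real_normed_algebra_1"
  by (induction n) (auto intro: smooth_intros)

lemma smooth_divide_const [smooth_intros]: "smooth f \<Longrightarrow> smooth (\<lambda>x. f x / c)"
  for c :: "'b::real_normed_field"
  unfolding divide_inverse by (intro smooth_intros)

lemma pd_real: "(f has_field_derivative d) (at x) \<Longrightarrow> pd b f x = d * b"
  for f :: "real \<Rightarrow> real"
  using has_derivative_pd[of f "(*) d" x b] by (simp add: has_field_derivative_def)

lemma smooth_sin: "smooth (sin :: real \<Rightarrow> real)"
proof (rule smooth_coinduct[of "\<lambda>f. \<exists>a b. f = (\<lambda>x::real. a * sin x + b * cos x)"])
  show "\<exists>a b. sin = (\<lambda>x::real. a * sin x + b * cos x)" by (intro exI[of _ 1] exI[of _ 0]) auto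
next
  fix f :: "real \<Rightarrow> real" and x
  assume "\<exists>a b. f = (\<lambda>x::real. a * sin x + b * cos x)"
  then obtain a b where f: "f = (\<lambda>x::real. a * sin x + b * cos x)" by auto
  have d: "(f has_field_derivative (- b) * sin x + a * cos x) (at x)" for x
    unfolding f by (auto intro!: derivative_eq_intros)
  show "f differentiable at x" using d has_field_derivative_def differentiable_def by metis
  fix c :: real assume "c \<in> Basis"
  then have "pd c f = (\<lambda>x. (- b) * sin x + a * cos x)" using pd_real[OF d] by auto
  then show "\<exists>a b. pd c f = (\<lambda>x::real. a * sin x + b * cos x)" by blast
qed

lemma smooth_cos: "smooth (cos :: real \<Rightarrow> real)"
proof -
  have "cos = (\<lambda>x::real. sin (x + pi / 2))" by (auto simp: sin_add)
  moreover have "smooth (\<lambda>x::real. sin (x + pi / 2))"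
    by (intro smooth_compose[OF smooth_sin] smooth_intros)
  ultimately show ?thesis by metis
qed

lemma smooth_exp: "smooth (exp :: real \<Rightarrow> real)"
proof (rule smooth_coinduct[of "\<lambda>f. f = exp"])
  have d: "(exp has_field_derivative exp x) (at x)" for x :: real by (rule DERIV_exp)
  show "f differentiable at x" if "f = exp" for f :: "real \<Rightarrow> real" and x
    using that d has_field_derivative_def differentiable_def by metis
  show "pd c f = exp" if "f = exp" "c \<in> Basis" for f :: "real \<Rightarrow> real" and c
    using pd_real[OF d] that by auto
qed auto

lemmas smooth_exp_comp [smooth_intros] = smooth_compose[OF smooth_exp]
  and smooth_sin_comp [smooth_intros] = smooth_compose[OF smooth_sin]
  and smooth_cos_comp [smooth_intros] = smooth_compose[OF smooth_cos]

lemma smooth_cis [smooth_intros]: "smooth f \<Longrightarrow> smooth (\<lambda>x. cis (f x))"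
proof -
  assume "smooth f"
  moreover have "(\<lambda>x. cis (f x)) = (\<lambda>x. of_real (cos (f x)) + \<i> * of_real (sin (f x)))"
    by (simp add: cis.code complex_eq_iff fun_eq_iff)
  ultimately show ?thesis by (simp add: smooth_intros)
qed

section \<open>Rules for directional derivatives\<close>

lemma pd_const [simp]: "pd b (\<lambda>x. c) x = 0"
  by (simp add: pd_def)

lemma pd_linear_comp:
  "bounded_linear L \<Longrightarrow> f differentiable (at x) \<Longrightarrow> pd b (\<lambda>x. L (f x)) x = L (pd b f x)"
  by (rule has_derivative_pd, rule bounded_linear.has_derivative)
     (simp_all add: differentiable_has_derivative)

lemmas pd_minus = pd_linear_comp[OF bounded_linear_minus[OF bounded_linear_ident]]
lemmas pd_of_real = pd_linear_comp[OF bounded_linear_of_real]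
lemmas pd_cnj = pd_linear_comp[OF bounded_linear_cnj]

lemma pd_add:
  "f differentiable (at x) \<Longrightarrow> g differentiable (at x) \<Longrightarrow> pd b (\<lambda>x. f x + g x) x = pd b f x + pd b g x"
  by (rule has_derivative_pd) (intro has_derivative_add differentiable_has_derivative; assumption)

lemma pd_diff:
  "f differentiable (at x) \<Longrightarrow> g differentiable (at x) \<Longrightarrow> pd b (\<lambda>x. f x - g x) x = pd b f x - pd b g x"
  by (rule has_derivative_pd) (intro has_derivative_diff differentiable_has_derivative; assumption)

lemma pd_sum:
  "(\<And>i. i \<in> I \<Longrightarrow> f i differentiable (at x)) \<Longrightarrow> pd b (\<lambda>x. \<Sum>i\<in>I. f i x) x = (\<Sum>i\<in>I. pd b (f i) x)"
  by (rule has_derivative_pd) (intro has_derivative_sum differentiable_has_derivative; assumption)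

lemma pd_mult:
  fixes f :: "'a::euclidean_space \<Rightarrow> 'b::real_normed_algebra"
  shows "f differentiable (at x) \<Longrightarrow> g differentiable (at x) \<Longrightarrow>
    pd b (\<lambda>x. f x * g x) x = f x * pd b g x + pd b f x * g x"
  by (rule has_derivative_pd) (intro has_derivative_mult differentiable_has_derivative; assumption)

lemma pd_cmult:
  fixes f :: "'a::euclidean_space \<Rightarrow> 'b::real_normed_algebra"
  shows "f differentiable (at x) \<Longrightarrow> pd b (\<lambda>x. c * f x) x = c * pd b f x"
  by (rule pd_linear_comp[OF bounded_linear_mult_right])

lemma pd_compose_real:
  fixes f :: "real \<Rightarrow> real"
  assumes "(f has_field_derivative d) (at (g x))" "g differentiable (at x)"
  shows "pd b (\<lambda>x. f (g x)) x = d * pd b g x"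
proof (rule has_derivative_pd)
  show "((\<lambda>x. f (g x)) has_derivative (\<lambda>b. d * pd b g x)) (at x)"
    by (rule has_derivative_compose[OF differentiable_has_derivative[OF assms(2)]])
       (use assms(1) in \<open>simp add: has_field_derivative_def\<close>)
qed

lemma pd_affine:
  fixes f :: "'a::euclidean_space \<Rightarrow> 'b::real_normed_vector"
  assumes "f differentiable (at (c + t *\<^sub>R x))"
  shows "pd b (\<lambda>x. f (c + t *\<^sub>R x)) x = t *\<^sub>R pd b f (c + t *\<^sub>R x)"
proof -
  have d: "(f has_derivative (\<lambda>b. pd b f (c + t *\<^sub>R x))) (at (c + t *\<^sub>R x))"
    by (rule differentiable_has_derivative[OF assms])
  then interpret bounded_linear "\<lambda>b. pd b f (c + t *\<^sub>R x)" by (rule has_derivative_bounded_linear)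
  show ?thesis
    by (rule has_derivative_pd, rule has_derivative_eq_rhs,
        rule has_derivative_compose[where g = f and f = "\<lambda>x. c + t *\<^sub>R x", OF _ d]) (auto intro!: derivative_eq_intros simp: scaleR)
qed

section \<open>Restriction to lines and symmetry of second derivatives\<close>

lemma has_real_derivative_line:
  fixes f :: "'a::euclidean_space \<Rightarrow> real"
  assumes "f differentiable (at (c + s *\<^sub>R a))"
  shows "((\<lambda>s. f (c + s *\<^sub>R a)) has_real_derivative pd a f (c + s *\<^sub>R a)) (at s)"
proof -
  have d: "(f has_derivative (\<lambda>b. pd b f (c + s *\<^sub>R a))) (at (c + s *\<^sub>R a))"
    by (rule differentiable_has_derivative[OF assms])
  then interpret bounded_linear "\<lambda>b. pd b f (c + s *\<^sub>R a)" by (rule has_derivative_bounded_linear)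
  show ?thesis unfolding has_field_derivative_def
    by (rule has_derivative_eq_rhs, rule has_derivative_compose[where g = f and f = "\<lambda>s. c + s *\<^sub>R a", OF _ d])
       (auto intro!: derivative_eq_intros simp: scaleR)
qed

text \<open>Two applications of the mean value theorem: in direction a to the increment of f in
  direction b, then in direction b to \<open>pd a f\<close>. The left side is symmetric in a and b
  although the right side is not visibly so.\<close>

lemma second_difference:
  fixes f :: "'a::euclidean_space \<Rightarrow> real"
  assumes f: "smooth f" and ab: "a \<in> Basis" "b \<in> Basis" and h: "h > 0"
  shows "\<exists>y. dist y x \<le> 2 * h \<and>
    f (x + h *\<^sub>R a + h *\<^sub>R b) - f (x + h *\<^sub>R a) - f (x + h *\<^sub>R b) + f x = h\<^sup>2 * pd b (pd a f) y"
proof -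
  have d: "f differentiable (at z)" "pd a f differentiable (at z)" for z
    using smooth_differentiable smooth_pd f ab by blast+
  define g where "g s = f (x + h *\<^sub>R b + s *\<^sub>R a) - f (x + s *\<^sub>R a)" for s
  have dg: "(g has_real_derivative pd a f (x + h *\<^sub>R b + s *\<^sub>R a) - pd a f (x + s *\<^sub>R a)) (at s)" for s
    unfolding g_def by (intro DERIV_diff has_real_derivative_line d)
  then obtain s where s: "0 < s" "s < h"
    "g h - g 0 = (h - 0) * (pd a f (x + h *\<^sub>R b + s *\<^sub>R a) - pd a f (x + s *\<^sub>R a))"
    using MVT2[OF h dg] by blast
  have "((\<lambda>t. pd a f (x + s *\<^sub>R a + t *\<^sub>R b)) has_real_derivative pd b (pd a f) (x + s *\<^sub>R a + t *\<^sub>R b)) (at t)" for t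
    by (intro has_real_derivative_line d)
  from MVT2[OF h this] obtain t where t: "0 < t" "t < h"
    "pd a f (x + s *\<^sub>R a + h *\<^sub>R b) - pd a f (x + s *\<^sub>R a + 0 *\<^sub>R b) = (h - 0) * pd b (pd a f) (x + s *\<^sub>R a + t *\<^sub>R b)"
    by blast
  have "dist (x + s *\<^sub>R a + t *\<^sub>R b) x \<le> norm (s *\<^sub>R a) + norm (t *\<^sub>R b)"
    unfolding dist_norm by (rule order_trans[OF _ norm_triangle_ineq]) simp
  also have "\<dots> \<le> 2 * h" using s t ab by simp
  finally show ?thesis using s(3) t(3)
    by (intro exI[of _ "x + s *\<^sub>R a + t *\<^sub>R b"]) (simp add: g_def power2_eq_square algebra_simps)
qed

lemma pd_pd_commute_real:
  fixes f :: "'a::euclidean_space \<Rightarrow> real"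
  assumes f: "smooth f" and ab: "a \<in> Basis" "b \<in> Basis"
  shows "pd a (pd b f) x = pd b (pd a f) x"
proof -
  define h where "h n = inverse (real (Suc n))" for n
  have h: "h n > 0" for n by (simp add: h_def)
  have h0: "(\<lambda>n. 2 * h n) \<longlonglongrightarrow> 2 * 0"
    unfolding h_def by (intro tendsto_intros LIMSEQ_inverse_real_of_nat)
  let ?D = "\<lambda>a b n. f (x + h n *\<^sub>R a + h n *\<^sub>R b) - f (x + h n *\<^sub>R a) - f (x + h n *\<^sub>R b) + f x"
  have lim: "(\<lambda>n. ?D a b n / (h n)\<^sup>2) \<longlonglongrightarrow> pd b (pd a f) x"
    if ab: "a \<in> Basis" "b \<in> Basis" for a b
  proof -
    obtain y where y: "\<And>n. dist (y n) x \<le> 2 * h n" "\<And>n. ?D a b n = (h n)\<^sup>2 * pd b (pd a f) (y n)"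
      using second_difference[OF f ab h] by metis
    have "y \<longlonglongrightarrow> x"
      by (subst tendsto_dist_iff, rule tendsto_sandwich[OF _ _ tendsto_const h0[unfolded mult_zero_right]]) (auto simp: y(1))
    moreover have "isCont (pd b (pd a f)) x"
      using smooth_continuous[of "pd b (pd a f)" UNIV, OF smooth_pd[OF smooth_pd[OF f]]] ab
      by (simp add: continuous_on_eq_continuous_at)
    ultimately have "(\<lambda>n. pd b (pd a f) (y n)) \<longlonglongrightarrow> pd b (pd a f) x"
      by (simp add: isCont_tendsto_compose)
    moreover have "(\<lambda>n. ?D a b n / (h n)\<^sup>2) = (\<lambda>n. pd b (pd a f) (y n))"
      unfolding y(2) using h by (simp add: less_imp_neq[THEN not_sym])
    ultimately show ?thesis by (simp only:)
  qed
  \<comment> \<open>Exchanging a and b does not change the second difference, so both mixed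
    derivatives are limits of one and the same sequence.\<close>
  have "(\<lambda>n. ?D a b n / (h n)\<^sup>2) \<longlonglongrightarrow> pd a (pd b f) x"
    using lim[OF ab(2,1)] by (simp add: algebra_simps)
  then show ?thesis using lim[OF ab] LIMSEQ_unique by blast
qed

lemma pd_pd_commute:
  fixes f :: "'a::euclidean_space \<Rightarrow> complex"
  assumes f: "smooth f" and ab: "a \<in> Basis" "b \<in> Basis"
  shows "pd a (pd b f) x = pd b (pd a f) x"
proof -
  have *: "L (pd a (pd b f) x) = pd a (pd b (\<lambda>x. L (f x))) x"
    if "bounded_linear L" "a \<in> Basis" "b \<in> Basis" for L :: "complex \<Rightarrow> real" and a b
  proof -
    have "pd b (\<lambda>x. L (f x)) = (\<lambda>x. L (pd b f x))"
      using pd_linear_comp[OF that(1) smooth_differentiable[OF f]] by blast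
    then show ?thesis
      using pd_linear_comp[OF that(1) smooth_differentiable[OF smooth_pd[OF f that(3)]]] by simp
  qed
  show ?thesis
    using *[OF bounded_linear_Re] *[OF bounded_linear_Im] ab
      pd_pd_commute_real[OF smooth_Re[OF f]] pd_pd_commute_real[OF smooth_Im[OF f]]
    by (simp add: complex_eq_iff)
qed

section \<open>Smooth functions with compact support\<close>

lemma pd_eq_0_outside:
  assumes "\<And>x. norm x > R \<Longrightarrow> f x = 0" "norm x > R"
  shows "pd b f x = 0"
proof (rule has_derivative_pd)
  have "open {x. norm x > R}" by (intro open_Collect_less continuous_intros)
  then show "(f has_derivative (\<lambda>b. 0)) (at x)"
    by (rule has_derivative_transform_within_open[OF has_derivative_const[of 0]])
      (use assms in auto)
qed

text \<open>Compact support is phrased as vanishing outside some ball, which is easy to follow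
  through sums, derivatives and affine substitutions. The range is arbitrary because real bumps and
  complex test functions occur side by side.\<close>

definition cc_smooth :: "('a::euclidean_space \<Rightarrow> 'b::real_normed_vector) \<Rightarrow> bool" where
  "cc_smooth f \<longleftrightarrow> smooth f \<and> (\<exists>R. \<forall>x. norm x > R \<longrightarrow> f x = 0)"

lemma test_functions_iff: "g \<in> test_functions \<longleftrightarrow> cc_smooth g"
proof -
  have "compact (closure {z. g z \<noteq> 0}) \<longleftrightarrow> (\<exists>R. \<forall>x. norm x > R \<longrightarrow> g x = 0)"
    by (simp add: compact_closure bounded_iff) (metis linorder_not_le)
  then show ?thesis by (simp add: test_functions_def cc_smooth_def)
qed

lemma cc_smoothD: "cc_smooth f \<Longrightarrow> smooth f"
  by (simp add: cc_smooth_def)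

lemma cc_smooth_pd: "cc_smooth f \<Longrightarrow> b \<in> Basis \<Longrightarrow> cc_smooth (pd b f)"
  unfolding cc_smooth_def using smooth_pd pd_eq_0_outside by metis

lemma cc_smooth_bilinear:
  assumes "bounded_bilinear B" "smooth f" "cc_smooth g"
  shows "cc_smooth (\<lambda>x. B (f x) (g x))"
  using assms unfolding cc_smooth_def
  by (metis smooth_bilinear bounded_bilinear.zero_right)

lemmas cc_smooth_mult = cc_smooth_bilinear[OF bounded_bilinear_mult]

lemma cc_smooth_mult_left: "cc_smooth f \<Longrightarrow> smooth g \<Longrightarrow> cc_smooth (\<lambda>x. f x * g x)"
  for f :: "'a::euclidean_space \<Rightarrow> 'b::real_normed_algebra"
  unfolding cc_smooth_def by (metis smooth_mult mult_zero_left)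

lemma cc_smooth_linear_comp:
  assumes "bounded_linear L" "cc_smooth f"
  shows "cc_smooth (\<lambda>x. L (f x))"
  using assms unfolding cc_smooth_def
  by (metis smooth_linear_comp linear_simps(3))

lemmas cc_smooth_minus = cc_smooth_linear_comp[OF bounded_linear_minus[OF bounded_linear_ident]]
lemmas cc_smooth_of_real = cc_smooth_linear_comp[OF bounded_linear_of_real]
lemmas cc_smooth_cnj = cc_smooth_linear_comp[OF bounded_linear_cnj]

lemma cc_smooth_zero: "cc_smooth (\<lambda>x. 0)"
  by (auto simp: cc_smooth_def smooth_const)

lemma cc_smooth_add: "cc_smooth f \<Longrightarrow> cc_smooth g \<Longrightarrow> cc_smooth (\<lambda>x. f x + g x)"
proof -
  assume "cc_smooth f" "cc_smooth g"
  moreover from this obtain R S where "\<forall>x. norm x > R \<longrightarrow> f x = 0" "\<forall>x. norm x > S \<longrightarrow> g x = 0"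
    by (auto simp: cc_smooth_def)
  then have "\<forall>x. norm x > max R S \<longrightarrow> f x + g x = 0" by auto
  ultimately show ?thesis unfolding cc_smooth_def by (blast intro: smooth_add)
qed

lemma cc_smooth_diff: "cc_smooth f \<Longrightarrow> cc_smooth g \<Longrightarrow> cc_smooth (\<lambda>x. f x - g x)"
  using cc_smooth_add[OF _ cc_smooth_minus, of f g] by simp

lemma cc_smooth_sum: "(\<And>i. i \<in> I \<Longrightarrow> cc_smooth (f i)) \<Longrightarrow> cc_smooth (\<lambda>x. \<Sum>i\<in>I. f i x)"
  by (induction I rule: infinite_finite_induct) (auto intro: cc_smooth_add cc_smooth_zero)

lemma cc_smooth_affine:
  fixes f :: "'a::euclidean_space \<Rightarrow> 'b::real_normed_vector"
  assumes "cc_smooth f" "t \<noteq> 0"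
  shows "cc_smooth (\<lambda>x. f (c + t *\<^sub>R x))"
proof -
  from assms obtain R where R: "\<And>x. norm x > R \<Longrightarrow> f x = 0" by (auto simp: cc_smooth_def)
  have "f (c + t *\<^sub>R x) = 0" if "norm x > (R + norm c) / \<bar>t\<bar>" for x
  proof (rule R)
    have "R + norm c < norm (t *\<^sub>R x)" using that assms(2) by (simp add: field_simps)
    also have "\<dots> \<le> norm (c + t *\<^sub>R x) + norm c" by (metis add.commute add_diff_cancel_left' norm_triangle_ineq4)
    finally show "R < norm (c + t *\<^sub>R x)" by simp
  qed
  then show ?thesis using assms(1) unfolding cc_smooth_def
    by (auto intro!: smooth_compose[of f] smooth_intros)
qed

lemma cc_smooth_imp_bounded:
  assumes "cc_smooth f"
  obtains C where "\<And>x. norm (f x) \<le> C" "C > 0"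
proof -
  from assms obtain R where R: "\<And>x. norm x > R \<Longrightarrow> f x = 0" by (auto simp: cc_smooth_def)
  have "compact (f ` cball 0 R)"
    by (intro compact_continuous_image smooth_continuous cc_smoothD assms) simp
  then obtain C where C: "\<And>x. x \<in> cball 0 R \<Longrightarrow> norm (f x) \<le> C"
    by (meson bounded_iff compact_imp_bounded image_eqI)
  have "norm (f x) \<le> max C 1" for x
    using C[of x] R[of x] by (cases "norm x > R") auto
  then show ?thesis using that[of "max C 1"] by auto
qed

section \<open>A smooth bump function\<close>

lemma poly_mult_exp_minus_tendsto_0:
  fixes p :: "real poly"
  shows "((\<lambda>x. poly p x * exp (- x)) \<longlongrightarrow> 0) at_top"
proof -
  have "((\<lambda>x. \<Sum>i\<le>degree p. coeff p i * (x ^ i / exp x)) \<longlongrightarrow> (\<Sum>i\<le>degree p. coeff p i * 0)) at_top"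
    by (intro tendsto_sum tendsto_mult tendsto_const tendsto_power_div_exp_0)
  moreover have "(\<lambda>x. \<Sum>i\<le>degree p. coeff p i * (x ^ i / exp x)) = (\<lambda>x. poly p x * exp (- x))"
    by (simp add: poly_altdef exp_minus sum_distrib_right divide_inverse mult.assoc)
  ultimately show ?thesis by simp
qed

text \<open>The functions p(1/t) exp(-1/t), extended by 0 to t \<le> 0, form a family closed under
  differentiation; the polynomial parameter is there for the coinductive proof of
  smoothness.\<close>

definition flat :: "real poly \<Rightarrow> real \<Rightarrow> real" where
  "flat p t = (if t > 0 then poly p (1 / t) * exp (- (1 / t)) else 0)"

lemma flat_tendsto_0: "(flat p \<longlongrightarrow> 0) (at 0)"
proof (rule filterlim_split_at)
  show "(flat p \<longlongrightarrow> 0) (at_left 0)"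
    by (rule tendsto_eventually) (auto simp: flat_def eventually_at_filter)
  have "((\<lambda>t. poly p (inverse t) * exp (- inverse t)) \<longlongrightarrow> 0) (at_right 0)"
    by (rule filterlim_compose[OF poly_mult_exp_minus_tendsto_0 filterlim_inverse_at_top_right])
  then show "(flat p \<longlongrightarrow> 0) (at_right 0)"
    by (rule Lim_transform_eventually) (auto simp: flat_def eventually_at_filter divide_inverse)
qed

text \<open>For t > 0 the derivative is (p - p')(1/t) t^(-2) exp(-1/t), and the factor t^(-2) is the
  polynomial X^2 = \<open>[:0, 0, 1:]\<close> evaluated at 1/t.\<close>

lemma flat_has_derivative:
  "(flat p has_field_derivative flat ([:0, 0, 1:] * (p - pderiv p)) t) (at t)"
proof -
  consider "t > 0" | "t < 0" | "t = 0" by linarith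
  then show ?thesis
  proof cases
    case 1
    have "((\<lambda>t. poly p (1 / t) * exp (- (1 / t))) has_field_derivative
        flat ([:0, 0, 1:] * (p - pderiv p)) t) (at t)"
      using 1 by (auto intro!: derivative_eq_intros simp: flat_def field_simps power2_eq_square)
    then show ?thesis
      by (rule has_field_derivative_transform_within_open[of _ _ _ "{0<..}"])
         (use 1 in \<open>auto simp: flat_def\<close>)
  next
    case 2
    have "((\<lambda>t. 0) has_field_derivative flat ([:0, 0, 1:] * (p - pderiv p)) t) (at t)"
      using 2 by (auto simp: flat_def)
    then show ?thesis
      by (rule has_field_derivative_transform_within_open[of _ _ _ "{..<0}"])
         (use 2 in \<open>auto simp: flat_def\<close>)
  next
    case 3
    \<comment> \<open>Division by t multiplies the polynomial by X, so the difference quotient at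
      the origin is again of the form \<open>flat\<close>, and its limit is already known to be
      0.\<close>
    have "(\<lambda>t. (flat p t - flat p 0) / (t - 0)) = flat (pCons 0 p)"
      by (auto simp: flat_def fun_eq_iff)
    then show ?thesis using flat_tendsto_0[of "pCons 0 p"] 3
      by (simp add: has_field_derivative_iff flat_def[of _ 0])
  qed
qed

lemma smooth_flat: "smooth (flat p)"
proof (rule smooth_coinduct[of "\<lambda>f. \<exists>p. f = flat p"])
  fix f :: "real \<Rightarrow> real" and x b :: real assume "\<exists>p. f = flat p"
  then obtain p where f: "f = flat p" by auto
  show "f differentiable at x"
    unfolding f using flat_has_derivative by (auto simp: differentiable_def has_field_derivative_def)
  assume "b \<in> Basis"
  then have "pd b f = flat ([:0, 0, 1:] * (p - pderiv p))"
    unfolding f using pd_real[OF flat_has_derivative] by auto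
  then show "\<exists>p. pd b f = flat p" by blast
qed auto

text \<open>This is exp(-1/(1 - |x|^2)) on the open unit ball and 0 elsewhere. Its values lie in
  [0, exp (-1)], hence below 1.\<close>

definition bump :: "'a::euclidean_space \<Rightarrow> real" where
  "bump x = flat 1 (1 - x \<bullet> x)"

lemma bump_pos_iff: "bump x > 0 \<longleftrightarrow> norm x < 1"
  by (auto simp: bump_def flat_def power2_norm_eq_inner[symmetric] abs_square_less_1)

lemma bump_nonneg: "bump x \<ge> 0"
  by (simp add: bump_def flat_def)

lemma bump_eq_0: "norm x \<ge> 1 \<Longrightarrow> bump x = 0"
  using bump_pos_iff[of x] bump_nonneg[of x] by linarith

lemma cc_smooth_bump: "cc_smooth (bump :: 'a::euclidean_space \<Rightarrow> real)"
  unfolding cc_smooth_def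
proof
  show "smooth bump" unfolding bump_def[abs_def]
    by (intro smooth_compose[OF smooth_flat] smooth_intros)
  show "\<exists>R. \<forall>x::'a. R < norm x \<longrightarrow> bump x = 0"
    by (intro exI[of _ 1]) (simp add: bump_eq_0)
qed

lemma cc_smooth_lipschitz:
  fixes f :: "'a::euclidean_space \<Rightarrow> 'b::real_normed_vector"
  assumes "cc_smooth f"
  obtains L where "L > 0" "\<And>x y. norm (f x - f y) \<le> L * dist x y"
proof -
  have "\<exists>C. \<forall>b\<in>Basis. \<forall>x. norm (pd b f x) \<le> C"
  proof -
    have "\<forall>b\<in>Basis. \<exists>C. (\<forall>x. norm (pd b f x) \<le> C) \<and> C > 0"
      using cc_smooth_imp_bounded[OF cc_smooth_pd[OF assms]] by metis
    then obtain C where C: "\<And>b x. b \<in> Basis \<Longrightarrow> norm (pd b f x) \<le> C b" "\<And>b. b \<in> Basis \<Longrightarrow> C b > 0"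
      by metis
    have "norm (pd b f x) \<le> (\<Sum>b\<in>Basis. C b)" if "b \<in> Basis" for b x
      using C(1)[OF that, of x] member_le_sum[of b Basis C] that C(2)
      by (force simp: less_imp_le intro: order_trans)
    then show ?thesis by blast
  qed
  then obtain C where C: "\<And>b x. b \<in> Basis \<Longrightarrow> norm (pd b f x) \<le> C" by blast
  have C0: "C \<ge> 0" using C[OF SOME_Basis] norm_ge_zero order_trans by blast
  let ?L = "real DIM('a) * C"
  have "norm (f x - f y) \<le> ?L * norm (x - y)" for x y
  proof (rule differentiable_bound[of UNIV f "\<lambda>x v. \<Sum>b\<in>Basis. (v \<bullet> b) *\<^sub>R pd b f x"])
    show "(f has_derivative (\<lambda>v. \<Sum>b\<in>Basis. (v \<bullet> b) *\<^sub>R pd b f x)) (at x within UNIV)" for x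
      by (simp add: has_derivative_pd_sum smooth_differentiable cc_smoothD[OF assms])
    show "onorm (\<lambda>v. \<Sum>b\<in>Basis. (v \<bullet> b) *\<^sub>R pd b f x) \<le> ?L" for x
    proof (rule onorm_bound)
      fix v :: 'a
      have "norm (\<Sum>b\<in>Basis. (v \<bullet> b) *\<^sub>R pd b f x) \<le> (\<Sum>b\<in>(Basis::'a set). norm v * C)"
        by (rule sum_norm_le) (auto intro!: mult_mono C Basis_le_norm)
      then show "norm (\<Sum>b\<in>Basis. (v \<bullet> b) *\<^sub>R pd b f x) \<le> ?L * norm v" by (simp add: mult_ac)
    qed (simp add: C0)
  qed auto
  then have "norm (f x - f y) \<le> (?L + 1) * dist x y" for x y
    by (smt (verit) dist_norm distrib_right mult_cancel_right1 norm_ge_zero)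
  moreover have "?L + 1 > 0" using C0 by (simp add: add_nonneg_pos)
  ultimately show ?thesis using that by blast
qed

section \<open>Differentiation under the integral sign\<close>

text \<open>What is dominated is the oscillation of the partial derivatives near x0, by e times a
  fixed integrable function. The mean value inequality then bounds the linearisation error of the
  integrand by a small multiple of |x - x0|, and integrating this bound gives the derivative
  directly.\<close>

lemma has_derivative_integral:
  fixes f :: "'a::euclidean_space \<Rightarrow> 'c \<Rightarrow> 'b::{banach, second_countable_topology}"
  assumes int: "\<And>x. integrable M (f x)"
    and diff: "\<And>x y. (\<lambda>x. f x y) differentiable (at x)"
    and intd: "\<And>b. b \<in> Basis \<Longrightarrow> integrable M (\<lambda>y. pd b (\<lambda>x. f x y) x0)"
    and g: "integrable M g"
    and unif: "\<And>e. e > 0 \<Longrightarrow> \<exists>d>0. \<forall>x y. \<forall>b\<in>Basis. dist x x0 < d \<longrightarrow>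
       norm (pd b (\<lambda>x. f x y) x - pd b (\<lambda>x. f x y) x0) \<le> e * g y"
  shows "((\<lambda>x. \<integral>y. f x y \<partial>M) has_derivative
      (\<lambda>v. \<Sum>b\<in>Basis. (v \<bullet> b) *\<^sub>R (\<integral>y. pd b (\<lambda>x. f x y) x0 \<partial>M))) (at x0)"
  unfolding has_derivative_at_alt
proof (intro conjI allI impI)
  show "bounded_linear (\<lambda>v. \<Sum>b\<in>Basis. (v \<bullet> b) *\<^sub>R (\<integral>y. pd b (\<lambda>x. f x y) x0 \<partial>M))"
    by (intro bounded_linear_sum bounded_linear_scaleR_const bounded_linear_inner_left)
next
  fix e :: real assume e: "e > 0"
  define I where "I = (\<integral>y. \<bar>g y\<bar> \<partial>M)"
  have I: "I \<ge> 0" by (simp add: I_def)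
  \<comment> \<open>Summing over the directions and integrating the bound costs DIM times I; the 1
    in I + 1 keeps the denominator positive when g vanishes almost everywhere.\<close>
  define e' where "e' = e / (real DIM('a) * (I + 1))"
  have e': "e' > 0" using e I by (simp add: e'_def)
  obtain d where d: "d > 0" and unif': "\<And>x y b. b \<in> Basis \<Longrightarrow> dist x x0 < d \<Longrightarrow>
      norm (pd b (\<lambda>x. f x y) x - pd b (\<lambda>x. f x y) x0) \<le> e' * g y"
    using unif[OF e'] by metis
  show "\<exists>d>0. \<forall>x. norm (x - x0) < d \<longrightarrow> norm ((\<integral>y. f x y \<partial>M) - (\<integral>y. f x0 y \<partial>M) -
      (\<Sum>b\<in>Basis. ((x - x0) \<bullet> b) *\<^sub>R (\<integral>y. pd b (\<lambda>x. f x y) x0 \<partial>M))) \<le> e * norm (x - x0)"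
  proof (intro exI conjI allI impI d)
    fix x assume x: "norm (x - x0) < d"
    define F where "F z y v = (\<Sum>b\<in>Basis. (v \<bullet> b) *\<^sub>R pd b (\<lambda>x. f x y) z)" for z y v
    \<comment> \<open>At x = x0 the left side of \<open>unif'\<close> is 0, which forces g to be
      nonnegative.\<close>
    have gpos: "g y \<ge> 0" for y
      using unif'[OF SOME_Basis, of x0 y] d e' by (simp add: zero_le_mult_iff)
    have bound: "norm (f x y - f x0 y - F x0 y (x - x0)) \<le> norm (x - x0) * (real DIM('a) * e' * \<bar>g y\<bar>)" for y
    proof (rule differentiable_bound_linearization[of x0 x "ball x0 d" "\<lambda>x. f x y" "\<lambda>z. F z y"])
      show "x0 + t *\<^sub>R (x - x0) \<in> ball x0 d" if "t \<in> {0..1}" for t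
      proof -
        have "norm (t *\<^sub>R (x - x0)) \<le> norm (x - x0)" using that by (simp add: mult_left_le_one_le)
        then show ?thesis using x by (simp add: dist_norm)
      qed
      show "((\<lambda>x. f x y) has_derivative F z y) (at z within ball x0 d)" for z
        using has_derivative_at_withinI[OF has_derivative_pd_sum[OF diff]] by (simp add: F_def[abs_def])
      show "onorm (F z y - F x0 y) \<le> real DIM('a) * e' * \<bar>g y\<bar>" if z: "z \<in> ball x0 d" for z
      proof (rule onorm_bound)
        fix v
        have "(F z y - F x0 y) v =
            (\<Sum>b\<in>Basis. (v \<bullet> b) *\<^sub>R (pd b (\<lambda>x. f x y) z - pd b (\<lambda>x. f x y) x0))"
          by (simp add: F_def sum_subtractf scaleR_diff_right)
        also have "norm \<dots> \<le> (\<Sum>b\<in>(Basis::'a set). norm v * (e' * g y))"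
          using z by (intro sum_norm_le) (auto intro!: mult_mono unif' Basis_le_norm simp: dist_commute)
        finally show "norm ((F z y - F x0 y) v) \<le> real DIM('a) * e' * \<bar>g y\<bar> * norm v"
          using gpos by (simp add: mult_ac)
      qed (use e' in auto)
    qed (use d in auto)
    have Fint: "integrable M (\<lambda>y. F x0 y (x - x0))"
      unfolding F_def by (intro Bochner_Integration.integrable_sum integrable_scaleR_right) (auto intro: intd)
    have "(\<integral>y. f x y \<partial>M) - (\<integral>y. f x0 y \<partial>M) - (\<Sum>b\<in>Basis. ((x - x0) \<bullet> b) *\<^sub>R (\<integral>y. pd b (\<lambda>x. f x y) x0 \<partial>M))
        = (\<integral>y. f x y - f x0 y - F x0 y (x - x0) \<partial>M)"
      using Fint int intd by (simp add: F_def)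
    also have "norm \<dots> \<le> (\<integral>y. norm (x - x0) * (real DIM('a) * e' * \<bar>g y\<bar>) \<partial>M)"
    proof (rule order_trans[OF integral_norm_bound integral_mono])
      show "integrable M (\<lambda>y. norm (f x y - f x0 y - F x0 y (x - x0)))" using int Fint by auto
      show "integrable M (\<lambda>y. norm (x - x0) * (real DIM('a) * e' * \<bar>g y\<bar>))" using g by auto
    qed (rule bound)
    also have "\<dots> = norm (x - x0) * (real DIM('a) * e' * I)" by (simp add: I_def)
    also have "\<dots> = norm (x - x0) * (e * (I / (I + 1)))" by (simp add: e'_def)
    also have "\<dots> \<le> norm (x - x0) * (e * 1)"
      using e I by (intro mult_left_mono) auto
    finally show "norm ((\<integral>y. f x y \<partial>M) - (\<integral>y. f x0 y \<partial>M) -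
      (\<Sum>b\<in>Basis. ((x - x0) \<bullet> b) *\<^sub>R (\<integral>y. pd b (\<lambda>x. f x y) x0 \<partial>M))) \<le> e * norm (x - x0)"
      by (simp add: mult_ac)
  qed (rule d)
qed

section \<open>Convolution and integration by parts\<close>

lemma integral_lborel_affine:
  fixes f :: "'a::euclidean_space \<Rightarrow> 'b::{banach, second_countable_topology}"
  assumes f: "f \<in> borel_measurable borel" and c: "c \<noteq> 0"
  shows "(\<integral>x. f x \<partial>lborel) = \<bar>c\<bar> ^ DIM('a) *\<^sub>R (\<integral>x. f (t + c *\<^sub>R x) \<partial>lborel)"
  using f by (subst lborel_affine[OF c, of t]) (simp add: integral_density integral_distr)

lemma nn_integral_lborel_affine:
  fixes f :: "'a::euclidean_space \<Rightarrow> ennreal"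
  assumes f: "f \<in> borel_measurable borel" and c: "c \<noteq> 0"
  shows "(\<integral>\<^sup>+x. f x \<partial>lborel) = ennreal (\<bar>c\<bar> ^ DIM('a)) * (\<integral>\<^sup>+x. f (t + c *\<^sub>R x) \<partial>lborel)"
  using f by (subst lborel_affine[OF c, of t]) (simp add: nn_integral_density nn_integral_distr nn_integral_cmult)

definition locally_integrable :: "('a::euclidean_space \<Rightarrow> complex) \<Rightarrow> bool" where
  "locally_integrable u \<longleftrightarrow> u \<in> borel_measurable borel \<and>
     (\<forall>R. integrable lborel (\<lambda>x. indicator (cball 0 R) x *\<^sub>R u x))"

lemma locally_integrable_measurable [measurable_dest]:
  "locally_integrable u \<Longrightarrow> u \<in> borel_measurable borel"
  by (simp add: locally_integrable_def)

lemma smooth_measurable [measurable_dest]: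
  "smooth f \<Longrightarrow> f \<in> borel_measurable borel"
  by (simp add: borel_measurable_continuous_onI smooth_continuous)

lemma locally_integrable_mult:
  assumes u: "locally_integrable u" and g: "g \<in> borel_measurable borel"
    and C: "\<And>x. norm (g x) \<le> C" and R: "\<And>x. norm x > R \<Longrightarrow> g x = 0"
  shows "integrable lborel (\<lambda>x. u x * g x)"
proof (rule Bochner_Integration.integrable_bound)
  show "integrable lborel (\<lambda>x. C *\<^sub>R (indicator (cball 0 R) x *\<^sub>R u x))"
    using u by (intro integrable_scaleR_right) (auto simp: locally_integrable_def)
  show "(\<lambda>x. u x * g x) \<in> borel_measurable lborel"
    using g u by (auto dest: locally_integrable_measurable)
  have "norm (u x * g x) \<le> norm (C *\<^sub>R (indicator (cball 0 R) x *\<^sub>R u x))" for x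
  proof (cases "norm x > R")
    case False
    have "norm (g x) * norm (u x) \<le> \<bar>C\<bar> * norm (u x)"
      by (rule mult_right_mono[OF order_trans[OF C abs_ge_self]]) simp
    with False show ?thesis by (simp add: norm_mult mult.commute)
  qed (simp add: R)
  then show "AE x in lborel. norm (u x * g x) \<le> norm (C *\<^sub>R (indicator (cball 0 R) x *\<^sub>R u x))" by simp
qed

lemma locally_integrable_cc_smooth:
  assumes "locally_integrable u" "cc_smooth g"
  shows "integrable lborel (\<lambda>x. u x * g x)"
proof -
  obtain R where R: "\<And>x. norm x > R \<Longrightarrow> g x = 0" using assms(2) by (auto simp: cc_smooth_def)
  obtain C where C: "\<And>x. norm (g x) \<le> C" using cc_smooth_imp_bounded[OF assms(2)] by blast
  show ?thesis
    by (rule locally_integrable_mult[OF assms(1) _ C R]) (simp add: smooth_measurable cc_smoothD[OF assms(2)])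
qed

lemma continuous_locally_integrable:
  assumes "continuous_on UNIV u"
  shows "locally_integrable u"
  unfolding locally_integrable_def
  using assms by (auto intro!: borel_measurable_continuous_onI borel_integrable_compact continuous_on_subset[of UNIV u])

lemma cc_smooth_integrable: "cc_smooth g \<Longrightarrow> integrable lborel g" for g :: "'a::euclidean_space \<Rightarrow> complex"
  using locally_integrable_cc_smooth[OF continuous_locally_integrable[of "\<lambda>_. 1"], of g] by simp

definition conv :: "('a::euclidean_space \<Rightarrow> complex) \<Rightarrow> ('a \<Rightarrow> complex) \<Rightarrow> 'a \<Rightarrow> complex" where
  "conv k u x = (\<integral>y. u y * k (x - y) \<partial>lborel)"

lemma cc_smooth_reflect: "cc_smooth f \<Longrightarrow> cc_smooth (\<lambda>y. f (x - y))"
  for f :: "'a::euclidean_space \<Rightarrow> 'b::real_normed_vector"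
  using cc_smooth_affine[of f "-1" x] by simp

lemma pd_reflect:
  fixes f :: "'a::euclidean_space \<Rightarrow> 'b::real_normed_vector"
  shows "smooth f \<Longrightarrow> pd b (\<lambda>y. f (x - y)) y = - pd b f (x - y)"
  using pd_affine[of f x "-1" y b] smooth_differentiable[of f] by simp

lemma pd_translate:
  fixes f :: "'a::euclidean_space \<Rightarrow> 'b::real_normed_vector"
  shows "smooth f \<Longrightarrow> pd b (\<lambda>x. f (x - y)) x = pd b f (x - y)"
  using pd_affine[of f "- y" 1 x b] smooth_differentiable[of f] by simp

text \<open>The derivative falls on the kernel. The derivatives of a test function are Lipschitz,
  and this is the uniform oscillation bound required for differentiating under the integral, with u
  merely locally integrable.\<close>

lemma conv_has_derivative:
  assumes k: "cc_smooth k" and u: "locally_integrable u"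
  shows "(conv k u has_derivative (\<lambda>v. \<Sum>b\<in>Basis. (v \<bullet> b) *\<^sub>R conv (pd b k) u x0)) (at x0)"
proof -
  have ks: "smooth k" using k by (rule cc_smoothD)
  obtain R where R: "\<And>x. norm x > R \<Longrightarrow> k x = 0" using k by (auto simp: cc_smooth_def)
  have kd: "(\<lambda>x. u y * k (x - y)) differentiable at x" for x y
    using smooth_differentiable[OF smooth_mult[OF smooth_const smooth_compose[OF ks smooth_diff[OF smooth_ident smooth_const]]]] .
  have pdk: "pd b (\<lambda>x. u y * k (x - y)) x = u y * pd b k (x - y)" for b x y
    using pd_cmult[OF smooth_differentiable[OF smooth_compose[OF ks smooth_diff[OF smooth_ident smooth_const]]]]
      pd_translate[OF ks] by metis
  have "\<forall>b\<in>Basis. \<exists>L. L > 0 \<and> (\<forall>x y. norm (pd b k x - pd b k y) \<le> L * dist x y)"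
    using cc_smooth_lipschitz[OF cc_smooth_pd[OF k]] by metis
  then obtain L where L: "\<And>b. b \<in> Basis \<Longrightarrow> L b > 0"
    "\<And>b x y. b \<in> Basis \<Longrightarrow> norm (pd b k x - pd b k y) \<le> L b * dist x y" by metis
  define M where "M = (\<Sum>b\<in>Basis. L b)"
  have M: "M > 0" unfolding M_def using L(1) by (intro sum_pos) auto
  have LM: "L b \<le> M" if "b \<in> Basis" for b
    unfolding M_def by (rule member_le_sum) (use that L(1) in \<open>auto simp: less_imp_le\<close>)
  \<comment> \<open>For x within distance 1 of x0 the integrand and its derivatives vanish once |y|
    exceeds R + |x0| + 1, so u is needed on this ball only.\<close>
  let ?g = "\<lambda>y. norm (indicator (cball 0 (R + norm x0 + 1)) y *\<^sub>R u y)"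
  have "((\<lambda>x. \<integral>y. u y * k (x - y) \<partial>lborel) has_derivative
      (\<lambda>v. \<Sum>b\<in>Basis. (v \<bullet> b) *\<^sub>R (\<integral>y. pd b (\<lambda>x. u y * k (x - y)) x0 \<partial>lborel))) (at x0)"
  proof (rule has_derivative_integral[where g = ?g])
    show "integrable lborel (\<lambda>y. u y * k (x - y))" for x
      by (intro locally_integrable_cc_smooth u cc_smooth_reflect k)
    show "integrable lborel (\<lambda>y. pd b (\<lambda>x. u y * k (x - y)) x0)" if "b \<in> Basis" for b
      unfolding pdk using that by (intro locally_integrable_cc_smooth u cc_smooth_reflect cc_smooth_pd k)
    show "integrable lborel ?g"
      using u by (intro integrable_norm) (auto simp: locally_integrable_def)
    fix e :: real assume e: "e > 0"
    show "\<exists>d>0. \<forall>x y. \<forall>b\<in>Basis. dist x x0 < d \<longrightarrow>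
       norm (pd b (\<lambda>x. u y * k (x - y)) x - pd b (\<lambda>x. u y * k (x - y)) x0) \<le> e * ?g y"
    proof (intro exI[of _ "min 1 (e / M)"] conjI allI ballI impI)
      fix x y b assume b: "b \<in> (Basis::'a set)" and x: "dist x x0 < min 1 (e / M)"
      have *: "norm (pd b k (x - y) - pd b k (x0 - y)) \<le> e"
      proof -
        have "norm (pd b k (x - y) - pd b k (x0 - y)) \<le> L b * dist (x - y) (x0 - y)"
          by (rule L(2)[OF b])
        also have "\<dots> \<le> M * (e / M)"
          using x LM[OF b] M e by (intro mult_mono) (auto simp: dist_norm)
        finally show ?thesis using M by simp
      qed
      show "norm (pd b (\<lambda>x. u y * k (x - y)) x - pd b (\<lambda>x. u y * k (x - y)) x0) \<le> e * ?g y"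
      proof (cases "norm y \<le> R + norm x0 + 1")
        case True
        have "norm (u y * pd b k (x - y) - u y * pd b k (x0 - y)) \<le> norm (u y) * e"
          unfolding right_diff_distrib[symmetric] norm_mult by (rule mult_left_mono[OF *]) simp
        with True show ?thesis by (simp add: pdk mult.commute)
      next
        case False
        have "norm (x - y) > R" "norm (x0 - y) > R"
          using x False norm_triangle_ineq2[of y x] norm_triangle_ineq2[of y x0] norm_triangle_ineq2[of x x0]
          by (auto simp: dist_norm norm_minus_commute)
        then show ?thesis using e by (simp add: pdk pd_eq_0_outside[OF R])
      qed
    qed (use e M in auto)
  qed (use kd in auto)
  then show ?thesis by (simp add: pdk conv_def[abs_def])
qed

lemma pd_conv:
  assumes "cc_smooth k" "locally_integrable u" "b \<in> Basis"
  shows "pd b (conv k u) = conv (pd b k) u"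
proof
  fix x
  have "(\<Sum>i\<in>Basis. (b \<bullet> i) *\<^sub>R conv (pd i k) u x) = (\<Sum>i\<in>Basis. if i = b then conv (pd b k) u x else 0)"
    using assms(3) by (intro sum.cong) (auto simp: inner_Basis)
  then show "pd b (conv k u) x = conv (pd b k) u x"
    using has_derivative_pd[OF conv_has_derivative[OF assms(1,2)]] assms(3) by simp
qed

lemma smooth_conv:
  assumes "cc_smooth k" "locally_integrable u"
  shows "smooth (conv k u)"
proof (rule smooth_coinduct[of "\<lambda>f. \<exists>k. cc_smooth k \<and> f = conv k u"])
  show "\<exists>k'. cc_smooth k' \<and> conv k u = conv k' u" using assms(1) by blast
  show "f differentiable at x" if "\<exists>k. cc_smooth k \<and> f = conv k u" for f x
    using that conv_has_derivative[OF _ assms(2)] by (auto simp: differentiable_def)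
  show "\<exists>k. cc_smooth k \<and> pd b f = conv k u" if "\<exists>k. cc_smooth k \<and> f = conv k u" "b \<in> Basis" for f b
    using that pd_conv[OF _ assms(2)] cc_smooth_pd by blast
qed

text \<open>Convolving g with the constant 1 gives a constant function, by translation invariance,
  and its derivative is the convolution of \<open>pd b g\<close> with 1. So the rule for derivatives
  of convolutions already contains the vanishing of this integral.\<close>

lemma integral_pd_eq_0:
  fixes g :: "'a::euclidean_space \<Rightarrow> complex"
  assumes g: "cc_smooth g" and b: "b \<in> Basis"
  shows "(\<integral>x. pd b g x \<partial>lborel) = 0"
proof -
  have const: "conv k (\<lambda>_. 1) = (\<lambda>x. \<integral>y. k y \<partial>lborel)" if "cc_smooth k" for k :: "'a \<Rightarrow> complex"
    using integral_lborel_affine[OF smooth_measurable[OF cc_smoothD[OF that]], of "-1"]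
    by (auto simp: conv_def)
  have "(\<integral>x. pd b g x \<partial>lborel) = conv (pd b g) (\<lambda>_. 1) 0"
    using const[OF cc_smooth_pd[OF g b]] by metis
  also have "\<dots> = pd b (conv g (\<lambda>_. 1)) 0"
    using pd_conv[OF g continuous_locally_integrable b] by simp
  also have "\<dots> = 0" unfolding const[OF g] by simp
  finally show ?thesis .
qed

lemma integration_by_parts:
  fixes f g :: "'a::euclidean_space \<Rightarrow> complex"
  assumes f: "smooth f" and g: "cc_smooth g" and b: "b \<in> Basis"
  shows "(\<integral>x. f x * pd b g x \<partial>lborel) = - (\<integral>x. pd b f x * g x \<partial>lborel)"
proof -
  have gs: "smooth g" using g by (rule cc_smoothD)
  have i: "integrable lborel (\<lambda>x. f x * pd b g x)" "integrable lborel (\<lambda>x. pd b f x * g x)"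
    using f g b by (auto intro!: cc_smooth_integrable cc_smooth_mult cc_smooth_pd smooth_pd)
  have "pd b (\<lambda>x. f x * g x) = (\<lambda>x. f x * pd b g x + pd b f x * g x)"
    using pd_mult[OF smooth_differentiable[OF f] smooth_differentiable[OF gs]] by blast
  then have "(\<integral>x. f x * pd b g x + pd b f x * g x \<partial>lborel) = 0"
    using integral_pd_eq_0[OF cc_smooth_mult[OF f g] b] by simp
  then show ?thesis using i by (simp add: add_eq_0_iff)
qed

section \<open>Square integrable functions\<close>

definition L2f :: "('a::euclidean_space \<Rightarrow> complex) \<Rightarrow> bool" where
  "L2f u \<longleftrightarrow> u \<in> borel_measurable borel \<and> integrable lborel (\<lambda>x. (cmod (u x))\<^sup>2)"

text \<open>Squared norms are used throughout, with nsq (u + v) \<le> 2 nsq u + 2 nsq v in the role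
  of the triangle inequality.\<close>

definition nsq :: "('a::euclidean_space \<Rightarrow> complex) \<Rightarrow> real" where
  "nsq u = (\<integral>x. (cmod (u x))\<^sup>2 \<partial>lborel)"

definition l2ip :: "('a::euclidean_space \<Rightarrow> complex) \<Rightarrow> ('a \<Rightarrow> complex) \<Rightarrow> complex" where
  "l2ip u v = (\<integral>x. u x * cnj (v x) \<partial>lborel)"

lemma L2f_measurable [measurable_dest]: "L2f u \<Longrightarrow> u \<in> borel_measurable borel"
  by (simp add: L2f_def)

lemma nsq_nonneg: "nsq u \<ge> 0"
  by (simp add: nsq_def)

lemma L2f_bound:
  assumes "integrable lborel g" "u \<in> borel_measurable borel" "\<And>x. (cmod (u x))\<^sup>2 \<le> g x"
  shows "L2f u" "nsq u \<le> (\<integral>x. g x \<partial>lborel)"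
proof -
  have i: "integrable lborel (\<lambda>x. (cmod (u x))\<^sup>2)"
    by (rule Bochner_Integration.integrable_bound[OF assms(1)])
       (use assms(2) order_trans[OF assms(3) abs_ge_self] in auto)
  then show "L2f u" using assms(2) by (simp add: L2f_def)
  show "nsq u \<le> (\<integral>x. g x \<partial>lborel)"
    unfolding nsq_def by (rule integral_mono[OF i assms(1,3)])
qed

lemma cmod_add_sq_le: "(cmod (a + b))\<^sup>2 \<le> 2 * (cmod a)\<^sup>2 + 2 * (cmod b)\<^sup>2"
proof -
  have "(cmod (a + b))\<^sup>2 \<le> (cmod a + cmod b)\<^sup>2" by (simp add: norm_triangle_ineq power_mono)
  also have "\<dots> \<le> 2 * (cmod a)\<^sup>2 + 2 * (cmod b)\<^sup>2"
    using sum_squares_bound[of "cmod a" "cmod b"] by (simp add: power2_sum)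
  finally show ?thesis .
qed

lemma L2f_add: "L2f u \<Longrightarrow> L2f v \<Longrightarrow> L2f (\<lambda>x. u x + v x)"
  and nsq_add_le: "L2f u \<Longrightarrow> L2f v \<Longrightarrow> nsq (\<lambda>x. u x + v x) \<le> 2 * nsq u + 2 * nsq v"
proof -
  assume "L2f u" "L2f v"
  then have *: "integrable lborel (\<lambda>x. 2 * (cmod (u x))\<^sup>2 + 2 * (cmod (v x))\<^sup>2)"
    "(\<lambda>x. u x + v x) \<in> borel_measurable borel" and i: "integrable lborel (\<lambda>x. (cmod (u x))\<^sup>2)"
    "integrable lborel (\<lambda>x. (cmod (v x))\<^sup>2)"
    by (auto simp: L2f_def)
  show "L2f (\<lambda>x. u x + v x)" by (rule L2f_bound[OF * cmod_add_sq_le])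
  show "nsq (\<lambda>x. u x + v x) \<le> 2 * nsq u + 2 * nsq v"
    using L2f_bound(2)[OF * cmod_add_sq_le] i by (simp add: nsq_def)
qed

lemma L2f_cmult: "L2f u \<Longrightarrow> L2f (\<lambda>x. c * u x)"
  by (auto simp: L2f_def norm_mult power_mult_distrib)

lemma nsq_cmult: "nsq (\<lambda>x. c * u x) = (cmod c)\<^sup>2 * nsq u"
  by (simp add: nsq_def norm_mult power_mult_distrib)

lemma L2f_minus: "L2f u \<Longrightarrow> L2f (\<lambda>x. - u x)"
  by (simp add: L2f_def)

lemma nsq_minus: "nsq (\<lambda>x. - u x) = nsq u"
  by (simp add: nsq_def)

lemma L2f_diff: "L2f u \<Longrightarrow> L2f v \<Longrightarrow> L2f (\<lambda>x. u x - v x)"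
  using L2f_add[OF _ L2f_minus, of u v] by simp

lemma nsq_diff_le: "L2f u \<Longrightarrow> L2f v \<Longrightarrow> nsq (\<lambda>x. u x - v x) \<le> 2 * nsq u + 2 * nsq v"
  using nsq_add_le[OF _ L2f_minus, of u v] by (simp add: nsq_minus)

lemma L2f_zero: "L2f (\<lambda>x. 0)"
  by (simp add: L2f_def)

lemma L2f_sum: "(\<And>i. i \<in> I \<Longrightarrow> L2f (f i)) \<Longrightarrow> L2f (\<lambda>x. \<Sum>i\<in>I. f i x)"
  by (induction I rule: infinite_finite_induct) (auto intro: L2f_add L2f_zero)

lemma borel_measurable_cnj [measurable]:
  "u \<in> borel_measurable M \<Longrightarrow> (\<lambda>x. cnj (u x)) \<in> borel_measurable M"
  by (rule borel_measurable_continuous_on[of cnj]) (auto intro: continuous_intros)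

lemma L2f_cnj: "L2f u \<Longrightarrow> L2f (\<lambda>x. cnj (u x))"
  by (auto simp: L2f_def)

lemma cmod_mult_le: "cmod (a * b) \<le> (cmod a)\<^sup>2 + (cmod b)\<^sup>2"
  using sum_squares_bound[of "cmod a" "cmod b"] zero_le_power2[of "cmod a"] zero_le_power2[of "cmod b"]
  unfolding norm_mult by linarith

lemma L2f_mult_integrable:
  assumes "L2f u" "L2f v"
  shows "integrable lborel (\<lambda>x. u x * v x)"
  by (rule Bochner_Integration.integrable_bound[of _ "\<lambda>x. (cmod (u x))\<^sup>2 + (cmod (v x))\<^sup>2"])
     (use assms in \<open>auto simp: L2f_def norm_mult[symmetric] intro!: AE_I2 cmod_mult_le\<close>)

lemma L2f_ip_integrable: "L2f u \<Longrightarrow> L2f v \<Longrightarrow> integrable lborel (\<lambda>x. u x * cnj (v x))"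
  by (intro L2f_mult_integrable L2f_cnj)

lemma nn_integral_nsq: "L2f u \<Longrightarrow> (\<integral>\<^sup>+x. ennreal ((cmod (u x))\<^sup>2) \<partial>lborel) = ennreal (nsq u)"
  unfolding nsq_def L2f_def by (intro nn_integral_eq_integral) auto

lemma cauchy_schwarz_nsq:
  assumes u: "L2f u" and v: "L2f v"
  shows "(cmod (\<integral>x. u x * v x \<partial>lborel))\<^sup>2 \<le> nsq u * nsq v"
proof -
  have [measurable]: "u \<in> borel_measurable borel" "v \<in> borel_measurable borel"
    using u v by (auto simp: L2f_def)
  have "ennreal (cmod (\<integral>x. u x * v x \<partial>lborel)) \<le> (\<integral>\<^sup>+x. ennreal (cmod (u x * v x)) \<partial>lborel)"
    by (rule integral_norm_bound_ennreal[OF L2f_mult_integrable[OF u v]])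
  then have "(ennreal (cmod (\<integral>x. u x * v x \<partial>lborel)))\<^sup>2 \<le>
      (\<integral>\<^sup>+x. ennreal (cmod (u x)) * ennreal (cmod (v x)) \<partial>lborel)\<^sup>2"
    by (simp add: norm_mult ennreal_mult power_mono)
  also have "\<dots> \<le> (\<integral>\<^sup>+x. (ennreal (cmod (u x)))\<^sup>2 \<partial>lborel) * (\<integral>\<^sup>+x. (ennreal (cmod (v x)))\<^sup>2 \<partial>lborel)"
    by (rule Cauchy_Schwarz_nn_integral) auto
  also have "\<dots> = ennreal (nsq u * nsq v)"
    using nn_integral_nsq[OF u] nn_integral_nsq[OF v]
    by (simp add: ennreal_power ennreal_mult nsq_nonneg)
  finally show ?thesis
    by (simp add: ennreal_power nsq_nonneg)
qed

lemma l2ip_cnj: "l2ip v u = cnj (l2ip u v)"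
  unfolding l2ip_def Bochner_Integration.integral_cnj[symmetric] by (simp add: mult.commute)

lemma l2ip_self: "L2f u \<Longrightarrow> l2ip u u = of_real (nsq u)"
  by (simp add: l2ip_def nsq_def complex_norm_square[symmetric] flip: of_real_power)

lemma nsq_cnj: "nsq (\<lambda>x. cnj (u x)) = nsq u"
  by (simp add: nsq_def)

lemma l2ip_bound: "L2f u \<Longrightarrow> L2f v \<Longrightarrow> (cmod (l2ip u v))\<^sup>2 \<le> nsq u * nsq v"
  unfolding l2ip_def using cauchy_schwarz_nsq[of u "\<lambda>x. cnj (v x)"] L2f_cnj[of v] by (simp add: nsq_cnj)

lemma l2ip_diff_left: "L2f u \<Longrightarrow> L2f v \<Longrightarrow> L2f w \<Longrightarrow> l2ip (\<lambda>x. u x - v x) w = l2ip u w - l2ip v w"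
  unfolding l2ip_def by (simp add: left_diff_distrib L2f_ip_integrable)

lemma l2ip_diff_right: "L2f u \<Longrightarrow> L2f v \<Longrightarrow> L2f w \<Longrightarrow> l2ip u (\<lambda>x. v x - w x) = l2ip u v - l2ip u w"
  unfolding l2ip_def by (simp add: right_diff_distrib L2f_ip_integrable)

lemma l2ip_tendsto_left:
  assumes "\<And>k. L2f (f k)" "L2f u" "L2f v" "(\<lambda>k. nsq (\<lambda>x. f k x - u x)) \<longlonglongrightarrow> 0"
  shows "(\<lambda>k. l2ip (f k) v) \<longlonglongrightarrow> l2ip u v"
proof -
  have "(\<lambda>k. (cmod (l2ip (f k) v - l2ip u v))\<^sup>2) \<longlonglongrightarrow> 0"
  proof (rule tendsto_sandwich[OF _ _ tendsto_const])
    show "(\<lambda>k. nsq (\<lambda>x. f k x - u x) * nsq v) \<longlonglongrightarrow> 0"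
      using tendsto_mult[OF assms(4) tendsto_const] by simp
    show "eventually (\<lambda>k. (cmod (l2ip (f k) v - l2ip u v))\<^sup>2 \<le> nsq (\<lambda>x. f k x - u x) * nsq v) sequentially"
      using l2ip_bound[OF L2f_diff[OF assms(1,2)] assms(3)] assms(1-3)
      by (simp add: l2ip_diff_left)
  qed simp
  then have "(\<lambda>k. sqrt ((cmod (l2ip (f k) v - l2ip u v))\<^sup>2)) \<longlonglongrightarrow> sqrt 0" by (rule tendsto_real_sqrt)
  then show ?thesis by (simp add: tendsto_norm_zero_iff LIM_zero_iff)
qed

lemma l2ip_tendsto_right:
  assumes "\<And>k. L2f (f k)" "L2f u" "L2f v" "(\<lambda>k. nsq (\<lambda>x. f k x - u x)) \<longlonglongrightarrow> 0"
  shows "(\<lambda>k. l2ip v (f k)) \<longlonglongrightarrow> l2ip v u"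
  unfolding l2ip_cnj[of v] by (rule tendsto_cnj[OF l2ip_tendsto_left[OF assms]])

lemma L2f_locally_integrable:
  assumes "L2f u" shows "locally_integrable u"
  unfolding locally_integrable_def
proof (intro conjI allI)
  show m: "u \<in> borel_measurable borel" using assms by (simp add: L2f_def)
  fix R :: real
  show "integrable lborel (\<lambda>x. indicator (cball 0 R) x *\<^sub>R u x)"
  proof (rule Bochner_Integration.integrable_bound)
    show "integrable lborel (\<lambda>x::'a. indicator (cball 0 R) x + (cmod (u x))\<^sup>2)"
    proof (rule Bochner_Integration.integrable_add)
      show "integrable lborel (indicat_real (cball (0::'a) R))"
        using emeasure_lborel_cball_finite[of "0::'a" R] by (simp add: less_top)
    qed (use assms in \<open>simp add: L2f_def\<close>)
    have "norm (indicator (cball 0 R) x *\<^sub>R u x) \<le> norm (indicator (cball 0 R) x + (cmod (u x))\<^sup>2)" for x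
      using cmod_mult_le[of "u x" 1]
      by (auto simp: indicator_def split: if_splits)
    then show "AE x in lborel. norm (indicator (cball 0 R) x *\<^sub>R u x) \<le> norm (indicator (cball 0 R) x + (cmod (u x))\<^sup>2)"
      by simp
    show "(\<lambda>x. indicator (cball 0 R) x *\<^sub>R u x) \<in> borel_measurable lborel"
      by (intro borel_measurable_scaleR borel_measurable_indicator) (use m in auto)
  qed
qed

lemma cc_smooth_L2f:
  assumes "cc_smooth g" shows "L2f g"
proof -
  have "integrable lborel (\<lambda>x. g x * cnj (g x))"
    by (intro cc_smooth_integrable cc_smooth_mult cc_smooth_cnj cc_smoothD assms)
  then have "integrable lborel (\<lambda>x. complex_of_real ((cmod (g x))\<^sup>2))"
    by (simp only: complex_norm_square)
  then show ?thesis
    using smooth_measurable[OF cc_smoothD[OF assms]] integrable_Re by (fastforce simp: L2f_def)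
qed

lemma L2f_bounded_mult:
  assumes u: "L2f u" and m: "c \<in> borel_measurable borel" and C: "\<And>x. cmod (c x) \<le> C"
  shows "L2f (\<lambda>x. c x * u x)" "nsq (\<lambda>x. c x * u x) \<le> C\<^sup>2 * nsq u"
proof -
  have 1: "integrable lborel (\<lambda>x. C\<^sup>2 * (cmod (u x))\<^sup>2)" using u by (auto simp: L2f_def)
  have 2: "(\<lambda>x. c x * u x) \<in> borel_measurable borel" using u m by (auto simp: L2f_def)
  have 3: "(cmod (c x * u x))\<^sup>2 \<le> C\<^sup>2 * (cmod (u x))\<^sup>2" for x
    unfolding norm_mult power_mult_distrib by (intro mult_right_mono power_mono C) auto
  show "L2f (\<lambda>x. c x * u x)" "nsq (\<lambda>x. c x * u x) \<le> C\<^sup>2 * nsq u"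
    using L2f_bound[OF 1 2 3] by (simp_all add: nsq_def)
qed

lemma nsq_dominated_convergence:
  assumes "\<And>n. f n \<in> borel_measurable borel" "integrable lborel w"
    "\<And>n x. (cmod (f n x))\<^sup>2 \<le> w x" "AE x in lborel. (\<lambda>n. f n x) \<longlonglongrightarrow> 0"
  shows "(\<lambda>n. nsq (f n)) \<longlonglongrightarrow> 0"
proof -
  have "(\<lambda>n. \<integral>x. (cmod (f n x))\<^sup>2 \<partial>lborel) \<longlonglongrightarrow> (LINT x|(lborel::'a measure). 0)"
  proof (rule integral_dominated_convergence[where w = w])
    show "AE x in lborel. (\<lambda>n. (cmod (f n x))\<^sup>2) \<longlonglongrightarrow> 0"
      using assms(4)
    proof eventually_elim
      case (elim x)
      from tendsto_power[OF tendsto_norm[OF elim], of 2] show ?case by simp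
    qed
  qed (use assms in auto)
  then show ?thesis by (simp add: nsq_def)
qed

text \<open>A function that is \<open>measurable_on\<close> the whole space is, by definition, an
  almost everywhere limit of continuous functions. The passage from Borel measurability is made for
  real functions, hence the real and imaginary parts.\<close>

lemma measurable_ae_limit_continuous:
  fixes v :: "'a::euclidean_space \<Rightarrow> complex"
  assumes "v \<in> borel_measurable borel"
  obtains g where "\<And>n. continuous_on UNIV (g n)" "AE x in lborel. (\<lambda>n::nat. g n x) \<longlonglongrightarrow> v x"
proof -
  have real: "f measurable_on UNIV" if "f \<in> borel_measurable borel" for f :: "'a \<Rightarrow> real"
    by (rule lebesgue_measurable_imp_measurable_on_real) (use that in \<open>auto intro: measurable_completion\<close>)
  have "(\<lambda>x. Re (v x)) measurable_on UNIV" "(\<lambda>x. Im (v x)) measurable_on UNIV"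
    using assms by (auto intro!: real)
  then obtain N M g h where g: "negligible N" "\<And>n::nat. continuous_on UNIV (g n)"
      "\<And>x. x \<notin> N \<Longrightarrow> (\<lambda>n. g n x) \<longlonglongrightarrow> Re (v x)"
    and h: "negligible M" "\<And>n::nat. continuous_on UNIV (h n)"
      "\<And>x. x \<notin> M \<Longrightarrow> (\<lambda>n. h n x) \<longlonglongrightarrow> Im (v x)"
    unfolding measurable_on_def by auto
  have "AE x in lborel. x \<notin> N \<union> M"
    using negligible_Un[OF g(1) h(1)] AE_not_in
    by (metis AE_completion_iff negligible_iff_null_sets)
  then have "AE x in lborel. (\<lambda>n. Complex (g n x) (h n x)) \<longlonglongrightarrow> v x"
  proof eventually_elim
    case (elim x)
    have "(\<lambda>n. Complex (g n x) (h n x)) \<longlonglongrightarrow> Complex (Re (v x)) (Im (v x))"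
      using elim g(3) h(3) by (intro tendsto_Complex) auto
    then show ?case by simp
  qed
  moreover have "continuous_on UNIV (\<lambda>x. Complex (g n x) (h n x))" for n
    unfolding Complex_eq by (intro continuous_intros g h)
  ultimately show ?thesis using that[of "\<lambda>n x. Complex (g n x) (h n x)"] by blast
qed

text \<open>Truncating u in value and in space makes it bounded with bounded support. Its almost
  everywhere continuous approximants carry no bound of their own; clipping their values and
  multiplying by a continuous cutoff supplies the dominating function without changing the
  limit.\<close>

lemma L2f_continuous_approx:
  fixes u :: "'a::euclidean_space \<Rightarrow> complex"
  assumes u: "L2f u" and e: "e > 0"
  obtains g where "continuous_on UNIV g" "L2f g" "nsq (\<lambda>x. u x - g x) < e"
proof -
  have um [measurable]: "u \<in> borel_measurable borel" using u by (simp add: L2f_def)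
  define v where "v n x = (if cmod (u x) \<le> real n \<and> norm x \<le> real n then u x else 0)" for n x
  have vm [measurable]: "v n \<in> borel_measurable borel" for n unfolding v_def[abs_def] by measurable
  have "(\<lambda>n. nsq (\<lambda>x. u x - v n x)) \<longlonglongrightarrow> 0"
  proof (rule nsq_dominated_convergence[where w = "\<lambda>x. (cmod (u x))\<^sup>2"])
    show "integrable lborel (\<lambda>x. (cmod (u x))\<^sup>2)" using u by (simp add: L2f_def)
    show "AE x in lborel. (\<lambda>n. u x - v n x) \<longlonglongrightarrow> 0"
    proof (rule AE_I2)
      fix x
      have "eventually (\<lambda>n. u x - v n x = 0) sequentially"
        using eventually_ge_at_top[of "nat \<lceil>cmod (u x)\<rceil> + nat \<lceil>norm x\<rceil>"]
      proof eventually_elim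
        case (elim n)
        have "cmod (u x) \<le> real n" "norm x \<le> real n" using elim by linarith+
        then show ?case by (simp add: v_def)
      qed
      then show "(\<lambda>n. u x - v n x) \<longlonglongrightarrow> 0" by (rule tendsto_eventually)
    qed
  qed (auto simp: v_def)
  then have "eventually (\<lambda>n. nsq (\<lambda>x. u x - v n x) < e / 4) sequentially"
    using e by (intro order_tendstoD) auto
  \<comment> \<open>The index is taken as a successor so that the radius ?n below is
    positive.\<close>
  then obtain n where n: "nsq (\<lambda>x. u x - v (Suc n) x) < e / 4"
    unfolding eventually_sequentially by (meson le_SucI order_refl)
  let ?n = "real (Suc n)"
  have vb: "cmod (v (Suc n) x) \<le> ?n" and v0: "norm x > ?n \<Longrightarrow> v (Suc n) x = 0" for x
    by (auto simp: v_def)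
  obtain g where g: "\<And>k. continuous_on UNIV (g k)" "AE x in lborel. (\<lambda>k::nat. g k x) \<longlonglongrightarrow> v (Suc n) x"
    using measurable_ae_limit_continuous[OF vm] by blast
  \<comment> \<open>The radial retraction onto the disc of radius ?n: continuous, bounded by ?n and
    the identity on the disc.\<close>
  define clip where "clip z = z * complex_of_real (?n / max ?n (cmod z))" for z
  have clip_cont: "continuous_on UNIV clip"
    unfolding clip_def by (intro continuous_intros) auto
  have clip_le: "cmod (clip z) \<le> ?n" for z
  proof -
    have "cmod z * (?n / max ?n (cmod z)) \<le> max ?n (cmod z) * (?n / max ?n (cmod z))"
      by (rule mult_right_mono) auto
    then show ?thesis unfolding clip_def norm_mult norm_of_real by simp
  qed
  have clip_id: "clip z = z" if "cmod z \<le> ?n" for z using that by (simp add: clip_def max_absorb1)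
  define c where "c x = complex_of_real (max 0 (min 1 (?n + 1 - norm x)))" for x :: 'a
  have c_cont: "continuous_on UNIV c" unfolding c_def by (intro continuous_intros)
  have c_le: "cmod (c x) \<le> 1" for x by (simp add: c_def)
  have c1: "c x = 1" if "norm x \<le> ?n" for x using that by (simp add: c_def)
  have c0: "c x = 0" if "norm x > ?n + 1" for x using that by (simp add: c_def)
  define h where "h k x = c x * clip (g k x)" for k x
  have h_cont: "continuous_on UNIV (h k)" for k
    unfolding h_def by (intro continuous_on_mult c_cont continuous_on_compose2[OF clip_cont g(1)]) auto
  have hm [measurable]: "h k \<in> borel_measurable borel" for k
    by (intro borel_measurable_continuous_onI h_cont)
  let ?w = "\<lambda>x. (2 * ?n)\<^sup>2 * indicator (cball 0 (?n + 1)) x :: real"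
  have w: "integrable lborel (\<lambda>x. ?w (x::'a))"
    by (auto intro!: emeasure_lborel_cball_finite)
  have hb: "cmod (h k x) \<le> ?n" for k x
    unfolding h_def norm_mult using mult_mono[OF c_le clip_le[of "g k x"], of x] by simp
  have h0: "h k x = 0" if "norm x > ?n + 1" for k x using c0[OF that] by (simp add: h_def)
  have hL2: "L2f (h k)" for k
  proof (rule L2f_bound(1)[OF w])
    show "(cmod (h k x))\<^sup>2 \<le> ?w x" for x
    proof (cases "norm x > ?n + 1")
      case False
      have "(cmod (h k x))\<^sup>2 \<le> (2 * ?n)\<^sup>2" using hb[of k x] by (intro power_mono) auto
      with False show ?thesis by simp
    qed (simp add: h0)
  qed simp
  have "(\<lambda>k. nsq (\<lambda>x. v (Suc n) x - h k x)) \<longlonglongrightarrow> 0"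
  proof (rule nsq_dominated_convergence[OF _ w])
    show "(cmod (v (Suc n) x - h k x))\<^sup>2 \<le> ?w x" for k x
    proof (cases "norm x > ?n + 1")
      case True
      then show ?thesis using v0[of x] by (simp add: h0)
    next
      case False
      have "(cmod (v (Suc n) x - h k x))\<^sup>2 \<le> (2 * ?n)\<^sup>2"
        using hb[of k x] vb[of x] norm_triangle_ineq4[of "v (Suc n) x" "h k x"]
        by (intro power_mono) auto
      with False show ?thesis by simp
    qed
    show "AE x in lborel. (\<lambda>k. v (Suc n) x - h k x) \<longlonglongrightarrow> 0"
      using g(2)
    proof eventually_elim
      case (elim x)
      have "isCont clip (v (Suc n) x)" using clip_cont by (simp add: continuous_on_eq_continuous_at)
      from isCont_tendsto_compose[OF this elim]
      have "(\<lambda>k. h k x) \<longlonglongrightarrow> c x * clip (v (Suc n) x)"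
        unfolding h_def by (intro tendsto_intros)
      also have "c x * clip (v (Suc n) x) = v (Suc n) x"
        using clip_id[OF vb[of x]] v0[of x] c1[of x] by (cases "norm x > ?n") simp_all
      finally show ?case using tendsto_diff[OF tendsto_const[of "v (Suc n) x"]] by fastforce
    qed
  qed simp
  then have "eventually (\<lambda>k. nsq (\<lambda>x. v (Suc n) x - h k x) < e / 4) sequentially"
    using e by (intro order_tendstoD) auto
  then obtain k where k: "nsq (\<lambda>x. v (Suc n) x - h k x) < e / 4"
    unfolding eventually_sequentially by (meson order_refl)
  have vL2: "L2f (v (Suc n))"
    by (rule L2f_bound(1)[of "\<lambda>x. (cmod (u x))\<^sup>2"]) (use u in \<open>auto simp: L2f_def v_def\<close>)
  have "nsq (\<lambda>x. (u x - v (Suc n) x) + (v (Suc n) x - h k x)) \<le> 2 * (e / 4) + 2 * (e / 4)"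
    using nsq_add_le[OF L2f_diff[OF u vL2] L2f_diff[OF vL2 hL2[of k]]] n k by linarith
  moreover have "nsq (\<lambda>x. (u x - v (Suc n) x) + (v (Suc n) x - h k x)) < 2 * (e / 4) + 2 * (e / 4)"
    using nsq_add_le[OF L2f_diff[OF u vL2] L2f_diff[OF vL2 hL2[of k]]] n k by linarith
  ultimately have "nsq (\<lambda>x. u x - h k x) < e" by simp
  then show ?thesis using that[OF h_cont hL2] by blast
qed

text \<open>The Riesz-Fischer argument with squared norms. Along a subsequence the squared distances
  are below 8^(-j), so the sum of 4^j |d j|^2 is integrable and therefore finite almost everywhere.
  Since |d j| \<le> 4^j |d j|^2 + 4^(-j), the increments are then absolutely summable almost
  everywhere.\<close>

lemma L2_complete:
  fixes f :: "nat \<Rightarrow> 'a::euclidean_space \<Rightarrow> complex"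
  assumes f: "\<And>n. L2f (f n)"
    and cauchy: "\<And>e. e > 0 \<Longrightarrow> \<exists>N. \<forall>m\<ge>N. \<forall>n\<ge>N. nsq (\<lambda>x. f m x - f n x) < e"
  obtains v where "L2f v" "(\<lambda>n. nsq (\<lambda>x. f n x - v x)) \<longlonglongrightarrow> 0"
proof -
  have fm [measurable]: "f n \<in> borel_measurable borel" for n using f by (simp add: L2f_def)
  obtain N where N: "\<And>j m n. m \<ge> N j \<Longrightarrow> n \<ge> N j \<Longrightarrow> nsq (\<lambda>x. f m x - f n x) < (1/8::real) ^ j"
    using cauchy[of "(1/8) ^ j" for j] by (metis zero_less_divide_1_iff zero_less_numeral zero_less_power)
  define r where "r = rec_nat (N 0) (\<lambda>j p. max (Suc p) (N (Suc j)))"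
  have r0: "r j \<ge> N j" for j by (cases j) (auto simp: r_def)
  have rS: "r (Suc j) > r j" for j by (simp add: r_def)
  have r: "strict_mono r" using rS by (simp add: strict_mono_Suc_iff)
  define d where "d j x = f (r (Suc j)) x - f (r j) x" for j x
  have dL2: "L2f (d j)" for j unfolding d_def by (intro L2f_diff f)
  have dN: "nsq (d j) \<le> (1/8) ^ j" for j
    unfolding d_def using N[OF order_trans[OF r0 less_imp_le[OF rS]] r0] by (simp add: less_imp_le)
  have dm [measurable]: "d j \<in> borel_measurable borel" for j using dL2 by (simp add: L2f_def)
  have "(\<integral>\<^sup>+x. (\<Sum>j. ennreal (4 ^ j * (cmod (d j x))\<^sup>2)) \<partial>lborel) =
      (\<Sum>j. \<integral>\<^sup>+x. ennreal (4 ^ j * (cmod (d j x))\<^sup>2) \<partial>lborel)"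
    by (rule nn_integral_suminf) simp
  also have "\<dots> = (\<Sum>j. ennreal (4 ^ j * nsq (d j)))"
    by (simp add: ennreal_mult nn_integral_cmult nn_integral_nsq[OF dL2] nsq_nonneg)
  also have "\<dots> \<le> (\<Sum>j. ennreal ((1/2) ^ j))"
  proof (intro suminf_le ennreal_leI)
    fix j
    have "4 ^ j * nsq (d j) \<le> 4 ^ j * (1/8) ^ j" using dN by (intro mult_left_mono) auto
    also have "\<dots> = (1/2) ^ j" by (simp add: power_mult_distrib[symmetric])
    finally show "4 ^ j * nsq (d j) \<le> (1/2) ^ j" .
  qed auto
  also have "\<dots> = ennreal (\<Sum>j. (1/2) ^ j)" by (rule suminf_ennreal2) (auto intro: summable_geometric)
  finally have "(\<integral>\<^sup>+x. (\<Sum>j. ennreal (4 ^ j * (cmod (d j x))\<^sup>2)) \<partial>lborel) \<noteq> \<infinity>"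
    by (auto simp: top_unique)
  then have "AE x in lborel. (\<Sum>j. ennreal (4 ^ j * (cmod (d j x))\<^sup>2)) \<noteq> \<infinity>"
    by (intro nn_integral_noteq_infinite) auto
  then have conv: "AE x in lborel. convergent (\<lambda>n. f (r n) x)"
  proof eventually_elim
    case (elim x)
    have s: "summable (\<lambda>j. 4 ^ j * (cmod (d j x))\<^sup>2)"
      using elim by (intro summable_suminf_not_top) auto
    have "summable (\<lambda>j. 4 ^ j * (cmod (d j x))\<^sup>2 + (1/4) ^ j)"
      by (intro summable_add s summable_geometric) simp
    then have "summable (\<lambda>j. d j x)"
    proof (rule summable_comparison_test')
      fix j
      have "2 * (2 ^ j * cmod (d j x)) * (1/2) ^ j \<le> (2 ^ j * cmod (d j x))\<^sup>2 + ((1/2) ^ j)\<^sup>2"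
        by (rule sum_squares_bound)
      moreover have "2 * (2 ^ j * cmod (d j x)) * (1/2) ^ j = 2 * cmod (d j x)"
        by (simp add: power_divide)
      moreover have "(2 ^ j * cmod (d j x))\<^sup>2 = 4 ^ j * (cmod (d j x))\<^sup>2"
        by (simp add: power_mult_distrib power2_eq_square flip: power_mult_distrib)
      moreover have "((1/2::real) ^ j)\<^sup>2 = (1/4) ^ j"
        by (simp add: power2_eq_square flip: power_mult_distrib)
      ultimately show "norm (d j x) \<le> 4 ^ j * (cmod (d j x))\<^sup>2 + (1/4) ^ j"
        by (smt (verit) norm_ge_zero)
    qed
    then have "convergent (\<lambda>n. \<Sum>j<n. d j x)" by (simp add: summable_iff_convergent)
    moreover have "(\<Sum>j<n. d j x) = f (r n) x - f (r 0) x" for n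
      unfolding d_def by (rule sum_lessThan_telescope)
    ultimately have "convergent (\<lambda>n. f (r n) x - f (r 0) x)" by simp
    then have "convergent (\<lambda>n. (f (r n) x - f (r 0) x) + f (r 0) x)"
      by (intro convergent_add convergent_const)
    then show ?case by simp
  qed
  define v where "v x = lim (\<lambda>n. f (r n) x)" for x
  have vm [measurable]: "v \<in> borel_measurable borel" unfolding v_def[abs_def] by measurable
  have lim: "AE x in lborel. (\<lambda>n. f (r n) x) \<longlonglongrightarrow> v x"
    using conv by eventually_elim (simp add: v_def convergent_LIMSEQ_iff)
  \<comment> \<open>Fatou's lemma along the subsequence. Nonnegative integrals are used because the
    square integrability of \<open>f m - v\<close> is only deduced from this bound.\<close>
  have key: "(\<integral>\<^sup>+x. ennreal ((cmod (f m x - v x))\<^sup>2) \<partial>lborel) \<le> ennreal e"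
    if e: "e > 0" and M: "\<forall>m\<ge>M. \<forall>n\<ge>M. nsq (\<lambda>x. f m x - f n x) < e" and m: "m \<ge> M" for e M m
  proof -
    have "(\<integral>\<^sup>+x. ennreal ((cmod (f m x - v x))\<^sup>2) \<partial>lborel) =
        (\<integral>\<^sup>+x. liminf (\<lambda>n. ennreal ((cmod (f m x - f (r n) x))\<^sup>2)) \<partial>lborel)"
    proof (rule nn_integral_cong_AE, use lim in eventually_elim)
      case (elim x)
      have "(\<lambda>n. ennreal ((cmod (f m x - f (r n) x))\<^sup>2)) \<longlonglongrightarrow> ennreal ((cmod (f m x - v x))\<^sup>2)"
        by (intro tendsto_intros elim)
      then show ?case by (intro lim_imp_Liminf[symmetric]) auto
    qed
    also have "\<dots> \<le> liminf (\<lambda>n. \<integral>\<^sup>+x. ennreal ((cmod (f m x - f (r n) x))\<^sup>2) \<partial>lborel)"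
      by (rule nn_integral_liminf) simp
    also have "\<dots> \<le> ennreal e"
    proof (rule Liminf_le)
      show "eventually (\<lambda>n. (\<integral>\<^sup>+x. ennreal ((cmod (f m x - f (r n) x))\<^sup>2) \<partial>lborel) \<le> ennreal e) sequentially"
        using eventually_ge_at_top[of M]
      proof eventually_elim
        case (elim n)
        then have "r n \<ge> M" using seq_suble[OF r, of n] by simp
        then show ?case using M m by (simp add: nn_integral_nsq[OF L2f_diff[OF f f]] less_imp_le ennreal_leI)
      qed
    qed simp
    finally show ?thesis .
  qed
  have L2: "L2f (\<lambda>x. f m x - v x)" "nsq (\<lambda>x. f m x - v x) \<le> e"
    if e: "e > 0" and M: "\<forall>m\<ge>M. \<forall>n\<ge>M. nsq (\<lambda>x. f m x - f n x) < e" and m: "m \<ge> M" for e M m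
  proof -
    have i: "integrable lborel (\<lambda>x. (cmod (f m x - v x))\<^sup>2)"
      using key[OF that] by (intro integrableI_bounded) (auto simp: less_top[symmetric] top_unique)
    then show L: "L2f (\<lambda>x. f m x - v x)" by (simp add: L2f_def)
    show "nsq (\<lambda>x. f m x - v x) \<le> e"
      using key[OF that] e by (simp add: nn_integral_nsq[OF L])
  qed
  have tend: "(\<lambda>n. nsq (\<lambda>x. f n x - v x)) \<longlonglongrightarrow> 0"
  proof (rule LIMSEQ_I)
    fix e :: real assume e: "e > 0"
    then obtain M where "\<forall>m\<ge>M. \<forall>n\<ge>M. nsq (\<lambda>x. f m x - f n x) < e / 2" using cauchy[of "e / 2"] by auto
    from L2(2)[OF _ this] e have "\<forall>n\<ge>M. nsq (\<lambda>x. f n x - v x) \<le> e / 2" by simp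
    then have "\<forall>n\<ge>M. norm (nsq (\<lambda>x. f n x - v x) - 0) < e"
      using e nsq_nonneg by (metis abs_of_nonneg diff_zero field_sum_of_halves le_less_trans less_add_same_cancel1
          half_gt_zero_iff real_norm_def)
    then show "\<exists>no. \<forall>n\<ge>no. norm (nsq (\<lambda>x. f n x - v x) - 0) < e" by blast
  qed
  obtain M where "\<forall>m\<ge>M. \<forall>n\<ge>M. nsq (\<lambda>x. f m x - f n x) < 1" using cauchy[of 1] by auto
  from L2(1)[OF _ this order_refl] have "L2f (\<lambda>x. f M x - v x)" by simp
  from L2f_diff[OF f[of M] this] have "L2f v" by simp
  with tend that show ?thesis by blast
qed

section \<open>Localised integral operators and mollification\<close>

lemma nn_integral_nsq_bound:
  assumes "f \<in> borel_measurable borel" "c \<ge> 0"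
    "(\<integral>\<^sup>+x. ennreal ((cmod (f x))\<^sup>2) \<partial>lborel) \<le> ennreal c"
  shows "L2f f" "nsq f \<le> c"
proof -
  have "integrable lborel (\<lambda>x. (cmod (f x))\<^sup>2)"
    using assms by (intro integrableI_bounded) (auto simp: less_top[symmetric] top_unique)
  then show L: "L2f f" using assms(1) by (simp add: L2f_def)
  show "nsq f \<le> c" using assms(2,3) by (simp add: nn_integral_nsq[OF L])
qed

lemma kernel_section_measurable:
  fixes k :: "'a::euclidean_space \<Rightarrow> 'a \<Rightarrow> complex"
  assumes "continuous_on UNIV (\<lambda>p. k (fst p) (snd p))"
  shows "k x \<in> borel_measurable borel"
proof -
  have "continuous_on UNIV (\<lambda>y. k (fst (x, y)) (snd (x, y)))"
    by (rule continuous_on_compose2[OF assms]) (auto intro!: continuous_intros)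
  then show ?thesis by (simp add: borel_measurable_continuous_onI)
qed

lemma kernel_integrable:
  fixes k :: "'a::euclidean_space \<Rightarrow> 'a \<Rightarrow> complex"
  assumes u: "locally_integrable u" and k: "continuous_on UNIV (\<lambda>p. k (fst p) (snd p))"
    and bd: "\<And>y. cmod (k x y) \<le> C" and supp: "\<And>y. dist x y \<ge> e \<Longrightarrow> k x y = 0"
  shows "integrable lborel (\<lambda>y. u y * k x y)"
proof (rule locally_integrable_mult[OF u kernel_section_measurable[OF k] bd])
  show "k x y = 0" if "norm y > norm x + e" for y
    using that norm_triangle_ineq2[of y x] by (intro supp) (auto simp: dist_norm norm_minus_commute)
qed

text \<open>The kernel lives within distance e of the diagonal and has size C / e^m, where m is the
  dimension. Cauchy-Schwarz on the ball of radius e bounds the squared value at x by C^2 V / e^m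
  times the mass of |u|^2 on that ball; integrating in x returns the factor V e^m. The resulting
  bound is independent of e.\<close>

lemma kernel_operator_bound:
  fixes k :: "'a::euclidean_space \<Rightarrow> 'a \<Rightarrow> complex"
  defines "V \<equiv> unit_ball_vol (real DIM('a))"
  assumes u: "L2f u" and k: "continuous_on UNIV (\<lambda>p. k (fst p) (snd p))" and e: "e > 0"
    and bd: "\<And>x y. norm x \<le> R \<Longrightarrow> cmod (k x y) \<le> C / e ^ DIM('a)"
    and supp: "\<And>x y. norm x \<le> R \<Longrightarrow> dist x y \<ge> e \<Longrightarrow> k x y = 0"
  shows "L2f (\<lambda>x. indicator (cball 0 R) x *\<^sub>R (\<integral>y. u y * k x y \<partial>lborel))"
    and "nsq (\<lambda>x. indicator (cball 0 R) x *\<^sub>R (\<integral>y. u y * k x y \<partial>lborel)) \<le> (C * V)\<^sup>2 * nsq u"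
proof -
  let ?S = "\<lambda>x. indicator (cball 0 R) x *\<^sub>R (\<integral>y. u y * k x y \<partial>lborel)"
  let ?m = "DIM('a)"
  have V: "V \<ge> 0" by (simp add: V_def)
  have um [measurable]: "u \<in> borel_measurable borel" using u by (simp add: L2f_def)
  have km: "(\<lambda>p. k (fst p) (snd p)) \<in> borel_measurable (borel \<Otimes>\<^sub>M borel)"
    using borel_measurable_continuous_onI[OF k] by (simp add: borel_prod)
  have Sm: "?S \<in> borel_measurable borel"
  proof (intro borel_measurable_scaleR borel_measurable_indicator)
    have "(\<lambda>p. u (snd p) * k (fst p) (snd p)) \<in> borel_measurable (borel \<Otimes>\<^sub>M lborel)"
      using km by (intro borel_measurable_times) (auto intro: measurable_compose[OF measurable_snd])
    then show "(\<lambda>x. \<integral>y. u y * k x y \<partial>lborel) \<in> borel_measurable borel"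
      by (intro lborel.borel_measurable_lebesgue_integral) (simp add: case_prod_beta')
  qed auto
  \<comment> \<open>The mass of |u|^2 on the ball of radius e around x, written with an indicator on
    the product space so that the order of integration can be exchanged.\<close>
  define P where "P x = (\<integral>\<^sup>+y. ennreal ((cmod (u y))\<^sup>2) * indicator {p. dist (fst p) (snd p) < e} (x, y) \<partial>lborel)" for x
  have opn: "open {p :: 'a \<times> 'a. dist (fst p) (snd p) < e}"
    by (intro open_Collect_less continuous_intros)
  have mP: "(\<lambda>p. ennreal ((cmod (u (snd p)))\<^sup>2) * indicator {p. dist (fst p) (snd p) < e} p)
      \<in> borel_measurable (M \<Otimes>\<^sub>M lborel)" if "sets M = sets borel" for M :: "'a measure"
  proof (intro borel_measurable_times_ennreal borel_measurable_indicator)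
    have "sets (M \<Otimes>\<^sub>M lborel) = sets (borel :: ('a \<times> 'a) measure)"
      unfolding borel_prod[symmetric] by (intro sets_pair_measure_cong that) simp
    then show "{p. dist (fst p) (snd p) < e} \<in> sets (M \<Otimes>\<^sub>M lborel)" using borel_open[OF opn] by simp
    show "(\<lambda>p. ennreal ((cmod (u (snd p)))\<^sup>2)) \<in> borel_measurable (M \<Otimes>\<^sub>M lborel)"
      by (rule measurable_compose[OF measurable_snd]) simp
  qed
  have pointwise: "ennreal ((cmod (?S x))\<^sup>2) \<le> ennreal (C\<^sup>2 * V / e ^ ?m) * P x" for x
  proof (cases "norm x \<le> R")
    case True
    let ?u = "\<lambda>y. indicator (ball x e) y *\<^sub>R u y"
    have uL: "L2f ?u"
    proof (rule L2f_bound(1)[of "\<lambda>y. (cmod (u y))\<^sup>2"])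
      show "?u \<in> borel_measurable borel"
        by (intro borel_measurable_scaleR borel_measurable_indicator) auto
    qed (use u in \<open>auto simp: L2f_def indicator_def\<close>)
    have kb: "(cmod (k x y))\<^sup>2 \<le> (C / e ^ ?m)\<^sup>2 * indicator (ball x e) y" for y
    proof (cases "dist x y < e")
      case True
      then show ?thesis using bd[OF \<open>norm x \<le> R\<close>, of y] by (simp add: power_mono)
    qed (simp add: supp[OF True])
    have ki: "integrable lborel (\<lambda>y. (C / e ^ ?m)\<^sup>2 * indicator (ball x e) y)"
      using emeasure_lborel_ball_finite[of x e] by (simp add: less_top)
    note kL = L2f_bound[OF ki kernel_section_measurable[OF k] kb]
    have "(\<integral>y. (C / e ^ ?m)\<^sup>2 * indicator (ball x e) y \<partial>lborel) = (C / e ^ ?m)\<^sup>2 * (V * e ^ ?m)"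
      using e by (simp add: content_ball V_def)
    also have "\<dots> = C\<^sup>2 * V / e ^ ?m" using e by (simp add: power2_eq_square)
    finally have kn: "nsq (k x) \<le> C\<^sup>2 * V / e ^ ?m" using kL(2) by simp
    have "(\<integral>y. u y * k x y \<partial>lborel) = (\<integral>y. ?u y * k x y \<partial>lborel)"
      by (rule Bochner_Integration.integral_cong) (auto simp: indicator_def supp[OF True])
    then have "(cmod (?S x))\<^sup>2 \<le> nsq ?u * nsq (k x)"
      using cauchy_schwarz_nsq[OF uL kL(1)] True by simp
    also have "\<dots> \<le> nsq ?u * (C\<^sup>2 * V / e ^ ?m)"
      by (rule mult_left_mono[OF kn nsq_nonneg])
    finally have "ennreal ((cmod (?S x))\<^sup>2) \<le> ennreal (nsq ?u * (C\<^sup>2 * V / e ^ ?m))"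
      by (rule ennreal_leI)
    also have "\<dots> = ennreal (C\<^sup>2 * V / e ^ ?m) * ennreal (nsq ?u)"
      using V e by (subst ennreal_mult) (simp_all add: nsq_nonneg mult.commute)
    also have "ennreal (nsq ?u) = P x"
      unfolding nn_integral_nsq[OF uL, symmetric] P_def
      by (rule nn_integral_cong) (auto simp: indicator_def)
    finally show ?thesis .
  qed simp
  have "(\<integral>\<^sup>+x. ennreal ((cmod (?S x))\<^sup>2) \<partial>lborel) \<le> (\<integral>\<^sup>+x. ennreal (C\<^sup>2 * V / e ^ ?m) * P x \<partial>lborel)"
    by (intro nn_integral_mono pointwise)
  also have "\<dots> = ennreal (C\<^sup>2 * V / e ^ ?m) * (\<integral>\<^sup>+x. P x \<partial>lborel)"
  proof (rule nn_integral_cmult)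
    show "P \<in> borel_measurable lborel"
      unfolding P_def using mP[of lborel]
      by (intro lborel.borel_measurable_nn_integral) (simp add: case_prod_beta')
  qed
  also have "(\<integral>\<^sup>+x. P x \<partial>lborel) =
      (\<integral>\<^sup>+y. \<integral>\<^sup>+x. ennreal ((cmod (u y))\<^sup>2) * indicator {p. dist (fst p) (snd p) < e} (x, y) \<partial>lborel \<partial>lborel)"
    unfolding P_def using mP[of lborel]
    by (intro lborel_pair.Fubini'[symmetric]) (simp add: case_prod_beta')
  also have "\<dots> = (\<integral>\<^sup>+y. ennreal ((cmod (u y))\<^sup>2) * ennreal (V * e ^ ?m) \<partial>lborel)"
  proof (rule nn_integral_cong)
    fix y :: 'a
    have "(\<integral>\<^sup>+x. ennreal ((cmod (u y))\<^sup>2) * indicator {p. dist (fst p) (snd p) < e} (x, y) \<partial>lborel) =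
        (\<integral>\<^sup>+x. ennreal ((cmod (u y))\<^sup>2) * indicator (ball y e) x \<partial>lborel)"
      by (rule nn_integral_cong) (auto simp: indicator_def dist_commute)
    also have "\<dots> = ennreal ((cmod (u y))\<^sup>2) * ennreal (V * e ^ ?m)"
      using e by (subst nn_integral_cmult) (auto simp: emeasure_ball V_def intro!: borel_measurable_indicator)
    finally show "(\<integral>\<^sup>+x. ennreal ((cmod (u y))\<^sup>2) * indicator {p. dist (fst p) (snd p) < e} (x, y) \<partial>lborel) =
      ennreal ((cmod (u y))\<^sup>2) * ennreal (V * e ^ ?m)" .
  qed
  also have "\<dots> = ennreal (nsq u) * ennreal (V * e ^ ?m)"
    by (simp add: nn_integral_multc nn_integral_nsq[OF u])
  also have "ennreal (C\<^sup>2 * V / e ^ ?m) * (ennreal (nsq u) * ennreal (V * e ^ ?m)) = ennreal ((C * V)\<^sup>2 * nsq u)"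
    using e V by (simp add: ennreal_mult'[symmetric] nsq_nonneg power2_eq_square mult_ac)
  finally have fin: "(\<integral>\<^sup>+x. ennreal ((cmod (?S x))\<^sup>2) \<partial>lborel) \<le> ennreal ((C * V)\<^sup>2 * nsq u)" .
  show "L2f ?S" "nsq ?S \<le> (C * V)\<^sup>2 * nsq u"
    using nn_integral_nsq_bound[OF Sm _ fin] by (simp_all add: nsq_nonneg)
qed

text \<open>The operators converge to multiplication by \<open>\<sigma>\<close>: they are uniformly bounded on \<open>L\<^sup>2\<close>, so it
  suffices to treat continuous functions.\<close>

lemma kernel_operator_tendsto:
  fixes k :: "nat \<Rightarrow> 'a::euclidean_space \<Rightarrow> 'a \<Rightarrow> complex"
  assumes u: "L2f u" and k: "\<And>n. continuous_on UNIV (\<lambda>p. k n (fst p) (snd p))"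
    and e: "\<And>n. e n > 0" "e \<longlonglongrightarrow> 0"
    and bd: "\<And>n x y. norm x \<le> R \<Longrightarrow> cmod (k n x y) \<le> C / e n ^ DIM('a)"
    and supp: "\<And>n x y. norm x \<le> R \<Longrightarrow> dist x y \<ge> e n \<Longrightarrow> k n x y = 0"
    and mean: "\<And>d. d > 0 \<Longrightarrow>
      eventually (\<lambda>n. \<forall>x. norm x \<le> R \<longrightarrow> cmod ((\<integral>y. k n x y \<partial>lborel) - \<sigma>) \<le> d) sequentially"
  shows "L2f (\<lambda>x. indicator (cball 0 R) x *\<^sub>R ((\<integral>y. u y * k n x y \<partial>lborel) - \<sigma> * u x))"
    and "(\<lambda>n. nsq (\<lambda>x. indicator (cball 0 R) x *\<^sub>R ((\<integral>y. u y * k n x y \<partial>lborel) - \<sigma> * u x))) \<longlonglongrightarrow> 0"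
proof -
  let ?m = "DIM('a)"
  define V where "V = unit_ball_vol (real DIM('a))"
  have V: "V \<ge> 0" by (simp add: V_def)
  define S where "S n u x = indicator (cball 0 R) x *\<^sub>R (\<integral>y. u y * k n x y \<partial>lborel)" for n u x
  have SL: "L2f (S n v)" and SN: "nsq (S n v) \<le> (C * V)\<^sup>2 * nsq v" if "L2f v" for n v
    using kernel_operator_bound[where R = R and k = "k n" and e = "e n", OF that k e(1) bd supp] by (simp_all add: S_def[abs_def] V_def)
  define T where "T v x = indicator (cball 0 R) x *\<^sub>R (\<sigma> * v x)" for v and x :: 'a
  have TL: "L2f (T v)" and TN: "nsq (T v) \<le> (cmod \<sigma>)\<^sup>2 * nsq v" if "L2f v" for v
  proof -
    have m: "(\<lambda>x. indicator (cball 0 R) x *\<^sub>R \<sigma>) \<in> borel_measurable borel"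
      by (intro borel_measurable_scaleR borel_measurable_indicator) auto
    have le: "cmod (indicator (cball 0 R) x *\<^sub>R \<sigma>) \<le> cmod \<sigma>" for x :: 'a by (simp add: indicator_def)
    have eq: "(\<lambda>x. (indicator (cball 0 R) x *\<^sub>R \<sigma>) * v x) = T v" by (simp add: T_def fun_eq_iff)
    show "L2f (T v)" "nsq (T v) \<le> (cmod \<sigma>)\<^sup>2 * nsq v"
      using L2f_bounded_mult[OF that m le] unfolding eq by auto
  qed
  have D: "(\<lambda>x. indicator (cball 0 R) x *\<^sub>R ((\<integral>y. v y * k n x y \<partial>lborel) - \<sigma> * v x)) = (\<lambda>x. S n v x - T v x)" for n v
    by (simp add: S_def T_def fun_eq_iff scaleR_diff_right)
  show "L2f (\<lambda>x. indicator (cball 0 R) x *\<^sub>R ((\<integral>y. u y * k n x y \<partial>lborel) - \<sigma> * u x))"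
    unfolding D by (intro L2f_diff SL TL u)
  show "(\<lambda>n. nsq (\<lambda>x. indicator (cball 0 R) x *\<^sub>R ((\<integral>y. u y * k n x y \<partial>lborel) - \<sigma> * u x))) \<longlonglongrightarrow> 0"
    unfolding D
  proof (rule order_tendstoI)
    fix a :: real assume "a < 0"
    then show "eventually (\<lambda>n. nsq (\<lambda>x. S n u x - T u x) > a) sequentially"
      using nsq_nonneg less_le_trans by (intro always_eventually allI) blast
  next
    fix a :: real assume a: "a > 0"
    \<comment> \<open>The error budget: replacing u by a continuous g costs at most Q * nsq (u - g)
      < a/2, and a uniform error s for g on the ball of measure W costs at most 4 s^2 W \<le>
      a/4.\<close>
    define Q where "Q = 2 * (C * V)\<^sup>2 + 4 * (cmod \<sigma>)\<^sup>2 + 1"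
    have Q: "Q > 0" by (simp add: Q_def add_nonneg_pos)
    obtain g where gc: "continuous_on UNIV g" and gL: "L2f g" and gN: "nsq (\<lambda>x. u x - g x) < a / (2 * Q)"
      using L2f_continuous_approx[OF u, of "a / (2 * Q)"] a Q by auto
    have gli: "locally_integrable g" "locally_integrable u"
      using gL u by (simp_all add: L2f_locally_integrable)
    define W where "W = measure lborel (cball (0::'a) R)"
    define s where "s = sqrt (a / (16 * (W + 1)))"
    have W: "W \<ge> 0" by (simp add: W_def)
    have s: "s > 0" using a W by (simp add: s_def)
    have ssq: "s\<^sup>2 = a / (16 * (W + 1))" using a W by (simp add: s_def)
    obtain G where G: "\<And>x. norm x \<le> R \<Longrightarrow> cmod (g x) \<le> G" "G > 0"
    proof -
      have "compact (g ` cball 0 R)" using gc continuous_on_subset by (intro compact_continuous_image) auto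
      then obtain G where "\<And>x. norm x \<le> R \<Longrightarrow> cmod (g x) \<le> G"
        by (metis bounded_iff compact_imp_bounded image_eqI mem_cball_0)
      then have "\<And>x. norm x \<le> R \<Longrightarrow> cmod (g x) \<le> max G 1" by (simp add: max.coboundedI1)
      then show ?thesis using that[of "max G 1"] by auto
    qed
    define w where "w = s / (2 * (\<bar>C\<bar> * V + 1))"
    have CV: "\<bar>C\<bar> * V + 1 > 0" using V by (simp add: add_nonneg_pos)
    have w: "w > 0" using s CV by (simp add: w_def)
    have "uniformly_continuous_on (cball 0 (R + 1)) g"
      using gc continuous_on_subset by (intro compact_uniformly_continuous) auto
    then obtain d where d: "d > 0" "\<And>x y. norm x \<le> R + 1 \<Longrightarrow> norm y \<le> R + 1 \<Longrightarrow> dist y x < d \<Longrightarrow> dist (g y) (g x) < w"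
      unfolding uniformly_continuous_on_def using w by (metis mem_cball_0)
    have "eventually (\<lambda>n. e n < min d 1) sequentially"
      using e(2) d(1) by (intro order_tendstoD) auto
    moreover have "eventually (\<lambda>n. \<forall>x. norm x \<le> R \<longrightarrow> cmod ((\<integral>y. k n x y \<partial>lborel) - \<sigma>) \<le> s / (2 * G)) sequentially"
      using s G by (intro mean) auto
    ultimately show "eventually (\<lambda>n. nsq (\<lambda>x. S n u x - T u x) < a) sequentially"
    proof eventually_elim
      case (elim n)
      have sup: "cmod ((\<integral>y. g y * k n x y \<partial>lborel) - \<sigma> * g x) \<le> s" if x: "norm x \<le> R" for x
      proof -
        have i1: "integrable lborel (\<lambda>y. g y * k n x y)"
          by (rule kernel_integrable[OF gli(1) k bd[OF x] supp[OF x]])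
        have i2: "integrable lborel (\<lambda>y. g x * k n x y)"
          by (rule kernel_integrable[OF _ k bd[OF x] supp[OF x]]) (intro continuous_locally_integrable continuous_intros)
        \<comment> \<open>The first summand is small by uniform continuity of g near the ball, the
          second because the total mass of the kernel tends to \<sigma>.\<close>
        have "(\<integral>y. g y * k n x y \<partial>lborel) - \<sigma> * g x =
            (\<integral>y. g y * k n x y - g x * k n x y \<partial>lborel) + g x * ((\<integral>y. k n x y \<partial>lborel) - \<sigma>)"
          using i1 i2 by (simp add: algebra_simps)
        moreover have "cmod (\<integral>y. g y * k n x y - g x * k n x y \<partial>lborel) \<le> s / 2"
        proof -
          have "cmod (\<integral>y. g y * k n x y - g x * k n x y \<partial>lborel) \<le>
              (\<integral>y. w * (\<bar>C\<bar> / e n ^ ?m) * indicator (ball x (e n)) y \<partial>lborel)"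
          proof (rule order_trans[OF integral_norm_bound integral_mono])
            show "integrable lborel (\<lambda>y. cmod (g y * k n x y - g x * k n x y))"
              using i1 i2 by (intro integrable_norm Bochner_Integration.integrable_diff)
            show "integrable lborel (\<lambda>y. w * (\<bar>C\<bar> / e n ^ ?m) * indicator (ball x (e n)) y)"
              using emeasure_lborel_ball_finite[of x "e n"] by (simp add: less_top)
            fix y
            show "cmod (g y * k n x y - g x * k n x y) \<le> w * (\<bar>C\<bar> / e n ^ ?m) * indicator (ball x (e n)) y"
            proof (cases "dist x y < e n")
              case True
              have "norm y \<le> R + 1"
                using True x elim(1) norm_triangle_ineq2[of y x] by (auto simp: dist_norm norm_minus_commute)
              then have "cmod (g y - g x) \<le> w"
                using d(2)[of x y] True x elim(1) by (simp add: dist_norm norm_minus_commute)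
              moreover have "cmod (k n x y) \<le> \<bar>C\<bar> / e n ^ ?m"
                using bd[OF x, of n y] e(1)[of n]
                by (meson abs_ge_self divide_right_mono less_imp_le order_trans zero_le_power)
              ultimately have "cmod (g y - g x) * cmod (k n x y) \<le> w * (\<bar>C\<bar> / e n ^ ?m)"
                using w by (intro mult_mono) auto
              with True show ?thesis by (simp add: left_diff_distrib[symmetric] norm_mult)
            qed (simp add: supp[OF x])
          qed
          also have "\<dots> = w * (\<bar>C\<bar> * V)"
            using e(1)[of n] by (simp add: content_ball V_def less_imp_le)
          also have "\<dots> \<le> w * (\<bar>C\<bar> * V + 1)" using w by simp
          also have "\<dots> = s / 2" using CV unfolding w_def by (metis less_irrefl mult.commute nonzero_mult_divide_mult_cancel_left times_divide_eq_left)
          finally show ?thesis .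
        qed
        moreover have "cmod (g x * ((\<integral>y. k n x y \<partial>lborel) - \<sigma>)) \<le> G * (s / (2 * G))"
          unfolding norm_mult using elim(2) x G s by (intro mult_mono) auto
        then have "cmod (g x * ((\<integral>y. k n x y \<partial>lborel) - \<sigma>)) \<le> s / 2" using G by simp
        ultimately show ?thesis using norm_triangle_mono by fastforce
      qed
      have gN': "nsq (\<lambda>x. S n g x - T g x) \<le> s\<^sup>2 * W"
      proof -
        have "integrable lborel (\<lambda>x::'a. s\<^sup>2 * indicator (cball 0 R) x)"
          using emeasure_lborel_cball_finite[of "0::'a" R] by (simp add: less_top)
        moreover have "(cmod (S n g x - T g x))\<^sup>2 \<le> s\<^sup>2 * indicator (cball 0 R) x" for x
          using sup[of x] s by (auto simp: S_def T_def indicator_def intro!: power_mono)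
        ultimately have "nsq (\<lambda>x. S n g x - T g x) \<le> (\<integral>x. s\<^sup>2 * indicator (cball (0::'a) R) x \<partial>lborel)"
          using L2f_diff[OF SL[OF gL] TL[OF gL]] by (intro L2f_bound(2)) (auto simp: L2f_def)
        then show ?thesis by (simp add: W_def)
      qed
      have lin: "S n u x - T u x = S n (\<lambda>x. u x - g x) x + ((S n g x - T g x) - T (\<lambda>x. u x - g x) x)" for x
      proof (cases "norm x \<le> R")
        case True
        note kernel_integrable[OF _ k bd[OF True] supp[OF True]]
        then show ?thesis using gli by (simp add: S_def T_def algebra_simps)
      qed (simp add: S_def T_def)
      have L: "L2f (\<lambda>x. u x - g x)" by (intro L2f_diff u gL)
      have "nsq (\<lambda>x. S n u x - T u x) \<le> 2 * nsq (S n (\<lambda>x. u x - g x)) +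
          2 * (2 * nsq (\<lambda>x. S n g x - T g x) + 2 * nsq (T (\<lambda>x. u x - g x)))"
        unfolding lin
        by (rule order_trans[OF nsq_add_le[OF SL[OF L] L2f_diff[OF L2f_diff[OF SL[OF gL] TL[OF gL]] TL[OF L]]]
              add_left_mono[OF mult_left_mono[OF nsq_diff_le[OF L2f_diff[OF SL[OF gL] TL[OF gL]] TL[OF L]]]]]) simp
      also have "\<dots> \<le> 2 * ((C * V)\<^sup>2 * nsq (\<lambda>x. u x - g x)) + 2 * (2 * (s\<^sup>2 * W) + 2 * ((cmod \<sigma>)\<^sup>2 * nsq (\<lambda>x. u x - g x)))"
        by (intro add_mono mult_left_mono SN[OF L] TN[OF L] gN') auto
      also have "\<dots> = (2 * (C * V)\<^sup>2 + 4 * (cmod \<sigma>)\<^sup>2) * nsq (\<lambda>x. u x - g x) + 4 * s\<^sup>2 * W"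
        by (simp add: algebra_simps)
      also have "\<dots> \<le> Q * nsq (\<lambda>x. u x - g x) + a / 4"
      proof (rule add_mono)
        show "(2 * (C * V)\<^sup>2 + 4 * (cmod \<sigma>)\<^sup>2) * nsq (\<lambda>x. u x - g x) \<le> Q * nsq (\<lambda>x. u x - g x)"
          by (rule mult_right_mono) (simp_all add: Q_def nsq_nonneg)
        have "4 * s\<^sup>2 * W = a / 4 * (W / (W + 1))" unfolding ssq using W by (simp add: field_simps)
        also have "\<dots> \<le> a / 4 * 1" using a W by (intro mult_left_mono) auto
        finally show "4 * s\<^sup>2 * W \<le> a / 4" by simp
      qed
      also have "\<dots> < Q * (a / (2 * Q)) + a / 2"
        using mult_strict_left_mono[OF gN Q] a by linarith
      also have "\<dots> = a" using Q by simp
      finally show ?case .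
    qed
  qed
qed

section \<open>Mollifiers\<close>

lemma integral_bump_pos: "(\<integral>x. bump x \<partial>(lborel :: 'a::euclidean_space measure)) > 0"
proof -
  have i: "integrable lborel (bump :: 'a \<Rightarrow> real)"
    using integrable_Re[OF cc_smooth_integrable[OF cc_smooth_of_real[OF cc_smooth_bump]]] by simp
  have "(\<integral>x. bump x \<partial>(lborel :: 'a measure)) \<noteq> 0"
  proof
    assume "(\<integral>x. bump x \<partial>(lborel :: 'a measure)) = 0"
    then have "AE x in (lborel :: 'a measure). bump x = 0"
      using integral_nonneg_eq_0_iff_AE[OF i] by (simp add: bump_nonneg)
    then have "AE x in (lborel :: 'a measure). x \<notin> ball 0 1"
      by eventually_elim (metis bump_pos_iff less_irrefl mem_ball_0)
    moreover have "ball (0::'a) 1 = {x. norm x < 1}" by auto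
    ultimately have "emeasure lborel (ball (0::'a) 1) = 0"
      by (simp add: AE_iff_null null_sets_def)
    then show False using unit_ball_vol_pos[of "real DIM('a)"] by (simp add: emeasure_ball)
  qed
  moreover have "(\<integral>x. bump x \<partial>(lborel :: 'a measure)) \<ge> 0"
    by (simp add: bump_nonneg)
  ultimately show ?thesis by linarith
qed

definition mollifier :: "real \<Rightarrow> 'a::euclidean_space \<Rightarrow> complex" where
  "mollifier e x = of_real (bump ((1 / e) *\<^sub>R x) / ((\<integral>y. bump y \<partial>(lborel :: 'a measure)) * e ^ DIM('a)))"

lemma cc_smooth_mollifier: "e > 0 \<Longrightarrow> cc_smooth (mollifier e)"
  using cc_smooth_affine[OF cc_smooth_bump, of "1 / e" 0]
  unfolding mollifier_def[abs_def] divide_inverse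
  by (intro cc_smooth_of_real cc_smooth_mult_left smooth_const) auto

lemma integral_mollifier:
  assumes e: "e > 0"
  shows "(\<integral>x. mollifier e x \<partial>(lborel :: 'a::euclidean_space measure)) = 1"
proof -
  have "(\<integral>x. bump ((1 / e) *\<^sub>R x) \<partial>(lborel :: 'a measure)) =
      e ^ DIM('a) * (\<integral>x. bump x \<partial>(lborel :: 'a measure))"
    using e smooth_measurable[OF cc_smoothD[OF cc_smooth_affine[OF cc_smooth_bump, of "1 / e" "0::'a"]]]
    by (subst integral_lborel_affine[of _ e 0]) auto
  then show ?thesis
    using e integral_bump_pos[where 'a = 'a] unfolding mollifier_def by simp
qed

lemma mollifier_eq_0: "e > 0 \<Longrightarrow> norm x \<ge> e \<Longrightarrow> mollifier e x = 0"
  by (simp add: mollifier_def bump_eq_0)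

lemma cnj_mollifier [simp]: "cnj (mollifier e x) = mollifier e x"
  by (simp add: mollifier_def)

text \<open>One constant serves all scales e. A derivative costs an additional factor 1/e, which
  Friedrichs' lemma recovers from the Lipschitz continuity of the coefficients.\<close>

lemma mollifier_bounds:
  obtains C where "C > 0" "\<And>e x. e > 0 \<Longrightarrow> cmod (mollifier e (x::'a::euclidean_space)) \<le> C / e ^ DIM('a)"
    "\<And>e x b. e > 0 \<Longrightarrow> b \<in> Basis \<Longrightarrow> cmod (pd b (mollifier e) (x::'a)) \<le> C / (e * e ^ DIM('a))"
proof -
  let ?I = "\<integral>y. bump y \<partial>(lborel :: 'a measure)"
  have I: "?I > 0" by (rule integral_bump_pos)
  have bs: "smooth (bump :: 'a \<Rightarrow> real)" by (rule cc_smoothD[OF cc_smooth_bump])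
  obtain C0 where C0: "\<And>x::'a. norm (bump x) \<le> C0" "C0 > 0"
    using cc_smooth_imp_bounded[OF cc_smooth_bump] by metis
  have "\<forall>b\<in>(Basis::'a set). \<exists>C. (\<forall>x::'a. norm (pd b bump x) \<le> C) \<and> C > 0"
    using cc_smooth_imp_bounded[OF cc_smooth_pd[OF cc_smooth_bump]] by metis
  then obtain B where B: "\<And>b x. b \<in> (Basis::'a set) \<Longrightarrow> norm (pd b bump (x::'a)) \<le> B b"
    "\<And>b. b \<in> (Basis::'a set) \<Longrightarrow> B b > 0" by metis
  define C where "C = (C0 + sum B (Basis::'a set)) / ?I"
  have sB: "sum B (Basis::'a set) \<ge> 0" using B(2) by (intro sum_nonneg) (auto simp: less_imp_le)
  have Bs: "B b \<le> sum B (Basis::'a set)" if "b \<in> Basis" for b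
    by (rule member_le_sum) (use that B(2) in \<open>auto simp: less_imp_le\<close>)
  have C: "C > 0" using C0 sB I by (simp add: C_def add_pos_nonneg)
  show ?thesis
  proof (rule that[OF C])
    fix e :: real and x b :: 'a assume e: "e > 0"
    have "norm (bump ((1 / e) *\<^sub>R x)) / ?I \<le> C"
      unfolding C_def using I sB C0(1)[of "(1 / e) *\<^sub>R x"] by (intro divide_right_mono) auto
    then have "norm (bump ((1 / e) *\<^sub>R x)) / ?I / e ^ DIM('a) \<le> C / e ^ DIM('a)"
      using e by (intro divide_right_mono) auto
    then show "cmod (mollifier e x) \<le> C / e ^ DIM('a)"
      unfolding mollifier_def norm_of_real using I e by (simp add: abs_divide abs_mult)
    assume b: "b \<in> Basis"
    have d: "bump differentiable at (0 + (1 / e) *\<^sub>R x)" by (rule smooth_differentiable[OF bs])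
    have d': "(\<lambda>x. bump (0 + (1 / e) *\<^sub>R x)) differentiable at x"
      by (rule smooth_differentiable[OF cc_smoothD[OF cc_smooth_affine[OF cc_smooth_bump]]]) (use e in auto)
    have eq: "pd b (mollifier e :: 'a \<Rightarrow> complex) x = of_real (inverse (?I * e ^ DIM('a)) * ((1 / e) * pd b bump ((1 / e) *\<^sub>R x)))"
    proof -
      have "mollifier e = (\<lambda>x::'a. of_real (inverse (?I * e ^ DIM('a)) * bump (0 + (1 / e) *\<^sub>R x)))"
        by (simp add: mollifier_def fun_eq_iff divide_inverse mult.commute)
      moreover have "pd b (\<lambda>x::'a. complex_of_real (inverse (?I * e ^ DIM('a)) * bump (0 + (1 / e) *\<^sub>R x))) x =
          of_real (inverse (?I * e ^ DIM('a)) * ((1 / e) * pd b bump (0 + (1 / e) *\<^sub>R x)))"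
        using d d' pd_affine[OF d, of b]
        by (subst pd_of_real, intro differentiable_mult, simp, simp) (subst pd_cmult, simp, simp)
      ultimately show ?thesis by simp
    qed
    have "cmod (pd b (mollifier e :: 'a \<Rightarrow> complex) x) = norm (pd b bump ((1 / e) *\<^sub>R x)) / ?I / (e * e ^ DIM('a))"
      unfolding eq norm_of_real using I e by (simp add: abs_mult field_simps)
    moreover have "norm (pd b bump ((1 / e) *\<^sub>R x)) / ?I \<le> C"
      unfolding C_def using I C0(2) order_trans[OF B(1)[OF b] Bs[OF b], of "(1 / e) *\<^sub>R x"]
      by (intro divide_right_mono) auto
    then have "norm (pd b bump ((1 / e) *\<^sub>R x)) / ?I / (e * e ^ DIM('a)) \<le> C / (e * e ^ DIM('a))"
      using e by (intro divide_right_mono) auto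
    ultimately show "cmod (pd b (mollifier e) x) \<le> C / (e * e ^ DIM('a))" by simp
  qed
qed

section \<open>Magnetic Schroedinger operators\<close>

lemma smooth_lipschitz_cball:
  fixes f :: "'a::euclidean_space \<Rightarrow> 'b::real_normed_vector"
  assumes "smooth f"
  obtains L where "L > 0" "\<And>x y. norm x \<le> R \<Longrightarrow> norm y \<le> R \<Longrightarrow> norm (f x - f y) \<le> L * dist x y"
proof -
  have "\<exists>C. \<forall>x\<in>cball 0 R. norm (pd b f x) \<le> C" if "b \<in> Basis" for b
  proof -
    have "compact (pd b f ` cball 0 R)"
      by (intro compact_continuous_image smooth_continuous smooth_pd assms that) simp
    then show ?thesis by (metis bounded_iff compact_imp_bounded image_eqI)
  qed
  then obtain C where C: "\<And>b x. b \<in> Basis \<Longrightarrow> norm x \<le> R \<Longrightarrow> norm (pd b f x) \<le> C b"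
    by (metis mem_cball_0)
  define L where "L = (\<Sum>b\<in>Basis. \<bar>C b\<bar>)"
  have L: "L \<ge> 0" by (simp add: L_def sum_nonneg)
  have "norm (f x - f y) \<le> L * norm (x - y)" if xy: "norm x \<le> R" "norm y \<le> R" for x y
  proof (rule differentiable_bound[of "cball 0 R" f "\<lambda>x v. \<Sum>b\<in>Basis. (v \<bullet> b) *\<^sub>R pd b f x"])
    show "(f has_derivative (\<lambda>v. \<Sum>b\<in>Basis. (v \<bullet> b) *\<^sub>R pd b f x)) (at x within cball 0 R)" for x
      by (rule has_derivative_at_withinI[OF has_derivative_pd_sum[OF smooth_differentiable[OF assms]]])
    show "onorm (\<lambda>v. \<Sum>b\<in>Basis. (v \<bullet> b) *\<^sub>R pd b f z) \<le> L" if "z \<in> cball 0 R" for z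
    proof (rule onorm_bound[OF L])
      fix v :: 'a
      have "norm (\<Sum>b\<in>Basis. (v \<bullet> b) *\<^sub>R pd b f z) \<le> (\<Sum>b\<in>Basis. norm v * \<bar>C b\<bar>)"
      proof (rule sum_norm_le)
        fix b :: 'a assume b: "b \<in> Basis"
        have "norm (pd b f z) \<le> \<bar>C b\<bar>" using C[OF b, of z] that by simp
        then show "norm ((v \<bullet> b) *\<^sub>R pd b f z) \<le> norm v * \<bar>C b\<bar>"
          unfolding norm_scaleR using Basis_le_norm[OF b, of v] by (intro mult_mono) auto
      qed
      then show "norm (\<Sum>b\<in>Basis. (v \<bullet> b) *\<^sub>R pd b f z) \<le> L * norm v"
        by (simp add: L_def sum_distrib_left mult.commute)
    qed
  qed (use xy in auto)
  then have "norm (f x - f y) \<le> (L + 1) * dist x y" if "norm x \<le> R" "norm y \<le> R" for x y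
    using that by (smt (verit) dist_norm mult_right_mono norm_ge_zero)
  then show ?thesis using that[of "L + 1"] L by auto
qed

lemma Re_l2ip_le:
  assumes "L2f u" "L2f v"
  shows "\<bar>Re (l2ip u v)\<bar> \<le> (nsq u + nsq v) / 2"
proof -
  have "(cmod (l2ip u v))\<^sup>2 \<le> nsq u * nsq v" by (rule l2ip_bound[OF assms])
  also have "\<dots> \<le> ((nsq u + nsq v) / 2)\<^sup>2"
    using sum_squares_bound[of "nsq u" "nsq v"] by (simp add: power2_eq_square field_simps)
  finally have "cmod (l2ip u v) \<le> (nsq u + nsq v) / 2"
    by (rule power2_le_imp_le) (simp add: nsq_nonneg)
  then show ?thesis using abs_Re_le_cmod order_trans by blast
qed

text \<open>The factor \<open>exp 1\<close> normalises the value at the origin to 1. There is no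
  plateau: as R grows the cutoff tends to 1 pointwise, and the remaining error is treated by
  dominated convergence. The summand 0 gives the argument the affine shape c + t x of the
  differentiation rules.\<close>

definition cutoff :: "real \<Rightarrow> 'a::euclidean_space \<Rightarrow> real" where
  "cutoff R x = bump (0 + (1 / R) *\<^sub>R x) * exp 1"

lemma cc_smooth_cutoff: "R > 0 \<Longrightarrow> cc_smooth (cutoff R)"
  unfolding cutoff_def[abs_def]
  by (intro cc_smooth_mult_left smooth_const cc_smooth_affine cc_smooth_bump) auto

lemma cutoff_bounds: "0 \<le> cutoff R x" "cutoff R x \<le> 1"
proof -
  show "0 \<le> cutoff R x" by (simp add: cutoff_def bump_nonneg)
  have "flat 1 (1 - t) \<le> exp (- 1)" if "t \<ge> 0" for t :: real
    using that by (auto simp: flat_def field_simps)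
  then have "bump (0 + (1 / R) *\<^sub>R x) \<le> exp (- 1)" by (simp add: bump_def)
  then have "bump (0 + (1 / R) *\<^sub>R x) * exp 1 \<le> exp (- 1) * exp 1" by (intro mult_right_mono) auto
  then show "cutoff R x \<le> 1" by (simp add: cutoff_def flip: exp_add)
qed

lemma cutoff_eq_0: "R > 0 \<Longrightarrow> norm x \<ge> R \<Longrightarrow> cutoff R x = 0"
  by (simp add: cutoff_def bump_eq_0)

lemma cutoff_tendsto: "(\<lambda>n. cutoff (real (Suc n)) x) \<longlonglongrightarrow> 1"
proof -
  have "(\<lambda>n. inverse (real (Suc n)) *\<^sub>R x) \<longlonglongrightarrow> 0 *\<^sub>R x"
    by (intro tendsto_scaleR LIMSEQ_inverse_real_of_nat tendsto_const)
  moreover have "isCont (bump :: 'a \<Rightarrow> real) (0 *\<^sub>R x)"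
    using smooth_continuous[OF cc_smoothD[OF cc_smooth_bump[where 'a = 'a]], of UNIV]
    by (simp add: continuous_on_eq_continuous_at)
  ultimately have "(\<lambda>n. bump (inverse (real (Suc n)) *\<^sub>R x)) \<longlonglongrightarrow> bump (0 *\<^sub>R x)"
    by (rule isCont_tendsto_compose[rotated])
  then have "(\<lambda>n. bump (inverse (real (Suc n)) *\<^sub>R x) * exp 1) \<longlonglongrightarrow> bump (0::'a) * exp 1"
    by (intro tendsto_mult tendsto_const) simp
  moreover have "bump (0::'a) * exp 1 = 1" by (simp add: bump_def flat_def flip: exp_add)
  ultimately show ?thesis by (simp add: cutoff_def divide_inverse)
qed

lemma pd_scaled:
  fixes f :: "'a::euclidean_space \<Rightarrow> real"
  assumes "smooth f"
  shows "pd b (\<lambda>x. f (0 + s *\<^sub>R x) * c) = (\<lambda>x. pd b f (0 + s *\<^sub>R x) * (s * c))"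
proof
  fix x
  have "(\<lambda>x. f (0 + s *\<^sub>R x)) differentiable at x"
    by (intro smooth_differentiable smooth_compose[OF assms] smooth_intros)
  then have "pd b (\<lambda>x. c * f (0 + s *\<^sub>R x)) x = c * pd b (\<lambda>x. f (0 + s *\<^sub>R x)) x"
    by (rule pd_cmult)
  also have "\<dots> = c * (s *\<^sub>R pd b f (0 + s *\<^sub>R x))"
    by (subst pd_affine) (simp_all add: smooth_differentiable[OF assms])
  finally show "pd b (\<lambda>x. f (0 + s *\<^sub>R x) * c) x = pd b f (0 + s *\<^sub>R x) * (s * c)"
    by (simp add: mult_ac)
qed

text \<open>By scaling, a first derivative is of order 1/R and a second one of order 1/R^2; the
  latter is weakened to 1/R, using R \<ge> 1, so that a single rate governs all commutator
  terms.\<close>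

lemma cutoff_derivative_bounds:
  obtains C where "C > 0"
    "\<And>R b x. R \<ge> 1 \<Longrightarrow> b \<in> Basis \<Longrightarrow> \<bar>pd b (cutoff R) (x::'a::euclidean_space)\<bar> \<le> C / R"
    "\<And>R b x. R \<ge> 1 \<Longrightarrow> b \<in> Basis \<Longrightarrow> \<bar>pd b (pd b (cutoff R)) (x::'a)\<bar> \<le> C / R"
proof -
  let ?f = "bump :: 'a \<Rightarrow> real"
  have bs: "smooth ?f" by (rule cc_smoothD[OF cc_smooth_bump])
  have "\<forall>b\<in>(Basis::'a set). \<exists>C>0. (\<forall>x::'a. \<bar>pd b ?f x\<bar> \<le> C) \<and> (\<forall>x::'a. \<bar>pd b (pd b ?f) x\<bar> \<le> C)"
  proof
    fix b :: 'a assume b: "b \<in> Basis"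
    obtain C1 where C1: "C1 > 0" "\<And>x. norm (pd b ?f x) \<le> C1"
      using cc_smooth_imp_bounded[OF cc_smooth_pd[OF cc_smooth_bump b]] by metis
    obtain C2 where C2: "C2 > 0" "\<And>x. norm (pd b (pd b ?f) x) \<le> C2"
      using cc_smooth_imp_bounded[OF cc_smooth_pd[OF cc_smooth_pd[OF cc_smooth_bump b] b]] by metis
    show "\<exists>C>0. (\<forall>x::'a. \<bar>pd b ?f x\<bar> \<le> C) \<and> (\<forall>x::'a. \<bar>pd b (pd b ?f) x\<bar> \<le> C)"
      using C1 C2 by (intro exI[of _ "max C1 C2"]) (auto intro: max.coboundedI1 max.coboundedI2)
  qed
  then obtain B where B: "\<And>b. b \<in> (Basis::'a set) \<Longrightarrow> B b > 0"
    "\<And>b x. b \<in> (Basis::'a set) \<Longrightarrow> \<bar>pd b ?f x\<bar> \<le> B b"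
    "\<And>b x. b \<in> (Basis::'a set) \<Longrightarrow> \<bar>pd b (pd b ?f) x\<bar> \<le> B b" by metis
  define C where "C = sum B (Basis :: 'a set)"
  have BC: "B b \<le> C" if "b \<in> Basis" for b
    unfolding C_def by (rule member_le_sum) (use that B(1) in \<open>auto simp: less_imp_le\<close>)
  have C: "C > 0" unfolding C_def using B(1) by (intro sum_pos) auto
  have cf: "cutoff R = (\<lambda>x::'a. ?f (0 + (1 / R) *\<^sub>R x) * exp 1)" for R
    by (simp add: cutoff_def fun_eq_iff)
  show ?thesis
  proof (rule that[of "C * exp 1"])
    show "C * exp 1 > 0" using C by simp
    fix R :: real and b x :: 'a assume R: "R \<ge> 1" and b: "b \<in> Basis"
    have p1: "pd b (cutoff R) = (\<lambda>x. pd b ?f (0 + (1 / R) *\<^sub>R x) * (1 / R * exp 1))"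
      unfolding cf by (rule pd_scaled[OF bs])
    have p2: "pd b (pd b (cutoff R)) = (\<lambda>x. pd b (pd b ?f) (0 + (1 / R) *\<^sub>R x) * (1 / R * (1 / R * exp 1)))"
      unfolding p1 by (rule pd_scaled[OF smooth_pd[OF bs b]])
    have "\<bar>pd b (cutoff R) x\<bar> \<le> C * (1 / R * exp 1)"
      unfolding p1 abs_mult using order_trans[OF B(2)[OF b] BC[OF b]] R C by (intro mult_mono) auto
    then show "\<bar>pd b (cutoff R) x\<bar> \<le> C * exp 1 / R" by simp
    have "\<bar>pd b (pd b (cutoff R)) x\<bar> \<le> C * (1 / R * (1 * exp 1))"
      unfolding p2 abs_mult using order_trans[OF B(3)[OF b] BC[OF b]] R C
      by (intro mult_mono) (auto simp: divide_le_eq)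
    then show "\<bar>pd b (pd b (cutoff R)) x\<bar> \<le> C * exp 1 / R" by simp
  qed
qed

section \<open>The magnetic operator on smooth functions\<close>

locale magnetic =
  fixes A :: "'a::euclidean_space \<Rightarrow> 'a \<Rightarrow> real" and V :: "'a \<Rightarrow> real"
  assumes A: "b \<in> Basis \<Longrightarrow> smooth (A b)"
    and V: "smooth V" "\<And>x. V x \<ge> 0"
begin

text \<open>The sign is opposite to that of \<open>cov_x\<close> and \<open>cov_y\<close>; only
  squares of those enter the magnetic Laplacian. In this form \<open>cov\<close> is formally
  skew-adjoint, because A is real.\<close>

definition cov :: "'a \<Rightarrow> ('a \<Rightarrow> complex) \<Rightarrow> 'a \<Rightarrow> complex" where
  "cov b u x = pd b u x - \<i> * of_real (A b x) * u x"

definition H :: "('a \<Rightarrow> complex) \<Rightarrow> 'a \<Rightarrow> complex" where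
  "H u x = of_real (V x) * u x - (\<Sum>b\<in>Basis. cov b (cov b u) x)"

lemma smooth_cov: "smooth u \<Longrightarrow> b \<in> Basis \<Longrightarrow> smooth (cov b u)"
  unfolding cov_def[abs_def] by (intro smooth_intros smooth_pd A)

lemma cc_smooth_cov: "cc_smooth u \<Longrightarrow> b \<in> Basis \<Longrightarrow> cc_smooth (cov b u)"
  unfolding cov_def[abs_def]
  by (intro cc_smooth_diff cc_smooth_pd cc_smooth_mult smooth_mult smooth_const smooth_of_real A)

lemma smooth_H: "smooth u \<Longrightarrow> smooth (H u)"
  unfolding H_def[abs_def] by (intro smooth_intros smooth_cov V)

lemma cc_smooth_H: "cc_smooth u \<Longrightarrow> cc_smooth (H u)"
  unfolding H_def[abs_def]
  by (intro cc_smooth_diff cc_smooth_sum cc_smooth_cov cc_smooth_mult smooth_of_real V)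

lemma cov_mult:
  "smooth f \<Longrightarrow> smooth u \<Longrightarrow> cov b (\<lambda>x. f x * u x) x = pd b f x * u x + f x * cov b u x"
  unfolding cov_def by (subst pd_mult) (simp_all add: smooth_differentiable algebra_simps)

lemma cov_cmult: "smooth u \<Longrightarrow> cov b (\<lambda>x. c * u x) x = c * cov b u x"
  using cov_mult[OF smooth_const] by simp

lemma cov_add: "smooth u \<Longrightarrow> smooth v \<Longrightarrow> cov b (\<lambda>x. u x + v x) x = cov b u x + cov b v x"
  unfolding cov_def by (subst pd_add) (simp_all add: smooth_differentiable algebra_simps)

lemma cov_diff: "smooth u \<Longrightarrow> smooth v \<Longrightarrow> cov b (\<lambda>x. u x - v x) x = cov b u x - cov b v x"
  unfolding cov_def by (subst pd_diff) (simp_all add: smooth_differentiable algebra_simps)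

lemma H_diff: "smooth u \<Longrightarrow> smooth v \<Longrightarrow> H (\<lambda>x. u x - v x) x = H u x - H v x"
proof -
  assume uv: "smooth u" "smooth v"
  have "cov b (\<lambda>x. u x - v x) = (\<lambda>x. cov b u x - cov b v x)" for b
    using cov_diff[OF uv] by blast
  then show ?thesis
    using uv unfolding H_def by (simp add: cov_diff smooth_cov sum_subtractf algebra_simps)
qed

lemma integrable_smooth_cc: "smooth w \<Longrightarrow> cc_smooth g \<Longrightarrow> integrable lborel (\<lambda>x. w x * cnj (g x))"
  by (intro cc_smooth_integrable cc_smooth_mult cc_smooth_cnj)

lemma cov_by_parts:
  assumes w: "smooth w" and g: "cc_smooth g" and b: "b \<in> Basis"
  shows "l2ip (cov b w) g = - l2ip w (cov b g)"
proof -
  have gs: "smooth g" by (rule cc_smoothD[OF g])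
  have pc: "pd b (\<lambda>x. cnj (g x)) = (\<lambda>x. cnj (pd b g x))"
    using pd_cnj[OF smooth_differentiable[OF gs]] by blast
  have As: "smooth (\<lambda>x. \<i> * of_real (A b x) * w x)" by (intro smooth_intros A b w)
  have i: "integrable lborel (\<lambda>x. pd b w x * cnj (g x))" "integrable lborel (\<lambda>x. w x * cnj (pd b g x))"
    "integrable lborel (\<lambda>x. \<i> * of_real (A b x) * w x * cnj (g x))"
    using w g b As by (auto intro!: integrable_smooth_cc smooth_pd cc_smooth_pd)
  have "l2ip (cov b w) g = (\<integral>x. pd b w x * cnj (g x) - \<i> * of_real (A b x) * w x * cnj (g x) \<partial>lborel)"
    by (simp add: l2ip_def cov_def algebra_simps)
  also have "\<dots> = - (\<integral>x. w x * cnj (pd b g x) \<partial>lborel) - (\<integral>x. \<i> * of_real (A b x) * w x * cnj (g x) \<partial>lborel)"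
    using i integration_by_parts[OF w cc_smooth_cnj[OF g] b] by (simp add: pc)
  also have "\<dots> = - (\<integral>x. w x * cnj (pd b g x) + \<i> * of_real (A b x) * w x * cnj (g x) \<partial>lborel)"
    using i by simp
  also have "\<dots> = - l2ip w (cov b g)"
    by (simp add: l2ip_def cov_def algebra_simps)
  finally show ?thesis .
qed

text \<open>The first argument is only assumed smooth, since the identity is later applied to
  functions without compact support; the boundary terms are killed by g.\<close>

lemma H_form:
  assumes w: "smooth w" and g: "cc_smooth g"
  shows "l2ip (H w) g = (\<Sum>b\<in>Basis. l2ip (cov b w) (cov b g)) + l2ip (\<lambda>x. of_real (V x) * w x) g"
proof -
  have i: "integrable lborel (\<lambda>x. cov b (cov b w) x * cnj (g x))" if "b \<in> Basis" for b
    using that by (intro integrable_smooth_cc g smooth_cov w)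
  have iV: "integrable lborel (\<lambda>x. of_real (V x) * w x * cnj (g x))"
    by (intro integrable_smooth_cc g smooth_mult smooth_of_real V w)
  have "l2ip (H w) g = (\<integral>x. of_real (V x) * w x * cnj (g x) - (\<Sum>b\<in>Basis. cov b (cov b w) x * cnj (g x)) \<partial>lborel)"
    by (simp add: l2ip_def H_def left_diff_distrib sum_distrib_right)
  also have "\<dots> = l2ip (\<lambda>x. of_real (V x) * w x) g - (\<Sum>b\<in>Basis. l2ip (cov b (cov b w)) g)"
    using i iV by (simp add: l2ip_def)
  also have "(\<Sum>b\<in>Basis. l2ip (cov b (cov b w)) g) = - (\<Sum>b\<in>Basis. l2ip (cov b w) (cov b g))"
    by (simp add: cov_by_parts smooth_cov w g sum_negf)
  finally show ?thesis by simp
qed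

lemma H_symmetric:
  assumes w: "cc_smooth w" and g: "cc_smooth g"
  shows "l2ip (H w) g = l2ip w (H g)"
proof -
  have "l2ip (\<lambda>x. of_real (V x) * w x) g = l2ip w (\<lambda>x. of_real (V x) * g x)"
    by (simp add: l2ip_def mult_ac)
  moreover have "l2ip (H g) w = (\<Sum>b\<in>Basis. l2ip (cov b g) (cov b w)) + l2ip (\<lambda>x. of_real (V x) * g x) w"
    by (rule H_form[OF cc_smoothD[OF g] w])
  then have "l2ip w (H g) = (\<Sum>b\<in>Basis. l2ip (cov b w) (cov b g)) + l2ip w (\<lambda>x. of_real (V x) * g x)"
    unfolding l2ip_cnj[of w] l2ip_cnj[of "cov _ w"] by simp
  ultimately show ?thesis using H_form[OF cc_smoothD[OF w] g] by simp
qed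

lemma V_term: "Re (l2ip (\<lambda>x. of_real (V x) * g x) g) \<ge> 0"
proof -
  have "of_real (V x) * g x * cnj (g x) = of_real (V x * (cmod (g x))\<^sup>2)" for x
    by (simp only: mult.assoc complex_norm_square of_real_mult)
  then have "l2ip (\<lambda>x. of_real (V x) * g x) g = of_real (\<integral>x. V x * (cmod (g x))\<^sup>2 \<partial>lborel)"
    unfolding l2ip_def by (simp only: integral_complex_of_real)
  then have "Re (l2ip (\<lambda>x. of_real (V x) * g x) g) = (\<integral>x. V x * (cmod (g x))\<^sup>2 \<partial>lborel)"
    by simp
  also have "\<dots> \<ge> 0" by (simp add: V)
  finally show ?thesis .
qed

lemma H_form_le: "cc_smooth g \<Longrightarrow> (\<Sum>b\<in>Basis. nsq (cov b g)) \<le> Re (l2ip (H g) g)"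
  using V_term[of g] by (simp add: H_form cc_smoothD l2ip_self cc_smooth_L2f cc_smooth_cov)

text \<open>A Caccioppoli inequality. Pairing H w with \<eta>^2 w gives the localised energy, a term
  with V that is dropped because V \<ge> 0, and cross terms with the gradient of \<eta>, which half
  of the energy absorbs.\<close>

lemma energy_estimate:
  assumes w: "smooth w" and eta: "cc_smooth \<eta>"
  shows "(\<Sum>b\<in>Basis. nsq (\<lambda>x. of_real (\<eta> x) * cov b w x)) \<le>
    nsq (\<lambda>x. of_real (\<eta> x) * H w x) + nsq (\<lambda>x. of_real (\<eta> x) * w x) +
    4 * (\<Sum>b\<in>Basis. nsq (\<lambda>x. of_real (pd b \<eta> x) * w x))"
proof -
  let ?\<eta> = "\<lambda>x. complex_of_real (\<eta> x)"
  have e: "cc_smooth ?\<eta>" by (rule cc_smooth_of_real[OF eta])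
  have es: "smooth ?\<eta>" by (rule cc_smoothD[OF e])
  have pe: "pd b ?\<eta> = (\<lambda>x. of_real (pd b \<eta> x))" for b
    using pd_of_real[OF smooth_differentiable[OF cc_smoothD[OF eta]]] by blast
  let ?g = "\<lambda>x. ?\<eta> x * (?\<eta> x * w x)"
  have g: "cc_smooth ?g" "cc_smooth (\<lambda>x. ?\<eta> x * w x)"
    by (intro cc_smooth_mult_left e smooth_mult es w)+
  let ?a = "\<lambda>b x. ?\<eta> x * cov b w x" and ?p = "\<lambda>b x. of_real (pd b \<eta> x) * w x"
  have aL: "L2f (?a b)" "L2f (?p b)" if "b \<in> Basis" for b
    using that by (auto intro!: cc_smooth_L2f cc_smooth_mult_left cc_smooth_of_real cc_smooth_pd e eta smooth_cov w)
  have cg: "cov b ?g x = ?\<eta> x * (2 * ?p b x + ?a b x)" for b x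
    using cov_mult[OF es smooth_mult[OF es w], of b x] cov_mult[OF es w, of b x]
    by (simp add: pe algebra_simps)
  have "l2ip (cov b w) (cov b ?g) = of_real (nsq (?a b)) + 2 * l2ip (?a b) (?p b)" if b: "b \<in> Basis" for b
  proof -
    have "l2ip (cov b w) (cov b ?g) = (\<integral>x. ?a b x * cnj (?a b x) + 2 * (?a b x * cnj (?p b x)) \<partial>lborel)"
      unfolding l2ip_def cg by (simp add: algebra_simps)
    also have "\<dots> = l2ip (?a b) (?a b) + 2 * l2ip (?a b) (?p b)"
      using L2f_ip_integrable[OF aL(1)[OF b] aL(1)[OF b]] L2f_ip_integrable[OF aL[OF b]]
      unfolding l2ip_def by simp
    finally show ?thesis by (simp add: l2ip_self aL b)
  qed
  then have "l2ip (H w) ?g = (\<Sum>b\<in>Basis. of_real (nsq (?a b)) + 2 * l2ip (?a b) (?p b)) + l2ip (\<lambda>x. of_real (V x) * w x) ?g"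
    unfolding H_form[OF w g(1)] by simp
  moreover have "l2ip (H w) ?g = l2ip (\<lambda>x. ?\<eta> x * H w x) (\<lambda>x. ?\<eta> x * w x)"
    by (simp add: l2ip_def mult_ac)
  moreover have "l2ip (\<lambda>x. of_real (V x) * w x) ?g = l2ip (\<lambda>x. of_real (V x) * (?\<eta> x * w x)) (\<lambda>x. ?\<eta> x * w x)"
    by (simp add: l2ip_def mult_ac)
  ultimately have "(\<Sum>b\<in>Basis. nsq (?a b) + 2 * Re (l2ip (?a b) (?p b))) \<le> Re (l2ip (\<lambda>x. ?\<eta> x * H w x) (\<lambda>x. ?\<eta> x * w x))"
    using V_term[of "\<lambda>x. ?\<eta> x * w x"] by simp
  moreover have "\<bar>Re (l2ip (\<lambda>x. ?\<eta> x * H w x) (\<lambda>x. ?\<eta> x * w x))\<bar> \<le> (nsq (\<lambda>x. ?\<eta> x * H w x) + nsq (\<lambda>x. ?\<eta> x * w x)) / 2"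
    by (intro Re_l2ip_le cc_smooth_L2f cc_smooth_mult_left e smooth_H w)
  \<comment> \<open>Young's inequality for the pairing of ?a with twice ?p spends exactly one half
    of the energy.\<close>
  moreover have "(\<Sum>b\<in>Basis. nsq (?a b) / 2 - 2 * nsq (?p b)) \<le> (\<Sum>b\<in>Basis. nsq (?a b) + 2 * Re (l2ip (?a b) (?p b)))"
  proof (rule sum_mono)
    fix b :: 'a assume b: "b \<in> Basis"
    have "l2ip (?a b) (\<lambda>x. 2 * ?p b x) = 2 * l2ip (?a b) (?p b)"
      by (simp add: l2ip_def mult.left_commute)
    moreover have "nsq (\<lambda>x. 2 * ?p b x) = 4 * nsq (?p b)"
      using nsq_cmult[of 2 "?p b"] by simp
    ultimately show "nsq (?a b) / 2 - 2 * nsq (?p b) \<le> nsq (?a b) + 2 * Re (l2ip (?a b) (?p b))"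
      using Re_l2ip_le[OF aL(1)[OF b] L2f_cmult[OF aL(2)[OF b], of 2]] by simp
  qed
  moreover have "(\<Sum>b\<in>Basis. nsq (?a b) / 2 - 2 * nsq (?p b)) = (\<Sum>b\<in>Basis. nsq (?a b)) / 2 - 2 * (\<Sum>b\<in>Basis. nsq (?p b))"
    by (simp add: sum_subtractf sum_divide_distrib sum_distrib_left)
  moreover have "a \<le> p + q + 4 * c" if "s \<le> r" "\<bar>r\<bar> \<le> (p + q) / 2" "t \<le> s" "t = a / 2 - 2 * c"
    for a c p q r s t :: real using that by (simp add: field_simps)
  ultimately show ?thesis by blast
qed

text \<open>The coefficient of order zero when H is expanded into partial derivatives. Its imaginary
  part is the divergence of A, so it is not real in general, although H is symmetric.\<close>

definition zeroth :: "'a \<Rightarrow> complex" where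
  "zeroth x = (\<Sum>b\<in>Basis. \<i> * of_real (pd b (A b) x) + of_real ((A b x)\<^sup>2)) + of_real (V x)"

lemma smooth_zeroth: "smooth zeroth"
  unfolding zeroth_def[abs_def] by (intro smooth_intros smooth_pd A V)

lemma H_expand:
  assumes u: "smooth u"
  shows "H u x = - (\<Sum>b\<in>Basis. pd b (pd b u) x) + (\<Sum>b\<in>Basis. 2 * \<i> * of_real (A b x) * pd b u x) + zeroth x * u x"
proof -
  have "cov b (cov b u) x = pd b (pd b u) x - 2 * \<i> * of_real (A b x) * pd b u x -
      (\<i> * of_real (pd b (A b) x) + of_real ((A b x)\<^sup>2)) * u x" if b: "b \<in> Basis" for b
  proof -
    have dA: "(\<lambda>x. complex_of_real (A b x)) differentiable at x"
      by (intro smooth_differentiable smooth_of_real A b)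
    have pA: "pd b (\<lambda>x. complex_of_real (A b x)) x = of_real (pd b (A b) x)"
      by (rule pd_of_real[OF smooth_differentiable[OF A[OF b]]])
    have du: "u differentiable at x" "pd b u differentiable at x"
      by (intro smooth_differentiable u smooth_pd b)+
    have "pd b (cov b u) x = pd b (pd b u) x - \<i> * (of_real (A b x) * pd b u x + of_real (pd b (A b) x) * u x)"
    proof -
      have "cov b u = (\<lambda>x. pd b u x - \<i> * (of_real (A b x) * u x))" by (simp add: cov_def fun_eq_iff mult.assoc)
      then show ?thesis
        using dA du pA
        by (simp add: pd_diff pd_cmult pd_mult differentiable_mult)
    qed
    then show ?thesis
      by (simp add: cov_def[of b "cov b u"]) (simp add: cov_def algebra_simps power2_eq_square)
  qed
  then show ?thesis
    unfolding H_def zeroth_def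
    by (simp add: sum_subtractf sum.distrib sum_distrib_right distrib_right sum_negf)
qed

end

section \<open>Mollification and the commutator with the operator\<close>

lemma indicator_scaleR_L2f: "L2f u \<Longrightarrow> L2f (\<lambda>x. indicator (cball 0 R) x *\<^sub>R u x)"
  and nsq_indicator_le: "L2f u \<Longrightarrow> nsq (\<lambda>x. indicator (cball 0 R) x *\<^sub>R u x) \<le> nsq u"
proof -
  assume u: "L2f u"
  have m: "(\<lambda>x. indicator (cball 0 R) x *\<^sub>R (1::complex)) \<in> borel_measurable borel"
    by (intro borel_measurable_scaleR borel_measurable_indicator) auto
  have le: "cmod (indicator (cball 0 R) x *\<^sub>R (1::complex)) \<le> 1" for x :: 'a by (simp add: indicator_def)
  show "L2f (\<lambda>x. indicator (cball 0 R) x *\<^sub>R u x)" "nsq (\<lambda>x. indicator (cball 0 R) x *\<^sub>R u x) \<le> nsq u"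
    using L2f_bounded_mult[OF u m le] by simp_all
qed

lemma continuous_indicator_L2f:
  fixes u :: "'a::euclidean_space \<Rightarrow> complex"
  assumes "continuous_on UNIV u"
  shows "L2f (\<lambda>x. indicator (cball 0 R) x *\<^sub>R u x)"
proof -
  have "compact (u ` cball 0 R)" using assms continuous_on_subset by (intro compact_continuous_image) auto
  then obtain C where C: "\<And>x. norm x \<le> R \<Longrightarrow> norm (u x) \<le> C"
    by (metis bounded_iff compact_imp_bounded image_eqI mem_cball_0)
  show ?thesis
  proof (rule L2f_bound(1))
    show "integrable lborel (\<lambda>x::'a. C\<^sup>2 * indicator (cball 0 R) x)"
      using emeasure_lborel_cball_finite[of "0::'a" R] by (simp add: less_top)
    show "(\<lambda>x. indicator (cball 0 R) x *\<^sub>R u x) \<in> borel_measurable borel"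
      using assms by (intro borel_measurable_scaleR borel_measurable_indicator) (auto intro: borel_measurable_continuous_onI)
    show "(cmod (indicator (cball 0 R) x *\<^sub>R u x))\<^sup>2 \<le> C\<^sup>2 * indicator (cball 0 R) x" for x
      using C[of x] by (auto simp: indicator_def intro: power_mono)
  qed
qed

lemma nsq_mono:
  assumes "L2f v" "u \<in> borel_measurable borel" "\<And>x. cmod (u x) \<le> cmod (v x)"
  shows "L2f u" "nsq u \<le> nsq v"
  using L2f_bound[of "\<lambda>x. (cmod (v x))\<^sup>2" u] assms by (auto simp: L2f_def nsq_def power_mono)

lemma continuous_kernel_difference:
  assumes "smooth f"
  shows "continuous_on UNIV (\<lambda>p. f (fst p - snd p))"
  by (rule continuous_on_compose2[OF smooth_continuous[OF assms]]) (auto intro!: continuous_intros)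

lemma mollify_tendsto:
  fixes u :: "'a::euclidean_space \<Rightarrow> complex"
  assumes u: "L2f u" and e: "\<And>n. e n > 0" "e \<longlonglongrightarrow> 0"
  shows "L2f (\<lambda>x. indicator (cball 0 R) x *\<^sub>R (conv (mollifier (e n)) u x - u x))"
    and "(\<lambda>n. nsq (\<lambda>x. indicator (cball 0 R) x *\<^sub>R (conv (mollifier (e n)) u x - u x))) \<longlonglongrightarrow> 0"
proof -
  obtain C where C: "C > 0" "\<And>e x. e > 0 \<Longrightarrow> cmod (mollifier e (x::'a)) \<le> C / e ^ DIM('a)"
    using mollifier_bounds by metis
  let ?k = "\<lambda>n x y. mollifier (e n) (x - y :: 'a)"
  have int: "(\<integral>y. ?k n x y \<partial>lborel) = 1" for n x
    using integral_lborel_affine[OF smooth_measurable[OF cc_smoothD[OF cc_smooth_mollifier[OF e(1)[of n]]]], of "-1" x]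
      integral_mollifier[OF e(1)[of n], where 'a = 'a] by simp
  have k: "continuous_on UNIV (\<lambda>p. ?k n (fst p) (snd p))" for n
    by (intro continuous_kernel_difference cc_smoothD cc_smooth_mollifier e)
  have bd: "cmod (?k n x y) \<le> C / e n ^ DIM('a)" for n x y by (rule C(2)[OF e(1)])
  have supp: "?k n x y = 0" if "dist x y \<ge> e n" for n x y
    using that by (intro mollifier_eq_0 e) (simp add: dist_norm)
  note T = kernel_operator_tendsto[OF u k e bd supp, where \<sigma> = 1 and R = R]
  show "L2f (\<lambda>x. indicator (cball 0 R) x *\<^sub>R (conv (mollifier (e n)) u x - u x))"
    using T(1)[of n] by (simp add: int conv_def)
  show "(\<lambda>n. nsq (\<lambda>x. indicator (cball 0 R) x *\<^sub>R (conv (mollifier (e n)) u x - u x))) \<longlonglongrightarrow> 0"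
    using T(2) by (simp add: int conv_def)
qed

context magnetic
begin

text \<open>Friedrichs' lemma: the second order part of \<open>H\<close> has constant coefficients, so commuting \<open>H\<close>
  with a mollification only produces an operator of order zero.\<close>

lemma friedrichs:
  fixes u f :: "'a \<Rightarrow> complex"
  assumes u: "L2f u" and f: "L2f f" and weak: "\<And>g. cc_smooth g \<Longrightarrow> l2ip f g = l2ip u (H g)"
    and e: "\<And>n. e n > 0" "e \<longlonglongrightarrow> 0" "\<And>n. 2 * e n \<le> 1"
  shows "(\<lambda>n. nsq (\<lambda>x. indicator (cball 0 R) x *\<^sub>R (H (conv (mollifier (e n)) u) x - conv (mollifier (e n)) f x))) \<longlonglongrightarrow> 0"
proof -
  let ?m = "\<lambda>n. mollifier (e n) :: 'a \<Rightarrow> complex"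
  have m: "cc_smooth (?m n)" for n by (rule cc_smooth_mollifier[OF e(1)])
  have ms: "smooth (?m n)" for n by (rule cc_smoothD[OF m])
  have lu: "locally_integrable u" by (rule L2f_locally_integrable[OF u])
  have real: "cnj (pd b (?m n) x) = pd b (?m n) x" for n b x
    using pd_cnj[OF smooth_differentiable[OF ms], of b n x] unfolding cnj_mollifier by (rule sym)
  have real2: "cnj (pd b (pd b (?m n)) x) = pd b (pd b (?m n)) x" if "b \<in> Basis" for n b x
    using pd_cnj[OF smooth_differentiable[OF smooth_pd[OF ms that]], of b n x] unfolding real by (rule sym)
  \<comment> \<open>The kernel of the commutator. The second order terms cancel, the first order
    terms carry a difference of coefficients, and the order zero coefficient at y appears conjugated
    because there H stands in the second slot of the inner product.\<close>
  define k where "k n x y = (\<Sum>b\<in>Basis. 2 * \<i> * (of_real (A b x) - of_real (A b y)) * pd b (?m n) (x - y)) +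
      (zeroth x - cnj (zeroth y)) * ?m n (x - y)" for n x y
  have cz: "zeroth x - cnj (zeroth x) = (\<Sum>b\<in>Basis. 2 * \<i> * of_real (pd b (A b) x))" for x
  proof -
    have "zeroth x - cnj (zeroth x) = (\<Sum>b\<in>Basis. \<i> * of_real (pd b (A b) x) + of_real ((A b x)\<^sup>2)) -
        (\<Sum>b\<in>Basis. - \<i> * of_real (pd b (A b) x) + of_real ((A b x)\<^sup>2))"
      by (simp add: zeroth_def)
    also have "\<dots> = (\<Sum>b\<in>Basis. 2 * \<i> * of_real (pd b (A b) x))"
      unfolding sum_subtractf[symmetric] by (rule sum.cong) simp_all
    finally show ?thesis .
  qed
  have kid: "H (conv (?m n) u) x - conv (?m n) f x = (\<integral>y. u y * k n x y \<partial>lborel)" for n x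
  proof -
    let ?g = "\<lambda>y. ?m n (x - y)"
    have g: "cc_smooth ?g" by (rule cc_smooth_reflect[OF m])
    have pg: "pd b ?g = (\<lambda>y. - pd b (?m n) (x - y))" for b
      using pd_reflect[OF ms] by blast
    have ppg: "pd b (pd b ?g) = (\<lambda>y. pd b (pd b (?m n)) (x - y))" if "b \<in> Basis" for b
    proof -
      have "(\<lambda>y. pd b (?m n) (x - y)) differentiable at y" for y
        by (intro smooth_differentiable cc_smoothD cc_smooth_reflect cc_smooth_pd m that)
      then show ?thesis
        unfolding pg using pd_reflect[OF smooth_pd[OF ms that]] by (simp add: pd_minus fun_eq_iff)
    qed
    have Hg: "cnj (H ?g y) = - (\<Sum>b\<in>Basis. pd b (pd b (?m n)) (x - y)) +
        (\<Sum>b\<in>Basis. 2 * \<i> * of_real (A b y) * pd b (?m n) (x - y)) + cnj (zeroth y) * ?m n (x - y)" for y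
      unfolding H_expand[OF cc_smoothD[OF g]] by (simp add: pg ppg[unfolded pg] real real2 cong: sum.cong)
    \<comment> \<open>The weak equation is applied to the reflected mollifier y \<mapsto> m (x - y)
      as a test function.\<close>
    have Fn: "conv (?m n) f x = (\<integral>y. u y * cnj (H ?g y) \<partial>lborel)"
      using weak[OF g] by (simp add: l2ip_def conv_def)
    have i0: "integrable lborel (\<lambda>y. u y * (c y * h (x - y)))" if "smooth c" "cc_smooth h" for c h
      by (intro locally_integrable_cc_smooth[OF lu] cc_smooth_mult cc_smooth_reflect that)
    have i1: "integrable lborel (\<lambda>y. u y * h (x - y))" if "cc_smooth h" for h
      by (intro locally_integrable_cc_smooth[OF lu] cc_smooth_reflect that)
    have ig: "integrable lborel (\<lambda>y. u y * cnj (H ?g y))"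
      by (intro locally_integrable_cc_smooth[OF lu] cc_smooth_cnj cc_smooth_H g)
    have "H (conv (?m n) u) x = - (\<Sum>b\<in>Basis. conv (pd b (pd b (?m n))) u x) +
        (\<Sum>b\<in>Basis. 2 * \<i> * of_real (A b x) * conv (pd b (?m n)) u x) + zeroth x * conv (?m n) u x"
      unfolding H_expand[OF smooth_conv[OF m lu]]
      by (simp add: pd_conv[OF m lu] pd_conv[OF cc_smooth_pd[OF m] lu] cong: sum.cong)
    also have "\<dots> = (\<integral>y. u y * (- (\<Sum>b\<in>Basis. pd b (pd b (?m n)) (x - y)) +
        (\<Sum>b\<in>Basis. 2 * \<i> * of_real (A b x) * pd b (?m n) (x - y)) + zeroth x * ?m n (x - y)) \<partial>lborel)"
    proof -
      have 1: "integrable lborel (\<lambda>y. \<Sum>b\<in>Basis. u y * pd b (pd b (?m n)) (x - y))"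
        by (intro Bochner_Integration.integrable_sum i1 cc_smooth_pd m)
      have 2: "integrable lborel (\<lambda>y. \<Sum>b\<in>Basis. 2 * \<i> * of_real (A b x) * (u y * pd b (?m n) (x - y)))"
        by (intro Bochner_Integration.integrable_sum integrable_mult_right i1 cc_smooth_pd m)
      have 3: "integrable lborel (\<lambda>y. zeroth x * (u y * ?m n (x - y)))"
        by (intro integrable_mult_right i1 m)
      have "(\<integral>y. u y * (- (\<Sum>b\<in>Basis. pd b (pd b (?m n)) (x - y)) +
        (\<Sum>b\<in>Basis. 2 * \<i> * of_real (A b x) * pd b (?m n) (x - y)) + zeroth x * ?m n (x - y)) \<partial>lborel) =
        (\<integral>y. - (\<Sum>b\<in>Basis. u y * pd b (pd b (?m n)) (x - y)) +
        (\<Sum>b\<in>Basis. 2 * \<i> * of_real (A b x) * (u y * pd b (?m n) (x - y))) + zeroth x * (u y * ?m n (x - y)) \<partial>lborel)"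
        by (rule Bochner_Integration.integral_cong) (simp_all add: sum_distrib_left distrib_left right_diff_distrib mult_ac)
      also have "\<dots> = - (\<Sum>b\<in>Basis. conv (pd b (pd b (?m n))) u x) +
        (\<Sum>b\<in>Basis. 2 * \<i> * of_real (A b x) * conv (pd b (?m n)) u x) + zeroth x * conv (?m n) u x"
        using 1 2 3 i1[OF cc_smooth_pd[OF m]] i1[OF cc_smooth_pd[OF cc_smooth_pd[OF m]]]
        by (simp add: conv_def)
      finally show ?thesis by simp
    qed
    finally have "H (conv (?m n) u) x - conv (?m n) f x = (\<integral>y. u y * (- (\<Sum>b\<in>Basis. pd b (pd b (?m n)) (x - y)) +
        (\<Sum>b\<in>Basis. 2 * \<i> * of_real (A b x) * pd b (?m n) (x - y)) + zeroth x * ?m n (x - y)) \<partial>lborel) -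
        (\<integral>y. u y * cnj (H ?g y) \<partial>lborel)"
      unfolding Fn by simp
    also have "\<dots> = (\<integral>y. u y * (- (\<Sum>b\<in>Basis. pd b (pd b (?m n)) (x - y)) +
        (\<Sum>b\<in>Basis. 2 * \<i> * of_real (A b x) * pd b (?m n) (x - y)) + zeroth x * ?m n (x - y)) - u y * cnj (H ?g y) \<partial>lborel)"
    proof (rule Bochner_Integration.integral_diff[OF _ ig, symmetric])
      show "integrable lborel (\<lambda>y. u y * (- (\<Sum>b\<in>Basis. pd b (pd b (?m n)) (x - y)) +
        (\<Sum>b\<in>Basis. 2 * \<i> * of_real (A b x) * pd b (?m n) (x - y)) + zeroth x * ?m n (x - y)))"
        by (intro locally_integrable_cc_smooth[OF lu] cc_smooth_add cc_smooth_minus cc_smooth_sum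
            cc_smooth_mult smooth_const cc_smooth_reflect cc_smooth_pd m)
    qed
    also have "\<dots> = (\<integral>y. u y * k n x y \<partial>lborel)"
      unfolding Hg k_def
      by (rule Bochner_Integration.integral_cong)
         (simp_all add: algebra_simps sum_subtractf sum_distrib_left)
    finally show ?thesis .
  qed
  obtain C where C: "C > 0" "\<And>e x. e > 0 \<Longrightarrow> cmod (mollifier e (x::'a)) \<le> C / e ^ DIM('a)"
    "\<And>e x b. e > 0 \<Longrightarrow> b \<in> Basis \<Longrightarrow> cmod (pd b (mollifier e) (x::'a)) \<le> C / (e * e ^ DIM('a))"
    using mollifier_bounds by metis
  have "\<exists>L>0. \<forall>x y. norm x \<le> R + 1 \<longrightarrow> norm y \<le> R + 1 \<longrightarrow> cmod (of_real (A b x) - of_real (A b y)) \<le> L * dist x y"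
    if "b \<in> Basis" for b
    using smooth_lipschitz_cball[OF smooth_of_real[OF A[OF that]], of "R + 1"] by metis
  then obtain LA where LA: "\<And>b. b \<in> Basis \<Longrightarrow> LA b > 0"
    "\<And>b x y. b \<in> Basis \<Longrightarrow> norm x \<le> R + 1 \<Longrightarrow> norm y \<le> R + 1 \<Longrightarrow>
      cmod (of_real (A b x) - of_real (A b y)) \<le> LA b * dist x y" by metis
  obtain Lz where Lz: "Lz > 0" "\<And>x y. norm x \<le> R + 1 \<Longrightarrow> norm y \<le> R + 1 \<Longrightarrow>
      cmod (zeroth x - zeroth y) \<le> Lz * dist x y"
    using smooth_lipschitz_cball[OF smooth_zeroth, of "R + 1"] by metis
  obtain Z where Z: "Z > 0" "\<And>x. norm x \<le> R + 1 \<Longrightarrow> cmod (zeroth x) \<le> Z"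
  proof -
    have "compact (zeroth ` cball 0 (R + 1))"
      by (intro compact_continuous_image smooth_continuous smooth_zeroth) simp
    then obtain Z where "\<And>x. norm x \<le> R + 1 \<Longrightarrow> cmod (zeroth x) \<le> Z"
      by (metis bounded_iff compact_imp_bounded image_eqI mem_cball_0)
    then have "\<And>x. norm x \<le> R + 1 \<Longrightarrow> cmod (zeroth x) \<le> max Z 1" by (simp add: max.coboundedI1)
    then show ?thesis using that[of "max Z 1"] by auto
  qed
  have kc: "continuous_on UNIV (\<lambda>p. k n (fst p) (snd p))" for n
    unfolding k_def
    by (intro continuous_intros continuous_kernel_difference smooth_pd ms
        continuous_on_compose2[OF smooth_continuous[OF smooth_zeroth, of UNIV]]
        continuous_on_compose2[OF smooth_continuous[OF A, of _ UNIV]]) auto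
  have near: "norm y \<le> R + 1" if "norm x \<le> R" "dist x y < 2 * e n" for n x y
    using that e(3)[of n] norm_triangle_ineq2[of y x] by (simp add: dist_norm norm_minus_commute)
  \<comment> \<open>Twice the scale, because the derivative of the mollifier is known to vanish only
    strictly outside the ball of radius e n.\<close>
  have supp: "k n x y = 0" if "dist x y \<ge> 2 * e n" for n x y
  proof -
    have "norm (x - y) > e n" using that e(1)[of n] by (simp add: dist_norm)
    moreover from this have "?m n (x - y) = 0" by (intro mollifier_eq_0[OF e(1)]) simp
    moreover have "pd b (?m n) (x - y) = 0" for b
      by (rule pd_eq_0_outside[OF mollifier_eq_0[OF e(1)] \<open>norm (x - y) > e n\<close>]) simp
    ultimately show ?thesis by (simp add: k_def)
  qed
  \<comment> \<open>On the support the coefficients of the first order terms are at most of size 2 e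
    n times a Lipschitz constant; this cancels the factor 1 / e n in the derivative of the
    mollifier, so the kernel has the size required uniformly in n.\<close>
  define C' where "C' = (\<Sum>b\<in>Basis. 4 * LA b * C) + 2 * Z * C"
  have C': "C' \<ge> 0" unfolding C'_def using LA(1) Z C by (intro add_nonneg_nonneg sum_nonneg) (auto simp: less_imp_le)
  have bd: "cmod (k n x y) \<le> C' * 2 ^ DIM('a) / (2 * e n) ^ DIM('a)" if x: "norm x \<le> R" for n x y
  proof (cases "dist x y < 2 * e n")
    case True
    have y: "norm y \<le> R + 1" and x1: "norm x \<le> R + 1" using near[OF x True] x by auto
    let ?E = "e n ^ DIM('a)"
    have E: "?E > 0" "e n > 0" using e(1)[of n] by auto
    have "cmod (k n x y) \<le> (\<Sum>b\<in>Basis. 4 * LA b * C / ?E) + 2 * Z * C / ?E"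
      unfolding k_def
    proof (intro order_trans[OF norm_triangle_ineq] add_mono sum_norm_le)
      fix b :: 'a assume b: "b \<in> Basis"
      have "cmod (of_real (A b x) - of_real (A b y)) \<le> LA b * (2 * e n)"
        using order_trans[OF LA(2)[OF b x1 y] mult_left_mono[of "dist x y" "2 * e n" "LA b"]] True LA(1)[OF b] by simp
      then have "cmod (of_real (A b x) - of_real (A b y)) * cmod (pd b (?m n) (x - y)) \<le>
          LA b * (2 * e n) * (C / (e n * ?E))"
        using LA(1)[OF b] E C(1) by (intro mult_mono C(3)[OF e(1) b]) auto
      then have "2 * (cmod (of_real (A b x) - of_real (A b y)) * cmod (pd b (?m n) (x - y))) \<le>
          2 * (LA b * (2 * e n) * (C / (e n * ?E)))" by simp
      also have "\<dots> = 4 * LA b * C / ?E" using E by (simp add: field_simps)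
      finally show "cmod (2 * \<i> * (of_real (A b x) - of_real (A b y)) * pd b (?m n) (x - y)) \<le> 4 * LA b * C / ?E"
        by (simp add: norm_mult mult.assoc)
    next
      have "cmod (zeroth x - cnj (zeroth y)) \<le> 2 * Z"
        using norm_triangle_ineq4[of "zeroth x" "cnj (zeroth y)"] Z(2)[OF x1] Z(2)[OF y] by simp
      then have "cmod (zeroth x - cnj (zeroth y)) * cmod (?m n (x - y)) \<le> 2 * Z * (C / ?E)"
        using Z(1) by (intro mult_mono C(2)[OF e(1)]) auto
      then show "cmod ((zeroth x - cnj (zeroth y)) * ?m n (x - y)) \<le> 2 * Z * C / ?E"
        by (simp add: norm_mult)
    qed
    also have "\<dots> = C' / ?E" by (simp add: C'_def add_divide_distrib sum_divide_distrib)
    also have "\<dots> = C' * 2 ^ DIM('a) / (2 * e n) ^ DIM('a)" by (simp add: power_mult_distrib)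
    finally show ?thesis .
  qed (use supp C' e(1)[of n] in \<open>auto simp: not_less\<close>)
  \<comment> \<open>Integration by parts moves the derivative from the mollifier to A. The
    divergence of A that appears is exactly the difference between \<open>zeroth\<close> and its
    conjugate, so the conjugate disappears and the difference of two nearby values of
    \<open>zeroth\<close> remains. Hence the limit operator is multiplication by 0.\<close>
  have mean: "(\<integral>y. k n x y \<partial>lborel) = (\<integral>y. (zeroth x - zeroth y) * ?m n (x - y) \<partial>lborel)" for n x
  proof -
    let ?g = "\<lambda>y. ?m n (x - y)"
    have g: "cc_smooth ?g" by (rule cc_smooth_reflect[OF m])
    have pg: "pd b ?g = (\<lambda>y. - pd b (?m n) (x - y))" for b
      using pd_reflect[OF ms] by blast
    have trm: "(\<integral>y. (of_real (A b x) - of_real (A b y)) * pd b (?m n) (x - y) \<partial>lborel) =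
        - (\<integral>y. of_real (pd b (A b) y) * ?g y \<partial>lborel)" if b: "b \<in> Basis" for b
    proof -
      have s: "smooth (\<lambda>y. complex_of_real (A b x) - of_real (A b y))" by (intro smooth_intros A b)
      have "pd b (\<lambda>y. complex_of_real (A b x) - of_real (A b y)) = (\<lambda>y. - of_real (pd b (A b) y))"
      proof
        fix y
        have d: "A b differentiable at y" by (rule smooth_differentiable[OF A[OF b]])
        have d': "(\<lambda>y. complex_of_real (A b y)) differentiable at y"
          by (rule smooth_differentiable[OF smooth_of_real[OF A[OF b]]])
        have "pd b (\<lambda>y. complex_of_real (A b y)) y = of_real (pd b (A b) y)" by (rule pd_of_real[OF d])
        then show "pd b (\<lambda>y. complex_of_real (A b x) - of_real (A b y)) y = - of_real (pd b (A b) y)"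
          using pd_diff[OF differentiable_const d', of b "of_real (A b x)"] by simp
      qed
      then show ?thesis using integration_by_parts[OF s g b] unfolding pg by (simp add: minus_equation_iff)
    qed
    have i: "integrable lborel (\<lambda>y. c y * h (x - y))" if "smooth c" "cc_smooth h" for c h :: "'a \<Rightarrow> complex"
      by (intro cc_smooth_integrable cc_smooth_mult cc_smooth_reflect that)
    have s1: "smooth (\<lambda>y. complex_of_real (A b x) - of_real (A b y))" "smooth (\<lambda>y. complex_of_real (pd b (A b) y))"
      if "b \<in> Basis" for b
      by (intro smooth_intros smooth_pd A that)+
    have i1: "integrable lborel (\<lambda>y. (of_real (A b x) - of_real (A b y)) * pd b (?m n) (x - y))"
      "integrable lborel (\<lambda>y. of_real (pd b (A b) y) * ?g y)" if "b \<in> Basis" for b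
      using that by (auto intro!: i s1 cc_smooth_pd m)
    have i2: "integrable lborel (\<lambda>y. (zeroth x - cnj (zeroth y)) * ?g y)"
      by (intro i m smooth_intros smooth_zeroth)
    have "(\<integral>y. k n x y \<partial>lborel) = (\<integral>y. (\<Sum>b\<in>Basis. 2 * \<i> * ((of_real (A b x) - of_real (A b y)) * pd b (?m n) (x - y))) +
        (zeroth x - cnj (zeroth y)) * ?g y \<partial>lborel)"
      by (simp add: k_def mult.assoc)
    also have "\<dots> = (\<Sum>b\<in>Basis. 2 * \<i> * (\<integral>y. (of_real (A b x) - of_real (A b y)) * pd b (?m n) (x - y) \<partial>lborel)) +
        (\<integral>y. (zeroth x - cnj (zeroth y)) * ?g y \<partial>lborel)"
      using i1 i2 by simp
    also have "\<dots> = (\<Sum>b\<in>Basis. 2 * \<i> * (- (\<integral>y. of_real (pd b (A b) y) * ?g y \<partial>lborel))) +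
        (\<integral>y. (zeroth x - cnj (zeroth y)) * ?g y \<partial>lborel)"
      by (simp add: trm)
    also have "\<dots> = (\<integral>y. (\<Sum>b\<in>Basis. 2 * \<i> * (- (of_real (pd b (A b) y) * ?g y))) +
        (zeroth x - cnj (zeroth y)) * ?g y \<partial>lborel)"
      using i1 i2 by simp
    also have "\<dots> = (\<integral>y. (zeroth x - zeroth y) * ?g y \<partial>lborel)"
    proof (rule Bochner_Integration.integral_cong[OF refl])
      fix y
      have "(\<Sum>b\<in>Basis. 2 * \<i> * (- (of_real (pd b (A b) y) * ?g y))) = - (zeroth y - cnj (zeroth y)) * ?g y"
        unfolding cz by (simp add: sum_distrib_right sum_negf mult.assoc)
      then show "(\<Sum>b\<in>Basis. 2 * \<i> * (- (of_real (pd b (A b) y) * ?g y))) + (zeroth x - cnj (zeroth y)) * ?g y =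
          (zeroth x - zeroth y) * ?g y" by (simp add: algebra_simps)
    qed
    finally show ?thesis .
  qed
  have mean_le: "cmod (\<integral>y. k n x y \<partial>lborel) \<le> Lz * (2 * e n)" if x: "norm x \<le> R" for n x
  proof -
    have mi: "integrable lborel (\<lambda>y. cmod (?m n (x - y)))"
      by (intro integrable_norm cc_smooth_integrable cc_smooth_reflect m)
    have "cmod (?m n z) = Re (?m n z)" for z
      using integral_bump_pos[where 'a = 'a] e(1)[of n] bump_nonneg[of "(1 / e n) *\<^sub>R z"]
      unfolding mollifier_def norm_of_real Re_complex_of_real by (simp add: abs_mult)
    then have "(\<integral>y. cmod (?m n (x - y)) \<partial>lborel) = Re (\<integral>y. ?m n (x - y) \<partial>lborel)"
      using cc_smooth_integrable[OF cc_smooth_reflect[OF m]] by simp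
    also have "(\<integral>y. ?m n (x - y) \<partial>lborel) = 1"
      using integral_lborel_affine[OF smooth_measurable[OF ms[of n]], of "-1" x]
        integral_mollifier[OF e(1)[of n], where 'a = 'a] by simp
    finally have m1: "(\<integral>y. cmod (?m n (x - y)) \<partial>lborel) = 1" by simp
    have "cmod (\<integral>y. k n x y \<partial>lborel) \<le> (\<integral>y. Lz * (2 * e n) * cmod (?m n (x - y)) \<partial>lborel)"
      unfolding mean
    proof (rule order_trans[OF integral_norm_bound integral_mono])
      show "integrable lborel (\<lambda>y. cmod ((zeroth x - zeroth y) * ?m n (x - y)))"
        by (intro integrable_norm cc_smooth_integrable cc_smooth_mult cc_smooth_reflect m smooth_intros smooth_zeroth)
      show "integrable lborel (\<lambda>y. Lz * (2 * e n) * cmod (?m n (x - y)))" using mi by simp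
      fix y
      show "cmod ((zeroth x - zeroth y) * ?m n (x - y)) \<le> Lz * (2 * e n) * cmod (?m n (x - y))"
      proof (cases "dist x y < 2 * e n")
        case True
        have "cmod (zeroth x - zeroth y) \<le> Lz * dist x y" using near[OF x True] x by (intro Lz(2)) auto
        also have "\<dots> \<le> Lz * (2 * e n)" using True Lz(1) by (intro mult_left_mono) auto
        finally show ?thesis unfolding norm_mult by (intro mult_right_mono) auto
      next
        case False
        then have "?m n (x - y) = 0" using e(1)[of n] by (intro mollifier_eq_0) (auto simp: dist_norm)
        then show ?thesis by simp
      qed
    qed
    also have "\<dots> = Lz * (2 * e n)" using m1 by simp
    finally show ?thesis .
  qed
  have e2: "(\<lambda>n. 2 * e n) \<longlonglongrightarrow> 0" using tendsto_mult[OF tendsto_const e(2), of 2] by simp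
  have "eventually (\<lambda>n. \<forall>x. norm x \<le> R \<longrightarrow> cmod ((\<integral>y. k n x y \<partial>lborel) - 0) \<le> d) sequentially" if d: "d > 0" for d
  proof -
    have "eventually (\<lambda>n. 2 * e n < d / Lz) sequentially"
      by (rule order_tendstoD(2)[OF e2]) (use d Lz(1) in auto)
    then show ?thesis
    proof eventually_elim
      case (elim n)
      then have "Lz * (2 * e n) \<le> d" using Lz(1) by (simp add: field_simps)
      then show ?case using mean_le order_trans by fastforce
    qed
  qed
  from kernel_operator_tendsto(2)[OF u kc _ e2 bd supp this] e(1)
  show ?thesis by (simp add: kid)
qed

text \<open>The cutoff enters squared so that the first order commutator term keeps a factor \<eta>:
  what the energy estimate controls is \<eta> times the covariant derivative, not the covariant
  derivative itself.\<close>

lemma H_mult_square: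
  assumes w: "smooth w" and eta: "smooth \<eta>"
  shows "H (\<lambda>x. of_real (\<eta> x) * (of_real (\<eta> x) * w x)) x = of_real (\<eta> x) * (of_real (\<eta> x) * H w x) -
    (\<Sum>b\<in>Basis. 4 * (of_real (pd b \<eta> x) * (of_real (\<eta> x) * cov b w x))) -
    (\<Sum>b\<in>Basis. of_real (2 * (pd b \<eta> x)\<^sup>2 + 2 * \<eta> x * pd b (pd b \<eta>) x)) * w x"
proof -
  let ?e = "\<lambda>x. complex_of_real (\<eta> x)"
  have e: "smooth ?e" by (rule smooth_of_real[OF eta])
  have pe: "pd b ?e = (\<lambda>x. of_real (pd b \<eta> x))" for b
    using pd_of_real[OF smooth_differentiable[OF eta]] by blast
  have c1: "cov b (\<lambda>x. ?e x * (?e x * w x)) = (\<lambda>x. of_real (pd b \<eta> x) * (?e x * w x) + ?e x * (of_real (pd b \<eta> x) * w x + ?e x * cov b w x))" for b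
    using cov_mult[OF e smooth_mult[OF e w], of b] cov_mult[OF e w, of b] by (simp add: pe fun_eq_iff)
  have c2: "cov b (cov b (\<lambda>x. ?e x * (?e x * w x))) x =
      4 * (of_real (pd b \<eta> x) * (?e x * cov b w x)) + of_real (2 * (pd b \<eta> x)\<^sup>2 + 2 * \<eta> x * pd b (pd b \<eta>) x) * w x +
      ?e x * (?e x * cov b (cov b w) x)" if b: "b \<in> Basis" for b
  proof -
    have p: "smooth (\<lambda>x. complex_of_real (pd b \<eta> x))" by (intro smooth_of_real smooth_pd eta b)
    have pp: "pd b (\<lambda>x. complex_of_real (pd b \<eta> x)) x = of_real (pd b (pd b \<eta>) x)"
      by (rule pd_of_real[OF smooth_differentiable[OF smooth_pd[OF eta b]]])
    have s: "smooth (\<lambda>x. ?e x * w x)" "smooth (\<lambda>x. of_real (pd b \<eta> x) * w x)" "smooth (\<lambda>x. ?e x * cov b w x)"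
      by (intro smooth_mult e p w smooth_cov b)+
    have "cov b (cov b (\<lambda>x. ?e x * (?e x * w x))) x = cov b (\<lambda>x. of_real (pd b \<eta> x) * (?e x * w x)) x +
        (cov b (\<lambda>x. ?e x * (of_real (pd b \<eta> x) * w x)) x + cov b (\<lambda>x. ?e x * (?e x * cov b w x)) x)"
      unfolding c1 distrib_left by (subst cov_add, (intro smooth_add smooth_mult e p w smooth_cov b)+,
        subst cov_add, (intro smooth_add smooth_mult e p w smooth_cov b)+) (rule refl)
    then show ?thesis
      using cov_mult[OF p s(1), of b x] cov_mult[OF e s(2), of b x] cov_mult[OF e s(3), of b x]
        cov_mult[OF e w, of b x] cov_mult[OF p w, of b x] cov_mult[OF e smooth_cov[OF w b], of b x]
      by (simp add: pe pp algebra_simps power2_eq_square)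
  qed
  show ?thesis
  proof -
    have "(\<Sum>b\<in>Basis. cov b (cov b (\<lambda>x. ?e x * (?e x * w x))) x) =
      (\<Sum>b\<in>Basis. 4 * (of_real (pd b \<eta> x) * (?e x * cov b w x))) +
      (\<Sum>b\<in>Basis. of_real (2 * (pd b \<eta> x)\<^sup>2 + 2 * \<eta> x * pd b (pd b \<eta>) x)) * w x +
      ?e x * (?e x * (\<Sum>b\<in>Basis. cov b (cov b w) x))"
      by (simp only: c2 sum.distrib sum_distrib_left sum_distrib_right cong: sum.cong)
    then show ?thesis unfolding H_def by (simp only:) (simp add: algebra_simps)
  qed
qed

lemma nsq_sum_le:
  assumes "finite I" "\<And>i. i \<in> I \<Longrightarrow> L2f (f i)"
  shows "nsq (\<lambda>x. \<Sum>i\<in>I. f i x) \<le> real (card I) * (\<Sum>i\<in>I. nsq (f i))"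
proof -
  have i: "integrable lborel (\<lambda>x. real (card I) * (\<Sum>i\<in>I. (cmod (f i x))\<^sup>2))"
    using assms(2) by (auto simp: L2f_def)
  have le: "(cmod (\<Sum>i\<in>I. f i x))\<^sup>2 \<le> real (card I) * (\<Sum>i\<in>I. (cmod (f i x))\<^sup>2)" for x
  proof -
    have "(cmod (\<Sum>i\<in>I. f i x))\<^sup>2 \<le> (\<Sum>i\<in>I. 1 * cmod (f i x))\<^sup>2"
      by (intro power_mono) (auto intro: sum_norm_le)
    also have "\<dots> \<le> (\<Sum>i\<in>I. 1\<^sup>2) * (\<Sum>i\<in>I. (cmod (f i x))\<^sup>2)" by (rule Cauchy_Schwarz_ineq_sum)
    finally show ?thesis by simp
  qed
  have "nsq (\<lambda>x. \<Sum>i\<in>I. f i x) \<le> (\<integral>x. real (card I) * (\<Sum>i\<in>I. (cmod (f i x))\<^sup>2) \<partial>lborel)"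
    by (rule L2f_bound(2)[OF i _ le]) (use L2f_measurable[OF L2f_sum[of I f]] assms(2) in simp)
  also have "\<dots> = real (card I) * (\<Sum>i\<in>I. nsq (f i))"
    using assms(2) by (simp add: nsq_def L2f_def)
  finally show ?thesis .
qed

text \<open>Turns a smooth approximation on the ball of radius R into a test function. The error
  consists of a near part of order 1/R, a far part carrying 1 - \<eta>^2, and the commutator terms,
  of order 1/R by the bounds on the derivatives of the cutoff and the energy estimate. All constants
  depend on u and f only through their norms.\<close>

lemma cutoff_graph_estimate:
  fixes u f :: "'a \<Rightarrow> complex"
  assumes u: "L2f u" and f: "L2f f" and w: "smooth w" and R: "R \<ge> 1"
    and C: "C > 0" "\<And>b x. b \<in> Basis \<Longrightarrow> \<bar>pd b (cutoff R) (x::'a)\<bar> \<le> C / R"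
      "\<And>b x. b \<in> Basis \<Longrightarrow> \<bar>pd b (pd b (cutoff R)) (x::'a)\<bar> \<le> C / R"
    and wu: "L2f (\<lambda>x. indicator (cball 0 R) x *\<^sub>R (w x - u x))" "nsq (\<lambda>x. indicator (cball 0 R) x *\<^sub>R (w x - u x)) \<le> 1 / R"
    and Hf: "L2f (\<lambda>x. indicator (cball 0 R) x *\<^sub>R (H w x - f x))" "nsq (\<lambda>x. indicator (cball 0 R) x *\<^sub>R (H w x - f x)) \<le> 1 / R"
  defines "g \<equiv> \<lambda>x. of_real (cutoff R x) * (of_real (cutoff R x) * w x)"
    and "P \<equiv> 2 + 2 * nsq f" and "Q \<equiv> 2 + 2 * nsq u" and "m \<equiv> real DIM('a)"
  shows "cc_smooth g"
    and "nsq (\<lambda>x. g x - u x) \<le> 2 * (1 / R) + 2 * nsq (\<lambda>x. of_real ((cutoff R x)\<^sup>2 - 1) * u x)"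
    and "nsq (\<lambda>x. H g x - f x) \<le> 2 * (2 * (1 / R) + 2 * nsq (\<lambda>x. of_real ((cutoff R x)\<^sup>2 - 1) * f x)) +
      2 * (2 * (m * (m * (16 * C\<^sup>2 * (P + Q + 4 * (m * (C\<^sup>2 * Q))))) / R) + 2 * ((m * (2 * C\<^sup>2 + 2 * C))\<^sup>2 * Q / R))"
proof -
  let ?\<eta> = "cutoff R :: 'a \<Rightarrow> real"
  let ?I = "\<lambda>x::'a. indicat_real (cball 0 R) x"
  have eta: "cc_smooth ?\<eta>" and es: "smooth ?\<eta>" using cc_smooth_cutoff[of R] R by (auto intro: cc_smoothD)
  have ec: "cc_smooth (\<lambda>x. complex_of_real (?\<eta> x))" by (rule cc_smooth_of_real[OF eta])
  show g: "cc_smooth g" unfolding g_def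
    by (intro cc_smooth_mult_left ec smooth_mult smooth_of_real es w)
  have out: "?\<eta> x = 0" "pd b ?\<eta> x = 0" "pd b (pd b ?\<eta>) x = 0" if "x \<notin> cball 0 R" for x b
  proof -
    have x: "norm x > R" using that by simp
    have 0: "?\<eta> x = 0" if "norm x > R" for x using that R by (intro cutoff_eq_0) auto
    then show "?\<eta> x = 0" using x .
    have 1: "pd b ?\<eta> x = 0" if "norm x > R" for x by (rule pd_eq_0_outside[OF 0 that])
    then show "pd b ?\<eta> x = 0" using x .
    show "pd b (pd b ?\<eta>) x = 0" by (rule pd_eq_0_outside[OF 1 x])
  qed
  have eb: "cmod (of_real (?\<eta> x)) \<le> 1" for x using cutoff_bounds[of R x] by simp
  have e2: "cmod (of_real (?\<eta> x) * (of_real (?\<eta> x) * z)) \<le> cmod (?I x *\<^sub>R z)" for x z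
  proof (cases "x \<in> cball 0 R")
    case True
    have "?\<eta> x * ?\<eta> x \<le> 1 * 1" using cutoff_bounds[of R x] by (intro mult_mono) auto
    then have "?\<eta> x * ?\<eta> x * cmod z \<le> 1 * cmod z" by (intro mult_right_mono) auto
    then show ?thesis using True cutoff_bounds[of R x] by (simp add: norm_mult mult.assoc)
  qed (simp add: out)
  have e1: "cmod (of_real (?\<eta> x) * z) \<le> cmod (?I x *\<^sub>R z)" for x z
  proof (cases "x \<in> cball 0 R")
    case True
    have "?\<eta> x * cmod z \<le> 1 * cmod z" using cutoff_bounds[of R x] by (intro mult_right_mono) auto
    then show ?thesis using True cutoff_bounds[of R x] by (simp add: norm_mult)
  qed (simp add: out)
  have em: "(\<lambda>x. of_real (?\<eta> x) * (of_real (?\<eta> x) * h x)) \<in> borel_measurable borel" if "h \<in> borel_measurable borel" for h :: "'a \<Rightarrow> complex"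
    using that smooth_measurable[OF cc_smoothD[OF ec]] by simp
  have far: "L2f (\<lambda>x. of_real ((?\<eta> x)\<^sup>2 - 1) * h x)" if "L2f h" for h
  proof (rule L2f_bounded_mult(1)[OF that])
    show "(\<lambda>x. complex_of_real ((?\<eta> x)\<^sup>2 - 1)) \<in> borel_measurable borel"
      using smooth_measurable[OF es] by simp
    show "cmod (complex_of_real ((?\<eta> x)\<^sup>2 - 1)) \<le> 1" for x
    proof -
      have "0 \<le> (?\<eta> x)\<^sup>2" "(?\<eta> x)\<^sup>2 \<le> 1" using cutoff_bounds[of R x] by (auto simp: power_le_one)
      then show ?thesis unfolding norm_of_real by simp
    qed
  qed
  have wm: "w \<in> borel_measurable borel" "H w \<in> borel_measurable borel"
    using smooth_measurable w smooth_H by auto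
  have um: "u \<in> borel_measurable borel" "f \<in> borel_measurable borel" using u f by (auto simp: L2f_def)
  have near: "L2f (\<lambda>x. of_real (?\<eta> x) * (of_real (?\<eta> x) * (w x - u x)))"
    "nsq (\<lambda>x. of_real (?\<eta> x) * (of_real (?\<eta> x) * (w x - u x))) \<le> 1 / R"
    "L2f (\<lambda>x. of_real (?\<eta> x) * (of_real (?\<eta> x) * (H w x - f x)))"
    "nsq (\<lambda>x. of_real (?\<eta> x) * (of_real (?\<eta> x) * (H w x - f x))) \<le> 1 / R"
    using nsq_mono[OF wu(1) em e2] nsq_mono[OF Hf(1) em e2] wu(2) Hf(2) wm um by auto
  have "(\<lambda>x. g x - u x) = (\<lambda>x. of_real (?\<eta> x) * (of_real (?\<eta> x) * (w x - u x)) + of_real ((?\<eta> x)\<^sup>2 - 1) * u x)"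
    by (simp add: g_def fun_eq_iff algebra_simps power2_eq_square)
  then have "nsq (\<lambda>x. g x - u x) \<le> 2 * nsq (\<lambda>x. of_real (?\<eta> x) * (of_real (?\<eta> x) * (w x - u x))) +
      2 * nsq (\<lambda>x. of_real ((?\<eta> x)\<^sup>2 - 1) * u x)"
    using nsq_add_le[OF near(1) far[OF u]] by simp
  also have "\<dots> \<le> 2 * (1 / R) + 2 * nsq (\<lambda>x. of_real ((?\<eta> x)\<^sup>2 - 1) * u x)"
    by (intro add_right_mono mult_left_mono near) auto
  finally show "nsq (\<lambda>x. g x - u x) \<le> 2 * (1 / R) + 2 * nsq (\<lambda>x. of_real ((?\<eta> x)\<^sup>2 - 1) * u x)" .
  have R1: "1 / R \<le> 1" using R by simp
  \<comment> \<open>Since 1/R \<le> 1, closeness to u and f on the ball bounds w and H w there by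
    constants that do not depend on R.\<close>
  have Pb: "L2f (\<lambda>x. ?I x *\<^sub>R H w x)" "nsq (\<lambda>x. ?I x *\<^sub>R H w x) \<le> P"
    and Qb: "L2f (\<lambda>x. ?I x *\<^sub>R w x)" "nsq (\<lambda>x. ?I x *\<^sub>R w x) \<le> Q"
  proof -
    have *: "nsq (\<lambda>x. ?I x *\<^sub>R h x) \<le> 2 + 2 * nsq v"
      if v: "L2f v" and hv: "L2f (\<lambda>x. ?I x *\<^sub>R (h x - v x))" "nsq (\<lambda>x. ?I x *\<^sub>R (h x - v x)) \<le> 1 / R" for h v :: "'a \<Rightarrow> complex"
    proof -
      have "(\<lambda>x. ?I x *\<^sub>R h x) = (\<lambda>x. ?I x *\<^sub>R (h x - v x) + ?I x *\<^sub>R v x)"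
        by (simp add: fun_eq_iff scaleR_diff_right)
      then have "nsq (\<lambda>x. ?I x *\<^sub>R h x) \<le> 2 * nsq (\<lambda>x. ?I x *\<^sub>R (h x - v x)) + 2 * nsq (\<lambda>x. ?I x *\<^sub>R v x)"
        using nsq_add_le[OF hv(1) indicator_scaleR_L2f[OF v]] by simp
      also have "\<dots> \<le> 2 * 1 + 2 * nsq v"
        by (intro add_mono mult_left_mono nsq_indicator_le v order_trans[OF hv(2) R1]) auto
      finally show ?thesis by simp
    qed
    show "L2f (\<lambda>x. ?I x *\<^sub>R H w x)" "L2f (\<lambda>x. ?I x *\<^sub>R w x)"
      by (intro continuous_indicator_L2f smooth_continuous smooth_H w)+
    show "nsq (\<lambda>x. ?I x *\<^sub>R H w x) \<le> P" "nsq (\<lambda>x. ?I x *\<^sub>R w x) \<le> Q"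
      unfolding P_def Q_def by (intro * u f wu Hf)+
  qed
  have Q0: "Q \<ge> 0" "P \<ge> 0" by (simp_all add: Q_def P_def nsq_nonneg)
  have CR: "(C / R)\<^sup>2 \<le> C\<^sup>2" "(C / R)\<^sup>2 \<le> C\<^sup>2 / R" "C / R \<le> C"
  proof -
    show *: "C / R \<le> C" using C R by (simp add: divide_le_eq)
    then show "(C / R)\<^sup>2 \<le> C\<^sup>2" using C R by (intro power_mono) auto
    have "(C / R)\<^sup>2 = C / R * (C / R)" by (simp add: power2_eq_square)
    also have "\<dots> \<le> C / R * C" using * C R by (intro mult_left_mono) auto
    finally show "(C / R)\<^sup>2 \<le> C\<^sup>2 / R" by (simp add: power2_eq_square)
  qed
  have pdw: "L2f (\<lambda>x. of_real (pd b ?\<eta> x) * w x)" "nsq (\<lambda>x. of_real (pd b ?\<eta> x) * w x) \<le> C\<^sup>2 * Q" if b: "b \<in> Basis" for b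
  proof -
    have m: "(\<lambda>x. complex_of_real (pd b ?\<eta> x)) \<in> borel_measurable borel"
      using smooth_measurable[OF smooth_pd[OF es b]] by simp
    have le: "cmod (of_real (pd b ?\<eta> x)) \<le> C" for x
      using order_trans[OF C(2)[OF b] CR(3)] by simp
    have eq: "(\<lambda>x. of_real (pd b ?\<eta> x) * (?I x *\<^sub>R w x)) = (\<lambda>x. of_real (pd b ?\<eta> x) * w x)"
      by (auto simp: fun_eq_iff indicator_def out)
    show "L2f (\<lambda>x. of_real (pd b ?\<eta> x) * w x)" "nsq (\<lambda>x. of_real (pd b ?\<eta> x) * w x) \<le> C\<^sup>2 * Q"
      using L2f_bounded_mult[OF Qb(1) m le] mult_left_mono[OF Qb(2), of "C\<^sup>2"] unfolding eq by auto
  qed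
  let ?c = "\<lambda>b x. of_real (?\<eta> x) * cov b w x"
  have "(\<Sum>b\<in>Basis. nsq (?c b)) \<le> nsq (\<lambda>x. of_real (?\<eta> x) * H w x) + nsq (\<lambda>x. of_real (?\<eta> x) * w x) +
      4 * (\<Sum>b\<in>Basis. nsq (\<lambda>x. of_real (pd b ?\<eta> x) * w x))"
    by (rule energy_estimate[OF w eta])
  also have "\<dots> \<le> P + Q + 4 * (\<Sum>b\<in>(Basis::'a set). C\<^sup>2 * Q)"
  proof (intro add_mono mult_left_mono sum_mono pdw)
    show "nsq (\<lambda>x. of_real (?\<eta> x) * H w x) \<le> P"
      by (rule order_trans[OF nsq_mono(2)[OF Pb(1) _ e1] Pb(2)])
         (use smooth_measurable[OF cc_smoothD[OF ec]] wm in simp)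
    show "nsq (\<lambda>x. of_real (?\<eta> x) * w x) \<le> Q"
      by (rule order_trans[OF nsq_mono(2)[OF Qb(1) _ e1] Qb(2)])
         (use smooth_measurable[OF cc_smoothD[OF ec]] wm in simp)
  qed auto
  finally have energy: "(\<Sum>b\<in>Basis. nsq (?c b)) \<le> P + Q + 4 * (m * (C\<^sup>2 * Q))" by (simp add: m_def)
  have cL: "L2f (?c b)" if "b \<in> Basis" for b
    using that by (intro cc_smooth_L2f cc_smooth_mult_left ec smooth_cov w)
  \<comment> \<open>S is the first order and T the zeroth order part of the commutator of H with
    \<eta>^2.\<close>
  define S where "S x = (\<Sum>b\<in>Basis. 4 * (of_real (pd b ?\<eta> x) * ?c b x))" for x
  define T where "T x = (\<Sum>b\<in>Basis. of_real (2 * (pd b ?\<eta> x)\<^sup>2 + 2 * ?\<eta> x * pd b (pd b ?\<eta>) x)) * w x" for x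
  have Sb: "L2f (\<lambda>x. 4 * (of_real (pd b ?\<eta> x) * ?c b x))"
    "nsq (\<lambda>x. 4 * (of_real (pd b ?\<eta> x) * ?c b x)) \<le> 16 * C\<^sup>2 / R * (P + Q + 4 * (m * (C\<^sup>2 * Q)))" if b: "b \<in> Basis" for b
  proof -
    have m: "(\<lambda>x. complex_of_real (pd b ?\<eta> x)) \<in> borel_measurable borel"
      using smooth_measurable[OF smooth_pd[OF es b]] by simp
    have le: "cmod (of_real (pd b ?\<eta> x)) \<le> C / R" for x using C(2)[OF b] by simp
    note B = L2f_bounded_mult[OF cL[OF b] m le]
    show "L2f (\<lambda>x. 4 * (of_real (pd b ?\<eta> x) * ?c b x))" by (intro L2f_cmult B)
    have "nsq (\<lambda>x. 4 * (of_real (pd b ?\<eta> x) * ?c b x)) = 16 * nsq (\<lambda>x. of_real (pd b ?\<eta> x) * ?c b x)"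
      using nsq_cmult[of 4 "\<lambda>x. of_real (pd b ?\<eta> x) * ?c b x"] by simp
    also have "\<dots> \<le> 16 * (C\<^sup>2 / R * (P + Q + 4 * (m * (C\<^sup>2 * Q))))"
    proof (intro mult_left_mono order_trans[OF B(2)] mult_mono CR)
      show "nsq (?c b) \<le> P + Q + 4 * (m * (C\<^sup>2 * Q))"
        by (rule order_trans[OF member_le_sum[of b Basis "\<lambda>b. nsq (?c b)"] energy]) (use b nsq_nonneg in auto)
    qed (use C R nsq_nonneg in auto)
    finally show "nsq (\<lambda>x. 4 * (of_real (pd b ?\<eta> x) * ?c b x)) \<le> 16 * C\<^sup>2 / R * (P + Q + 4 * (m * (C\<^sup>2 * Q)))"
      by (simp add: mult.assoc)
  qed
  have SL: "L2f S" unfolding S_def by (intro L2f_sum Sb)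
  have "nsq S \<le> real (card (Basis::'a set)) * (\<Sum>b\<in>Basis. nsq (\<lambda>x. 4 * (of_real (pd b ?\<eta> x) * ?c b x)))"
    unfolding S_def by (intro nsq_sum_le Sb) auto
  also have "\<dots> \<le> real (card (Basis::'a set)) * (\<Sum>b\<in>(Basis::'a set). 16 * C\<^sup>2 / R * (P + Q + 4 * (m * (C\<^sup>2 * Q))))"
    by (intro mult_left_mono sum_mono Sb) auto
  also have "\<dots> = m * (m * (16 * C\<^sup>2 * (P + Q + 4 * (m * (C\<^sup>2 * Q))))) / R" by (simp add: m_def)
  finally have SN: "nsq S \<le> m * (m * (16 * C\<^sup>2 * (P + Q + 4 * (m * (C\<^sup>2 * Q))))) / R" .
  let ?t = "\<lambda>x. \<Sum>b\<in>Basis. complex_of_real (2 * (pd b ?\<eta> x)\<^sup>2 + 2 * ?\<eta> x * pd b (pd b ?\<eta>) x)"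
  have tm: "?t \<in> borel_measurable borel"
    using smooth_measurable[OF smooth_pd[OF es]] smooth_measurable[OF es] smooth_measurable[OF smooth_pd[OF smooth_pd[OF es]]]
    by (intro borel_measurable_sum borel_measurable_of_real borel_measurable_add borel_measurable_times borel_measurable_const borel_measurable_power) auto
  have tb: "cmod (?t x) \<le> m * (2 * C\<^sup>2 + 2 * C) / R" for x
  proof -
    have "cmod (?t x) \<le> (\<Sum>b\<in>(Basis::'a set). (2 * C\<^sup>2 + 2 * C) / R)"
    proof (rule sum_norm_le)
      fix b :: 'a assume b: "b \<in> Basis"
      have "(pd b ?\<eta> x)\<^sup>2 \<le> (C / R)\<^sup>2" using power_mono[OF C(2)[OF b], of x 2] by simp
      then have 1: "(pd b ?\<eta> x)\<^sup>2 \<le> C\<^sup>2 / R" using CR(2) by linarith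
      have "\<bar>?\<eta> x\<bar> * \<bar>pd b (pd b ?\<eta>) x\<bar> \<le> 1 * (C / R)"
        using cutoff_bounds[of R x] by (intro mult_mono C(3) b) auto
      then have 2: "\<bar>?\<eta> x * pd b (pd b ?\<eta>) x\<bar> \<le> C / R" by (simp add: abs_mult)
      have "\<bar>2 * (pd b ?\<eta> x)\<^sup>2 + 2 * ?\<eta> x * pd b (pd b ?\<eta>) x\<bar> \<le> 2 * (C\<^sup>2 / R) + 2 * (C / R)"
      proof -
        have "\<bar>2 * (pd b ?\<eta> x)\<^sup>2 + 2 * (?\<eta> x * pd b (pd b ?\<eta>) x)\<bar> \<le>
            \<bar>2 * (pd b ?\<eta> x)\<^sup>2\<bar> + \<bar>2 * (?\<eta> x * pd b (pd b ?\<eta>) x)\<bar>" by (rule abs_triangle_ineq)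
        also have "\<dots> \<le> 2 * (C\<^sup>2 / R) + 2 * (C / R)"
          using 1 2 by (intro add_mono) (simp_all only: abs_mult abs_numeral, simp_all)
        finally show ?thesis by (simp add: mult.assoc)
      qed
      then show "cmod (complex_of_real (2 * (pd b ?\<eta> x)\<^sup>2 + 2 * ?\<eta> x * pd b (pd b ?\<eta>) x)) \<le> (2 * C\<^sup>2 + 2 * C) / R"
        unfolding norm_of_real by (simp add: add_divide_distrib)
    qed
    then show ?thesis by (simp add: m_def)
  qed
  have Teq: "(\<lambda>x. ?t x * (?I x *\<^sub>R w x)) = T"
    by (auto simp: fun_eq_iff T_def indicator_def out)
  have TL: "L2f T" and TN: "nsq T \<le> (m * (2 * C\<^sup>2 + 2 * C))\<^sup>2 * Q / R"
  proof -
    note B = L2f_bounded_mult[OF Qb(1) tm tb, unfolded Teq]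
    show "L2f T" by (rule B(1))
    have "nsq T \<le> (m * (2 * C\<^sup>2 + 2 * C) / R)\<^sup>2 * Q"
      by (rule order_trans[OF B(2)]) (intro mult_left_mono Qb, auto)
    also have "(m * (2 * C\<^sup>2 + 2 * C) / R)\<^sup>2 \<le> (m * (2 * C\<^sup>2 + 2 * C))\<^sup>2 / R"
      unfolding power_divide using R by (intro divide_left_mono) (auto simp: power2_eq_square)
    finally show "nsq T \<le> (m * (2 * C\<^sup>2 + 2 * C))\<^sup>2 * Q / R" using Q0 by (simp add: mult_right_mono)
  qed
  have Hg: "(\<lambda>x. H g x - f x) = (\<lambda>x. (of_real (?\<eta> x) * (of_real (?\<eta> x) * (H w x - f x)) + of_real ((?\<eta> x)\<^sup>2 - 1) * f x) - (S x + T x))"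
    unfolding g_def H_mult_square[OF w es] by (simp add: fun_eq_iff S_def T_def algebra_simps power2_eq_square)
  have "nsq (\<lambda>x. H g x - f x) \<le> 2 * nsq (\<lambda>x. of_real (?\<eta> x) * (of_real (?\<eta> x) * (H w x - f x)) + of_real ((?\<eta> x)\<^sup>2 - 1) * f x) +
      2 * nsq (\<lambda>x. S x + T x)"
    unfolding Hg by (intro nsq_diff_le L2f_add near far f SL TL)
  also have "\<dots> \<le> 2 * (2 * (1 / R) + 2 * nsq (\<lambda>x. of_real ((?\<eta> x)\<^sup>2 - 1) * f x)) +
      2 * (2 * (m * (m * (16 * C\<^sup>2 * (P + Q + 4 * (m * (C\<^sup>2 * Q))))) / R) + 2 * ((m * (2 * C\<^sup>2 + 2 * C))\<^sup>2 * Q / R))"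
    by (intro add_mono mult_left_mono order_trans[OF nsq_add_le[OF near(3) far[OF f]]]
        order_trans[OF nsq_add_le[OF SL TL]] near SN TN order_refl) auto
  finally show "nsq (\<lambda>x. H g x - f x) \<le> 2 * (2 * (1 / R) + 2 * nsq (\<lambda>x. of_real ((?\<eta> x)\<^sup>2 - 1) * f x)) +
      2 * (2 * (m * (m * (16 * C\<^sup>2 * (P + Q + 4 * (m * (C\<^sup>2 * Q))))) / R) + 2 * ((m * (2 * C\<^sup>2 + 2 * C))\<^sup>2 * Q / R))" .
qed

end

section \<open>The adjoint as the closure of the operator on test functions\<close>

context magnetic
begin

text \<open>The graph of the adjoint of H on test functions: the pairs of square integrable
  functions with H u = f in the sense of distributions.\<close>

definition weak_H :: "('a \<Rightarrow> complex) \<Rightarrow> ('a \<Rightarrow> complex) \<Rightarrow> bool" where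
  "weak_H u f \<longleftrightarrow> L2f u \<and> L2f f \<and> (\<forall>g. cc_smooth g \<longrightarrow> l2ip f g = l2ip u (H g))"

text \<open>Both u and f are mollified at the same scale. The error in H w splits into the
  commutator, controlled by Friedrichs' lemma, and the mollification error of f.\<close>

lemma weak_H_local_approx:
  assumes "weak_H u f" and d: "d > 0"
  obtains w where "smooth w"
    "L2f (\<lambda>x. indicator (cball 0 R) x *\<^sub>R (w x - u x))" "nsq (\<lambda>x. indicator (cball 0 R) x *\<^sub>R (w x - u x)) \<le> d"
    "L2f (\<lambda>x. indicator (cball 0 R) x *\<^sub>R (H w x - f x))" "nsq (\<lambda>x. indicator (cball 0 R) x *\<^sub>R (H w x - f x)) \<le> d"
proof -
  have u: "L2f u" and f: "L2f f" and weak: "\<And>g. cc_smooth g \<Longrightarrow> l2ip f g = l2ip u (H g)"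
    using assms(1) by (auto simp: weak_H_def)
  let ?I = "\<lambda>x::'a. indicat_real (cball 0 R) x"
  \<comment> \<open>Half of 1/(n + 1), as Friedrichs' lemma requires twice the scale to be at most
    1.\<close>
  define e where "e n = inverse (real (Suc n)) * (1 / 2)" for n
  have e: "e n > 0" "2 * e n \<le> 1" for n by (auto simp: e_def field_simps)
  have "(\<lambda>n. inverse (real (Suc n)) * (1 / 2)) \<longlonglongrightarrow> 0 * (1 / 2)"
    by (intro tendsto_mult tendsto_const LIMSEQ_inverse_real_of_nat)
  then have e0: "e \<longlonglongrightarrow> 0" by (simp add: e_def[abs_def])
  define w where "w n = conv (mollifier (e n)) u" for n
  define F where "F n = conv (mollifier (e n)) f" for n
  have ws: "smooth (w n)" and Fs: "smooth (F n)" for n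
    unfolding w_def F_def by (intro smooth_conv cc_smooth_mollifier e L2f_locally_integrable u f)+
  have L1: "L2f (\<lambda>x. ?I x *\<^sub>R (w n x - u x))" and L2: "L2f (\<lambda>x. ?I x *\<^sub>R (F n x - f x))" for n
    unfolding w_def F_def by (intro mollify_tendsto(1) u f e e0)+
  have L3: "L2f (\<lambda>x. ?I x *\<^sub>R (H (w n) x - F n x))" for n
    by (intro continuous_indicator_L2f smooth_continuous smooth_diff smooth_H ws Fs)
  have t: "(\<lambda>n. nsq (\<lambda>x. ?I x *\<^sub>R (w n x - u x))) \<longlonglongrightarrow> 0"
    "(\<lambda>n. nsq (\<lambda>x. ?I x *\<^sub>R (F n x - f x))) \<longlonglongrightarrow> 0"
    "(\<lambda>n. nsq (\<lambda>x. ?I x *\<^sub>R (H (w n) x - F n x))) \<longlonglongrightarrow> 0"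
    unfolding w_def F_def by (intro mollify_tendsto(2) friedrichs u f e e0 weak; assumption)+
  have "eventually (\<lambda>n. nsq (\<lambda>x. ?I x *\<^sub>R (w n x - u x)) < d \<and> nsq (\<lambda>x. ?I x *\<^sub>R (F n x - f x)) < d / 4 \<and>
      nsq (\<lambda>x. ?I x *\<^sub>R (H (w n) x - F n x)) < d / 4) sequentially"
    using d by (intro eventually_conj order_tendstoD(2)[OF t(1)] order_tendstoD(2)[OF t(2)] order_tendstoD(2)[OF t(3)]) auto
  then obtain n where n: "nsq (\<lambda>x. ?I x *\<^sub>R (w n x - u x)) < d" "nsq (\<lambda>x. ?I x *\<^sub>R (F n x - f x)) < d / 4"
      "nsq (\<lambda>x. ?I x *\<^sub>R (H (w n) x - F n x)) < d / 4"
    unfolding eventually_sequentially by blast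
  have eq: "(\<lambda>x. ?I x *\<^sub>R (H (w n) x - f x)) = (\<lambda>x. ?I x *\<^sub>R (H (w n) x - F n x) + ?I x *\<^sub>R (F n x - f x))"
    by (simp add: fun_eq_iff scaleR_diff_right)
  have "nsq (\<lambda>x. ?I x *\<^sub>R (H (w n) x - f x)) \<le> 2 * nsq (\<lambda>x. ?I x *\<^sub>R (H (w n) x - F n x)) + 2 * nsq (\<lambda>x. ?I x *\<^sub>R (F n x - f x))"
    unfolding eq by (rule nsq_add_le[OF L3 L2])
  also have "\<dots> \<le> 2 * (d / 4) + 2 * (d / 4)" by (intro add_mono mult_left_mono less_imp_le n) auto
  also have "\<dots> = d" by simp
  finally have "nsq (\<lambda>x. ?I x *\<^sub>R (H (w n) x - f x)) \<le> d" .
  moreover have "L2f (\<lambda>x. ?I x *\<^sub>R (H (w n) x - f x))" unfolding eq by (intro L2f_add L2 L3)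
  ultimately show ?thesis using that[OF ws L1] n(1) by (auto intro: less_imp_le)
qed

lemma cutoff_far_tendsto:
  fixes h :: "'a \<Rightarrow> complex"
  assumes h: "L2f h"
  shows "(\<lambda>n. nsq (\<lambda>x. of_real ((cutoff (real (Suc n)) x)\<^sup>2 - 1) * h x)) \<longlonglongrightarrow> 0"
proof (rule nsq_dominated_convergence[where w = "\<lambda>x. (cmod (h x))\<^sup>2"])
  show "(\<lambda>x. complex_of_real ((cutoff (real (Suc n)) x)\<^sup>2 - 1) * h x) \<in> borel_measurable borel" for n
  proof -
    have m: "cutoff (real (Suc n)) \<in> borel_measurable (borel :: 'a measure)"
      by (rule smooth_measurable[OF cc_smoothD[OF cc_smooth_cutoff]]) simp
    have "(\<lambda>x::'a. complex_of_real ((cutoff (real (Suc n)) x)\<^sup>2 - 1)) \<in> borel_measurable borel"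
      by (rule borel_measurable_continuous_on[OF _ m, of "\<lambda>t. complex_of_real (t\<^sup>2 - 1)"]) (intro continuous_intros)
    then show ?thesis using h by (intro borel_measurable_times) (auto simp: L2f_def)
  qed
  show "integrable lborel (\<lambda>x. (cmod (h x))\<^sup>2)" using h by (simp add: L2f_def)
  show "(cmod (complex_of_real ((cutoff (real (Suc n)) x)\<^sup>2 - 1) * h x))\<^sup>2 \<le> (cmod (h x))\<^sup>2" for n and x :: 'a
  proof -
    have "0 \<le> (cutoff (real (Suc n)) x)\<^sup>2" "(cutoff (real (Suc n)) x)\<^sup>2 \<le> 1"
      using cutoff_bounds[of "real (Suc n)" x] by (auto simp: power_le_one)
    then have "\<bar>(cutoff (real (Suc n)) x)\<^sup>2 - 1\<bar> * cmod (h x) \<le> 1 * cmod (h x)"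
      by (intro mult_right_mono) auto
    then show ?thesis unfolding norm_mult norm_of_real by (intro power_mono) auto
  qed
  show "AE x in lborel. (\<lambda>n. complex_of_real ((cutoff (real (Suc n)) x)\<^sup>2 - 1) * h x) \<longlonglongrightarrow> 0"
  proof (rule AE_I2)
    fix x :: 'a
    have "(\<lambda>n. complex_of_real ((cutoff (real (Suc n)) x)\<^sup>2 - 1) * h x) \<longlonglongrightarrow> complex_of_real (1\<^sup>2 - 1) * h x"
      by (intro tendsto_intros cutoff_tendsto)
    then show "(\<lambda>n. complex_of_real ((cutoff (real (Suc n)) x)\<^sup>2 - 1) * h x) \<longlonglongrightarrow> 0" by simp
  qed
qed

text \<open>Density of the test functions in the graph norm of the adjoint. For each k a local
  approximation within 1/(k + 1) on the ball of radius k + 1 is cut off at the same radius; the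
  constants of the cutoff estimate do not depend on k.\<close>

lemma weak_H_approx:
  assumes weak: "weak_H u f"
  obtains g where "\<And>k. cc_smooth (g k)" "(\<lambda>k. nsq (\<lambda>x. g k x - u x)) \<longlonglongrightarrow> 0"
    "(\<lambda>k. nsq (\<lambda>x. H (g k) x - f x)) \<longlonglongrightarrow> 0"
proof -
  have u: "L2f u" and f: "L2f f" using weak by (auto simp: weak_H_def)
  obtain C where C: "C > 0"
    "\<And>R b x. R \<ge> 1 \<Longrightarrow> b \<in> Basis \<Longrightarrow> \<bar>pd b (cutoff R) (x::'a)\<bar> \<le> C / R"
    "\<And>R b x. R \<ge> 1 \<Longrightarrow> b \<in> Basis \<Longrightarrow> \<bar>pd b (pd b (cutoff R)) (x::'a)\<bar> \<le> C / R"
    using cutoff_derivative_bounds by metis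
  define R where "R k = real (Suc k)" for k
  have R: "R k \<ge> 1" "1 / R k > 0" for k by (auto simp: R_def)
  define Q where "Q k w \<longleftrightarrow> smooth w \<and>
    L2f (\<lambda>x. indicator (cball 0 (R k)) x *\<^sub>R (w x - u x)) \<and> nsq (\<lambda>x. indicator (cball 0 (R k)) x *\<^sub>R (w x - u x)) \<le> 1 / R k \<and>
    L2f (\<lambda>x. indicator (cball 0 (R k)) x *\<^sub>R (H w x - f x)) \<and> nsq (\<lambda>x. indicator (cball 0 (R k)) x *\<^sub>R (H w x - f x)) \<le> 1 / R k" for k w
  have "\<exists>w. Q k w" for k
    using weak_H_local_approx[OF weak R(2), of "R k" k] unfolding Q_def by blast
  then obtain w' where "\<And>k. Q k (w' k)" by metis
  then obtain w where w: "\<And>k. smooth (w k)"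
    "\<And>k. L2f (\<lambda>x. indicator (cball 0 (R k)) x *\<^sub>R (w k x - u x))"
    "\<And>k. nsq (\<lambda>x. indicator (cball 0 (R k)) x *\<^sub>R (w k x - u x)) \<le> 1 / R k"
    "\<And>k. L2f (\<lambda>x. indicator (cball 0 (R k)) x *\<^sub>R (H (w k) x - f x))"
    "\<And>k. nsq (\<lambda>x. indicator (cball 0 (R k)) x *\<^sub>R (H (w k) x - f x)) \<le> 1 / R k"
    unfolding Q_def using that[of w'] by auto
  note E = cutoff_graph_estimate[OF u f w(1) R(1) C(1) C(2)[OF R(1)] C(3)[OF R(1)] w(2-5)]
  let ?g = "\<lambda>k x. of_real (cutoff (R k) x) * (of_real (cutoff (R k) x) * w k x)"
  have inv: "(\<lambda>k. c / R k) \<longlonglongrightarrow> 0" for c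
    using tendsto_mult[OF tendsto_const LIMSEQ_inverse_real_of_nat, of c] by (simp add: R_def divide_inverse)
  have farl: "(\<lambda>k. nsq (\<lambda>x. of_real ((cutoff (R k) x)\<^sup>2 - 1) * h x)) \<longlonglongrightarrow> 0" if "L2f h" for h :: "'a \<Rightarrow> complex"
    unfolding R_def by (rule cutoff_far_tendsto[OF that])
  show ?thesis
  proof (rule that[of ?g])
    show "cc_smooth (?g k)" for k by (rule E(1))
    show "(\<lambda>k. nsq (\<lambda>x. ?g k x - u x)) \<longlonglongrightarrow> 0"
    proof (rule tendsto_sandwich[OF always_eventually always_eventually tendsto_const])
      show "(\<lambda>k. 2 * (1 / R k) + 2 * nsq (\<lambda>x. of_real ((cutoff (R k) x)\<^sup>2 - 1) * u x)) \<longlonglongrightarrow> 0"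
        using tendsto_add[OF tendsto_mult[OF tendsto_const inv] tendsto_mult[OF tendsto_const farl[OF u]], of 2 1 2] by simp
    qed (intro allI nsq_nonneg E(2))+
    show "(\<lambda>k. nsq (\<lambda>x. H (?g k) x - f x)) \<longlonglongrightarrow> 0"
    proof (rule tendsto_sandwich[OF always_eventually always_eventually tendsto_const])
      let ?K1 = "real DIM('a) * (real DIM('a) * (16 * C\<^sup>2 * (2 + 2 * nsq f + (2 + 2 * nsq u) + 4 * (real DIM('a) * (C\<^sup>2 * (2 + 2 * nsq u))))))"
      let ?K2 = "(real DIM('a) * (2 * C\<^sup>2 + 2 * C))\<^sup>2 * (2 + 2 * nsq u)"
      have "(\<lambda>k. 2 * (2 * (1 / R k) + 2 * nsq (\<lambda>x. of_real ((cutoff (R k) x)\<^sup>2 - 1) * f x)) +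
         2 * (2 * (?K1 / R k) + 2 * (?K2 / R k))) \<longlonglongrightarrow> 2 * (2 * 0 + 2 * 0) + 2 * (2 * 0 + 2 * 0)"
        by (intro tendsto_add tendsto_mult tendsto_const inv farl f)
      then show "(\<lambda>k. 2 * (2 * (1 / R k) + 2 * nsq (\<lambda>x. of_real ((cutoff (R k) x)\<^sup>2 - 1) * f x)) +
         2 * (2 * (?K1 / R k) + 2 * (?K2 / R k))) \<longlonglongrightarrow> 0" by simp
    qed (intro allI nsq_nonneg E(3))+
  qed
qed

lemma weak_H_cc_smooth: "cc_smooth u \<Longrightarrow> weak_H u (H u)"
  by (simp add: weak_H_def cc_smooth_L2f cc_smooth_H H_symmetric)

text \<open>The defining relation of the pair (u, f) is passed to the limit along test functions
  approximating v in the graph norm. Symmetry of the adjoint is what remains to be shown for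
  essential self-adjointness.\<close>

lemma weak_H_symmetric:
  assumes "weak_H u f" "weak_H v h"
  shows "l2ip f v = l2ip u h"
proof -
  obtain g where g: "\<And>k. cc_smooth (g k)" "(\<lambda>k. nsq (\<lambda>x. g k x - v x)) \<longlonglongrightarrow> 0"
    "(\<lambda>k. nsq (\<lambda>x. H (g k) x - h x)) \<longlonglongrightarrow> 0" using weak_H_approx[OF assms(2)] by blast
  have L: "L2f u" "L2f f" "L2f v" "L2f h" using assms by (auto simp: weak_H_def)
  have "(\<lambda>k. l2ip f (g k)) \<longlonglongrightarrow> l2ip f v"
    by (rule l2ip_tendsto_right[OF cc_smooth_L2f[OF g(1)] L(3,2) g(2)])
  moreover have "(\<lambda>k. l2ip u (H (g k))) \<longlonglongrightarrow> l2ip u h"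
    by (rule l2ip_tendsto_right[OF cc_smooth_L2f[OF cc_smooth_H[OF g(1)]] L(4,1) g(3)])
  moreover have "l2ip f (g k) = l2ip u (H (g k))" for k using assms(1) g(1) by (simp add: weak_H_def)
  ultimately show ?thesis using LIMSEQ_unique by fastforce
qed

lemma nsq_tendsto_Cauchy:
  fixes f :: "nat \<Rightarrow> 'a \<Rightarrow> complex"
  assumes "\<And>k. L2f (f k)" "L2f u" "(\<lambda>k. nsq (\<lambda>x. f k x - u x)) \<longlonglongrightarrow> 0" "e > 0"
  shows "\<exists>N. \<forall>m\<ge>N. \<forall>n\<ge>N. nsq (\<lambda>x. f m x - f n x) < e"
proof -
  have "eventually (\<lambda>k. nsq (\<lambda>x. f k x - u x) < e / 4) sequentially"
    using assms(3,4) by (intro order_tendstoD) auto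
  then obtain N where N: "\<And>k. k \<ge> N \<Longrightarrow> nsq (\<lambda>x. f k x - u x) < e / 4"
    unfolding eventually_sequentially by blast
  have "nsq (\<lambda>x. f m x - f n x) < e" if "m \<ge> N" "n \<ge> N" for m n
  proof -
    have "nsq (\<lambda>x. f m x - f n x) \<le> 2 * nsq (\<lambda>x. f m x - u x) + 2 * nsq (\<lambda>x. f n x - u x)"
      using nsq_diff_le[OF L2f_diff[OF assms(1,2)] L2f_diff[OF assms(1,2)], of m n] by simp
    then show ?thesis using N[OF that(1)] N[OF that(2)] by linarith
  qed
  then show ?thesis by blast
qed

text \<open>The energy of a difference of test functions is at most Re (H d, d), so convergence in
  the graph norm forces the covariant derivatives to be Cauchy. Their limits later give the value of
  the adjoint of \<open>dbar\<close>.\<close>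

lemma cov_converges:
  assumes g: "\<And>k. cc_smooth (g k)" and u: "L2f u" "(\<lambda>k. nsq (\<lambda>x. g k x - u x)) \<longlonglongrightarrow> 0"
    and f: "L2f f" "(\<lambda>k. nsq (\<lambda>x. H (g k) x - f x)) \<longlonglongrightarrow> 0" and b: "b \<in> Basis"
  obtains v where "L2f v" "(\<lambda>k. nsq (\<lambda>x. cov b (g k) x - v x)) \<longlonglongrightarrow> 0"
proof (rule L2_complete[of "\<lambda>k. cov b (g k)"])
  show "L2f (cov b (g k))" for k by (intro cc_smooth_L2f cc_smooth_cov g b)
  fix e :: real assume e: "e > 0"
  obtain N1 where N1: "\<And>m n. m \<ge> N1 \<Longrightarrow> n \<ge> N1 \<Longrightarrow> nsq (\<lambda>x. g m x - g n x) < e"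
    using nsq_tendsto_Cauchy[OF cc_smooth_L2f[OF g] u e] by blast
  obtain N2 where N2: "\<And>m n. m \<ge> N2 \<Longrightarrow> n \<ge> N2 \<Longrightarrow> nsq (\<lambda>x. H (g m) x - H (g n) x) < e"
    using nsq_tendsto_Cauchy[OF cc_smooth_L2f[OF cc_smooth_H[OF g]] f e] by blast
  have "nsq (\<lambda>x. cov b (g m) x - cov b (g n) x) < e" if "m \<ge> max N1 N2" "n \<ge> max N1 N2" for m n
  proof -
    let ?d = "\<lambda>x. g m x - g n x"
    have d: "cc_smooth ?d" by (intro cc_smooth_diff g)
    have eq: "cov b ?d = (\<lambda>x. cov b (g m) x - cov b (g n) x)" "H ?d = (\<lambda>x. H (g m) x - H (g n) x)"
      using cov_diff[OF cc_smoothD[OF g[of m]] cc_smoothD[OF g[of n]]]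
        H_diff[OF cc_smoothD[OF g[of m]] cc_smoothD[OF g[of n]]] by blast+
    have "nsq (cov b ?d) \<le> (\<Sum>b\<in>Basis. nsq (cov b ?d))"
      by (rule member_le_sum[of b Basis "\<lambda>b. nsq (cov b ?d)"]) (use b nsq_nonneg in auto)
    also have "\<dots> \<le> Re (l2ip (H ?d) ?d)" by (rule H_form_le[OF d])
    also have "\<dots> \<le> (nsq (H ?d) + nsq ?d) / 2"
      using Re_l2ip_le[OF cc_smooth_L2f[OF cc_smooth_H[OF d]] cc_smooth_L2f[OF d]] by simp
    also have "\<dots> < (e + e) / 2"
      using N1[of m n] N2[of m n] that unfolding eq by (intro divide_strict_right_mono add_strict_mono) auto
    finally show ?thesis unfolding eq by simp
  qed
  then show "\<exists>N. \<forall>m\<ge>N. \<forall>n\<ge>N. nsq (\<lambda>x. cov b (g m) x - cov b (g n) x) < e" by blast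
qed

end

section \<open>Plurisubharmonic weights\<close>

lemma sum_Basis_vec:
  "(\<Sum>b\<in>(Basis :: (complex ^ 'n::finite) set). f b) = (\<Sum>j\<in>UNIV. f (axis j 1) + f (axis j \<i>))"
proof -
  have B: "(Basis :: (complex ^ 'n) set) = (\<lambda>(j, u). axis j u) ` (UNIV \<times> {1, \<i>})"
    by (auto simp: Basis_vec_def Basis_complex_def image_iff)
  have inj: "inj_on (\<lambda>(j, u). axis j u :: complex ^ 'n) (UNIV \<times> {1, \<i>})"
    by (auto simp: inj_on_def axis_eq_axis)
  have "(\<Sum>b\<in>(Basis :: (complex ^ 'n) set). f b) = (\<Sum>(j, u)\<in>UNIV \<times> {1, \<i>}. f (axis j u))"
    unfolding B by (subst sum.reindex[OF inj]) (simp add: case_prod_beta o_def)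
  also have "\<dots> = (\<Sum>j\<in>UNIV. \<Sum>u\<in>{1, \<i>}. f (axis j u))"
    by (rule sum.cartesian_product[symmetric])
  finally show ?thesis by (simp add: complex_eq_iff)
qed

lemma axis_Basis [simp]: "axis j 1 \<in> (Basis :: (complex ^ 'n::finite) set)" "axis j \<i> \<in> (Basis :: (complex ^ 'n::finite) set)"
  by (simp_all add: axis_in_Basis_iff Basis_complex_def)

lemma scale_axis: "c *s axis j d = axis j (c * d :: complex)"
  by (simp add: vec_eq_iff axis_def)

lemma d_x_eq_pd: "d_x j = pd (axis j 1)" and d_y_eq_pd: "d_y j = pd (axis j \<i>)"
  by (simp_all add: d_x_def d_y_def pd_def fun_eq_iff)

lemma pd_dir_add: "smooth f \<Longrightarrow> pd (v + w) f = (\<lambda>x. pd v f x + pd w f x)"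
  and pd_dir_scale: "smooth f \<Longrightarrow> pd (c *\<^sub>R v) f = (\<lambda>x. c *\<^sub>R pd v f x)"
proof -
  assume f: "smooth f"
  have l: "linear (\<lambda>b. pd b f x)" for x
    using linear_frechet_derivative[OF smooth_differentiable[OF f]] by (simp add: pd_def)
  show "pd (v + w) f = (\<lambda>x. pd v f x + pd w f x)" using linear_add[OF l] by blast
  show "pd (c *\<^sub>R v) f = (\<lambda>x. c *\<^sub>R pd v f x)" using linear_scale[OF l] by blast
qed

lemma pd_dir_minus: "smooth f \<Longrightarrow> pd (- v) f = (\<lambda>x. - pd v f x)"
  using pd_dir_scale[of f "-1" v] by simp

lemma smooth_pd_dir:
  fixes f :: "'a::euclidean_space \<Rightarrow> 'b::real_normed_vector"
  assumes f: "smooth f" shows "smooth (pd v f)"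
proof -
  have l: "linear (\<lambda>b. pd b f x)" for x
    using linear_frechet_derivative[OF smooth_differentiable[OF f]] by (simp add: pd_def)
  have "pd v f = (\<lambda>x. \<Sum>b\<in>Basis. (v \<bullet> b) *\<^sub>R pd b f x)"
  proof
    fix x
    have "pd v f x = pd (\<Sum>b\<in>Basis. (v \<bullet> b) *\<^sub>R b) f x" by (simp add: euclidean_representation)
    also have "\<dots> = (\<Sum>b\<in>Basis. (v \<bullet> b) *\<^sub>R pd b f x)"
      by (simp only: linear_sum[OF l] linear_scale[OF l])
    finally show "pd v f x = (\<Sum>b\<in>Basis. (v \<bullet> b) *\<^sub>R pd b f x)" .
  qed
  then show ?thesis by (simp add: smooth_sum smooth_scaleR smooth_const smooth_pd f)
qed

section \<open>The complex Hessian and its positivity\<close>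

lemma hessian_entry:
  assumes \<phi>: "smooth \<phi>"
  shows "complex_hessian \<phi> z $ j $ k =
    (of_real (pd (axis j 1) (pd (axis k 1) \<phi>) z + pd (axis j \<i>) (pd (axis k \<i>) \<phi>) z) +
     \<i> * of_real (pd (axis j 1) (pd (axis k \<i>) \<phi>) z - pd (axis j \<i>) (pd (axis k 1) \<phi>) z)) / 4"
proof -
  have 1: "pd b (\<lambda>w. complex_of_real (f w)) = (\<lambda>w. of_real (pd b f w))" if "smooth f" for b and f :: "complex ^ 'a \<Rightarrow> real"
    using pd_of_real[OF smooth_differentiable[OF that]] by blast
  let ?a = "pd (axis k 1) \<phi>" and ?b = "pd (axis k \<i>) \<phi>"
  have s: "smooth ?a" "smooth ?b" by (simp_all add: smooth_pd_dir \<phi>)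
  have zb: "d_zbar k (\<lambda>w. complex_of_real (\<phi> w)) = (\<lambda>w. (1 / 2) * of_real (?a w) + (\<i> / 2) * of_real (?b w))"
    by (simp add: d_zbar_def d_x_eq_pd d_y_eq_pd 1[OF \<phi>] fun_eq_iff field_simps)
  have sd: "(\<lambda>w. complex_of_real (?a w)) differentiable at z" "(\<lambda>w. complex_of_real (?b w)) differentiable at z" for z
    by (intro smooth_differentiable smooth_of_real s)+
  have 2: "pd c (\<lambda>w. (1 / 2) * complex_of_real (?a w) + (\<i> / 2) * of_real (?b w)) z =
      (1 / 2) * of_real (pd c ?a z) + (\<i> / 2) * of_real (pd c ?b z)" for c
    using sd by (subst pd_add) (simp_all add: pd_cmult differentiable_mult 1 s del: times_divide_eq_left)
  have "complex_hessian \<phi> z $ j $ k = d_z j (d_zbar k (\<lambda>w. complex_of_real (\<phi> w))) z"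
    by (simp add: complex_hessian_def)
  also have "\<dots> = ((1 / 2) * of_real (pd (axis j 1) ?a z) + (\<i> / 2) * of_real (pd (axis j 1) ?b z) -
     \<i> * ((1 / 2) * of_real (pd (axis j \<i>) ?a z) + (\<i> / 2) * of_real (pd (axis j \<i>) ?b z))) / 2"
    unfolding zb d_z_def d_x_eq_pd d_y_eq_pd 2 ..
  finally show ?thesis by (simp add: complex_eq_iff field_simps)
qed

lemma tr_hessian_eq:
  assumes "smooth \<phi>"
  shows "tr_hessian \<phi> z = (\<Sum>j\<in>UNIV. (pd (axis j 1) (pd (axis j 1) \<phi>) z + pd (axis j \<i>) (pd (axis j \<i>) \<phi>) z) / 4)"
  unfolding tr_hessian_def trace_def hessian_entry[OF assms] by simp

lemma smooth_tr_hessian: "smooth \<phi> \<Longrightarrow> smooth (tr_hessian \<phi>)"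
proof -
  assume \<phi>: "smooth \<phi>"
  have "tr_hessian \<phi> = (\<lambda>z. \<Sum>j\<in>UNIV. (pd (axis j 1) (pd (axis j 1) \<phi>) z + pd (axis j \<i>) (pd (axis j \<i>) \<phi>) z) / 4)"
    using tr_hessian_eq[OF \<phi>] by blast
  then show ?thesis by (simp only:) (intro smooth_intros smooth_pd_dir \<phi>)
qed

text \<open>If the Levi form at z were negative in direction w, then on a small circle the second
  order Taylor expansion would bound \<phi> from above by a function whose mean is below \<phi> z:
  the first order terms average to 0, the squares of sine and cosine to 1/2, their product to 0.
  This contradicts the sub-mean value inequality.\<close>

lemma levi_nonneg:
  fixes \<phi> :: "(complex, 'n::finite) vec \<Rightarrow> real"
  assumes \<phi>: "smooth \<phi>" and psh: "plurisubharmonic \<phi>"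
  shows "pd w (pd w \<phi>) z + pd (\<i> *s w) (pd (\<i> *s w) \<phi>) z \<ge> 0"
proof (rule ccontr)
  assume neg: "\<not> pd w (pd w \<phi>) z + pd (\<i> *s w) (pd (\<i> *s w) \<phi>) z \<ge> 0"
  define v where "v = \<i> *s w"
  define F11 F12 F21 F22 where "F11 = pd w (pd w \<phi>)" and "F12 = pd w (pd v \<phi>)"
    and "F21 = pd v (pd w \<phi>)" and "F22 = pd v (pd v \<phi>)"
  \<comment> \<open>Freezing the four second derivatives at z costs 4 \<delta>, which contributes 8
    pi \<delta> after integration over the circle; the main term is pi (F11 z + F22 z) = -16 pi
    \<delta>, so a strictly negative amount is left.\<close>
  define \<delta> where "\<delta> = - (F11 z + F22 z) / 16"
  have \<delta>: "\<delta> > 0" using neg by (simp add: \<delta>_def F11_def F22_def v_def)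
  have cont: "isCont F11 z" "isCont F12 z" "isCont F21 z" "isCont F22 z"
    using smooth_continuous[OF smooth_pd_dir[OF smooth_pd_dir[OF \<phi>]], of UNIV]
    by (auto simp: F11_def F12_def F21_def F22_def continuous_on_eq_continuous_at)
  have "eventually (\<lambda>y. dist (F11 y) (F11 z) < \<delta> \<and> dist (F12 y) (F12 z) < \<delta> \<and>
      dist (F21 y) (F21 z) < \<delta> \<and> dist (F22 y) (F22 z) < \<delta>) (nhds z)"
    using cont unfolding isCont_def tendsto_at_iff_tendsto_nhds
    by (intro eventually_conj) (erule tendstoD, rule \<delta>)+
  then obtain d where d: "d > 0" "\<And>y. dist y z < d \<Longrightarrow> \<bar>F11 y - F11 z\<bar> < \<delta> \<and> \<bar>F12 y - F12 z\<bar> < \<delta> \<and>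
      \<bar>F21 y - F21 z\<bar> < \<delta> \<and> \<bar>F22 y - F22 z\<bar> < \<delta>"
    unfolding eventually_nhds_metric dist_real_def by blast
  define r where "r = d / (2 * (norm w + norm v + 1))"
  have nn: "norm w + norm v + 1 > 0" using norm_ge_zero[of w] norm_ge_zero[of v] by linarith
  have r: "r > 0" using d(1) nn by (simp add: r_def)
  \<comment> \<open>The Taylor polynomial along the circle with second derivatives frozen at z,
    raised by the oscillation 4 \<delta>.\<close>
  let ?G = "\<lambda>t. \<phi> z + r * (pd w \<phi> z * cos t + pd v \<phi> z * sin t) +
      r\<^sup>2 / 2 * (F11 z * (cos t)\<^sup>2 + (F12 z + F21 z) * (sin t * cos t) + F22 z * (sin t)\<^sup>2 + 4 * \<delta>)"
  have ub: "\<phi> (z + cis t *s (r *\<^sub>R w)) \<le> ?G t" for t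
  proof -
    define u where "u = cos t *\<^sub>R w + sin t *\<^sub>R v"
    have eq: "cis t *s (r *\<^sub>R w) = r *\<^sub>R u"
      unfolding vec_eq_iff vector_smult_component vector_scaleR_component vector_add_component u_def v_def
      by (simp add: cis.code Complex_eq scaleR_conv_of_real algebra_simps)
    have un: "norm u \<le> norm w + norm v"
      unfolding u_def
      by (rule order_trans[OF norm_triangle_ineq]) (simp add: add_mono mult_left_le_one_le abs_cos_le_one abs_sin_le_one)
    have pdu: "pd u f = (\<lambda>x. cos t * pd w f x + sin t * pd v f x)" if "smooth f" for f :: "(complex, 'n) vec \<Rightarrow> real"
      unfolding u_def pd_dir_add[OF that] pd_dir_scale[OF that] by simp
    have d1: "((\<lambda>s. \<phi> (z + s *\<^sub>R u)) has_real_derivative pd u \<phi> (z + s *\<^sub>R u)) (at s)" for s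
      by (intro has_real_derivative_line smooth_differentiable \<phi>)
    have d2: "((\<lambda>s. pd u \<phi> (z + s *\<^sub>R u)) has_real_derivative pd u (pd u \<phi>) (z + s *\<^sub>R u)) (at s)" for s
      by (intro has_real_derivative_line smooth_differentiable smooth_pd_dir \<phi>)
    let ?D = "\<lambda>(m::nat) s. if m = 0 then \<phi> (z + s *\<^sub>R u) else if m = 1 then pd u \<phi> (z + s *\<^sub>R u) else pd u (pd u \<phi>) (z + s *\<^sub>R u)"
    have "\<exists>s. 0 < s \<and> s < r \<and> \<phi> (z + r *\<^sub>R u) = (\<Sum>m<2. ?D m 0 / fact m * r ^ m) + ?D 2 s / fact 2 * r ^ 2"
      by (rule Maclaurin[OF r, of 2 ?D]) (auto simp: less_2_cases_iff d1 d2)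
    then obtain s where s: "0 < s" "s < r"
      "\<phi> (z + r *\<^sub>R u) = \<phi> z + r * pd u \<phi> z + r\<^sup>2 / 2 * pd u (pd u \<phi>) (z + s *\<^sub>R u)"
      by (auto simp: numeral_2_eq_2 mult.commute)
    define y where "y = z + s *\<^sub>R u"
    have "dist y z \<le> r * (norm w + norm v + 1)"
      using s un by (simp add: y_def dist_norm) (intro mult_mono, auto)
    also have "\<dots> = d / 2" using nn by (simp add: r_def field_simps)
    also have "\<dots> < d" using d by simp
    finally have y: "dist y z < d" .
    have smw: "smooth (pd w \<phi>)" "smooth (pd v \<phi>)" by (intro smooth_pd_dir \<phi>)+
    have dw: "pd w \<phi> differentiable at y" "pd v \<phi> differentiable at y"
      using smw by (auto intro: smooth_differentiable)
    have split: "pd a (\<lambda>x. cos t * pd w \<phi> x + sin t * pd v \<phi> x) y = cos t * pd a (pd w \<phi>) y + sin t * pd a (pd v \<phi>) y" for a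
      using dw by (subst pd_add) (simp_all add: pd_cmult differentiable_mult)
    have pp: "pd u (pd u \<phi>) y = (cos t)\<^sup>2 * F11 y + (sin t * cos t) * F12 y + (sin t * cos t) * F21 y + (sin t)\<^sup>2 * F22 y"
      unfolding pdu[OF smooth_pd_dir[OF \<phi>]] unfolding pdu[OF \<phi>] split
      by (simp add: F11_def F12_def F21_def F22_def power2_eq_square algebra_simps)
    have bnd: "c * (F y) \<le> c * (F z) + \<delta>" if "\<bar>c\<bar> \<le> 1" "\<bar>F y - F z\<bar> < \<delta>" for c and F :: "(complex, 'n) vec \<Rightarrow> real"
    proof -
      have "c * (F y - F z) \<le> \<bar>c\<bar> * \<bar>F y - F z\<bar>" by (metis abs_ge_self abs_mult)
      also have "\<dots> \<le> 1 * \<delta>" using that by (intro mult_mono) auto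
      finally show ?thesis by (simp add: algebra_simps)
    qed
    have c1: "\<bar>(cos t)\<^sup>2\<bar> \<le> 1" "\<bar>sin t * cos t\<bar> \<le> 1" "\<bar>(sin t)\<^sup>2\<bar> \<le> 1"
      by (simp_all add: abs_square_le_1 abs_cos_le_one abs_sin_le_one abs_mult mult_le_one)
    have "pd u (pd u \<phi>) y \<le> ((cos t)\<^sup>2 * F11 z + \<delta>) + (sin t * cos t * F12 z + \<delta>) + (sin t * cos t * F21 z + \<delta>) + ((sin t)\<^sup>2 * F22 z + \<delta>)"
      unfolding pp using d(2)[OF y] c1 by (intro add_mono bnd) auto
    then have "r\<^sup>2 / 2 * pd u (pd u \<phi>) y \<le> r\<^sup>2 / 2 * (F11 z * (cos t)\<^sup>2 + (F12 z + F21 z) * (sin t * cos t) + F22 z * (sin t)\<^sup>2 + 4 * \<delta>)"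
      by (intro mult_left_mono) (auto simp: algebra_simps)
    then show ?thesis
      using s(3) unfolding eq y_def[symmetric] pdu[OF \<phi>] by (simp add: mult.commute)
  qed
  \<comment> \<open>An explicit antiderivative of ?G, so that its integral over a full period can be
    read off.\<close>
  let ?P = "\<lambda>t. \<phi> z * t + r * (pd w \<phi> z * sin t - pd v \<phi> z * cos t) +
      r\<^sup>2 / 2 * (F11 z * (t / 2 + sin t * cos t / 2) + (F12 z + F21 z) * ((sin t)\<^sup>2 / 2) + F22 z * (t / 2 - sin t * cos t / 2) + 4 * \<delta> * t)"
  have half: "x * (sin t)\<^sup>2 = x - x * (cos t)\<^sup>2" for x t :: real
    by (simp add: sin_squared_eq algebra_simps)
  have deriv: "(?P has_vector_derivative ?G t) (at t within {0..2 * pi})" for t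
    unfolding has_real_derivative_iff_has_vector_derivative[symmetric]
    by (auto intro!: derivative_eq_intros simp: power2_eq_square[symmetric] half) (simp add: half field_simps)
  have contG: "continuous_on {0..2 * pi} ?G" by (intro continuous_intros)
  have I: "(\<integral>t. indicator {0..2 * pi} t *\<^sub>R ?G t \<partial>lborel) = ?P (2 * pi) - ?P 0"
    by (rule integral_FTC_Icc[OF _ deriv contG]) auto
  have "2 * pi * \<phi> z \<le> (LINT t:{0..2 * pi}|lborel. \<phi> (z + cis t *s (r *\<^sub>R w)))"
    and int: "set_integrable lborel {0..2 * pi} (\<lambda>t. \<phi> (z + cis t *s (r *\<^sub>R w)))"
    using psh by (auto simp: plurisubharmonic_def field_simps)
  note this(1)
  also have "(LINT t:{0..2 * pi}|lborel. \<phi> (z + cis t *s (r *\<^sub>R w))) \<le> (LINT t:{0..2 * pi}|lborel. ?G t)"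
    by (rule set_integral_mono[OF int _ ub])
       (unfold set_integrable_def, rule borel_integrable_compact[OF _ contG], simp)
  also have "\<dots> = ?P (2 * pi) - ?P 0" using I by (simp add: set_lebesgue_integral_def)
  also have "\<dots> = 2 * pi * \<phi> z + r\<^sup>2 / 2 * (pi * (F11 z + F22 z) + 8 * pi * \<delta>)"
    by (simp add: algebra_simps)
  finally have "0 \<le> r\<^sup>2 / 2 * (pi * (F11 z + F22 z) + 8 * pi * \<delta>)" by simp
  also have "pi * (F11 z + F22 z) + 8 * pi * \<delta> = - 8 * pi * \<delta>" by (simp add: \<delta>_def field_simps)
  finally have "pi * (\<delta> * r\<^sup>2) \<le> 0" by simp
  moreover have "pi * (\<delta> * r\<^sup>2) > 0" using r \<delta> by simp
  ultimately show False by linarith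
qed

locale psh_weight =
  fixes \<phi> :: "(complex, 'n::finite) vec \<Rightarrow> real"
  assumes \<phi>: "smooth \<phi>" and psh: "plurisubharmonic \<phi>"
begin

abbreviation X :: "'n \<Rightarrow> (complex, 'n) vec" where "X j \<equiv> axis j 1"
abbreviation Y :: "'n \<Rightarrow> (complex, 'n) vec" where "Y j \<equiv> axis j \<i>"

text \<open>Four times the j-th diagonal entry of the complex Hessian, that is, the Laplacian of
  \<phi> in the j-th complex line.\<close>

definition diag :: "'n \<Rightarrow> (complex, 'n) vec \<Rightarrow> real" where
  "diag j z = pd (X j) (pd (X j) \<phi>) z + pd (Y j) (pd (Y j) \<phi>) z"

lemma diag_nonneg: "diag j z \<ge> 0"
  using levi_nonneg[OF \<phi> psh, of "X j" z] by (simp add: diag_def scale_axis)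

lemma tr_diag: "4 * tr_hessian \<phi> z = (\<Sum>j\<in>UNIV. diag j z)"
  unfolding tr_hessian_eq[OF \<phi>] diag_def by (simp add: sum_divide_distrib[symmetric])

lemma diag_le: "diag j z \<le> 4 * tr_hessian \<phi> z"
  unfolding tr_diag by (rule member_le_sum) (auto simp: diag_nonneg)

lemma tr_hessian_nonneg: "tr_hessian \<phi> z \<ge> 0"
  using sum_nonneg[of UNIV "\<lambda>j. diag j z"] diag_nonneg tr_diag[of z] by auto

text \<open>The entries of a positive semidefinite Hermitian matrix are dominated by its diagonal.
  The Levi form in the directions \<open>X j\<close> plus or minus \<open>X k\<close> bounds the
  real part of an entry, the directions \<open>X j\<close> plus or minus \<open>Y k\<close> bound
  the imaginary part.\<close>

lemma hessian_offdiag: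
  "\<bar>pd (X j) (pd (X k) \<phi>) z + pd (Y j) (pd (Y k) \<phi>) z\<bar> \<le> 4 * tr_hessian \<phi> z"
  "\<bar>pd (X j) (pd (Y k) \<phi>) z - pd (Y j) (pd (X k) \<phi>) z\<bar> \<le> 4 * tr_hessian \<phi> z"
proof -
  have comm: "pd a (pd b \<phi>) z = pd b (pd a \<phi>) z" if "a \<in> Basis" "b \<in> Basis" for a b
    by (rule pd_pd_commute_real[OF \<phi> that])
  have two: "pd (v + c *\<^sub>R w) (pd (v + c *\<^sub>R w) \<phi>) z =
      pd v (pd v \<phi>) z + c * (pd v (pd w \<phi>) z + pd w (pd v \<phi>) z) + c\<^sup>2 * pd w (pd w \<phi>) z" for v w c
  proof -
    have s: "smooth (pd v \<phi>)" "smooth (pd w \<phi>)" by (intro smooth_pd_dir \<phi>)+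
    have d: "pd v \<phi> differentiable at z" "pd w \<phi> differentiable at z"
      using s by (auto intro: smooth_differentiable)
    have "pd a (\<lambda>x. pd v \<phi> x + c * pd w \<phi> x) z = pd a (pd v \<phi>) z + c * pd a (pd w \<phi>) z" for a
      using d by (subst pd_add) (simp_all add: pd_cmult differentiable_mult)
    then show ?thesis
      unfolding pd_dir_add[OF smooth_pd_dir[OF \<phi>]] pd_dir_scale[OF smooth_pd_dir[OF \<phi>]]
      unfolding pd_dir_add[OF \<phi>] pd_dir_scale[OF \<phi>] real_scaleR_def
      by (simp add: power2_eq_square algebra_simps)
  qed
  have i: "\<i> *s (v + c *\<^sub>R w) = \<i> *s v + c *\<^sub>R (\<i> *s w)" for v w :: "(complex, 'n) vec" and c
    by (simp add: vec_eq_iff algebra_simps)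
  have neg: "axis j (- d) = (-1) *\<^sub>R (axis j d :: (complex, 'n) vec)" for j d by (simp add: vec_eq_iff axis_def)
  have L: "diag j z + c * (2 * (pd (X j) (pd (X k) \<phi>) z + pd (Y j) (pd (Y k) \<phi>) z)) + c\<^sup>2 * diag k z \<ge> 0" for c
    using levi_nonneg[OF \<phi> psh, of "X j + c *\<^sub>R X k" z] comm[of "X k" "X j"] comm[of "Y k" "Y j"]
    unfolding i two by (simp add: diag_def scale_axis algebra_simps)
  have nY: "pd (axis k (- 1)) (pd a \<phi>) z = - pd (X k) (pd a \<phi>) z" "pd a (pd (axis k (- 1)) \<phi>) z = - pd a (pd (X k) \<phi>) z"
    for a :: "(complex, 'n) vec"
  proof -
    have 1: "axis k (- 1) = - (X k)" by (simp add: vec_eq_iff axis_def)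
    show "pd (axis k (- 1)) (pd a \<phi>) z = - pd (X k) (pd a \<phi>) z"
      unfolding 1 pd_dir_minus[OF smooth_pd_dir[OF \<phi>]] ..
    show "pd a (pd (axis k (- 1)) \<phi>) z = - pd a (pd (X k) \<phi>) z"
      unfolding 1 pd_dir_minus[OF \<phi>] by (rule pd_minus[OF smooth_differentiable[OF smooth_pd_dir[OF \<phi>]]])
  qed
  have M: "diag j z + c * (2 * (pd (X j) (pd (Y k) \<phi>) z - pd (Y j) (pd (X k) \<phi>) z)) + c\<^sup>2 * diag k z \<ge> 0" for c
    using levi_nonneg[OF \<phi> psh, of "X j + c *\<^sub>R Y k" z] comm[of "Y k" "X j"] comm[of "X k" "Y j"]
    unfolding i two by (simp add: diag_def scale_axis nY algebra_simps)
  show "\<bar>pd (X j) (pd (X k) \<phi>) z + pd (Y j) (pd (Y k) \<phi>) z\<bar> \<le> 4 * tr_hessian \<phi> z"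
    using L[of 1] L[of "-1"] diag_le[of j z] diag_le[of k z] by (auto simp: abs_le_iff)
  show "\<bar>pd (X j) (pd (Y k) \<phi>) z - pd (Y j) (pd (X k) \<phi>) z\<bar> \<le> 4 * tr_hessian \<phi> z"
    using M[of 1] M[of "-1"] diag_le[of j z] diag_le[of k z] by (auto simp: abs_le_iff)
qed

text \<open>One formula for all components of the vector potential: multiplication by -i sends
  \<open>X j\<close> to - \<open>Y j\<close> and \<open>Y j\<close> to \<open>X j\<close>, which
  gives minus half the y-derivative and half the x-derivative of \<phi>.\<close>

definition A :: "(complex, 'n) vec \<Rightarrow> (complex, 'n) vec \<Rightarrow> real" where
  "A b z = pd ((- \<i>) *s b) \<phi> z * (1 / 2)"

definition V :: "(complex, 'n) vec \<Rightarrow> real" where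
  "V z = 2 * tr_hessian \<phi> z"

sublocale magnetic A V
proof
  show "smooth (A b)" for b unfolding A_def[abs_def] by (intro smooth_intros smooth_pd_dir \<phi>)
  show "smooth V" unfolding V_def[abs_def] by (intro smooth_intros smooth_tr_hessian \<phi>)
  show "V x \<ge> 0" for x by (simp add: V_def tr_hessian_nonneg)
qed

lemma A_X: "A (X j) = (\<lambda>z. - pd (Y j) \<phi> z * (1 / 2))" and A_Y: "A (Y j) = (\<lambda>z. pd (X j) \<phi> z * (1 / 2))"
proof -
  have e: "(- \<i>) *s X j = - Y j" "(- \<i>) *s Y j = X j" by (simp_all add: vec_eq_iff axis_def)
  show "A (X j) = (\<lambda>z. - pd (Y j) \<phi> z * (1 / 2))" "A (Y j) = (\<lambda>z. pd (X j) \<phi> z * (1 / 2))"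
    by (simp_all only: A_def[abs_def] e pd_dir_minus[OF \<phi>])
qed

section \<open>Commutators and the appearance of the electric potential\<close>

lemma cov_cov:
  assumes u: "smooth u" and ab: "a \<in> Basis" "b \<in> Basis"
  shows "cov a (cov b u) x = pd a (pd b u) x - \<i> * of_real (pd a (A b) x) * u x - \<i> * of_real (A b x) * pd a u x -
    \<i> * of_real (A a x) * pd b u x - of_real (A a x) * of_real (A b x) * u x"
proof -
  have dA: "(\<lambda>x. complex_of_real (A b x)) differentiable at x"
    by (intro smooth_differentiable smooth_of_real A ab)
  have pA: "pd a (\<lambda>x. complex_of_real (A b x)) x = of_real (pd a (A b) x)"
    by (rule pd_of_real[OF smooth_differentiable[OF A[OF ab(2)]]])
  have du: "u differentiable at x" "pd b u differentiable at x"
    by (intro smooth_differentiable u smooth_pd ab)+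
  have "cov b u = (\<lambda>x. pd b u x - \<i> * (of_real (A b x) * u x))" by (simp add: cov_def fun_eq_iff mult.assoc)
  then have "pd a (cov b u) x = pd a (pd b u) x - \<i> * (of_real (A b x) * pd a u x + of_real (pd a (A b) x) * u x)"
    using dA du pA by (simp add: pd_diff pd_cmult pd_mult differentiable_mult)
  then show ?thesis
    by (simp add: cov_def[of a "cov b u"]) (simp add: cov_def algebra_simps)
qed

text \<open>Second derivatives of u cancel by symmetry and the terms quadratic in A cancel as well;
  what remains is the magnetic field in the j-th complex line, which is half the Laplacian of \<phi>
  there.\<close>

lemma cov_commutator:
  assumes u: "smooth u"
  shows "cov (X j) (cov (Y j) u) x - cov (Y j) (cov (X j) u) x = - \<i> * of_real (diag j x / 2) * u x"
proof -
  have dd: "pd b (\<lambda>z. f z * (1 / 2)) x = pd b f x * (1 / 2)" if "smooth f" for b and f :: "(complex, 'n) vec \<Rightarrow> real"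
    using pd_mult[OF smooth_differentiable[OF that] differentiable_const[of "1 / 2 :: real"], where b = b and x = x]
    by (simp only: pd_const mult_zero_right add_0_left)
  have m: "pd b (\<lambda>z. - pd (Y j) \<phi> z * (1 / 2)) x = - pd b (pd (Y j) \<phi>) x * (1 / 2)" for b
    using dd[OF smooth_minus[OF smooth_pd_dir[OF \<phi>]], of b "Y j"]
      pd_minus[OF smooth_differentiable[OF smooth_pd_dir[OF \<phi>]], of b "Y j"] by simp
  show ?thesis
    unfolding cov_cov[OF u axis_Basis] cov_cov[OF u axis_Basis(2,1)]
    unfolding A_X A_Y m dd[OF smooth_pd_dir[OF \<phi>]] pd_pd_commute[OF u axis_Basis]
    by (simp add: diag_def field_simps)
qed

text \<open>In complex notation this is d/dz_j - (1/2) d\<phi>/dz_j. Up to sign it is the weighted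
  formal adjoint of d/dzbar_j, transported to unweighted functions by exp (- \<phi>/2).\<close>

definition dbarT :: "'n \<Rightarrow> ((complex, 'n) vec \<Rightarrow> complex) \<Rightarrow> (complex, 'n) vec \<Rightarrow> complex" where
  "dbarT j g z = (cov (X j) g z - \<i> * cov (Y j) g z) / 2"

lemma cc_smooth_dbarT: "cc_smooth g \<Longrightarrow> cc_smooth (dbarT j g)"
  unfolding dbarT_def[abs_def] divide_inverse
  by (intro cc_smooth_mult_left cc_smooth_diff cc_smooth_mult smooth_const cc_smooth_cov axis_Basis)

text \<open>Expanding the product, the cross terms combine after integration by parts to \<i> times
  the commutator of \<open>cov (X j)\<close> and \<open>cov (Y j)\<close>, that is, to
  multiplication by half of \<open>diag j\<close>. Summed over j this is V, with a positive sign;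
  exchanging the roles of \<open>dbarT\<close> and its formal adjoint would produce -V.\<close>

lemma dbarT_form:
  assumes g: "cc_smooth g" and h: "cc_smooth h"
  shows "(\<Sum>j\<in>UNIV. l2ip (dbarT j g) (dbarT j h)) = l2ip (H g) h / 4"
proof -
  have gs: "smooth g" using g by (rule cc_smoothD)
  have c: "L2f (cov b f)" if "b \<in> Basis" "cc_smooth f" for b f
    using that by (intro cc_smooth_L2f cc_smooth_cov)
  have one: "4 * l2ip (dbarT j g) (dbarT j h) = l2ip (cov (X j) g) (cov (X j) h) + l2ip (cov (Y j) g) (cov (Y j) h) +
      l2ip (\<lambda>x. of_real (diag j x / 2) * g x) h" for j
  proof -
    have i: "integrable lborel (\<lambda>x. cov a g x * cnj (cov b h x))" if "a \<in> Basis" "b \<in> Basis" for a b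
      using that by (intro L2f_ip_integrable c g h)
    have "4 * l2ip (dbarT j g) (dbarT j h) = (\<integral>x. 4 * (dbarT j g x * cnj (dbarT j h x)) \<partial>lborel)"
      by (simp add: l2ip_def)
    also have "\<dots> = (\<integral>x. cov (X j) g x * cnj (cov (X j) h x) + cov (Y j) g x * cnj (cov (Y j) h x) +
        \<i> * (cov (X j) g x * cnj (cov (Y j) h x)) - \<i> * (cov (Y j) g x * cnj (cov (X j) h x)) \<partial>lborel)"
      by (rule Bochner_Integration.integral_cong) (simp_all add: dbarT_def field_simps)
    also have "\<dots> = l2ip (cov (X j) g) (cov (X j) h) + l2ip (cov (Y j) g) (cov (Y j) h) +
        \<i> * l2ip (cov (X j) g) (cov (Y j) h) - \<i> * l2ip (cov (Y j) g) (cov (X j) h)"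
      using i by (simp add: l2ip_def)
    finally have e: "4 * l2ip (dbarT j g) (dbarT j h) = l2ip (cov (X j) g) (cov (X j) h) + l2ip (cov (Y j) g) (cov (Y j) h) +
        \<i> * l2ip (cov (X j) g) (cov (Y j) h) - \<i> * l2ip (cov (Y j) g) (cov (X j) h)" .
    have "\<i> * l2ip (cov (X j) g) (cov (Y j) h) - \<i> * l2ip (cov (Y j) g) (cov (X j) h) =
        \<i> * (l2ip (cov (X j) (cov (Y j) g)) h - l2ip (cov (Y j) (cov (X j) g)) h)"
      by (simp add: cov_by_parts smooth_cov gs h algebra_simps)
    also have "\<dots> = \<i> * l2ip (\<lambda>x. cov (X j) (cov (Y j) g) x - cov (Y j) (cov (X j) g) x) h"
      by (subst l2ip_diff_left) (simp_all add: c cc_smooth_cov cc_smooth_L2f g h)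
    also have "\<dots> = l2ip (\<lambda>x. of_real (diag j x / 2) * g x) h"
      unfolding cov_commutator[OF gs] l2ip_def Bochner_Integration.integral_mult_right_zero[symmetric]
      by (rule Bochner_Integration.integral_cong) (simp_all add: algebra_simps)
    finally show ?thesis using e by (simp add: algebra_simps)
  qed
  have ii: "integrable lborel (\<lambda>x. of_real (diag j x / 2) * g x * cnj (h x))" for j
  proof -
    have "smooth (\<lambda>x. complex_of_real (diag j x / 2))" unfolding diag_def by (intro smooth_intros smooth_pd_dir \<phi>)
    then show ?thesis by (intro integrable_smooth_cc h smooth_mult gs)
  qed
  have "(\<Sum>j\<in>UNIV. l2ip (\<lambda>x. of_real (diag j x / 2) * g x) h) = (\<integral>x. (\<Sum>j\<in>UNIV. of_real (diag j x / 2) * g x * cnj (h x)) \<partial>lborel)"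
    unfolding l2ip_def using ii by simp
  also have "\<dots> = l2ip (\<lambda>x. of_real (V x) * g x) h"
    unfolding l2ip_def
  proof (rule Bochner_Integration.integral_cong[OF refl])
    fix x
    have "(\<Sum>j\<in>UNIV. of_real (diag j x / 2) * g x * cnj (h x)) = of_real ((\<Sum>j\<in>UNIV. diag j x) / 2) * g x * cnj (h x)"
      by (simp add: sum_distrib_right sum_divide_distrib)
    then show "(\<Sum>j\<in>UNIV. of_real (diag j x / 2) * g x * cnj (h x)) = of_real (V x) * g x * cnj (h x)"
      unfolding tr_diag[symmetric] by (simp add: V_def)
  qed
  finally have Vs: "(\<Sum>j\<in>UNIV. l2ip (\<lambda>x. of_real (diag j x / 2) * g x) h) = l2ip (\<lambda>x. of_real (V x) * g x) h" .
  have "4 * (\<Sum>j\<in>UNIV. l2ip (dbarT j g) (dbarT j h)) = l2ip (H g) h"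
    unfolding H_form[OF gs h] sum_Basis_vec Vs[symmetric] by (simp add: sum_distrib_left one sum.distrib)
  then show ?thesis by (metis nonzero_mult_div_cancel_left zero_neq_numeral)
qed

section \<open>Identification of the Schroedinger operator\<close>

lemma vecs_L2: "u \<in> vecs L2_functions \<longleftrightarrow> L2f u"
  by (simp add: L2_functions_def L2f_def)

lemma ip_L2: "ip L2_functions u v = l2ip u v"
  by (simp add: L2_functions_def l2ip_def)

lemma core_eq: "schroedinger_core \<phi> (\<lambda>z. 2 * tr_hessian \<phi> z) = {(u, H u) | u. cc_smooth u}"
proof -
  have cx: "cov_x \<phi> j u = (\<lambda>z. (- 1) * cov (X j) u z)" and cy: "cov_y \<phi> j u = (\<lambda>z. (- 1) * cov (Y j) u z)" for j u
    by (auto simp: cov_x_def cov_y_def cov_def A_X A_Y d_x_eq_pd d_y_eq_pd fun_eq_iff)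
  have "(\<lambda>z. - magnetic_laplacian \<phi> u z + complex_of_real (2 * tr_hessian \<phi> z) * u z) = H u" if "cc_smooth u" for u
  proof -
    have s: "smooth (cov b u)" if "b \<in> Basis" for b by (intro smooth_cov cc_smoothD \<open>cc_smooth u\<close> that)
    show ?thesis
      unfolding magnetic_laplacian_def H_def cx cy sum_Basis_vec
      unfolding cov_cmult[OF s[OF axis_Basis(1)]] cov_cmult[OF s[OF axis_Basis(2)]]
      by (simp add: V_def fun_eq_iff)
  qed
  then show ?thesis by (auto simp: schroedinger_core_def test_functions_iff)
qed

lemma adjoint_core: "adjoint_op L2_functions L2_functions {(u, H u) | u. cc_smooth u} = {(u, f). weak_H u f}"
proof -
  have "(\<forall>g. cc_smooth g \<longrightarrow> l2ip (H g) v = l2ip g w) \<longleftrightarrow> (\<forall>g. cc_smooth g \<longrightarrow> l2ip w g = l2ip v (H g))" for v w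
    unfolding l2ip_cnj[of w] l2ip_cnj[of v] by auto
  then show ?thesis by (auto simp: adjoint_op_def weak_H_def vecs_L2 ip_L2)
qed

lemma adjoint_antimono: "S \<subseteq> T \<Longrightarrow> adjoint_op H1 H2 T \<subseteq> adjoint_op H1 H2 S"
  by (auto simp: adjoint_op_def)

text \<open>The definite description requires existence and uniqueness. The adjoint of the core is
  symmetric and contains the core, hence is self-adjoint. Since adjoints reverse inclusions, a
  self-adjoint S above the core lies below the adjoint of the core, and taking adjoints once more
  gives the opposite inclusion.\<close>

theorem magnetic_schroedinger_eq: "magnetic_schroedinger \<phi> (\<lambda>z. 2 * tr_hessian \<phi> z) = {(u, f). weak_H u f}"
proof -
  let ?S = "{(u, f). weak_H u f}" and ?C = "{(u, H u) | u. cc_smooth u}"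
  have C: "?C \<subseteq> ?S" using weak_H_cc_smooth by auto
  have sub: "?S \<subseteq> adjoint_op L2_functions L2_functions ?S"
  proof
    fix p assume "p \<in> ?S"
    then obtain v w where p: "p = (v, w)" "weak_H v w" by auto
    then have "L2f v" "L2f w" by (simp_all add: weak_H_def)
    moreover have "l2ip f v = l2ip u w" if "weak_H u f" for u f by (rule weak_H_symmetric[OF that p(2)])
    ultimately show "p \<in> adjoint_op L2_functions L2_functions ?S"
      unfolding p adjoint_op_def vecs_L2 ip_L2 by blast
  qed
  have sa: "adjoint_op L2_functions L2_functions ?S = ?S"
    using adjoint_antimono[OF C, of L2_functions L2_functions] sub by (simp add: adjoint_core)
  show ?thesis
    unfolding magnetic_schroedinger_def core_eq
  proof (rule the_equality)
    show "self_adjoint L2_functions ?S \<and> ?C \<subseteq> ?S" using sa C by (simp add: self_adjoint_def)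
    fix S assume S: "self_adjoint L2_functions S \<and> ?C \<subseteq> S"
    then have "S \<subseteq> ?S"
      using adjoint_antimono[of ?C S L2_functions L2_functions] by (simp add: adjoint_core self_adjoint_def)
    moreover from this have "?S \<subseteq> S"
      using adjoint_antimono[of S ?S L2_functions L2_functions] S sa by (simp add: self_adjoint_def)
    ultimately show "S = ?S" by blast
  qed
qed

end

section \<open>Weighted forms\<close>

lemma l2ip_sum_right:
  assumes "L2f u" "\<And>i. i \<in> I \<Longrightarrow> L2f (v i)"
  shows "l2ip u (\<lambda>x. \<Sum>i\<in>I. c i * v i x) = (\<Sum>i\<in>I. cnj (c i) * l2ip u (v i))"
proof -
  have "integrable lborel (\<lambda>x. cnj (c i) * (u x * cnj (v i x)))" if "i \<in> I" for i
    using L2f_ip_integrable[OF assms(1) assms(2)[OF that]] by simp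
  then have "(\<integral>x. (\<Sum>i\<in>I. cnj (c i) * (u x * cnj (v i x))) \<partial>lborel) = (\<Sum>i\<in>I. cnj (c i) * l2ip u (v i))"
    by (simp add: l2ip_def)
  then show ?thesis by (simp add: l2ip_def sum_distrib_left mult_ac)
qed

lemma l2ip_cmult_left: "l2ip (\<lambda>x. c * u x) v = c * l2ip u v"
  by (simp add: l2ip_def mult.assoc)

lemma l2ip_cmult_right: "l2ip u (\<lambda>x. c * v x) = cnj c * l2ip u v"
  by (simp add: l2ip_def mult.left_commute)

lemma l2ip_add_left: "L2f u \<Longrightarrow> L2f v \<Longrightarrow> L2f w \<Longrightarrow> l2ip (\<lambda>x. u x + v x) w = l2ip u w + l2ip v w"
  unfolding l2ip_def by (simp add: distrib_right L2f_ip_integrable)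

lemma l2ip_zero [simp]: "l2ip (\<lambda>x. 0) v = 0" "l2ip u (\<lambda>x. 0) = 0"
  by (simp_all add: l2ip_def)

lemma cnj_wedge_coeff [simp]: "cnj (wedge_coeff j J K) = wedge_coeff j J K"
  by (simp add: wedge_coeff_def)

lemma borel_measurable_vec_lambda_complex:
  fixes f :: "'i::finite \<Rightarrow> 'a \<Rightarrow> complex"
  assumes "\<And>i. f i \<in> borel_measurable M"
  shows "(\<lambda>z. \<chi> i. f i z) \<in> borel_measurable M"
proof -
  have eq: "(\<lambda>z. \<chi> i. f i z) = (\<lambda>z. \<Sum>i\<in>UNIV. axis i (f i z))"
    by (simp add: fun_eq_iff vec_eq_iff axis_def)
  have "linear (axis i :: complex \<Rightarrow> complex ^ 'i)" for i
    by (rule linearI) (simp_all add: vec_eq_iff axis_def)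
  then have "continuous_on UNIV (axis i :: complex \<Rightarrow> complex ^ 'i)" for i
    by (simp add: linear_continuous_on linear_conv_bounded_linear)
  then show ?thesis unfolding eq
    by (intro borel_measurable_sum borel_measurable_continuous_on[OF _ assms])
qed

section \<open>Passage to unweighted coefficients\<close>

locale psh_form = psh_weight \<phi> for \<phi> :: "(complex, 'n::{finite,linorder}) vec \<Rightarrow> real"
begin

abbreviation E :: "real \<Rightarrow> (complex, 'n) vec \<Rightarrow> complex" where
  "E s z \<equiv> complex_of_real (exp (s * \<phi> z))"

lemma smooth_E: "smooth (E s)"
  by (intro smooth_intros \<phi>)

lemma E_E: "E s z * E t z = E (s + t) z"
  by (simp add: exp_add[symmetric] distrib_right flip: of_real_mult)

lemma exp_half_cancel [simp]:
  "complex_of_real (exp (\<phi> z / 2)) * complex_of_real (exp (- (\<phi> z / 2))) = 1"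
  "complex_of_real (exp (- (\<phi> z / 2))) * complex_of_real (exp (\<phi> z / 2)) = 1"
  by (simp_all add: exp_add[symmetric] flip: of_real_mult)

text \<open>Multiplication by exp (- \<phi>/2) is unitary from the weighted to the unweighted space.
  All computations with forms are made with these coefficients, and \<open>mkform\<close> goes
  back.\<close>

definition cf :: "'n form \<Rightarrow> 'n set \<Rightarrow> (complex, 'n) vec \<Rightarrow> complex" where
  "cf u J z = u z $ J * E (- 1 / 2) z"

definition mkform :: "nat \<Rightarrow> ('n set \<Rightarrow> (complex, 'n) vec \<Rightarrow> complex) \<Rightarrow> 'n form" where
  "mkform q a z = (\<chi> J. if card J = q then a J z * E (1 / 2) z else 0)"

lemma cf_mkform: "cf (mkform q a) J = (if card J = q then a J else (\<lambda>z. 0))"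
  by (simp add: cf_def mkform_def fun_eq_iff mult.assoc)

lemma cf_measurable: "u \<in> borel_measurable borel \<Longrightarrow> cf u J \<in> borel_measurable borel"
  unfolding cf_def[abs_def]
  by (rule borel_measurable_times[OF borel_measurable_continuous_on[of "\<lambda>v. v $ J"] smooth_measurable[OF smooth_E]])
     (auto intro!: continuous_intros)

lemma cmod_cf: "(cmod (cf u J z))\<^sup>2 = (cmod (u z $ J))\<^sup>2 * exp (- \<phi> z)"
proof -
  have "(exp (- 1 / 2 * \<phi> z))\<^sup>2 = exp (- \<phi> z)" by (simp add: power2_eq_square exp_add[symmetric])
  then show ?thesis by (simp add: cf_def norm_mult power_mult_distrib)
qed

lemma vecs_forms: "u \<in> vecs (L2_forms \<phi> q) \<longleftrightarrow>
    u \<in> borel_measurable borel \<and> (\<forall>z J. card J \<noteq> q \<longrightarrow> u z $ J = 0) \<and> (\<forall>J. L2f (cf u J))"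
  using cf_measurable by (auto simp: L2_forms_def L2f_def cmod_cf)

lemma ip_forms: "ip (L2_forms \<phi> q) u v = (\<Sum>J | card J = q. l2ip (cf u J) (cf v J))"
proof -
  have "u z $ J * cnj (v z $ J) * complex_of_real (exp (- \<phi> z)) = cf u J z * cnj (cf v J z)" for z J
  proof -
    have "complex_of_real (exp (- \<phi> z)) = E (- 1 / 2) z * E (- 1 / 2) z" unfolding E_E by simp
    then show ?thesis unfolding cf_def by (simp only: complex_cnj_mult complex_cnj_complex_of_real) (simp add: mult_ac)
  qed
  then show ?thesis by (simp add: L2_forms_def l2ip_def)
qed

lemma cf_L2f: "u \<in> vecs (L2_forms \<phi> q) \<Longrightarrow> L2f (cf u J)"
  by (simp add: vecs_forms)

lemma mkform_vecs:
  assumes "\<And>J. card J = q \<Longrightarrow> L2f (a J)"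
  shows "mkform q a \<in> vecs (L2_forms \<phi> q)"
  unfolding vecs_forms
proof (intro conjI allI impI)
  have "(\<lambda>z. if card J = q then a J z * E (1 / 2) z else 0) \<in> borel_measurable borel" for J
    using borel_measurable_times[OF L2f_measurable[OF assms] smooth_measurable[OF smooth_E[of "1 / 2"]], of J]
    by (cases "card J = q") simp_all
  then show "mkform q a \<in> borel_measurable borel"
    unfolding mkform_def[abs_def] by (rule borel_measurable_vec_lambda_complex)
  show "mkform q a z $ J = 0" if "card J \<noteq> q" for z J using that by (simp add: mkform_def)
  show "L2f (cf (mkform q a) J)" for J using assms by (simp add: cf_mkform L2f_zero)
qed

lemma mkform_cf:
  assumes "u \<in> vecs (L2_forms \<phi> q)"
  shows "mkform q (cf u) = u"
  using assms by (auto simp: vecs_forms mkform_def cf_def fun_eq_iff vec_eq_iff mult.assoc)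

text \<open>The weight contributes -(1/2) d\<phi>/dzbar_j, which combines with the derivative of the
  conjugate of G to the conjugate of \<open>dbarT j G\<close>. The form of the test function on the
  left is chosen to make this happen.\<close>

lemma d_zbar_weighted:
  assumes G: "smooth G"
  shows "d_zbar j (\<lambda>z. cnj (G z) * E (- 1 / 2) z) z = cnj (dbarT j G z) * E (- 1 / 2) z"
proof -
  have e: "pd b (E (- 1 / 2)) z = of_real (- 1 / 2 * pd b \<phi> z) * E (- 1 / 2) z" for b
  proof -
    have "pd b (E (- 1 / 2)) z = of_real (pd b (\<lambda>z. exp (- 1 / 2 * \<phi> z)) z)"
      by (intro pd_of_real smooth_differentiable smooth_intros \<phi>)
    also have "pd b (\<lambda>z. exp (- 1 / 2 * \<phi> z)) z = exp (- 1 / 2 * \<phi> z) * pd b (\<lambda>z. - 1 / 2 * \<phi> z) z"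
      by (rule pd_compose_real[OF DERIV_exp]) (intro smooth_differentiable smooth_intros \<phi>)
    also have "pd b (\<lambda>z. - 1 / 2 * \<phi> z) z = - 1 / 2 * pd b \<phi> z"
      by (rule pd_cmult[OF smooth_differentiable[OF \<phi>]])
    finally show ?thesis by (simp add: mult.commute)
  qed
  define c where "c = E (- 1 / 2) z"
  have pG: "pd b (\<lambda>z. cnj (G z)) z = cnj (pd b G z)" for b by (rule pd_cnj[OF smooth_differentiable[OF G]])
  have "pd b (\<lambda>z. cnj (G z) * E (- 1 / 2) z) z = cnj (G z) * pd b (E (- 1 / 2)) z + pd b (\<lambda>z. cnj (G z)) z * E (- 1 / 2) z" for b
    by (rule pd_mult) (intro smooth_differentiable smooth_cnj G smooth_E)+
  then have t: "pd b (\<lambda>z. cnj (G z) * E (- 1 / 2) z) z = (cnj (pd b G z) - of_real (pd b \<phi> z / 2) * cnj (G z)) * c" for b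
    unfolding e pG c_def[symmetric] by (simp add: algebra_simps)
  show ?thesis
    unfolding d_zbar_def d_x_eq_pd d_y_eq_pd t dbarT_def cov_def A_X A_Y c_def[symmetric]
    by (simp add: field_simps)
qed

text \<open>The substitution g = cnj G * exp (- \<phi>/2) is a bijection of the test functions. It
  absorbs the weight and turns the bilinear pairing of distributions into the inner product, with
  \<open>dbarT\<close> acting on the test function.\<close>

lemma weak_dbar_iff: "weak_dbar q u f \<longleftrightarrow> (\<forall>K. card K = Suc q \<longrightarrow> (\<forall>G. cc_smooth G \<longrightarrow>
    l2ip (cf f K) G = (\<Sum>J | card J = q. \<Sum>j\<in>UNIV. wedge_coeff j J K * - l2ip (cf u J) (dbarT j G))))"
proof -
  let ?t = "\<lambda>G z. cnj (G z) * E (- 1 / 2) z"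
  have f: "(\<integral>z. f z $ K * ?t G z \<partial>lborel) = l2ip (cf f K) G" for G K
    by (simp add: l2ip_def cf_def mult_ac)
  have u: "(\<integral>z. u z $ J * d_zbar j (?t G) z \<partial>lborel) = l2ip (cf u J) (dbarT j G)" if "cc_smooth G" for G J j
    unfolding d_zbar_weighted[OF cc_smoothD[OF that]] by (simp add: l2ip_def cf_def mult_ac)
  have t: "cc_smooth (?t G)" if "cc_smooth G" for G
    by (intro cc_smooth_mult_left cc_smooth_cnj that smooth_E)
  have s: "\<exists>G. cc_smooth G \<and> g = ?t G" if "cc_smooth g" for g
  proof (intro exI conjI)
    show "cc_smooth (\<lambda>z. cnj (g z) * E (1 / 2) z)" by (intro cc_smooth_mult_left cc_smooth_cnj that smooth_E)
    show "g = ?t (\<lambda>z. cnj (g z) * E (1 / 2) z)"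
      by (simp add: fun_eq_iff mult.assoc)
  qed
  have all: "(\<forall>g\<in>test_functions. P g) \<longleftrightarrow> (\<forall>G. cc_smooth G \<longrightarrow> P (?t G))" for P :: "((complex, 'n) vec \<Rightarrow> complex) \<Rightarrow> bool"
  proof (intro iffI ballI allI impI)
    show "P (?t G)" if "\<forall>g\<in>test_functions. P g" "cc_smooth G" for G
      using that(1) t[OF that(2)] by (simp add: test_functions_iff)
    fix g :: "(complex, 'n) vec \<Rightarrow> complex" assume P: "\<forall>G. cc_smooth G \<longrightarrow> P (?t G)" and "g \<in> test_functions"
    then obtain G where G: "cc_smooth G" "g = ?t G" using s[of g] by (auto simp: test_functions_iff)
    show "P g" unfolding G(2) using P G(1) by blast
  qed
  show ?thesis unfolding weak_dbar_def all f
    by (intro iff_allI imp_cong refl) (simp only: u)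
qed

lemma dbar_iff: "(u, f) \<in> dbar \<phi> q \<longleftrightarrow> u \<in> vecs (L2_forms \<phi> q) \<and> f \<in> vecs (L2_forms \<phi> (Suc q)) \<and>
    (\<forall>K. card K = Suc q \<longrightarrow> (\<forall>G. cc_smooth G \<longrightarrow>
    l2ip (cf f K) G = (\<Sum>J | card J = q. \<Sum>j\<in>UNIV. wedge_coeff j J K * - l2ip (cf u J) (dbarT j G))))"
  by (simp add: dbar_def weak_dbar_iff)

lemma dbar_adj_iff: "(v, w) \<in> dbar_adj \<phi> q \<longleftrightarrow> v \<in> vecs (L2_forms \<phi> (Suc q)) \<and> w \<in> vecs (L2_forms \<phi> q) \<and>
    (\<forall>a b. (a, b) \<in> dbar \<phi> q \<longrightarrow> ip (L2_forms \<phi> (Suc q)) b v = ip (L2_forms \<phi> q) a w)"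
  by (auto simp: dbar_adj_def adjoint_op_def)

lemma dbarT_L2f: "cc_smooth G \<Longrightarrow> L2f (dbarT j G)"
  by (intro cc_smooth_L2f cc_smooth_dbarT)

text \<open>The distributional definition of \<open>dbar\<close> is a pairing against forms with one
  smooth, compactly supported coefficient; such forms therefore lie in the domain of the adjoint,
  and the value can be read off from the definition.\<close>

lemma dbar_adj_single:
  assumes K: "card K = Suc q" and G: "cc_smooth G"
  shows "(mkform (Suc q) (\<lambda>J. if J = K then G else (\<lambda>z. 0)),
    mkform q (\<lambda>J z. \<Sum>j\<in>UNIV. wedge_coeff j J K * - dbarT j G z)) \<in> dbar_adj \<phi> q"
  unfolding dbar_adj_iff
proof (intro conjI allI impI)
  show "mkform (Suc q) (\<lambda>J. if J = K then G else (\<lambda>z. 0)) \<in> vecs (L2_forms \<phi> (Suc q))"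
    by (intro mkform_vecs) (simp add: cc_smooth_L2f G L2f_zero)
  show "mkform q (\<lambda>J z. \<Sum>j\<in>UNIV. wedge_coeff j J K * - dbarT j G z) \<in> vecs (L2_forms \<phi> q)"
    by (intro mkform_vecs L2f_sum L2f_cmult L2f_minus dbarT_L2f G)
  fix a b assume ab: "(a, b) \<in> dbar \<phi> q"
  then have aL: "L2f (cf a J)" for J by (auto simp: dbar_iff cf_L2f)
  have "ip (L2_forms \<phi> (Suc q)) b (mkform (Suc q) (\<lambda>J. if J = K then G else (\<lambda>z. 0))) =
      (\<Sum>J | card J = Suc q. if J = K then l2ip (cf b K) G else 0)"
    unfolding ip_forms cf_mkform by (rule sum.cong) auto
  also have "\<dots> = l2ip (cf b K) G" using K by simp
  also have "\<dots> = (\<Sum>J | card J = q. \<Sum>j\<in>UNIV. wedge_coeff j J K * - l2ip (cf a J) (dbarT j G))"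
    using ab K G by (simp add: dbar_iff)
  also have "\<dots> = ip (L2_forms \<phi> q) a (mkform q (\<lambda>J z. \<Sum>j\<in>UNIV. wedge_coeff j J K * - dbarT j G z))"
    unfolding ip_forms cf_mkform
  proof (rule sum.cong[OF refl])
    fix J :: "'n set" assume "J \<in> {J. card J = q}"
    moreover have "l2ip (cf a J) (\<lambda>z. \<Sum>j\<in>UNIV. (- wedge_coeff j J K) * dbarT j G z) =
        (\<Sum>j\<in>UNIV. cnj (- wedge_coeff j J K) * l2ip (cf a J) (dbarT j G))"
      by (rule l2ip_sum_right[OF aL dbarT_L2f[OF G]])
    ultimately show "(\<Sum>j\<in>UNIV. wedge_coeff j J K * - l2ip (cf a J) (dbarT j G)) =
        l2ip (cf a J) (if card J = q then \<lambda>z. \<Sum>j\<in>UNIV. wedge_coeff j J K * - dbarT j G z else (\<lambda>z. 0))"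
      by simp
  qed
  finally show "ip (L2_forms \<phi> (Suc q)) b (mkform (Suc q) (\<lambda>J. if J = K then G else (\<lambda>z. 0))) =
    ip (L2_forms \<phi> q) a (mkform q (\<lambda>J z. \<Sum>j\<in>UNIV. wedge_coeff j J K * - dbarT j G z))" .
qed

subsection \<open>Top degree\<close>

lemma card_eq_n: "card (J :: 'n set) = CARD('n) \<longleftrightarrow> J = UNIV"
  by (metis card_subset_eq finite_class.finite_UNIV subset_UNIV)

lemma no_card_Suc_n: "card (J :: 'n set) \<noteq> Suc CARD('n)"
  using card_mono[of UNIV J] by auto

lemma Suc_n: "Suc (CARD('n) - 1) = CARD('n)"
  using finite_UNIV_card_ge_0[where 'a = 'n] by simp

lemma ip_top: "ip (L2_forms \<phi> CARD('n)) u v = l2ip (cf u UNIV) (cf v UNIV)"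
  by (simp add: ip_forms card_eq_n)

lemma top_vecs_eqI: "u \<in> vecs (L2_forms \<phi> CARD('n)) \<Longrightarrow> v \<in> vecs (L2_forms \<phi> CARD('n)) \<Longrightarrow> cf u UNIV = cf v UNIV \<Longrightarrow> u = v"
proof -
  assume u: "u \<in> vecs (L2_forms \<phi> CARD('n))" and v: "v \<in> vecs (L2_forms \<phi> CARD('n))" and eq: "cf u UNIV = cf v UNIV"
  have "mkform CARD('n) (cf u) = mkform CARD('n) (cf v)"
    using eq by (auto simp: mkform_def fun_eq_iff vec_eq_iff card_eq_n)
  then show "u = v" using mkform_cf[OF u] mkform_cf[OF v] by simp
qed

text \<open>The multiindices of length n - 1 are the complements of single indices, so exactly one j
  contributes to each. Its sign occurs twice and squares to 1, and the two minus signs, from the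
  adjoint and from the distributional derivative, cancel.\<close>

lemma top_wedge_sum:
  fixes v y :: "'n \<Rightarrow> (complex, 'n) vec \<Rightarrow> complex"
  assumes v: "\<And>j. L2f (v j)"
  shows "(\<Sum>J | card J = CARD('n) - 1. \<Sum>j\<in>UNIV. wedge_coeff j J UNIV *
      - l2ip (\<lambda>x. \<Sum>i\<in>UNIV. wedge_coeff i J UNIV * - v i x) (y j)) = (\<Sum>j\<in>UNIV. l2ip (v j) (y j))"
proof -
  have sets: "{J :: 'n set. card J = CARD('n) - 1} = (\<lambda>i. UNIV - {i}) ` UNIV"
  proof (intro equalityI subsetI)
    fix J :: "'n set" assume "J \<in> {J. card J = CARD('n) - 1}"
    then have "card (- J) = 1"
      using Suc_n card_Diff_subset[of J UNIV] by (simp add: Compl_eq_Diff_UNIV)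
    then obtain i where "- J = {i}" by (auto simp: card_1_singleton_iff)
    then show "J \<in> (\<lambda>i. UNIV - {i}) ` UNIV" by (metis Compl_eq_Diff_UNIV double_complement rangeI)
  qed (auto simp: card_Diff_singleton)
  have inj: "inj_on (\<lambda>i :: 'n. UNIV - {i}) UNIV" by (auto simp: inj_on_def)
  define s where "s i = ((- 1) ^ card {k \<in> UNIV - {i}. k < i} :: complex)" for i :: 'n
  have w: "wedge_coeff j (UNIV - {i}) UNIV = (if j = i then s i else 0)" for i j :: 'n
    by (auto simp: wedge_coeff_def s_def)
  have ss: "s i * s i = 1" for i by (simp add: s_def flip: power_add mult_2)
  have "(\<Sum>j\<in>UNIV. wedge_coeff j (UNIV - {k}) UNIV *
      - l2ip (\<lambda>x. \<Sum>i\<in>UNIV. wedge_coeff i (UNIV - {k}) UNIV * - v i x) (y j)) = l2ip (v k) (y k)" for k :: 'n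
  proof -
    have "(\<Sum>j\<in>UNIV. wedge_coeff j (UNIV - {k}) UNIV *
      - l2ip (\<lambda>x. \<Sum>i\<in>UNIV. wedge_coeff i (UNIV - {k}) UNIV * - v i x) (y j)) =
      s k * - l2ip (\<lambda>x. s k * - v k x) (y k)"
      unfolding w by (simp add: if_distrib if_distribR sum.delta cong: if_cong)
    also have "l2ip (\<lambda>x. s k * - v k x) (y k) = - s k * l2ip (v k) (y k)"
      using l2ip_cmult_left[of "- s k" "v k"] by simp
    finally show ?thesis using ss[of k] by (simp flip: mult.assoc)
  qed
  then show ?thesis unfolding sets by (subst sum.reindex[OF inj]) simp
qed

declare One_nat_def [simp del]

lemma dbar_top_iff: "(v, a) \<in> dbar \<phi> (CARD('n) - 1) \<longleftrightarrow> v \<in> vecs (L2_forms \<phi> (CARD('n) - 1)) \<and> a \<in> vecs (L2_forms \<phi> CARD('n)) \<and>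
    (\<forall>G. cc_smooth G \<longrightarrow> l2ip (cf a UNIV) G =
      (\<Sum>J | card J = CARD('n) - 1. \<Sum>j\<in>UNIV. wedge_coeff j J UNIV * - l2ip (cf v J) (dbarT j G)))"
  unfolding dbar_iff Suc_n card_eq_n by auto

definition topf :: "((complex, 'n) vec \<Rightarrow> complex) \<Rightarrow> 'n form" where
  "topf f = mkform CARD('n) (\<lambda>J. f)"

lemma cf_top [simp]: "cf (topf f) UNIV = f"
  by (simp add: topf_def cf_mkform)

lemma topf_vecs: "L2f f \<Longrightarrow> topf f \<in> vecs (L2_forms \<phi> CARD('n))"
  unfolding topf_def by (intro mkform_vecs)

lemma top_cf: "u \<in> vecs (L2_forms \<phi> CARD('n)) \<Longrightarrow> topf (cf u UNIV) = u"
  by (rule top_vecs_eqI) (simp_all add: topf_vecs cf_L2f)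

lemma cf_zero [simp]: "cf 0 J = (\<lambda>z. 0)"
  by (simp add: cf_def fun_eq_iff)

lemma zero_vecs: "0 \<in> vecs (L2_forms \<phi> q)"
  by (simp add: vecs_forms L2f_zero) (simp add: zero_fun_def)

lemma dbar_adj_zero: "(0, 0) \<in> dbar_adj \<phi> CARD('n)"
  by (simp add: dbar_adj_iff zero_vecs ip_forms)

lemma dbar_n_zero: "u \<in> vecs (L2_forms \<phi> CARD('n)) \<Longrightarrow> (u, 0) \<in> dbar \<phi> CARD('n)"
  using no_card_Suc_n by (auto simp: dbar_iff zero_vecs)

text \<open>Test functions approximating f in the graph norm have convergent images under each
  \<open>dbarT j\<close>. The limits are assembled into the value of the adjoint of
  \<open>dbar\<close> at f; both relations hold for the approximants, and each passes to the limit
  in the inner products. The factor 4 is the one of \<open>dbarT_form\<close>.\<close>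

lemma weak_H_imp_laplacian:
  assumes fh: "weak_H f (\<lambda>z. 4 * h z)"
  shows "(topf f, topf h) \<in> complex_laplacian \<phi> CARD('n)"
proof -
  have f: "L2f f" and h4: "L2f (\<lambda>z. 4 * h z)" using fh by (auto simp: weak_H_def)
  have h: "L2f h" using L2f_cmult[OF h4, of "1/4"] by simp
  obtain g where g: "\<And>k. cc_smooth (g k)" "(\<lambda>k. nsq (\<lambda>x. g k x - f x)) \<longlonglongrightarrow> 0"
    "(\<lambda>k. nsq (\<lambda>x. H (g k) x - 4 * h x)) \<longlonglongrightarrow> 0" using weak_H_approx[OF fh] by blast
  have gL: "L2f (g k)" for k by (rule cc_smooth_L2f[OF g(1)])
  define Q where "Q j v \<longleftrightarrow> L2f v \<and> (\<lambda>k. nsq (\<lambda>x. dbarT j (g k) x - v x)) \<longlonglongrightarrow> 0" for j v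
  have "\<exists>v. Q j v" for j
  proof -
    obtain p where p: "L2f p" "(\<lambda>k. nsq (\<lambda>x. cov (X j) (g k) x - p x)) \<longlonglongrightarrow> 0"
      using cov_converges[OF g(1) f g(2) h4 g(3) axis_Basis(1)] by blast
    obtain r where r: "L2f r" "(\<lambda>k. nsq (\<lambda>x. cov (Y j) (g k) x - r x)) \<longlonglongrightarrow> 0"
      using cov_converges[OF g(1) f g(2) h4 g(3) axis_Basis(2)] by blast
    have c: "L2f (cov b (g k))" if "b \<in> Basis" for b k by (intro cc_smooth_L2f cc_smooth_cov g that)
    have v: "L2f (\<lambda>x. 1 / 2 * (p x - \<i> * r x))" by (intro L2f_cmult L2f_diff p r)
    have "(\<lambda>k. nsq (\<lambda>x. dbarT j (g k) x - 1 / 2 * (p x - \<i> * r x))) \<longlonglongrightarrow> 0"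
    proof (rule tendsto_sandwich[OF always_eventually always_eventually tendsto_const])
      show "\<forall>k. nsq (\<lambda>x. dbarT j (g k) x - 1 / 2 * (p x - \<i> * r x)) \<le>
          2 * ((1 / 4) * nsq (\<lambda>x. cov (X j) (g k) x - p x)) + 2 * ((1 / 4) * nsq (\<lambda>x. cov (Y j) (g k) x - r x))"
      proof
        fix k
        have eq: "(\<lambda>x. dbarT j (g k) x - 1 / 2 * (p x - \<i> * r x)) =
            (\<lambda>x. 1 / 2 * (cov (X j) (g k) x - p x) + (- \<i> / 2) * (cov (Y j) (g k) x - r x))"
          by (simp add: dbarT_def fun_eq_iff field_simps)
        have nN: "nsq (\<lambda>x. 1 / 2 * (cov (X j) (g k) x - p x)) = 1 / 4 * nsq (\<lambda>x. cov (X j) (g k) x - p x)"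
          "nsq (\<lambda>x. (- \<i> / 2) * (cov (Y j) (g k) x - r x)) = 1 / 4 * nsq (\<lambda>x. cov (Y j) (g k) x - r x)"
          unfolding nsq_cmult by (simp_all add: norm_divide power_divide)
        show "nsq (\<lambda>x. dbarT j (g k) x - 1 / 2 * (p x - \<i> * r x)) \<le>
          2 * ((1 / 4) * nsq (\<lambda>x. cov (X j) (g k) x - p x)) + 2 * ((1 / 4) * nsq (\<lambda>x. cov (Y j) (g k) x - r x))"
          unfolding eq nN[symmetric] by (intro nsq_add_le L2f_cmult L2f_diff c p r axis_Basis)
      qed
      have "(\<lambda>k. 2 * ((1 / 4) * nsq (\<lambda>x. cov (X j) (g k) x - p x)) + 2 * ((1 / 4) * nsq (\<lambda>x. cov (Y j) (g k) x - r x))) \<longlonglongrightarrow>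
          2 * ((1 / 4) * 0) + 2 * ((1 / 4) * 0)"
        by (intro tendsto_add tendsto_mult tendsto_const p r)
      then show "(\<lambda>k. 2 * ((1 / 4) * nsq (\<lambda>x. cov (X j) (g k) x - p x)) + 2 * ((1 / 4) * nsq (\<lambda>x. cov (Y j) (g k) x - r x))) \<longlonglongrightarrow> 0"
        by simp
    qed (simp add: nsq_nonneg)
    with v have "Q j (\<lambda>x. 1 / 2 * (p x - \<i> * r x))" unfolding Q_def by blast
    then show ?thesis by blast
  qed
  then obtain v where vQ: "\<And>j. Q j (v j)" by metis
  have v: "L2f (v j)" "(\<lambda>k. nsq (\<lambda>x. dbarT j (g k) x - v j x)) \<longlonglongrightarrow> 0" for j
    using vQ[of j] unfolding Q_def by auto
  \<comment> \<open>The candidate for the image of \<open>topf f\<close> under the adjoint of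
    \<open>dbar\<close>.\<close>
  define w where "w = mkform (CARD('n) - 1) (\<lambda>J x. \<Sum>i\<in>UNIV. wedge_coeff i J UNIV * - v i x)"
  have wv: "w \<in> vecs (L2_forms \<phi> (CARD('n) - 1))"
    unfolding w_def by (intro mkform_vecs L2f_sum L2f_cmult L2f_minus v)
  have "(topf f, w) \<in> dbar_adj \<phi> (CARD('n) - 1)"
    unfolding dbar_adj_iff Suc_n
  proof (intro conjI allI impI topf_vecs f wv)
    fix a b assume ab: "(a, b) \<in> dbar \<phi> (CARD('n) - 1)"
    then have L: "L2f (cf a J)" "L2f (cf b J)" for J by (auto simp: dbar_top_iff cf_L2f)
    have "(\<lambda>k. \<Sum>J | card J = CARD('n) - 1. \<Sum>j\<in>UNIV. wedge_coeff j J UNIV * - l2ip (cf a J) (dbarT j (g k))) \<longlonglongrightarrow>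
        (\<Sum>J | card J = CARD('n) - 1. \<Sum>j\<in>UNIV. wedge_coeff j J UNIV * - l2ip (cf a J) (v j))"
      by (intro tendsto_sum tendsto_mult tendsto_const tendsto_minus l2ip_tendsto_right dbarT_L2f g v L)
    moreover have "(\<lambda>k. l2ip (cf b UNIV) (g k)) \<longlonglongrightarrow> l2ip (cf b UNIV) f"
      by (rule l2ip_tendsto_right[OF gL f L(2) g(2)])
    moreover have "l2ip (cf b UNIV) (g k) =
        (\<Sum>J | card J = CARD('n) - 1. \<Sum>j\<in>UNIV. wedge_coeff j J UNIV * - l2ip (cf a J) (dbarT j (g k)))" for k
      using ab g(1) by (simp add: dbar_top_iff)
    ultimately have lim: "l2ip (cf b UNIV) f = (\<Sum>J | card J = CARD('n) - 1. \<Sum>j\<in>UNIV. wedge_coeff j J UNIV * - l2ip (cf a J) (v j))"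
      by (simp add: LIMSEQ_unique)
    have "l2ip (cf a J) (\<lambda>x. \<Sum>i\<in>UNIV. (- wedge_coeff i J UNIV) * v i x) = (\<Sum>j\<in>UNIV. cnj (- wedge_coeff j J UNIV) * l2ip (cf a J) (v j))" for J
      by (rule l2ip_sum_right[OF L(1) v(1)])
    then have "ip (L2_forms \<phi> (CARD('n) - 1)) a w = (\<Sum>J | card J = CARD('n) - 1. \<Sum>j\<in>UNIV. wedge_coeff j J UNIV * - l2ip (cf a J) (v j))"
      unfolding ip_forms w_def cf_mkform by (intro sum.cong) auto
    then show "ip (L2_forms \<phi> CARD('n)) b (topf f) = ip (L2_forms \<phi> (CARD('n) - 1)) a w"
      using lim by (simp add: ip_top)
  qed
  moreover have "(w, topf h) \<in> dbar \<phi> (CARD('n) - 1)"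
    unfolding dbar_top_iff
  proof (intro conjI allI impI wv topf_vecs h)
    fix G :: "(complex, 'n) vec \<Rightarrow> complex" assume G: "cc_smooth G"
    have "(\<lambda>k. \<Sum>j\<in>UNIV. l2ip (dbarT j (g k)) (dbarT j G)) \<longlonglongrightarrow> (\<Sum>j\<in>UNIV. l2ip (v j) (dbarT j G))"
      by (intro tendsto_sum l2ip_tendsto_left dbarT_L2f g v G)
    moreover have "(\<lambda>k. l2ip (H (g k)) G / 4) \<longlonglongrightarrow> l2ip (\<lambda>z. 4 * h z) G / 4"
      by (intro tendsto_divide tendsto_const l2ip_tendsto_left cc_smooth_L2f cc_smooth_H g G h4) simp
    ultimately have "l2ip h G = (\<Sum>j\<in>UNIV. l2ip (v j) (dbarT j G))"
      using LIMSEQ_unique by (fastforce simp: dbarT_form[OF g(1) G] l2ip_cmult_left)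
    also have "\<dots> = (\<Sum>J | card J = CARD('n) - 1. \<Sum>j\<in>UNIV. wedge_coeff j J UNIV * - l2ip (cf w J) (dbarT j G))"
      unfolding top_wedge_sum[OF v(1), symmetric] w_def cf_mkform by (intro sum.cong) auto
    finally show "l2ip (cf (topf h) UNIV) G = (\<Sum>J | card J = CARD('n) - 1. \<Sum>j\<in>UNIV. wedge_coeff j J UNIV * - l2ip (cf w J) (dbarT j G))"
      by simp
  qed
  ultimately have "(topf f, topf h + 0) \<in> complex_laplacian \<phi> CARD('n)"
    unfolding complex_laplacian_def mem_Collect_eq
  proof (intro exI conjI)
    show "(topf f, 0) \<in> dbar \<phi> CARD('n)" by (rule dbar_n_zero[OF topf_vecs[OF f]])
    show "(0, 0) \<in> dbar_adj \<phi> CARD('n)" by (rule dbar_adj_zero)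
  qed auto
  then show ?thesis by simp
qed

text \<open>A test function G, read as a top degree form, is mapped by the adjoint of
  \<open>dbar\<close> to a form which again lies in the domain of \<open>dbar\<close>. Hence G can
  be paired with the Laplacian of u and both operators moved over to G, where together they act as H
  / 4.\<close>

lemma laplacian_imp_weak_H:
  assumes uw: "(u, w) \<in> complex_laplacian \<phi> CARD('n)"
  shows "u \<in> vecs (L2_forms \<phi> CARD('n))" "w \<in> vecs (L2_forms \<phi> CARD('n))" "weak_H (cf u UNIV) (\<lambda>z. 4 * cf w UNIV z)"
proof -
  have n0: "CARD('n) \<noteq> 0" using Suc_n by linarith
  obtain a b F v where w: "w = a + b" and F: "(u, F) \<in> dbar \<phi> CARD('n)" "(F, b) \<in> dbar_adj \<phi> CARD('n)"
    and v: "(u, v) \<in> dbar_adj \<phi> (CARD('n) - 1)" "(v, a) \<in> dbar \<phi> (CARD('n) - 1)"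
    using uw n0 unfolding complex_laplacian_def by auto
  show u: "u \<in> vecs (L2_forms \<phi> CARD('n))" using F by (simp add: dbar_iff)
  have b: "b \<in> vecs (L2_forms \<phi> CARD('n))" using F by (simp add: dbar_adj_iff)
  have a: "a \<in> vecs (L2_forms \<phi> CARD('n))" using v by (simp add: dbar_top_iff)
  \<comment> \<open>The summand b arises from degree n + 1, where only the zero form exists. Since
    the spaces consist of representatives, b is not literally 0 but has norm 0, as the pairing with
    itself shows.\<close>
  have "ip (L2_forms \<phi> (Suc CARD('n))) 0 F = ip (L2_forms \<phi> CARD('n)) b b"
    using F(2) dbar_n_zero[OF b] by (simp add: dbar_adj_iff)
  moreover have "ip (L2_forms \<phi> (Suc CARD('n))) 0 F = 0" by (simp add: ip_forms)
  ultimately have b0: "nsq (cf b UNIV) = 0"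
    unfolding ip_top l2ip_self[OF cf_L2f[OF b]] by simp
  have cw: "cf w UNIV = (\<lambda>z. cf a UNIV z + cf b UNIV z)"
    by (simp add: w cf_def fun_eq_iff distrib_right)
  show wv: "w \<in> vecs (L2_forms \<phi> CARD('n))"
  proof -
    have "cf w J = (\<lambda>z. cf a J z + cf b J z)" for J by (simp add: w cf_def fun_eq_iff distrib_right)
    moreover have "w \<in> borel_measurable borel"
      using a b unfolding w plus_fun_def vecs_forms by (intro borel_measurable_add) auto
    ultimately show ?thesis using a b by (auto simp: vecs_forms w intro: L2f_add)
  qed
  have weak: "l2ip (cf w UNIV) G = l2ip (cf u UNIV) (H G) / 4" if G: "cc_smooth G" for G
  proof -
    have "cmod (l2ip (cf b UNIV) G) ^ 2 \<le> 0"
      using l2ip_bound[OF cf_L2f[OF b] cc_smooth_L2f[OF G], of UNIV] b0 by simp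
    then have "l2ip (cf b UNIV) G = 0" by simp
    then have "l2ip (cf w UNIV) G = l2ip (cf a UNIV) G"
      unfolding cw using a b G by (simp add: l2ip_add_left cf_L2f cc_smooth_L2f)
    also have "\<dots> = (\<Sum>J | card J = CARD('n) - 1. \<Sum>j\<in>UNIV. wedge_coeff j J UNIV * - l2ip (cf v J) (dbarT j G))"
      using v(2) G by (simp add: dbar_top_iff)
    finally have 1: "l2ip (cf w UNIV) G = (\<Sum>J | card J = CARD('n) - 1. \<Sum>j\<in>UNIV. wedge_coeff j J UNIV * - l2ip (cf v J) (dbarT j G))" .
    \<comment> \<open>The image of the top degree form with coefficient G under the adjoint of
      \<open>dbar\<close>; by \<open>dbarT_form\<close> its own image under \<open>dbar\<close> has
      coefficient H G / 4.\<close>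
    define x where "x = mkform (CARD('n) - 1) (\<lambda>J x. \<Sum>i\<in>UNIV. wedge_coeff i J UNIV * - dbarT i G x)"
    have HG: "L2f (\<lambda>z. 1 / 4 * H G z)" by (intro L2f_cmult cc_smooth_L2f cc_smooth_H G)
    have "(x, topf (\<lambda>z. 1 / 4 * H G z)) \<in> dbar \<phi> (CARD('n) - 1)"
      unfolding dbar_top_iff
    proof (intro conjI allI impI topf_vecs HG)
      show "x \<in> vecs (L2_forms \<phi> (CARD('n) - 1))"
        unfolding x_def by (intro mkform_vecs L2f_sum L2f_cmult L2f_minus dbarT_L2f G)
      fix G' :: "(complex, 'n) vec \<Rightarrow> complex" assume G': "cc_smooth G'"
      have "l2ip (\<lambda>z. 1 / 4 * H G z) G' = (\<Sum>j\<in>UNIV. l2ip (dbarT j G) (dbarT j G'))"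
        unfolding dbarT_form[OF G G'] l2ip_cmult_left by simp
      also have "\<dots> = (\<Sum>J | card J = CARD('n) - 1. \<Sum>j\<in>UNIV. wedge_coeff j J UNIV * - l2ip (cf x J) (dbarT j G'))"
        unfolding top_wedge_sum[OF dbarT_L2f[OF G], symmetric] x_def cf_mkform by (intro sum.cong) auto
      finally show "l2ip (cf (topf (\<lambda>z. 1 / 4 * H G z)) UNIV) G' =
        (\<Sum>J | card J = CARD('n) - 1. \<Sum>j\<in>UNIV. wedge_coeff j J UNIV * - l2ip (cf x J) (dbarT j G'))" by simp
    qed
    then have "l2ip (\<lambda>z. 1 / 4 * H G z) (cf u UNIV) = ip (L2_forms \<phi> (CARD('n) - 1)) x v"
      using v(1) unfolding dbar_adj_iff Suc_n ip_top by (metis cf_top)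
    then have "cnj (l2ip (\<lambda>z. 1 / 4 * H G z) (cf u UNIV)) = cnj (ip (L2_forms \<phi> (CARD('n) - 1)) x v)" by simp
    then have "l2ip (cf u UNIV) (\<lambda>z. 1 / 4 * H G z) = (\<Sum>J | card J = CARD('n) - 1. l2ip (cf v J) (cf x J))"
      unfolding ip_forms l2ip_cnj[of "cf u UNIV"] l2ip_cnj[of "cf v _"] by simp
    also have "\<dots> = (\<Sum>J | card J = CARD('n) - 1. \<Sum>j\<in>UNIV. wedge_coeff j J UNIV * - l2ip (cf v J) (dbarT j G))"
    proof (rule sum.cong[OF refl])
      fix J :: "'n set" assume J: "J \<in> {J. card J = CARD('n) - 1}"
      have "L2f (cf v J)" using v(2) by (auto simp: dbar_top_iff cf_L2f)
      then have "l2ip (cf v J) (\<lambda>x. \<Sum>i\<in>UNIV. (- wedge_coeff i J UNIV) * dbarT i G x) =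
          (\<Sum>i\<in>UNIV. cnj (- wedge_coeff i J UNIV) * l2ip (cf v J) (dbarT i G))"
        by (intro l2ip_sum_right dbarT_L2f G)
      then show "l2ip (cf v J) (cf x J) = (\<Sum>j\<in>UNIV. wedge_coeff j J UNIV * - l2ip (cf v J) (dbarT j G))"
        using J by (simp add: x_def cf_mkform)
    qed
    finally show ?thesis unfolding 1[symmetric] l2ip_cmult_right by simp
  qed
  show "weak_H (cf u UNIV) (\<lambda>z. 4 * cf w UNIV z)"
    unfolding weak_H_def
  proof (intro conjI allI impI cf_L2f[OF u] L2f_cmult cf_L2f[OF wv])
    fix G :: "(complex, 'n) vec \<Rightarrow> complex" assume "cc_smooth G"
    from weak[OF this] show "l2ip (\<lambda>z. 4 * cf w UNIV z) G = l2ip (cf u UNIV) (H G)"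
      unfolding l2ip_cmult_left by (simp add: mult.commute)
  qed
qed

theorem laplacian_iff: "(u, w) \<in> complex_laplacian \<phi> CARD('n) \<longleftrightarrow>
    u \<in> vecs (L2_forms \<phi> CARD('n)) \<and> w \<in> vecs (L2_forms \<phi> CARD('n)) \<and> weak_H (cf u UNIV) (\<lambda>z. 4 * cf w UNIV z)"
  using laplacian_imp_weak_H weak_H_imp_laplacian top_cf by metis

declare One_nat_def [simp]

end

section \<open>Compactness of resolvents\<close>

lemma compact_resolvent_iff: "compact_resolvent H T \<longleftrightarrow> (\<exists>\<mu>. compact_op H (Defs.resolvent H T \<mu>))"
  by (auto simp: compact_resolvent_def resolvent_set_def compact_op_def)

text \<open>Three maps are used in place of one unitary equivalence: \<alpha> acts on right-hand
  sides and absorbs the constant factor between the two operators, \<beta> is isometric on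
  solutions, and \<gamma> carries limits back. The last one is separate because a limit is an
  arbitrary vector of the space, not a given solution.\<close>

lemma compact_op_transfer:
  fixes H1 :: "'v::ab_group_add hspace" and H2 :: "'w::ab_group_add hspace"
  assumes comp: "compact_op H1 R1" and sub: "R2 \<subseteq> vecs H2 \<times> vecs H2" and c: "c \<ge> 0"
    and \<alpha>: "\<And>p. p \<in> vecs H2 \<Longrightarrow> \<alpha> p \<in> vecs H1 \<and> hnorm H1 (\<alpha> p) = c * hnorm H2 p"
    and fwd: "\<And>p y. (p, y) \<in> R2 \<Longrightarrow> (\<alpha> p, \<beta> y) \<in> R1 \<and> hnorm H1 (\<beta> y) = hnorm H2 y"
    and bwd: "\<And>p y. p \<in> vecs H2 \<Longrightarrow> (\<alpha> p, y) \<in> R1 \<Longrightarrow> \<exists>x. (p, x) \<in> R2"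
    and lim: "\<And>y v. y \<in> vecs H2 \<Longrightarrow> v \<in> vecs H1 \<Longrightarrow> \<gamma> v \<in> vecs H2 \<and> hnorm H2 (y - \<gamma> v) = hnorm H1 (\<beta> y - v)"
  shows "compact_op H2 R2"
  unfolding compact_op_def bounded_op_def
proof (intro conjI ballI allI impI)
  have b: "\<forall>f\<in>vecs H1. \<exists>u. (f, u) \<in> R1" "\<exists>C. \<forall>(f, u)\<in>R1. hnorm H1 u \<le> C * hnorm H1 f"
    using comp by (auto simp: compact_op_def bounded_op_def)
  show "\<exists>u. (f, u) \<in> R2" if "f \<in> vecs H2" for f
    using b(1) \<alpha>[OF that] bwd[OF that] by blast
  obtain C where C: "\<And>f u. (f, u) \<in> R1 \<Longrightarrow> hnorm H1 u \<le> C * hnorm H1 f" using b(2) by blast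
  have "hnorm H2 u \<le> C * c * hnorm H2 f" if "(f, u) \<in> R2" for f u
    using fwd[OF that] C[of "\<alpha> f" "\<beta> u"] \<alpha>[of f] sub that by auto
  then show "\<exists>C. \<forall>(f, u)\<in>R2. hnorm H2 u \<le> C * hnorm H2 f" by blast
  fix f u C assume fu: "\<forall>k::nat. (f k, u k) \<in> R2 \<and> hnorm H2 (f k) \<le> C"
  then have "(\<alpha> (f k), \<beta> (u k)) \<in> R1 \<and> hnorm H1 (\<alpha> (f k)) \<le> c * C" for k
  proof -
    have R: "(f k, u k) \<in> R2" "hnorm H2 (f k) \<le> C" using fu by auto
    then have "f k \<in> vecs H2" using sub by blast
    then show ?thesis using fwd[OF R(1)] \<alpha>[of "f k"] mult_left_mono[OF R(2) c] by simp
  qed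
  then obtain r v where r: "strict_mono r" "v \<in> vecs H1" "(\<lambda>k. hnorm H1 (\<beta> (u (r k)) - v)) \<longlonglongrightarrow> 0"
    using comp[unfolded compact_op_def, THEN conjunct2, rule_format, of "\<lambda>k. \<alpha> (f k)" "\<lambda>k. \<beta> (u k)" "c * C"] by blast
  have "u (r k) \<in> vecs H2" for k using fu sub by blast
  then have "hnorm H2 (u (r k) - \<gamma> v) = hnorm H1 (\<beta> (u (r k)) - v)" "\<gamma> v \<in> vecs H2" for k
    using lim[OF _ r(2)] by blast+
  then show "\<exists>r v. strict_mono r \<and> v \<in> vecs H2 \<and> (\<lambda>k. hnorm H2 (u (r k) - v)) \<longlonglongrightarrow> 0"
    using r by (intro exI[of _ r] exI[of _ "\<gamma> v"]) simp
qed

context psh_form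
begin

lemma Re_l2ip_self: "Re (l2ip u u) = nsq u"
  unfolding l2ip_def nsq_def complex_norm_square[symmetric] by (simp flip: of_real_power)

lemma hnorm_L2: "hnorm L2_functions u = sqrt (nsq u)"
  by (simp add: hnorm_def ip_L2 Re_l2ip_self)

lemma hnorm_top: "hnorm (L2_forms \<phi> CARD('n)) u = sqrt (nsq (cf u UNIV))"
  by (simp add: hnorm_def ip_top Re_l2ip_self)

lemma scale_forms: "scale (L2_forms \<phi> q) c u = (\<lambda>z. c *s u z)"
  by (simp add: L2_forms_def)

lemma cf_add: "cf (u + v) J = (\<lambda>z. cf u J z + cf v J z)"
  and cf_diff: "cf (u - v) J = (\<lambda>z. cf u J z - cf v J z)"
  and cf_scale: "cf (\<lambda>z. c *s u z) J = (\<lambda>z. c * cf u J z)"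
  by (simp_all add: cf_def fun_eq_iff algebra_simps)

lemma vecs_add: "u \<in> vecs (L2_forms \<phi> q) \<Longrightarrow> v \<in> vecs (L2_forms \<phi> q) \<Longrightarrow> u + v \<in> vecs (L2_forms \<phi> q)"
  using cf_add[of u v] unfolding vecs_forms plus_fun_def by (auto intro: L2f_add)

lemma vecs_diff: "u \<in> vecs (L2_forms \<phi> q) \<Longrightarrow> v \<in> vecs (L2_forms \<phi> q) \<Longrightarrow> u - v \<in> vecs (L2_forms \<phi> q)"
  using cf_diff[of u v] unfolding vecs_forms fun_diff_def by (auto intro: L2f_diff)

lemma vecs_scale: "u \<in> vecs (L2_forms \<phi> q) \<Longrightarrow> (\<lambda>z. c *s u z) \<in> vecs (L2_forms \<phi> q)"
proof -
  assume u: "u \<in> vecs (L2_forms \<phi> q)"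
  have "continuous_on UNIV (\<lambda>v :: complex ^ 'n set. c *s v)"
    by (rule linear_continuous_on) (auto simp: linear_conv_bounded_linear[symmetric] intro!: linearI simp: vec_eq_iff algebra_simps)
  then have "(\<lambda>z. c *s u z) \<in> borel_measurable borel"
    using u by (intro borel_measurable_continuous_on[where f = "\<lambda>v. c *s v"]) (auto simp: vecs_forms)
  then show ?thesis using u unfolding vecs_forms cf_scale by (auto intro: L2f_cmult)
qed

text \<open>As H corresponds to four times the Laplacian, the spectral parameter \<nu> becomes 4
  \<nu> and the right-hand side is multiplied by 4, while the solution keeps its
  coefficient.\<close>

lemma resolvent_top_iff: "(P, U) \<in> Defs.resolvent (L2_forms \<phi> CARD('n)) (complex_laplacian \<phi> CARD('n)) \<nu> \<longleftrightarrow>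
    P \<in> vecs (L2_forms \<phi> CARD('n)) \<and> U \<in> vecs (L2_forms \<phi> CARD('n)) \<and>
    ((\<lambda>z. 4 * cf P UNIV z), cf U UNIV) \<in> Defs.resolvent L2_functions {(u, f). weak_H u f} (4 * \<nu>)"
proof
  assume "(P, U) \<in> Defs.resolvent (L2_forms \<phi> CARD('n)) (complex_laplacian \<phi> CARD('n)) \<nu>"
  then obtain W where W: "(U, W) \<in> complex_laplacian \<phi> CARD('n)" "P = W - (\<lambda>z. \<nu> *s U z)"
    by (auto simp: Defs.resolvent_def scale_forms)
  then have v: "U \<in> vecs (L2_forms \<phi> CARD('n))" "W \<in> vecs (L2_forms \<phi> CARD('n))"
    and h: "weak_H (cf U UNIV) (\<lambda>z. 4 * cf W UNIV z)" by (auto simp: laplacian_iff)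
  have "(\<lambda>z. 4 * cf P UNIV z) = (\<lambda>z. 4 * cf W UNIV z) - scale L2_functions (4 * \<nu>) (cf U UNIV)"
    by (simp add: W(2) cf_diff cf_scale L2_functions_def fun_eq_iff algebra_simps)
  with v h show "P \<in> vecs (L2_forms \<phi> CARD('n)) \<and> U \<in> vecs (L2_forms \<phi> CARD('n)) \<and>
    ((\<lambda>z. 4 * cf P UNIV z), cf U UNIV) \<in> Defs.resolvent L2_functions {(u, f). weak_H u f} (4 * \<nu>)"
    unfolding Defs.resolvent_def by (auto simp: W(2) intro!: vecs_diff vecs_scale)
next
  assume *: "P \<in> vecs (L2_forms \<phi> CARD('n)) \<and> U \<in> vecs (L2_forms \<phi> CARD('n)) \<and>
    ((\<lambda>z. 4 * cf P UNIV z), cf U UNIV) \<in> Defs.resolvent L2_functions {(u, f). weak_H u f} (4 * \<nu>)"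
  then obtain w where w: "weak_H (cf U UNIV) w" "(\<lambda>z. 4 * cf P UNIV z) = w - (\<lambda>z. 4 * \<nu> * cf U UNIV z)"
    by (auto simp: Defs.resolvent_def L2_functions_def)
  define W where "W = P + (\<lambda>z. \<nu> *s U z)"
  have "w = (\<lambda>z. 4 * cf W UNIV z)"
  proof
    fix z show "w z = 4 * cf W UNIV z"
      using fun_cong[OF w(2), of z] by (simp add: W_def cf_add cf_scale algebra_simps)
  qed
  then have "(U, W) \<in> complex_laplacian \<phi> CARD('n)"
    using * w(1) unfolding laplacian_iff W_def by (auto intro: vecs_add vecs_scale)
  moreover have "P = W - (\<lambda>z. \<nu> *s U z)" by (simp add: W_def)
  ultimately show "(P, U) \<in> Defs.resolvent (L2_forms \<phi> CARD('n)) (complex_laplacian \<phi> CARD('n)) \<nu>"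
    unfolding Defs.resolvent_def scale_forms by blast
qed

lemma resolvent_weak_H_vecs: "Defs.resolvent L2_functions {(u, f). weak_H u f} \<mu> \<subseteq> vecs L2_functions \<times> vecs L2_functions"
proof
  fix p assume "p \<in> Defs.resolvent L2_functions {(u, f). weak_H u f} \<mu>"
  then obtain u w where "weak_H u w" "p = (w - (\<lambda>z. \<mu> * u z), u)"
    by (auto simp: Defs.resolvent_def L2_functions_def)
  then show "p \<in> vecs L2_functions \<times> vecs L2_functions"
    unfolding mem_Times_iff vecs_L2 weak_H_def fst_conv snd_conv fun_diff_def by (auto intro: L2f_diff L2f_cmult)
qed

lemma sqrt16: "sqrt 16 = (4::real)"
  by (rule real_sqrt_unique) auto

theorem compact_resolvent_top_iff:
  "compact_resolvent (L2_forms \<phi> CARD('n)) (complex_laplacian \<phi> CARD('n)) \<longleftrightarrow>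
   compact_resolvent L2_functions (magnetic_schroedinger \<phi> (\<lambda>z. 2 * tr_hessian \<phi> z))"
  unfolding magnetic_schroedinger_eq compact_resolvent_iff
proof
  assume "\<exists>\<mu>. compact_op (L2_forms \<phi> CARD('n)) (Defs.resolvent (L2_forms \<phi> CARD('n)) (complex_laplacian \<phi> CARD('n)) \<mu>)"
  then obtain \<nu> where \<nu>: "compact_op (L2_forms \<phi> CARD('n)) (Defs.resolvent (L2_forms \<phi> CARD('n)) (complex_laplacian \<phi> CARD('n)) \<nu>)" ..
  have q: "L2f (\<lambda>z. p z / 4) \<and> sqrt (nsq (\<lambda>z. p z / 4)) = sqrt (nsq p) / 4" if "L2f p" for p :: "(complex, 'n) vec \<Rightarrow> complex"
  proof -
    have "nsq (\<lambda>z. p z / 4) = nsq p / 16"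
      using nsq_cmult[of "1/4" p] by (simp add: norm_divide power_divide)
    then have "sqrt (nsq (\<lambda>z. p z / 4)) = sqrt (nsq p) / 4" by (simp only: real_sqrt_divide sqrt16)
    then show ?thesis using L2f_cmult[OF that, of "1/4"] by simp
  qed
  have "compact_op L2_functions (Defs.resolvent L2_functions {(u, f). weak_H u f} (4 * \<nu>))"
  proof (rule compact_op_transfer[OF \<nu> resolvent_weak_H_vecs, where c = "1/4" and \<alpha> = "\<lambda>p. topf (\<lambda>z. p z / 4)"
        and \<beta> = topf and \<gamma> = "\<lambda>v. cf v UNIV"])
    show "topf (\<lambda>z. p z / 4) \<in> vecs (L2_forms \<phi> CARD('n)) \<and>
        hnorm (L2_forms \<phi> CARD('n)) (topf (\<lambda>z. p z / 4)) = 1 / 4 * hnorm L2_functions p" if "p \<in> vecs L2_functions" for p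
      using q[of p] that by (auto simp: vecs_L2 topf_vecs hnorm_top hnorm_L2)
    show "(topf (\<lambda>z. p z / 4), topf y) \<in> Defs.resolvent (L2_forms \<phi> CARD('n)) (complex_laplacian \<phi> CARD('n)) \<nu> \<and>
        hnorm (L2_forms \<phi> CARD('n)) (topf y) = hnorm L2_functions y"
      if "(p, y) \<in> Defs.resolvent L2_functions {(u, f). weak_H u f} (4 * \<nu>)" for p y
      using that resolvent_weak_H_vecs[of "4 * \<nu>"] q[of p]
      unfolding resolvent_top_iff by (auto simp: hnorm_top hnorm_L2 vecs_L2 topf_vecs)
    show "\<exists>x. (p, x) \<in> Defs.resolvent L2_functions {(u, f). weak_H u f} (4 * \<nu>)"
      if "(topf (\<lambda>z. p z / 4), y) \<in> Defs.resolvent (L2_forms \<phi> CARD('n)) (complex_laplacian \<phi> CARD('n)) \<nu>" for p y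
      using that unfolding resolvent_top_iff by auto
    show "cf v UNIV \<in> vecs L2_functions \<and> hnorm L2_functions (y - cf v UNIV) = hnorm (L2_forms \<phi> CARD('n)) (topf y - v)"
      if "v \<in> vecs (L2_forms \<phi> CARD('n))" for y v
      using that unfolding vecs_L2 hnorm_L2 hnorm_top cf_diff cf_top by (simp add: cf_L2f fun_diff_def)
  qed simp
  then show "\<exists>\<mu>. compact_op L2_functions (Defs.resolvent L2_functions {(u, f). weak_H u f} \<mu>)" ..
next
  assume "\<exists>\<mu>. compact_op L2_functions (Defs.resolvent L2_functions {(u, f). weak_H u f} \<mu>)"
  then obtain \<mu> where "compact_op L2_functions (Defs.resolvent L2_functions {(u, f). weak_H u f} \<mu>)" ..
  then have \<mu>: "compact_op L2_functions (Defs.resolvent L2_functions {(u, f). weak_H u f} (4 * (\<mu> / 4)))" by simp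
  have q: "L2f (\<lambda>z. 4 * p z) \<and> sqrt (nsq (\<lambda>z. 4 * p z)) = 4 * sqrt (nsq p)" if "L2f p" for p :: "(complex, 'n) vec \<Rightarrow> complex"
    using sqrt16 L2f_cmult[OF that, of 4] nsq_cmult[of 4 p]
    by (simp add: real_sqrt_mult)
  have "compact_op (L2_forms \<phi> CARD('n)) (Defs.resolvent (L2_forms \<phi> CARD('n)) (complex_laplacian \<phi> CARD('n)) (\<mu> / 4))"
  proof (rule compact_op_transfer[OF \<mu>, where c = 4 and \<alpha> = "\<lambda>P z. 4 * cf P UNIV z"
        and \<beta> = "\<lambda>U. cf U UNIV" and \<gamma> = topf])
    show "Defs.resolvent (L2_forms \<phi> CARD('n)) (complex_laplacian \<phi> CARD('n)) (\<mu> / 4) \<subseteq> vecs (L2_forms \<phi> CARD('n)) \<times> vecs (L2_forms \<phi> CARD('n))"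
      using resolvent_top_iff by auto
    show "(\<lambda>z. 4 * cf p UNIV z) \<in> vecs L2_functions \<and>
        hnorm L2_functions (\<lambda>z. 4 * cf p UNIV z) = 4 * hnorm (L2_forms \<phi> CARD('n)) p" if "p \<in> vecs (L2_forms \<phi> CARD('n))" for p
      using q[OF cf_L2f[OF that, of UNIV]] by (simp add: vecs_L2 hnorm_L2 hnorm_top)
    show "((\<lambda>z. 4 * cf p UNIV z), cf y UNIV) \<in> Defs.resolvent L2_functions {(u, f). weak_H u f} (4 * (\<mu> / 4)) \<and>
        hnorm L2_functions (cf y UNIV) = hnorm (L2_forms \<phi> CARD('n)) y"
      if "(p, y) \<in> Defs.resolvent (L2_forms \<phi> CARD('n)) (complex_laplacian \<phi> CARD('n)) (\<mu> / 4)" for p y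
      using that unfolding resolvent_top_iff by (simp add: hnorm_L2 hnorm_top)
    show "\<exists>x. (p, x) \<in> Defs.resolvent (L2_forms \<phi> CARD('n)) (complex_laplacian \<phi> CARD('n)) (\<mu> / 4)"
      if p: "p \<in> vecs (L2_forms \<phi> CARD('n))"
        and y: "((\<lambda>z. 4 * cf p UNIV z), y) \<in> Defs.resolvent L2_functions {(u, f). weak_H u f} (4 * (\<mu> / 4))" for p y
    proof -
      have "L2f y" using subsetD[OF resolvent_weak_H_vecs y] by (simp add: vecs_L2)
      then show ?thesis using p y unfolding resolvent_top_iff by (intro exI[of _ "topf y"]) (simp add: topf_vecs)
    qed
    show "topf v \<in> vecs (L2_forms \<phi> CARD('n)) \<and> hnorm (L2_forms \<phi> CARD('n)) (y - topf v) = hnorm L2_functions (cf y UNIV - v)"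
      if "v \<in> vecs L2_functions" for y v
      using that unfolding vecs_L2 hnorm_L2 hnorm_top cf_diff cf_top by (simp add: topf_vecs fun_diff_def)
  qed simp
  then show "\<exists>\<mu>. compact_op (L2_forms \<phi> CARD('n)) (Defs.resolvent (L2_forms \<phi> CARD('n)) (complex_laplacian \<phi> CARD('n)) \<mu>)" ..
qed

end

section \<open>A gauge adapted to a ball\<close>

text \<open>The power t^m is there because every derivative in x produces a factor t; with m as a
  parameter the family is closed under differentiation.\<close>

definition ray_integral :: "nat \<Rightarrow> 'a::euclidean_space \<Rightarrow> ('a \<Rightarrow> real) \<Rightarrow> 'a \<Rightarrow> real" where
  "ray_integral m c f x = (\<integral>t. indicator {0..1} t * (t ^ m * f (c + t *\<^sub>R (x - c))) \<partial>lborel)"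

lemma ray_integrable:
  fixes f :: "'a::euclidean_space \<Rightarrow> real"
  assumes "continuous_on UNIV f"
  shows "integrable lborel (\<lambda>t. indicator {0..1} t * (t ^ m * f (c + t *\<^sub>R (x - c))))"
proof -
  have "continuous_on {0..1} (\<lambda>t. t ^ m * f (c + t *\<^sub>R (x - c)))"
    by (intro continuous_intros continuous_on_compose2[OF assms]) auto
  from borel_integrable_compact[OF _ this] show ?thesis by simp
qed

lemma ray_integral_has_derivative:
  fixes f :: "'a::euclidean_space \<Rightarrow> real"
  assumes f: "smooth f"
  shows "(ray_integral m c f has_derivative (\<lambda>v. \<Sum>b\<in>Basis. (v \<bullet> b) *\<^sub>R ray_integral (Suc m) c (pd b f) x0)) (at x0)"
proof -
  let ?F = "\<lambda>x t. indicator {0..1} t * (t ^ m * f (c + t *\<^sub>R (x - c)))"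
  have aff: "c + t *\<^sub>R (x - c) = (c - t *\<^sub>R c) + t *\<^sub>R x" for t and x :: 'a by (simp add: algebra_simps)
  have sm: "smooth (\<lambda>x. f ((c - t *\<^sub>R c) + t *\<^sub>R x))" for t
    by (intro smooth_compose[OF f] smooth_intros)
  have diff: "(\<lambda>x. ?F x t) differentiable at x" for x t
    unfolding aff by (intro smooth_differentiable smooth_mult smooth_const sm)
  have pdF: "pd b (\<lambda>x. ?F x t) x = indicator {0..1} t * (t ^ Suc m * pd b f (c + t *\<^sub>R (x - c)))" for b t x
  proof -
    have "pd b (\<lambda>x. (indicator {0..1} t * t ^ m) * f ((c - t *\<^sub>R c) + t *\<^sub>R x)) x =
        (indicator {0..1} t * t ^ m) * pd b (\<lambda>x. f ((c - t *\<^sub>R c) + t *\<^sub>R x)) x"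
      by (rule pd_cmult[OF smooth_differentiable[OF sm]])
    also have "pd b (\<lambda>x. f ((c - t *\<^sub>R c) + t *\<^sub>R x)) x = t *\<^sub>R pd b f ((c - t *\<^sub>R c) + t *\<^sub>R x)"
      by (rule pd_affine[OF smooth_differentiable[OF f]])
    finally show ?thesis unfolding aff by (simp add: mult_ac)
  qed
  \<comment> \<open>This ball contains every segment from c to a point within distance 1 of
    x0.\<close>
  have "\<exists>L>0. \<forall>x y. norm x \<le> norm x0 + 2 * norm c + 1 \<longrightarrow> norm y \<le> norm x0 + 2 * norm c + 1 \<longrightarrow> norm (pd b f x - pd b f y) \<le> L * dist x y"
    if "b \<in> Basis" for b
    using smooth_lipschitz_cball[OF smooth_pd[OF f that], of "norm x0 + 2 * norm c + 1"] by metis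
  then obtain L where L: "\<And>b. b \<in> Basis \<Longrightarrow> L b > 0" "\<And>b x y. b \<in> Basis \<Longrightarrow> norm x \<le> norm x0 + 2 * norm c + 1 \<Longrightarrow>
      norm y \<le> norm x0 + 2 * norm c + 1 \<Longrightarrow> norm (pd b f x - pd b f y) \<le> L b * dist x y" by metis
  define M where "M = (\<Sum>b\<in>Basis. L b)"
  have M: "M > 0" unfolding M_def using L(1) by (intro sum_pos) auto
  have LM: "L b \<le> M" if "b \<in> Basis" for b
    unfolding M_def by (rule member_le_sum) (use that L(1) in \<open>auto simp: less_imp_le\<close>)
  have "((\<lambda>x. \<integral>t. ?F x t \<partial>lborel) has_derivative
      (\<lambda>v. \<Sum>b\<in>Basis. (v \<bullet> b) *\<^sub>R (\<integral>t. pd b (\<lambda>x. ?F x t) x0 \<partial>lborel))) (at x0)"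
  proof (rule has_derivative_integral[where g = "indicator {0..1}"])
    show "integrable lborel (?F x)" for x by (intro ray_integrable smooth_continuous f)
    show "integrable lborel (\<lambda>t. pd b (\<lambda>x. ?F x t) x0)" if "b \<in> Basis" for b
      unfolding pdF by (intro ray_integrable smooth_continuous smooth_pd f that)
    show "integrable lborel (indicator {0..1::real} :: real \<Rightarrow> real)" by simp
    fix e :: real assume e: "e > 0"
    show "\<exists>d>0. \<forall>x t. \<forall>b\<in>Basis. dist x x0 < d \<longrightarrow>
       norm (pd b (\<lambda>x. ?F x t) x - pd b (\<lambda>x. ?F x t) x0) \<le> e * indicator {0..1} t"
    proof (intro exI[of _ "min 1 (e / M)"] conjI allI ballI impI)
      fix x b :: 'a and t :: real assume b: "b \<in> Basis" and x: "dist x x0 < min 1 (e / M)"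
      show "norm (pd b (\<lambda>x. ?F x t) x - pd b (\<lambda>x. ?F x t) x0) \<le> e * indicator {0..1} t"
      proof (cases "t \<in> {0..1}")
        case True
        have n: "norm (c + t *\<^sub>R (y - c)) \<le> norm x0 + 2 * norm c + 1" if "dist y x0 < 1" for y
        proof -
          have "norm (t *\<^sub>R (y - c)) \<le> norm (y - c)" using True by (simp add: mult_left_le_one_le)
          moreover have "norm (y - c) \<le> norm y + norm c" by (rule norm_triangle_ineq4)
          moreover have "norm y \<le> norm x0 + 1" using that norm_triangle_ineq2[of y x0] by (simp add: dist_norm)
          ultimately show ?thesis using norm_triangle_ineq[of c "t *\<^sub>R (y - c)"] by linarith
        qed
        have "norm (pd b f (c + t *\<^sub>R (x - c)) - pd b f (c + t *\<^sub>R (x0 - c))) \<le> L b * dist (c + t *\<^sub>R (x - c)) (c + t *\<^sub>R (x0 - c))"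
          by (rule L(2)[OF b n n]) (use x in auto)
        also have "dist (c + t *\<^sub>R (x - c)) (c + t *\<^sub>R (x0 - c)) = t * dist x x0"
          using True by (simp add: dist_norm flip: scaleR_diff_right)
        also have "L b * (t * dist x x0) \<le> M * (1 * (e / M))"
          using x LM[OF b] M True L(1)[OF b] by (intro mult_mono) auto
        finally have "norm (pd b f (c + t *\<^sub>R (x - c)) - pd b f (c + t *\<^sub>R (x0 - c))) \<le> e" using M by simp
        then have "t ^ Suc m * norm (pd b f (c + t *\<^sub>R (x - c)) - pd b f (c + t *\<^sub>R (x0 - c))) \<le> 1 * e"
          using True by (intro mult_mono power_le_one) auto
        then show ?thesis using True unfolding pdF
          by (simp add: abs_mult flip: right_diff_distrib)
      qed (simp add: pdF)
    qed (use e M in auto)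
  qed (use diff in auto)
  then show ?thesis by (simp add: pdF ray_integral_def[abs_def])
qed

lemma pd_ray_integral:
  assumes "smooth f" "b \<in> Basis"
  shows "pd b (ray_integral m c f) = ray_integral (Suc m) c (pd b f)"
proof
  fix x
  have "(\<Sum>i\<in>Basis. (b \<bullet> i) *\<^sub>R ray_integral (Suc m) c (pd i f) x) = (\<Sum>i\<in>Basis. if i = b then ray_integral (Suc m) c (pd b f) x else 0)"
    using assms(2) by (intro sum.cong) (auto simp: inner_Basis)
  then show "pd b (ray_integral m c f) x = ray_integral (Suc m) c (pd b f) x"
    using has_derivative_pd[OF ray_integral_has_derivative[OF assms(1)]] assms(2) by simp
qed

lemma smooth_ray_integral:
  fixes f :: "'a::euclidean_space \<Rightarrow> real"
  assumes "smooth f" shows "smooth (ray_integral m c f)"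
proof (rule smooth_coinduct[of "\<lambda>F. \<exists>m f. smooth f \<and> F = ray_integral m c f"])
  show "\<exists>m' f'. smooth f' \<and> ray_integral m c f = ray_integral m' c f'" using assms by blast
  show "F differentiable at x" if "\<exists>m f. smooth f \<and> F = ray_integral m c f" for F x
    using that ray_integral_has_derivative unfolding differentiable_def by blast
  show "\<exists>m f. smooth f \<and> pd b F = ray_integral m c f" if "\<exists>m f. smooth f \<and> F = ray_integral m c f" "b \<in> Basis" for F b
    using that pd_ray_integral smooth_pd by blast
qed

text \<open>The fundamental theorem of calculus for t f(c + t (x - c)) on [0, 1]. It is what
  converts ray averages of A back into the value of A at x.\<close>

lemma ray_integral_fundamental:
  fixes f :: "'a::euclidean_space \<Rightarrow> real"
  assumes f: "smooth f"
  shows "f x = ray_integral 0 c f x + (\<Sum>a\<in>Basis. ((x - c) \<bullet> a) * ray_integral 1 c (pd a f) x)"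
proof -
  let ?p = "\<lambda>t. c + t *\<^sub>R (x - c)"
  let ?g = "\<lambda>t. t ^ 0 * f (?p t) + (\<Sum>a\<in>Basis. ((x - c) \<bullet> a) * (t ^ 1 * pd a f (?p t)))"
  have hr: "((\<lambda>t. t * f (?p t)) has_real_derivative ?g t) (at t)" for t
  proof -
    have eq: "pd (x - c) f (?p t) = (\<Sum>a\<in>Basis. ((x - c) \<bullet> a) * pd a f (?p t))"
      using has_derivative_pd[OF has_derivative_pd_sum[OF smooth_differentiable[OF f]], of "x - c" "?p t"]
      unfolding real_scaleR_def .
    have "((\<lambda>t. t * f (?p t)) has_real_derivative (f (?p t) + t * pd (x - c) f (?p t))) (at t)"
      using DERIV_mult[OF DERIV_ident has_real_derivative_line[OF smooth_differentiable[OF f], of c "x - c" t]]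
      by (simp add: add.commute mult.commute)
    then show ?thesis unfolding eq by (simp add: sum_distrib_left mult_ac)
  qed
  have d: "((\<lambda>t. t * f (?p t)) has_vector_derivative ?g t) (at t within {0..1})" for t
    using hr[of t] unfolding has_real_derivative_iff_has_vector_derivative by (rule has_vector_derivative_at_within)
  have ct: "continuous_on {0..1} (\<lambda>t. h (?p t))" if "smooth h" for h :: "'a \<Rightarrow> real"
    by (intro continuous_on_compose2[OF smooth_continuous[OF that, of UNIV]] continuous_intros) auto
  have "continuous_on {0..1} ?g" by (intro continuous_intros ct f smooth_pd) auto
  from integral_FTC_Icc[OF _ d this] have "(\<integral>t. indicator {0..1} t *\<^sub>R ?g t \<partial>lborel) = f x" by simp
  also have "(\<integral>t. indicator {0..1} t *\<^sub>R ?g t \<partial>lborel) =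
      (\<integral>t. indicator {0..1} t * (t ^ 0 * f (?p t)) + (\<Sum>a\<in>Basis. ((x - c) \<bullet> a) * (indicator {0..1} t * (t ^ 1 * pd a f (?p t)))) \<partial>lborel)"
    by (rule Bochner_Integration.integral_cong) (simp_all add: distrib_left sum_distrib_left mult_ac)
  also have "\<dots> = ray_integral 0 c f x + (\<Sum>a\<in>Basis. ((x - c) \<bullet> a) * ray_integral 1 c (pd a f) x)"
  proof -
    have i0: "integrable lborel (\<lambda>t. indicator {0..1} t * (t ^ 0 * f (?p t)))"
      by (intro ray_integrable smooth_continuous f)
    have i1: "integrable lborel (\<lambda>t. ((x - c) \<bullet> a) * (indicator {0..1} t * (t ^ 1 * pd a f (?p t))))" if "a \<in> Basis" for a
      by (intro integrable_mult_right ray_integrable smooth_continuous smooth_pd f that)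
    show ?thesis
      unfolding ray_integral_def
      by (subst Bochner_Integration.integral_add[OF i0 Bochner_Integration.integrable_sum[OF i1]], assumption)
         (subst Bochner_Integration.integral_sum[OF i1], auto)
  qed
  finally show ?thesis by simp
qed

text \<open>The line integral of A along the segment from c to x, that is, the gauge function of the
  radial or Fock-Schwinger gauge with base point c.\<close>

definition ray_gauge :: "('a::euclidean_space \<Rightarrow> 'a \<Rightarrow> real) \<Rightarrow> 'a \<Rightarrow> 'a \<Rightarrow> real" where
  "ray_gauge A c x = (\<Sum>a\<in>Basis. ((x - c) \<bullet> a) * ray_integral 0 c (A a) x)"

lemma smooth_ray_gauge:
  assumes "\<And>a. a \<in> Basis \<Longrightarrow> smooth (A a)"
  shows "smooth (ray_gauge A c)"
  unfolding ray_gauge_def[abs_def] by (intro smooth_intros smooth_ray_integral assms)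

text \<open>The homotopy formula of the Poincare lemma: the difference between the gradient of the
  gauge function and A depends on A only through its field, averaged along the ray with weight
  t.\<close>

lemma pd_ray_gauge:
  fixes A :: "'a::euclidean_space \<Rightarrow> 'a \<Rightarrow> real"
  assumes A: "\<And>a. a \<in> Basis \<Longrightarrow> smooth (A a)" and b: "b \<in> Basis"
  shows "pd b (ray_gauge A c) x - A b x =
    (\<Sum>a\<in>Basis. ((x - c) \<bullet> a) * ray_integral 1 c (\<lambda>y. pd b (A a) y - pd a (A b) y) x)"
proof -
  have r: "smooth (ray_integral 0 c (A a))" if "a \<in> Basis" for a by (intro smooth_ray_integral A that)
  have l: "smooth (\<lambda>x. (x - c) \<bullet> a)" for a by (intro smooth_intros)
  have pl: "pd b (\<lambda>x. (x - c) \<bullet> a) x = b \<bullet> a" for a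
    by (rule has_derivative_pd) (auto intro!: derivative_eq_intros)
  have "pd b (ray_gauge A c) x = (\<Sum>a\<in>Basis. pd b (\<lambda>x. ((x - c) \<bullet> a) * ray_integral 0 c (A a) x) x)"
    unfolding ray_gauge_def[abs_def] by (intro pd_sum smooth_differentiable smooth_mult l r)
  also have "\<dots> = (\<Sum>a\<in>Basis. ((x - c) \<bullet> a) * ray_integral 1 c (pd b (A a)) x + (b \<bullet> a) * ray_integral 0 c (A a) x)"
  proof (rule sum.cong[OF refl])
    fix a :: 'a assume a: "a \<in> Basis"
    show "pd b (\<lambda>x. ((x - c) \<bullet> a) * ray_integral 0 c (A a) x) x =
        ((x - c) \<bullet> a) * ray_integral 1 c (pd b (A a)) x + (b \<bullet> a) * ray_integral 0 c (A a) x"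
      using pd_mult[OF smooth_differentiable[OF l] smooth_differentiable[OF r[OF a]], of b a x]
      by (simp add: pl pd_ray_integral[OF A[OF a] b])
  qed
  also have "\<dots> = (\<Sum>a\<in>Basis. ((x - c) \<bullet> a) * ray_integral 1 c (pd b (A a)) x) + ray_integral 0 c (A b) x"
  proof -
    have "(\<Sum>a\<in>Basis. (b \<bullet> a) * ray_integral 0 c (A a) x) = (\<Sum>a\<in>Basis. if a = b then ray_integral 0 c (A b) x else 0)"
      using b by (intro sum.cong) (auto simp: inner_Basis)
    then show ?thesis using b by (simp add: sum.distrib)
  qed
  finally have "pd b (ray_gauge A c) x - A b x = (\<Sum>a\<in>Basis. ((x - c) \<bullet> a) * (ray_integral 1 c (pd b (A a)) x - ray_integral 1 c (pd a (A b)) x))"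
    using ray_integral_fundamental[OF A[OF b], of x c] by (simp add: right_diff_distrib sum_subtractf)
  also have "\<dots> = (\<Sum>a\<in>Basis. ((x - c) \<bullet> a) * ray_integral 1 c (\<lambda>y. pd b (A a) y - pd a (A b) y) x)"
  proof (rule sum.cong[OF refl])
    fix a :: 'a assume a: "a \<in> Basis"
    have "ray_integral 1 c (\<lambda>y. pd b (A a) y - pd a (A b) y) x = ray_integral 1 c (pd b (A a)) x - ray_integral 1 c (pd a (A b)) x"
      unfolding ray_integral_def right_diff_distrib
      by (intro Bochner_Integration.integral_diff ray_integrable smooth_continuous smooth_pd A a b)
    then show "((x - c) \<bullet> a) * (ray_integral 1 c (pd b (A a)) x - ray_integral 1 c (pd a (A b)) x) =
      ((x - c) \<bullet> a) * ray_integral 1 c (\<lambda>y. pd b (A a) y - pd a (A b) y) x" by simp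
  qed
  finally show ?thesis .
qed

text \<open>Jensen's inequality, in the form that the variance of f along the segment is
  nonnegative.\<close>

lemma ray_integral_square_le:
  fixes f :: "'a::euclidean_space \<Rightarrow> real"
  assumes f: "continuous_on UNIV f"
  shows "(ray_integral 0 c f x)\<^sup>2 \<le> ray_integral 0 c (\<lambda>y. (f y)\<^sup>2) x"
proof -
  let ?I = "\<lambda>t. indicator {0..1::real} t :: real"
  define h where "h t = f (c + t *\<^sub>R (x - c))" for t
  define m where "m = ray_integral 0 c f x"
  have i: "integrable lborel (\<lambda>t. ?I t * h t)" "integrable lborel (\<lambda>t. ?I t * (h t)\<^sup>2)"
    using ray_integrable[OF f, of 0 c x] ray_integrable[OF continuous_on_power[OF f], of 0 c x 2]
    by (simp_all add: h_def)
  have "0 \<le> (\<integral>t. ?I t * (h t - m)\<^sup>2 \<partial>lborel)" by simp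
  also have "\<dots> = (\<integral>t. ?I t * (h t)\<^sup>2 - 2 * m * (?I t * h t) + m\<^sup>2 * ?I t \<partial>lborel)"
    by (rule Bochner_Integration.integral_cong) (simp_all add: power2_diff algebra_simps)
  also have "\<dots> = (\<integral>t. ?I t * (h t)\<^sup>2 \<partial>lborel) - 2 * m * (\<integral>t. ?I t * h t \<partial>lborel) + m\<^sup>2"
    using i by simp
  also have "(\<integral>t. ?I t * h t \<partial>lborel) = m" by (simp add: m_def ray_integral_def h_def)
  finally have "m\<^sup>2 \<le> (\<integral>t. ?I t * (h t)\<^sup>2 \<partial>lborel)" by (simp add: power2_eq_square)
  then show ?thesis unfolding m_def by (simp add: ray_integral_def h_def)
qed

text \<open>A change of variables in \<open>x\<close> for \<open>t \<ge> 1/2\<close> and in \<open>c\<close> for \<open>t \<le> 1/2\<close> avoids the singularity of the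
  Jacobian, so averaging over the base point \<open>c\<close> of the gauge costs only a constant.\<close>

lemma averaged_ray_integral:
  fixes \<tau> :: "'a::euclidean_space \<Rightarrow> ennreal"
  assumes [measurable]: "\<tau> \<in> borel_measurable borel" and B: "convex B" "B \<in> sets borel"
  shows "(\<integral>\<^sup>+c. indicator B c * (\<integral>\<^sup>+x. indicator B x * (\<integral>\<^sup>+t. indicator {0..1::real} t * \<tau> (c + t *\<^sub>R (x - c)) \<partial>lborel) \<partial>lborel) \<partial>lborel) \<le>
    ennreal (2 ^ DIM('a)) * (\<integral>\<^sup>+y. indicator B y * \<tau> y \<partial>lborel) * emeasure lborel B"
proof -
  have [measurable]: "B \<in> sets borel" by (rule B)
  let ?I = "\<lambda>t. indicator {0..1::real} t :: ennreal"
  define J where "J = (\<integral>\<^sup>+y. indicator B y * \<tau> y \<partial>lborel)"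
  have conv: "c + t *\<^sub>R (x - c) \<in> B" if "c \<in> B" "x \<in> B" "t \<in> {0..1}" for c x t
    using convexD[OF B(1) that(1,2), of "1 - t" t] that(3) by (simp add: algebra_simps)
  \<comment> \<open>A dilation by s \<ge> 1/2 changes volume by at least the factor 2 ^ (- DIM). It
    is used with s = t in the variable x and with s = 1 - t in the variable c; convexity keeps the
    image point in B.\<close>
  have sub: "(\<integral>\<^sup>+x. indicator B (y + s *\<^sub>R x) * \<tau> (y + s *\<^sub>R x) \<partial>lborel) \<le> ennreal (2 ^ DIM('a)) * J" if s: "s \<ge> 1 / 2" for s :: real and y
  proof -
    have "J = ennreal (\<bar>s\<bar> ^ DIM('a)) * (\<integral>\<^sup>+x. indicator B (y + s *\<^sub>R x) * \<tau> (y + s *\<^sub>R x) \<partial>lborel)"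
      unfolding J_def using s by (intro nn_integral_lborel_affine) auto
    then have "ennreal (2 ^ DIM('a)) * J = ennreal (2 ^ DIM('a) * \<bar>s\<bar> ^ DIM('a)) * (\<integral>\<^sup>+x. indicator B (y + s *\<^sub>R x) * \<tau> (y + s *\<^sub>R x) \<partial>lborel)"
      by (simp add: ennreal_mult mult.assoc)
    moreover have "1 \<le> 2 ^ DIM('a) * \<bar>s\<bar> ^ DIM('a)"
      unfolding power_mult_distrib[symmetric] using s by (intro one_le_power) auto
    then have "1 * (\<integral>\<^sup>+x. indicator B (y + s *\<^sub>R x) * \<tau> (y + s *\<^sub>R x) \<partial>lborel) \<le>
        ennreal (2 ^ DIM('a) * \<bar>s\<bar> ^ DIM('a)) * (\<integral>\<^sup>+x. indicator B (y + s *\<^sub>R x) * \<tau> (y + s *\<^sub>R x) \<partial>lborel)"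
      by (intro mult_right_mono) (auto simp: ennreal_1[symmetric] simp del: ennreal_1 intro: ennreal_leI)
    ultimately show ?thesis by simp
  qed
  let ?f = "\<lambda>t c x. ?I t * (indicator B c * (indicator B x * \<tau> (c + t *\<^sub>R (x - c))))"
  have pt: "(\<integral>\<^sup>+c. \<integral>\<^sup>+x. ?f t c x \<partial>lborel \<partial>lborel) \<le> ?I t * (ennreal (2 ^ DIM('a)) * J * emeasure lborel B)" for t
  proof (cases "t \<in> {0..1}")
    case t: True
    show ?thesis
    proof (cases "t \<ge> 1 / 2")
      case True
      have "(\<integral>\<^sup>+c. \<integral>\<^sup>+x. ?f t c x \<partial>lborel \<partial>lborel) \<le> (\<integral>\<^sup>+c. indicator B c * (ennreal (2 ^ DIM('a)) * J) \<partial>lborel)"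
      proof (rule nn_integral_mono)
        fix c :: 'a
        have "(\<integral>\<^sup>+x. ?f t c x \<partial>lborel) \<le> (\<integral>\<^sup>+x. indicator B c * (indicator B ((c - t *\<^sub>R c) + t *\<^sub>R x) * \<tau> ((c - t *\<^sub>R c) + t *\<^sub>R x)) \<partial>lborel)"
          using t conv[of c _ t] by (intro nn_integral_mono) (auto simp: indicator_def algebra_simps)
        also have "\<dots> = indicator B c * (\<integral>\<^sup>+x. indicator B ((c - t *\<^sub>R c) + t *\<^sub>R x) * \<tau> ((c - t *\<^sub>R c) + t *\<^sub>R x) \<partial>lborel)"
          by (rule nn_integral_cmult) measurable
        also have "\<dots> \<le> indicator B c * (ennreal (2 ^ DIM('a)) * J)" by (intro mult_left_mono sub True) auto
        finally show "(\<integral>\<^sup>+x. ?f t c x \<partial>lborel) \<le> indicator B c * (ennreal (2 ^ DIM('a)) * J)" .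
      qed
      also have "\<dots> = ennreal (2 ^ DIM('a)) * J * emeasure lborel B"
        by (subst nn_integral_multc) (auto simp: mult.commute)
      finally show ?thesis using t by simp
    next
      case False
      have "(\<integral>\<^sup>+c. \<integral>\<^sup>+x. ?f t c x \<partial>lborel \<partial>lborel) = (\<integral>\<^sup>+x. \<integral>\<^sup>+c. ?f t c x \<partial>lborel \<partial>lborel)"
        by (rule lborel_pair.Fubini') measurable
      also have "\<dots> \<le> (\<integral>\<^sup>+x. indicator B x * (ennreal (2 ^ DIM('a)) * J) \<partial>lborel)"
      proof (rule nn_integral_mono)
        fix x :: 'a
        have "(\<integral>\<^sup>+c. ?f t c x \<partial>lborel) \<le> (\<integral>\<^sup>+c. indicator B x * (indicator B (t *\<^sub>R x + (1 - t) *\<^sub>R c) * \<tau> (t *\<^sub>R x + (1 - t) *\<^sub>R c)) \<partial>lborel)"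
          using t conv[of _ x t] by (intro nn_integral_mono) (auto simp: indicator_def algebra_simps)
        also have "\<dots> = indicator B x * (\<integral>\<^sup>+c. indicator B (t *\<^sub>R x + (1 - t) *\<^sub>R c) * \<tau> (t *\<^sub>R x + (1 - t) *\<^sub>R c) \<partial>lborel)"
          by (rule nn_integral_cmult) measurable
        also have "\<dots> \<le> indicator B x * (ennreal (2 ^ DIM('a)) * J)" using False by (intro mult_left_mono sub) auto
        finally show "(\<integral>\<^sup>+c. ?f t c x \<partial>lborel) \<le> indicator B x * (ennreal (2 ^ DIM('a)) * J)" .
      qed
      also have "\<dots> = ennreal (2 ^ DIM('a)) * J * emeasure lborel B"
        by (subst nn_integral_multc) (auto simp: mult.commute)
      finally show ?thesis using t by simp
    qed
  qed simp
  have "(\<integral>\<^sup>+c. indicator B c * (\<integral>\<^sup>+x. indicator B x * (\<integral>\<^sup>+t. ?I t * \<tau> (c + t *\<^sub>R (x - c)) \<partial>lborel) \<partial>lborel) \<partial>lborel) =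
      (\<integral>\<^sup>+c. \<integral>\<^sup>+x. \<integral>\<^sup>+t. ?f t c x \<partial>lborel \<partial>lborel \<partial>lborel)"
    by (auto simp: nn_integral_cmult[symmetric] mult_ac intro!: nn_integral_cong)
  also have "\<dots> = (\<integral>\<^sup>+c. \<integral>\<^sup>+t. \<integral>\<^sup>+x. ?f t c x \<partial>lborel \<partial>lborel \<partial>lborel)"
    by (intro nn_integral_cong lborel_pair.Fubini') measurable
  also have "\<dots> = (\<integral>\<^sup>+t. \<integral>\<^sup>+c. \<integral>\<^sup>+x. ?f t c x \<partial>lborel \<partial>lborel \<partial>lborel)"
    by (intro lborel_pair.Fubini') measurable
  also have "\<dots> \<le> (\<integral>\<^sup>+t. ?I t * (ennreal (2 ^ DIM('a)) * J * emeasure lborel B) \<partial>lborel)"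
    by (intro nn_integral_mono pt)
  also have "\<dots> = ennreal (2 ^ DIM('a)) * J * emeasure lborel B"
    by (subst nn_integral_multc) auto
  finally show ?thesis unfolding J_def .
qed

section \<open>Test functions with bounded magnetic energy\<close>

context psh_weight
begin

lemma Basis_cases:
  assumes "b \<in> (Basis :: (complex, 'n) vec set)"
  obtains j where "b = X j" | j where "b = Y j"
  using assms by (auto simp: Basis_vec_def Basis_complex_def)

text \<open>Each component of the field is, up to sign and symmetry of second derivatives, half of
  one of the two combinations in \<open>hessian_offdiag\<close>. This is where positivity of the
  Hessian lets its trace control the whole field.\<close>

lemma field_bound:
  assumes "a \<in> Basis" "b \<in> Basis"
  shows "\<bar>pd b (A a) z - pd a (A b) z\<bar> \<le> 2 * tr_hessian \<phi> z"
proof -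
  have half: "pd c (\<lambda>z. f z * (1 / 2)) z = pd c f z * (1 / 2)" if "smooth f" for c and f :: "(complex, 'n) vec \<Rightarrow> real"
    using pd_mult[OF smooth_differentiable[OF that] differentiable_const[of "1 / 2 :: real"], where b = c and x = z]
    by (simp only: pd_const mult_zero_right add_0_left)
  have dd: "pd c (\<lambda>z. pd e \<phi> z * (1 / 2)) z = pd c (pd e \<phi>) z * (1 / 2)" for c e
    by (rule half[OF smooth_pd_dir[OF \<phi>]])
  have nn: "pd c (\<lambda>z. - pd e \<phi> z * (1 / 2)) z = - pd c (pd e \<phi>) z * (1 / 2)" for c e
  proof -
    have s: "smooth (pd e \<phi>)" by (rule smooth_pd_dir[OF \<phi>])
    show ?thesis using half[OF smooth_minus[OF s], of c] pd_minus[OF smooth_differentiable[OF s], of c z] by simp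
  qed
  have comm: "pd a (pd b \<phi>) z = pd b (pd a \<phi>) z" if "a \<in> Basis" "b \<in> Basis" for a b
    by (rule pd_pd_commute_real[OF \<phi> that])
  note off = hessian_offdiag[of _ _ z]
  from assms(1) show ?thesis
  proof (cases rule: Basis_cases)
    case (1 k)
    note a = this
    from assms(2) show ?thesis
    proof (cases rule: Basis_cases)
      case (1 j)
      show ?thesis unfolding a 1 A_X nn using off(2)[of j k] comm[of "Y j" "X k"] by (auto simp: abs_le_iff)
    next
      case (2 j)
      show ?thesis unfolding a 2 A_X A_Y nn dd using off(1)[of j k] comm[of "X k" "X j"] comm[of "Y k" "Y j"] by (auto simp: abs_le_iff)
    qed
  next
    case (2 k)
    note a = this
    from assms(2) show ?thesis
    proof (cases rule: Basis_cases)
      case (1 j)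
      show ?thesis unfolding a 1 A_X A_Y nn dd using off(1)[of j k] comm[of "Y k" "Y j"] by (auto simp: abs_le_iff)
    next
      case (2 j)
      show ?thesis unfolding a 2 A_Y dd using off(2)[of j k] comm[of "Y k" "X j"] by (auto simp: abs_le_iff)
    qed
  qed
qed

lemma tr_continuous: "continuous_on UNIV (tr_hessian \<phi>)"
  by (rule smooth_continuous[OF smooth_tr_hessian[OF \<phi>]])

text \<open>Inside the unit ball a segment has length at most 2 and the field is at most 2 tr(M), so
  each of the m coordinates contributes at most 4 times the ray average of tr(M). Squaring gives 16
  m^2, and Jensen moves the square inside the average.\<close>

lemma gauge_bound:
  assumes c: "c \<in> ball c0 1" and x: "x \<in> ball c0 1" and b: "b \<in> Basis"
  shows "(pd b (ray_gauge A c) x - A b x)\<^sup>2 \<le> 16 * (real DIM((complex, 'n) vec))\<^sup>2 * ray_integral 0 c (\<lambda>y. (tr_hessian \<phi> y)\<^sup>2) x"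
proof -
  let ?m = "real DIM((complex, 'n) vec)" and ?R = "ray_integral 0 c (tr_hessian \<phi>) x"
  have A': "smooth (A a)" if "a \<in> Basis" for a by (rule A[OF that])
  have R: "?R \<ge> 0" unfolding ray_integral_def by (intro integral_nonneg_AE AE_I2) (auto simp: tr_hessian_nonneg indicator_def)
  have xc: "norm (x - c) \<le> 2"
    using c x dist_triangle[of x c c0] by (simp add: dist_norm norm_minus_commute)
  have one: "\<bar>ray_integral 1 c (\<lambda>y. pd b (A a) y - pd a (A b) y) x\<bar> \<le> 2 * ?R" if a: "a \<in> Basis" for a
  proof -
    have cont: "continuous_on UNIV (\<lambda>y. pd b (A a) y - pd a (A b) y)"
      by (intro smooth_continuous smooth_diff smooth_pd A' a b)
    have "\<bar>ray_integral 1 c (\<lambda>y. pd b (A a) y - pd a (A b) y) x\<bar> \<le>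
        (\<integral>t. 2 * (indicator {0..1} t * (t ^ 0 * tr_hessian \<phi> (c + t *\<^sub>R (x - c)))) \<partial>lborel)"
      unfolding ray_integral_def real_norm_def[symmetric]
    proof (rule order_trans[OF integral_norm_bound integral_mono])
      show "integrable lborel (\<lambda>t. norm (indicator {0..1} t * (t ^ 1 * (pd b (A a) (c + t *\<^sub>R (x - c)) - pd a (A b) (c + t *\<^sub>R (x - c))))))"
        by (intro integrable_norm ray_integrable[OF cont])
      show "integrable lborel (\<lambda>t. 2 * (indicator {0..1} t * (t ^ 0 * tr_hessian \<phi> (c + t *\<^sub>R (x - c)))))"
        by (intro integrable_mult_right ray_integrable[OF tr_continuous])
      fix t :: real
      show "norm (indicator {0..1} t * (t ^ 1 * (pd b (A a) (c + t *\<^sub>R (x - c)) - pd a (A b) (c + t *\<^sub>R (x - c))))) \<le>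
          2 * (indicator {0..1} t * (t ^ 0 * tr_hessian \<phi> (c + t *\<^sub>R (x - c))))"
      proof (cases "t \<in> {0..1}")
        case True
        have "\<bar>t\<bar> * \<bar>pd b (A a) (c + t *\<^sub>R (x - c)) - pd a (A b) (c + t *\<^sub>R (x - c))\<bar> \<le> 1 * (2 * tr_hessian \<phi> (c + t *\<^sub>R (x - c)))"
          using True by (intro mult_mono field_bound a b) auto
        then show ?thesis using True by (simp add: abs_mult)
      qed simp
    qed
    then show ?thesis by (simp add: ray_integral_def)
  qed
  have "\<bar>pd b (ray_gauge A c) x - A b x\<bar> \<le> (\<Sum>a\<in>(Basis::(complex, 'n) vec set). 2 * (2 * ?R))"
  proof (subst pd_ray_gauge[OF A' b], assumption, rule order_trans[OF sum_abs sum_mono])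
    fix a :: "(complex, 'n) vec" assume a: "a \<in> Basis"
    show "\<bar>((x - c) \<bullet> a) * ray_integral 1 c (\<lambda>y. pd b (A a) y - pd a (A b) y) x\<bar> \<le> 2 * (2 * ?R)"
      unfolding abs_mult using order_trans[OF Basis_le_norm[OF a] xc] by (intro mult_mono one a) auto
  qed
  then have "\<bar>pd b (ray_gauge A c) x - A b x\<bar> \<le> 4 * ?m * ?R" by simp
  then have "(pd b (ray_gauge A c) x - A b x)\<^sup>2 \<le> (4 * ?m * ?R)\<^sup>2"
    using power_mono[of "\<bar>pd b (ray_gauge A c) x - A b x\<bar>" _ 2] by simp
  also have "\<dots> = 16 * ?m\<^sup>2 * ?R\<^sup>2" by (simp add: power_mult_distrib)
  also have "\<dots> \<le> 16 * ?m\<^sup>2 * ray_integral 0 c (\<lambda>y. (tr_hessian \<phi> y)\<^sup>2) x"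
    by (intro mult_left_mono ray_integral_square_le tr_continuous) auto
  finally show ?thesis .
qed

lemma pd_cis:
  fixes \<theta> :: "'b::euclidean_space \<Rightarrow> real"
  assumes "smooth \<theta>"
  shows "pd b (\<lambda>x. cis (\<theta> x)) x = \<i> * of_real (pd b \<theta> x) * cis (\<theta> x)"
proof -
  have d: "\<theta> differentiable at x" by (rule smooth_differentiable[OF assms])
  have s: "(\<lambda>x. complex_of_real (cos (\<theta> x))) differentiable at x" "(\<lambda>x. complex_of_real (sin (\<theta> x))) differentiable at x"
    "(\<lambda>x. \<i> * complex_of_real (sin (\<theta> x))) differentiable at x"
    by (intro smooth_differentiable smooth_intros assms)+
  have r: "(\<lambda>x. cos (\<theta> x)) differentiable at x" "(\<lambda>x. sin (\<theta> x)) differentiable at x"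
    by (intro smooth_differentiable smooth_intros assms)+
  have 1: "pd b (\<lambda>x. complex_of_real (cos (\<theta> x))) x = of_real (- sin (\<theta> x) * pd b \<theta> x)"
    using pd_of_real[OF r(1), of b] pd_compose_real[OF DERIV_cos d, of b] by simp
  have 2: "pd b (\<lambda>x. complex_of_real (sin (\<theta> x))) x = of_real (cos (\<theta> x) * pd b \<theta> x)"
    using pd_of_real[OF r(2), of b] pd_compose_real[OF DERIV_sin d, of b] by simp
  have "(\<lambda>x. cis (\<theta> x)) = (\<lambda>x. of_real (cos (\<theta> x)) + \<i> * of_real (sin (\<theta> x)))"
    by (simp add: cis.code complex_eq_iff fun_eq_iff)
  then have "pd b (\<lambda>x. cis (\<theta> x)) x = pd b (\<lambda>x. complex_of_real (cos (\<theta> x))) x + \<i> * pd b (\<lambda>x. complex_of_real (sin (\<theta> x))) x"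
    using pd_add[OF s(1,3), of b] pd_cmult[OF s(2), of b \<i>] by simp
  then show ?thesis unfolding 1 2 by (simp add: complex_eq_iff)
qed

definition local_energy :: "(complex, 'n) vec \<Rightarrow> real" where
  "local_energy z = (LINT w:ball z 1|lborel. (tr_hessian \<phi> w)\<^sup>2)"

lemma nn_local_energy:
  "(\<integral>\<^sup>+y. indicator (ball z 1) y * ennreal ((tr_hessian \<phi> y)\<^sup>2) \<partial>lborel) = ennreal (local_energy z)"
proof -
  have i: "integrable lborel (\<lambda>y. indicator (cball z 1) y *\<^sub>R (tr_hessian \<phi> y)\<^sup>2)"
    by (intro borel_integrable_compact continuous_on_power continuous_on_subset[OF tr_continuous]) auto
  have m: "(\<lambda>y. (tr_hessian \<phi> y)\<^sup>2) \<in> borel_measurable borel"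
    by (intro borel_measurable_continuous_onI continuous_on_power tr_continuous)
  have "integrable lborel (\<lambda>y. indicator (ball z 1) y *\<^sub>R (tr_hessian \<phi> y)\<^sup>2)"
  proof (rule Bochner_Integration.integrable_bound[OF i])
    show "(\<lambda>y. indicator (ball z 1) y *\<^sub>R (tr_hessian \<phi> y)\<^sup>2) \<in> borel_measurable lborel"
      using m by (intro borel_measurable_scaleR borel_measurable_indicator) auto
  qed (auto simp: indicator_def)
  from nn_integral_eq_integral[OF this] show ?thesis
    unfolding local_energy_def set_lebesgue_integral_def
    by (simp add: ennreal_mult' ennreal_indicator[symmetric])
qed

text \<open>The average over all base points is bounded, so some base point does no worse. The
  additional 1 makes the contradiction strict even when the local energy is 0.\<close>

lemma good_base_point:
  obtains c where "c \<in> ball c0 1"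
    "(\<integral>\<^sup>+x. indicator (ball c0 1) x * ennreal (ray_integral 0 c (\<lambda>y. (tr_hessian \<phi> y)\<^sup>2) x) \<partial>lborel) \<le>
      ennreal (2 ^ DIM((complex, 'n) vec) * local_energy c0 + 1)"
proof -
  let ?B = "ball c0 1" and ?S = "ennreal (2 ^ DIM((complex, 'n) vec) * local_energy c0 + 1)"
  let ?T = "ennreal (2 ^ DIM((complex, 'n) vec)) * ennreal (local_energy c0)"
  have E0: "local_energy c0 \<ge> 0"
    unfolding local_energy_def set_lebesgue_integral_def by (intro integral_nonneg_AE AE_I2) auto
  have ST: "?S = ?T + 1" using E0 by (simp add: ennreal_mult)
  have m [measurable]: "(\<lambda>y. ennreal ((tr_hessian \<phi> y)\<^sup>2)) \<in> borel_measurable borel"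
    by (intro measurable_compose[OF borel_measurable_continuous_onI[OF tr_continuous]]) measurable
  define P where "P c = (\<integral>\<^sup>+x. indicator ?B x * (\<integral>\<^sup>+t. indicator {0..1::real} t * ennreal ((tr_hessian \<phi> (c + t *\<^sub>R (x - c)))\<^sup>2) \<partial>lborel) \<partial>lborel)" for c
  have avg: "(\<integral>\<^sup>+c. indicator ?B c * P c \<partial>lborel) \<le> ?T * emeasure lborel ?B"
    using averaged_ray_integral[OF m, of ?B] unfolding P_def nn_local_energy by simp
  have "\<exists>c\<in>?B. P c \<le> ?S"
  proof (rule ccontr)
    assume "\<not> (\<exists>c\<in>?B. P c \<le> ?S)"
    then have "(\<integral>\<^sup>+c. indicator ?B c * ?S \<partial>lborel) \<le> (\<integral>\<^sup>+c. indicator ?B c * P c \<partial>lborel)"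
      by (intro nn_integral_mono) (auto simp: indicator_def not_le intro: less_imp_le)
    also have "(\<integral>\<^sup>+c. indicator ?B c * ?S \<partial>lborel) = (?T + 1) * emeasure lborel ?B"
      unfolding ST by (subst nn_integral_multc) (auto simp: mult.commute intro!: borel_measurable_indicator)
    finally have "(?T + 1) * emeasure lborel ?B \<le> ?T * emeasure lborel ?B" using avg by (rule order_trans)
    moreover have "emeasure lborel ?B = ennreal (unit_ball_vol (real DIM((complex, 'n) vec)))"
      by (simp add: emeasure_ball)
    moreover have "unit_ball_vol (real DIM((complex, 'n) vec)) > 0" by (rule unit_ball_vol_pos) simp
    moreover have "?T = ennreal (2 ^ DIM((complex, 'n) vec) * local_energy c0)" using E0 by (simp add: ennreal_mult)
    ultimately show False using E0
      by (simp add: ennreal_plus[symmetric] ennreal_mult'[symmetric] ennreal_1[symmetric] del: ennreal_plus ennreal_1)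
  qed
  then obtain c where c: "c \<in> ?B" "P c \<le> ?S" by blast
  have "ennreal (ray_integral 0 c (\<lambda>y. (tr_hessian \<phi> y)\<^sup>2) x) =
      (\<integral>\<^sup>+t. indicator {0..1::real} t * ennreal ((tr_hessian \<phi> (c + t *\<^sub>R (x - c)))\<^sup>2) \<partial>lborel)" for x
  proof -
    have "(\<integral>\<^sup>+t. ennreal (indicator {0..1::real} t * (t ^ 0 * (tr_hessian \<phi> (c + t *\<^sub>R (x - c)))\<^sup>2)) \<partial>lborel) =
        ennreal (ray_integral 0 c (\<lambda>y. (tr_hessian \<phi> y)\<^sup>2) x)"
      unfolding ray_integral_def
      by (intro nn_integral_eq_integral ray_integrable continuous_on_power tr_continuous) auto
    then show ?thesis by (simp add: ennreal_mult' ennreal_indicator[symmetric])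
  qed
  then show ?thesis using that[OF c(1)] c(2) by (simp add: P_def)
qed

text \<open>A translated bump is multiplied by exp (\<i> \<theta>), with \<theta> the ray gauge at a
  good base point. The phase leaves the modulus alone and replaces A by A minus the gradient of
  \<theta>, whose L2 norm on the ball the local energy controls. N and K do not depend on the
  centre.\<close>

lemma local_test_function:
  obtains N K where "N > 0" "K \<ge> 0" "\<And>c0. \<exists>G. cc_smooth G \<and> (\<forall>x. x \<notin> ball c0 1 \<longrightarrow> G x = 0) \<and> nsq G = N \<and>
    (\<forall>b\<in>Basis. nsq (cov b G) \<le> K * (1 + local_energy c0))"
proof -
  let ?b = "bump :: (complex, 'n) vec \<Rightarrow> real" and ?m = "real DIM((complex, 'n) vec)"
  define N where "N = (\<integral>x. (?b x)\<^sup>2 \<partial>lborel)"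
  define D where "D = (\<Sum>b\<in>Basis. \<integral>x. (pd b ?b x)\<^sup>2 \<partial>lborel)"
  \<comment> \<open>D bounds the gradient of the bump, the factor 16 m^2 is that of
    \<open>gauge_bound\<close>, and the power of 2 is the cost of averaging over the base
    point.\<close>
  define K where "K = D + 16 * ?m\<^sup>2 * (2 ^ DIM((complex, 'n) vec) + 1)"
  have bs: "smooth ?b" by (rule cc_smoothD[OF cc_smooth_bump])
  have sqi: "integrable lborel (\<lambda>x. (h x)\<^sup>2)" if "cc_smooth h" for h :: "(complex, 'n) vec \<Rightarrow> real"
    using cc_smooth_L2f[OF cc_smooth_of_real[OF that]] by (simp add: L2f_def)
  have D0: "D \<ge> 0" unfolding D_def by (intro sum_nonneg integral_nonneg_AE) auto
  have K0: "K \<ge> 0" using D0 by (simp add: K_def)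
  have N0: "N > 0"
  proof -
    have "N \<noteq> 0"
    proof
      assume "N = 0"
      then have "AE x in (lborel :: (complex, 'n) vec measure). (?b x)\<^sup>2 = 0"
        unfolding N_def using integral_nonneg_eq_0_iff_AE[OF sqi[OF cc_smooth_bump]] by simp
      then have "AE x in (lborel :: (complex, 'n) vec measure). ?b x = 0" by simp
      then have "(\<integral>x. ?b x \<partial>lborel) = 0" by (rule integral_eq_zero_AE)
      then show False using integral_bump_pos[where 'a = "(complex, 'n) vec"] by simp
    qed
    moreover have "N \<ge> 0" by (simp add: N_def)
    ultimately show ?thesis by linarith
  qed
  have "\<exists>G. cc_smooth G \<and> (\<forall>x. x \<notin> ball c0 1 \<longrightarrow> G x = 0) \<and> nsq G = N \<and>
    (\<forall>b\<in>Basis. nsq (cov b G) \<le> K * (1 + local_energy c0))" for c0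
  proof -
    obtain c where c: "c \<in> ball c0 1" "(\<integral>\<^sup>+x. indicator (ball c0 1) x * ennreal (ray_integral 0 c (\<lambda>y. (tr_hessian \<phi> y)\<^sup>2) x) \<partial>lborel) \<le>
      ennreal (2 ^ DIM((complex, 'n) vec) * local_energy c0 + 1)" using good_base_point by blast
    define \<theta> where "\<theta> = ray_gauge A c"
    have \<theta>: "smooth \<theta>" unfolding \<theta>_def by (intro smooth_ray_gauge A)
    define \<kappa> where "\<kappa> x = ?b (- c0 + 1 *\<^sub>R x)" for x
    have \<kappa>c: "cc_smooth \<kappa>" unfolding \<kappa>_def[abs_def] by (intro cc_smooth_affine cc_smooth_bump) simp
    have \<kappa>0: "\<kappa> x = 0" if "x \<notin> ball c0 1" for x
      using that unfolding \<kappa>_def by (intro bump_eq_0) (simp add: dist_norm norm_minus_commute)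
    have \<kappa>1: "\<kappa> x \<ge> 0" "\<kappa> x \<le> 1" for x
    proof -
      show "\<kappa> x \<ge> 0" by (simp add: \<kappa>_def bump_nonneg)
      have "flat 1 t \<le> 1" for t by (simp add: flat_def)
      then show "\<kappa> x \<le> 1" by (simp add: \<kappa>_def bump_def)
    qed
    define G where "G x = of_real (\<kappa> x) * cis (\<theta> x)" for x
    have G: "cc_smooth G" unfolding G_def[abs_def]
      by (intro cc_smooth_mult_left cc_smooth_of_real \<kappa>c smooth_cis \<theta>)
    have G0: "G x = 0" if "x \<notin> ball c0 1" for x using \<kappa>0[OF that] by (simp add: G_def)
    have "nsq G = (\<integral>x. (\<kappa> x)\<^sup>2 \<partial>lborel)" by (simp add: nsq_def G_def norm_mult)
    also have "\<dots> = N"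
      unfolding N_def \<kappa>_def using integral_lborel_affine[of "\<lambda>x. (?b x)\<^sup>2" 1 "- c0"] smooth_measurable[OF bs] by simp
    finally have NG: "nsq G = N" .
    have covb: "nsq (cov b G) \<le> K * (1 + local_energy c0)" if b: "b \<in> Basis" for b
    proof -
      let ?R = "ray_integral 0 c (\<lambda>y. (tr_hessian \<phi> y)\<^sup>2)"
      have E0: "local_energy c0 \<ge> 0"
        unfolding local_energy_def set_lebesgue_integral_def by (intro integral_nonneg_AE AE_I2) auto
      have R0: "?R x \<ge> 0" for x unfolding ray_integral_def by (intro integral_nonneg_AE AE_I2) auto
      have ceq: "cov b G x = (of_real (pd b \<kappa> x) + \<i> * of_real (\<kappa> x * (pd b \<theta> x - A b x))) * cis (\<theta> x)" for x
      proof -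
        have "cov b G x = pd b (\<lambda>x. complex_of_real (\<kappa> x)) x * cis (\<theta> x) + of_real (\<kappa> x) * cov b (\<lambda>x. cis (\<theta> x)) x"
          unfolding G_def[abs_def] by (rule cov_mult[OF cc_smoothD[OF cc_smooth_of_real[OF \<kappa>c]] smooth_cis[OF \<theta>]])
        also have "pd b (\<lambda>x. complex_of_real (\<kappa> x)) x = of_real (pd b \<kappa> x)"
          by (rule pd_of_real[OF smooth_differentiable[OF cc_smoothD[OF \<kappa>c]]])
        finally show ?thesis unfolding cov_def pd_cis[OF \<theta>] by (simp add: algebra_simps)
      qed
      \<comment> \<open>Apart from the phase the two terms of \<open>ceq\<close> are the real and
        the imaginary part, so their squares add up without a cross term. As 0 \<le> \<kappa> \<le>
        1, only the square of the gauged potential on the ball is left.\<close>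
      have pw: "(cmod (cov b G x))\<^sup>2 \<le> (pd b \<kappa> x)\<^sup>2 + indicator (ball c0 1) x * (16 * ?m\<^sup>2 * ?R x)" for x
      proof -
        have "(cmod (of_real (pd b \<kappa> x) + \<i> * of_real (\<kappa> x * (pd b \<theta> x - A b x))))\<^sup>2 = (pd b \<kappa> x)\<^sup>2 + (\<kappa> x * (pd b \<theta> x - A b x))\<^sup>2"
          by (simp add: cmod_power2)
        then have "(cmod (cov b G x))\<^sup>2 = (pd b \<kappa> x)\<^sup>2 + (\<kappa> x * (pd b \<theta> x - A b x))\<^sup>2"
          unfolding ceq norm_mult by simp
        moreover have "(\<kappa> x * (pd b \<theta> x - A b x))\<^sup>2 \<le> indicator (ball c0 1) x * (16 * ?m\<^sup>2 * ?R x)"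
        proof (cases "x \<in> ball c0 1")
          case True
          have "(\<kappa> x)\<^sup>2 * (pd b \<theta> x - A b x)\<^sup>2 \<le> 1 * (16 * ?m\<^sup>2 * ?R x)"
            using \<kappa>1[of x] unfolding \<theta>_def
            by (intro mult_mono gauge_bound[OF c(1) True b] power_le_one) auto
          with True show ?thesis by (simp add: power_mult_distrib)
        qed (simp add: \<kappa>0)
        ultimately show ?thesis by simp
      qed
      have px: "pd b \<kappa> = (\<lambda>x. pd b ?b (- c0 + 1 *\<^sub>R x))"
      proof
        fix x
        have "pd b (\<lambda>x. ?b (- c0 + 1 *\<^sub>R x)) x = 1 *\<^sub>R pd b ?b (- c0 + 1 *\<^sub>R x)"
          by (rule pd_affine[OF smooth_differentiable[OF bs]])
        then show "pd b \<kappa> x = pd b ?b (- c0 + 1 *\<^sub>R x)" unfolding \<kappa>_def[abs_def] by (simp only: scaleR_one)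
      qed
      have "(\<integral>x. (pd b \<kappa> x)\<^sup>2 \<partial>lborel) = (\<integral>x. (pd b ?b x)\<^sup>2 \<partial>lborel)"
        unfolding px using integral_lborel_affine[of "\<lambda>x. (pd b ?b x)\<^sup>2" 1 "- c0"] smooth_measurable[OF smooth_pd[OF bs b]] by simp
      also have "\<dots> \<le> D" unfolding D_def
        by (rule member_le_sum[OF b]) auto
      finally have d: "(\<integral>\<^sup>+x. ennreal ((pd b \<kappa> x)\<^sup>2) \<partial>lborel) \<le> ennreal D"
        using nn_integral_eq_integral[OF sqi[OF cc_smooth_pd[OF \<kappa>c b]]] by (simp add: ennreal_leI)
      have Rm: "?R \<in> borel_measurable borel"
        by (intro smooth_measurable smooth_ray_integral smooth_power smooth_tr_hessian \<phi>)
      have "(\<integral>\<^sup>+x. ennreal ((cmod (cov b G x))\<^sup>2) \<partial>lborel) \<le>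
          (\<integral>\<^sup>+x. ennreal ((pd b \<kappa> x)\<^sup>2) + ennreal (16 * ?m\<^sup>2) * (indicator (ball c0 1) x * ennreal (?R x)) \<partial>lborel)"
      proof (rule nn_integral_mono)
        fix x
        have "ennreal ((cmod (cov b G x))\<^sup>2) \<le> ennreal ((pd b \<kappa> x)\<^sup>2 + indicator (ball c0 1) x * (16 * ?m\<^sup>2 * ?R x))"
          by (rule ennreal_leI[OF pw])
        also have "\<dots> = ennreal ((pd b \<kappa> x)\<^sup>2) + ennreal (16 * ?m\<^sup>2) * (indicator (ball c0 1) x * ennreal (?R x))"
          using R0[of x] by (cases "x \<in> ball c0 1") (simp_all add: ennreal_mult)
        finally show "ennreal ((cmod (cov b G x))\<^sup>2) \<le> ennreal ((pd b \<kappa> x)\<^sup>2) + ennreal (16 * ?m\<^sup>2) * (indicator (ball c0 1) x * ennreal (?R x))" .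
      qed
      also have "\<dots> = (\<integral>\<^sup>+x. ennreal ((pd b \<kappa> x)\<^sup>2) \<partial>lborel) + ennreal (16 * ?m\<^sup>2) * (\<integral>\<^sup>+x. indicator (ball c0 1) x * ennreal (?R x) \<partial>lborel)"
      proof -
        have m1: "(\<lambda>x. ennreal ((pd b \<kappa> x)\<^sup>2)) \<in> borel_measurable lborel"
          using smooth_measurable[OF smooth_pd[OF cc_smoothD[OF \<kappa>c] b]] by simp
        have m2: "(\<lambda>x. indicator (ball c0 1) x * ennreal (?R x)) \<in> borel_measurable lborel"
          using Rm by (intro borel_measurable_times_ennreal borel_measurable_indicator) auto
        show ?thesis using m1 m2 by (simp add: nn_integral_add nn_integral_cmult)
      qed
      also have "\<dots> \<le> ennreal D + ennreal (16 * ?m\<^sup>2) * ennreal (2 ^ DIM((complex, 'n) vec) * local_energy c0 + 1)"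
        by (intro add_mono mult_left_mono d c(2)) auto
      also have "\<dots> = ennreal (D + 16 * ?m\<^sup>2 * (2 ^ DIM((complex, 'n) vec) * local_energy c0 + 1))"
        using D0 E0 by (simp add: ennreal_mult'[symmetric] del: ennreal_plus flip: ennreal_plus)
      finally have "nsq (cov b G) \<le> D + 16 * ?m\<^sup>2 * (2 ^ DIM((complex, 'n) vec) * local_energy c0 + 1)"
        using D0 E0 by (intro nn_integral_nsq_bound(2) L2f_measurable cc_smooth_L2f cc_smooth_cov G b) auto
      also have "\<dots> \<le> K * (1 + local_energy c0)"
      proof -
        have "D \<le> D * (1 + local_energy c0)" using D0 E0 by (simp add: algebra_simps)
        moreover have "2 ^ DIM((complex, 'n) vec) * local_energy c0 + 1 \<le> (2 ^ DIM((complex, 'n) vec) + 1) * (1 + local_energy c0)"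
          using E0 by (simp add: algebra_simps)
        then have "16 * ?m\<^sup>2 * (2 ^ DIM((complex, 'n) vec) * local_energy c0 + 1) \<le> 16 * ?m\<^sup>2 * ((2 ^ DIM((complex, 'n) vec) + 1) * (1 + local_energy c0))"
          by (intro mult_left_mono) auto
        ultimately show ?thesis unfolding K_def distrib_right[of D] by (simp only: mult.assoc add_mono)
      qed
      finally show ?thesis .
    qed
    show ?thesis using G G0 NG covb by blast
  qed
  then show ?thesis using that N0 K0 by blast
qed

end

section \<open>Necessity of diverging local energy\<close>

context psh_form
begin

definition fsq :: "nat \<Rightarrow> 'n form \<Rightarrow> real" where
  "fsq q u = (\<Sum>J | card J = q. nsq (cf u J))"

lemma fsq_nonneg: "fsq q u \<ge> 0"
  by (simp add: fsq_def sum_nonneg nsq_nonneg)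

lemma ip_self: "u \<in> vecs (L2_forms \<phi> q) \<Longrightarrow> ip (L2_forms \<phi> q) u u = of_real (fsq q u)"
  by (simp add: ip_forms fsq_def l2ip_self cf_L2f)

lemma hnorm_forms: "hnorm (L2_forms \<phi> q) u = sqrt (fsq q u)"
  by (simp add: hnorm_def ip_forms fsq_def Re_l2ip_self)

lemma ip_cnj: "ip (L2_forms \<phi> q) v u = cnj (ip (L2_forms \<phi> q) u v)"
  unfolding ip_forms cnj_sum by (rule sum.cong[OF refl l2ip_cnj])

lemma ip_bound:
  assumes "u \<in> vecs (L2_forms \<phi> q)" "v \<in> vecs (L2_forms \<phi> q)"
  shows "cmod (ip (L2_forms \<phi> q) u v) \<le> sqrt (fsq q u * fsq q v)"
proof (rule real_le_rsqrt)
  have "cmod (ip (L2_forms \<phi> q) u v) \<le> (\<Sum>J | card J = q. sqrt (nsq (cf u J)) * sqrt (nsq (cf v J)))"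
    unfolding ip_forms
  proof (rule sum_norm_le)
    fix J
    have "(cmod (l2ip (cf u J) (cf v J)))\<^sup>2 \<le> nsq (cf u J) * nsq (cf v J)"
      using assms by (intro l2ip_bound cf_L2f)
    then show "cmod (l2ip (cf u J) (cf v J)) \<le> sqrt (nsq (cf u J)) * sqrt (nsq (cf v J))"
      unfolding real_sqrt_mult[symmetric] by (rule real_le_rsqrt)
  qed
  then have "(cmod (ip (L2_forms \<phi> q) u v))\<^sup>2 \<le> (\<Sum>J | card J = q. sqrt (nsq (cf u J)) * sqrt (nsq (cf v J)))\<^sup>2"
    by (intro power_mono) auto
  also have "\<dots> \<le> (\<Sum>J | card J = q. (sqrt (nsq (cf u J)))\<^sup>2) * (\<Sum>J | card J = q. (sqrt (nsq (cf v J)))\<^sup>2)"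
    by (rule Cauchy_Schwarz_ineq_sum)
  also have "\<dots> = fsq q u * fsq q v" by (simp add: fsq_def nsq_nonneg)
  finally show "(cmod (ip (L2_forms \<phi> q) u v))\<^sup>2 \<le> fsq q u * fsq q v" .
qed

lemma ip_diff_left: "u \<in> vecs (L2_forms \<phi> q) \<Longrightarrow> v \<in> vecs (L2_forms \<phi> q) \<Longrightarrow> w \<in> vecs (L2_forms \<phi> q) \<Longrightarrow>
    ip (L2_forms \<phi> q) (u - v) w = ip (L2_forms \<phi> q) u w - ip (L2_forms \<phi> q) v w"
  by (simp add: ip_forms cf_diff l2ip_diff_left cf_L2f sum_subtractf)

lemma ip_diff_right: "u \<in> vecs (L2_forms \<phi> q) \<Longrightarrow> v \<in> vecs (L2_forms \<phi> q) \<Longrightarrow> w \<in> vecs (L2_forms \<phi> q) \<Longrightarrow>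
    ip (L2_forms \<phi> q) u (v - w) = ip (L2_forms \<phi> q) u v - ip (L2_forms \<phi> q) u w"
  by (simp add: ip_forms cf_diff l2ip_diff_right cf_L2f sum_subtractf)

lemma ip_add_left: "u \<in> vecs (L2_forms \<phi> q) \<Longrightarrow> v \<in> vecs (L2_forms \<phi> q) \<Longrightarrow> w \<in> vecs (L2_forms \<phi> q) \<Longrightarrow>
    ip (L2_forms \<phi> q) (u + v) w = ip (L2_forms \<phi> q) u w + ip (L2_forms \<phi> q) v w"
  by (simp add: ip_forms cf_add l2ip_add_left cf_L2f sum.distrib)

lemma ip_scale_left: "ip (L2_forms \<phi> q) (\<lambda>z. c *s u z) w = c * ip (L2_forms \<phi> q) u w"
  by (simp add: ip_forms cf_scale l2ip_cmult_left sum_distrib_left)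

lemma fsq_diff_le: "u \<in> vecs (L2_forms \<phi> q) \<Longrightarrow> v \<in> vecs (L2_forms \<phi> q) \<Longrightarrow> fsq q (u - v) \<le> 2 * fsq q u + 2 * fsq q v"
  unfolding fsq_def cf_diff sum_distrib_left sum.distrib[symmetric] by (intro sum_mono nsq_diff_le cf_L2f)

section \<open>Linearity of the graphs and forms with a single coefficient\<close>

lemma dbar_diff:
  assumes "(u, f) \<in> dbar \<phi> q" "(u', f') \<in> dbar \<phi> q"
  shows "(u - u', f - f') \<in> dbar \<phi> q"
proof -
  have v: "u \<in> vecs (L2_forms \<phi> q)" "u' \<in> vecs (L2_forms \<phi> q)" "f \<in> vecs (L2_forms \<phi> (Suc q))" "f' \<in> vecs (L2_forms \<phi> (Suc q))"
    using assms by (auto simp: dbar_iff)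
  have "l2ip (cf (f - f') K) G = (\<Sum>J | card J = q. \<Sum>j\<in>UNIV. wedge_coeff j J K * - l2ip (cf (u - u') J) (dbarT j G))"
    if K: "card K = Suc q" and G: "cc_smooth G" for K G
  proof -
    have "l2ip (cf (f - f') K) G = l2ip (cf f K) G - l2ip (cf f' K) G"
      unfolding cf_diff using v G by (intro l2ip_diff_left cf_L2f cc_smooth_L2f)
    also have "\<dots> = (\<Sum>J | card J = q. \<Sum>j\<in>UNIV. wedge_coeff j J K * - l2ip (cf u J) (dbarT j G)) -
        (\<Sum>J | card J = q. \<Sum>j\<in>UNIV. wedge_coeff j J K * - l2ip (cf u' J) (dbarT j G))"
      using assms K G by (simp add: dbar_iff)
    also have "\<dots> = (\<Sum>J | card J = q. \<Sum>j\<in>UNIV. wedge_coeff j J K * - l2ip (cf (u - u') J) (dbarT j G))"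
      unfolding cf_diff l2ip_diff_left[OF cf_L2f[OF v(1)] cf_L2f[OF v(2)] dbarT_L2f[OF G]] sum_subtractf[symmetric]
      by (intro sum.cong refl) (simp add: algebra_simps)
    finally show ?thesis .
  qed
  then show ?thesis using v by (simp add: dbar_iff vecs_diff)
qed

lemma dbar_adj_diff:
  assumes "(u, f) \<in> dbar_adj \<phi> q" "(u', f') \<in> dbar_adj \<phi> q"
  shows "(u - u', f - f') \<in> dbar_adj \<phi> q"
proof -
  have v: "u \<in> vecs (L2_forms \<phi> (Suc q))" "u' \<in> vecs (L2_forms \<phi> (Suc q))" "f \<in> vecs (L2_forms \<phi> q)" "f' \<in> vecs (L2_forms \<phi> q)"
    using assms by (auto simp: dbar_adj_iff)
  have "ip (L2_forms \<phi> (Suc q)) b (u - u') = ip (L2_forms \<phi> q) a (f - f')" if ab: "(a, b) \<in> dbar \<phi> q" for a b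
  proof -
    have "a \<in> vecs (L2_forms \<phi> q)" "b \<in> vecs (L2_forms \<phi> (Suc q))" using ab by (auto simp: dbar_iff)
    then show ?thesis using assms ab v by (simp add: dbar_adj_iff ip_diff_right)
  qed
  then show ?thesis using v by (simp add: dbar_adj_iff vecs_diff)
qed

lemma laplacian_diff:
  assumes "(u, w) \<in> complex_laplacian \<phi> (Suc q)" "(u', w') \<in> complex_laplacian \<phi> (Suc q)"
  shows "(u - u', w - w') \<in> complex_laplacian \<phi> (Suc q)"
proof -
  obtain a b f v where 1: "w = a + b" "(u, f) \<in> dbar \<phi> (Suc q)" "(f, b) \<in> dbar_adj \<phi> (Suc q)"
    "(u, v) \<in> dbar_adj \<phi> q" "(v, a) \<in> dbar \<phi> q"
    using assms(1) by (auto simp: complex_laplacian_def)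
  obtain a' b' f' v' where 2: "w' = a' + b'" "(u', f') \<in> dbar \<phi> (Suc q)" "(f', b') \<in> dbar_adj \<phi> (Suc q)"
    "(u', v') \<in> dbar_adj \<phi> q" "(v', a') \<in> dbar \<phi> q"
    using assms(2) by (auto simp: complex_laplacian_def)
  have "w - w' = (a - a') + (b - b')" using 1 2 by simp
  moreover have "(u - u', f - f') \<in> dbar \<phi> (Suc q)" "(f - f', b - b') \<in> dbar_adj \<phi> (Suc q)"
    "(u - u', v - v') \<in> dbar_adj \<phi> q" "(v - v', a - a') \<in> dbar \<phi> q"
    using 1 2 by (auto intro: dbar_diff dbar_adj_diff)
  ultimately show ?thesis unfolding complex_laplacian_def by auto
qed

text \<open>In complex notation this is d/dzbar_j + (1/2) d\<phi>/dzbar_j, the conjugate of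
  d/dzbar_j under exp (- \<phi>/2); its formal adjoint is - \<open>dbarT j\<close>.\<close>

definition dbarN :: "'n \<Rightarrow> ((complex, 'n) vec \<Rightarrow> complex) \<Rightarrow> (complex, 'n) vec \<Rightarrow> complex" where
  "dbarN j g z = 1 / 2 * (cov (X j) g z + \<i> * cov (Y j) g z)"

lemma dbarN_L2f: "cc_smooth g \<Longrightarrow> L2f (dbarN j g)"
  unfolding dbarN_def[abs_def] by (intro L2f_cmult L2f_add cc_smooth_L2f cc_smooth_cov axis_Basis)

lemma dbarN_adjoint:
  assumes g: "cc_smooth g" and h: "cc_smooth h"
  shows "l2ip (dbarN j g) h = - l2ip g (dbarT j h)"
proof -
  have L: "L2f g" "L2f h" "L2f (cov b g)" "L2f (cov b h)" if "b \<in> Basis" for b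
    using g h that by (auto intro!: cc_smooth_L2f cc_smooth_cov)
  have "l2ip (dbarN j g) h = 1 / 2 * (l2ip (cov (X j) g) h + \<i> * l2ip (cov (Y j) g) h)"
    unfolding dbarN_def[abs_def] l2ip_cmult_left
    by (subst l2ip_add_left) (simp_all add: L(2)[OF axis_Basis(1)] L(3) L2f_cmult l2ip_cmult_left)
  also have "\<dots> = - (1 / 2 * (l2ip g (cov (X j) h) + \<i> * l2ip g (cov (Y j) h)))"
    by (simp add: cov_by_parts[OF cc_smoothD[OF g] h] algebra_simps)
  also have "1 / 2 * (l2ip g (cov (X j) h) + \<i> * l2ip g (cov (Y j) h)) = l2ip g (dbarT j h)"
  proof -
    have "dbarT j h = (\<lambda>z. 1 / 2 * (cov (X j) h z - \<i> * cov (Y j) h z))"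
      by (simp add: dbarT_def fun_eq_iff)
    then have "l2ip g (dbarT j h) = cnj (1 / 2) * l2ip g (\<lambda>z. cov (X j) h z - \<i> * cov (Y j) h z)"
      by (simp only: l2ip_cmult_right)
    also have "l2ip g (\<lambda>z. cov (X j) h z - \<i> * cov (Y j) h z) = l2ip g (cov (X j) h) + \<i> * l2ip g (cov (Y j) h)"
      using l2ip_diff_right[OF L(1)[OF axis_Basis(1)] L(4)[OF axis_Basis(1)] L2f_cmult[OF L(4)[OF axis_Basis(2)], of \<i>], of j j]
      by (simp add: l2ip_cmult_right)
    finally show ?thesis by simp
  qed
  finally show ?thesis .
qed

lemma nsq_dbar_le:
  assumes g: "cc_smooth g" and M: "\<And>b. b \<in> Basis \<Longrightarrow> nsq (cov b g) \<le> M"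
  shows "nsq (dbarT j g) \<le> M" "nsq (dbarN j g) \<le> M"
proof -
  have L: "L2f (cov (X j) g)" "L2f (\<lambda>z. \<i> * cov (Y j) g z)"
    by (intro L2f_cmult cc_smooth_L2f cc_smooth_cov g axis_Basis)+
  have n: "nsq (\<lambda>z. \<i> * cov (Y j) g z) = nsq (cov (Y j) g)" by (simp add: nsq_cmult)
  have "nsq (\<lambda>z. cov (X j) g z - \<i> * cov (Y j) g z) \<le> 2 * M + 2 * M"
    by (rule order_trans[OF nsq_diff_le[OF L]]) (unfold n, intro add_mono mult_left_mono M, auto)
  moreover have "dbarT j g = (\<lambda>z. 1 / 2 * (cov (X j) g z - \<i> * cov (Y j) g z))" by (simp add: dbarT_def fun_eq_iff)
  then have "nsq (dbarT j g) = 1 / 4 * nsq (\<lambda>z. cov (X j) g z - \<i> * cov (Y j) g z)"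
    by (simp only: nsq_cmult) (simp add: norm_divide power_divide)
  ultimately show "nsq (dbarT j g) \<le> M" by simp
  have "nsq (\<lambda>z. cov (X j) g z + \<i> * cov (Y j) g z) \<le> 2 * M + 2 * M"
    by (rule order_trans[OF nsq_add_le[OF L]]) (unfold n, intro add_mono mult_left_mono M, auto)
  moreover have "nsq (dbarN j g) = 1 / 4 * nsq (\<lambda>z. cov (X j) g z + \<i> * cov (Y j) g z)"
    unfolding dbarN_def[abs_def] nsq_cmult by (simp add: norm_divide power_divide)
  ultimately show "nsq (dbarN j g) \<le> M" by simp
qed

text \<open>On smooth coefficients the distributional image is the classical one, by integration by
  parts. Together with \<open>dbar_adj_single\<close> this places forms with a single test
  coefficient in the domains of both \<open>dbar\<close> and its adjoint, with explicit
  images.\<close>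

lemma dbar_single:
  assumes K: "card K = q" and G: "cc_smooth G"
  shows "(mkform q (\<lambda>J. if J = K then G else (\<lambda>z. 0)),
    mkform (Suc q) (\<lambda>J z. \<Sum>j\<in>UNIV. wedge_coeff j K J * dbarN j G z)) \<in> dbar \<phi> q"
  unfolding dbar_iff
proof (intro conjI allI impI)
  show "mkform q (\<lambda>J. if J = K then G else (\<lambda>z. 0)) \<in> vecs (L2_forms \<phi> q)"
    by (intro mkform_vecs) (simp add: cc_smooth_L2f G L2f_zero)
  show "mkform (Suc q) (\<lambda>J z. \<Sum>j\<in>UNIV. wedge_coeff j K J * dbarN j G z) \<in> vecs (L2_forms \<phi> (Suc q))"
    by (intro mkform_vecs L2f_sum L2f_cmult dbarN_L2f G)
  fix K' :: "'n set" and G' :: "(complex, 'n) vec \<Rightarrow> complex" assume K': "card K' = Suc q" and G': "cc_smooth G'"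
  have "l2ip (cf (mkform (Suc q) (\<lambda>J z. \<Sum>j\<in>UNIV. wedge_coeff j K J * dbarN j G z)) K') G' =
      cnj (l2ip G' (\<lambda>z. \<Sum>j\<in>UNIV. wedge_coeff j K K' * dbarN j G z))"
    using K' by (simp add: cf_mkform l2ip_cnj[of _ G'])
  also have "\<dots> = (\<Sum>j\<in>UNIV. wedge_coeff j K K' * l2ip (dbarN j G) G')"
    by (subst l2ip_sum_right) (simp_all add: cc_smooth_L2f G' dbarN_L2f G l2ip_cnj[of _ G'])
  also have "\<dots> = (\<Sum>J | card J = q. if J = K then (\<Sum>j\<in>UNIV. wedge_coeff j K K' * - l2ip G (dbarT j G')) else 0)"
    using K by (simp add: dbarN_adjoint[OF G G'])
  also have "\<dots> = (\<Sum>J | card J = q. \<Sum>j\<in>UNIV. wedge_coeff j J K' * - l2ip (cf (mkform q (\<lambda>J. if J = K then G else (\<lambda>z. 0))) J) (dbarT j G'))"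
    by (rule sum.cong) (auto simp: cf_mkform)
  finally show "l2ip (cf (mkform (Suc q) (\<lambda>J z. \<Sum>j\<in>UNIV. wedge_coeff j K J * dbarN j G z)) K') G' =
    (\<Sum>J | card J = q. \<Sum>j\<in>UNIV. wedge_coeff j J K' * - l2ip (cf (mkform q (\<lambda>J. if J = K then G else (\<lambda>z. 0))) J) (dbarT j G'))" .
qed

lemma fsq_mkform_le:
  assumes f: "\<And>j::'n. L2f (f j)" and M: "\<And>j. nsq (f j) \<le> M" and c: "\<And>J j. cmod (c J j) \<le> 1"
  shows "fsq q (mkform q (\<lambda>J z. \<Sum>j\<in>UNIV. c J j * f j z)) \<le> real (card (UNIV :: 'n set set)) * ((real CARD('n))\<^sup>2 * M)"
proof -
  have M0: "M \<ge> 0" using M[of undefined] nsq_nonneg order_trans by blast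
  have one: "nsq (\<lambda>z. \<Sum>j\<in>UNIV. c J j * f j z) \<le> (real CARD('n))\<^sup>2 * M" for J
  proof -
    have "nsq (\<lambda>z. \<Sum>j\<in>UNIV. c J j * f j z) \<le> real CARD('n) * (\<Sum>j\<in>UNIV. nsq (\<lambda>z. c J j * f j z))"
      using nsq_sum_le[of "UNIV :: 'n set" "\<lambda>j z. c J j * f j z"] L2f_cmult[OF f] by simp
    also have "\<dots> \<le> real CARD('n) * (\<Sum>j\<in>(UNIV::'n set). 1 * M)"
      unfolding nsq_cmult using c M nsq_nonneg by (intro mult_left_mono sum_mono mult_mono power_le_one) auto
    finally show ?thesis by (simp add: power2_eq_square)
  qed
  have "fsq q (mkform q (\<lambda>J z. \<Sum>j\<in>UNIV. c J j * f j z)) = (\<Sum>J | card J = q. nsq (\<lambda>z. \<Sum>j\<in>UNIV. c J j * f j z))"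
    unfolding fsq_def cf_mkform by (rule sum.cong) auto
  also have "\<dots> \<le> (\<Sum>J\<in>(UNIV :: 'n set set). nsq (\<lambda>z. \<Sum>j\<in>UNIV. c J j * f j z))"
    by (rule sum_mono2) (auto simp: nsq_nonneg)
  also have "\<dots> \<le> (\<Sum>J\<in>(UNIV :: 'n set set). (real CARD('n))\<^sup>2 * M)" by (intro sum_mono one)
  finally show ?thesis by simp
qed

lemma cmod_wedge_coeff_le: "cmod (wedge_coeff j J K) \<le> 1"
  by (simp add: wedge_coeff_def norm_power)

text \<open>Here W is the resolvent applied to d, and D, S are the two images that make up the form
  energy of d. Pairing the equation with W shows that the energy of W is small when W is small;
  pairing it with d bounds d by the energies of W and d through Cauchy-Schwarz. So d itself is small
  when W is small and d has bounded norm and energy.\<close>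

lemma resolvent_estimate:
  assumes W: "(W, B) \<in> complex_laplacian \<phi> (Suc q)" and d: "d = B - (\<lambda>z. \<mu> *s W z)"
    and D: "(d, D) \<in> dbar \<phi> (Suc q)" "fsq (Suc (Suc q)) D \<le> M" and S: "(d, S) \<in> dbar_adj \<phi> q" "fsq q S \<le> M"
  shows "fsq (Suc q) d \<le> 2 * sqrt ((sqrt (fsq (Suc q) W * fsq (Suc q) d) + cmod \<mu> * fsq (Suc q) W) * M) +
    cmod \<mu> * sqrt (fsq (Suc q) W * fsq (Suc q) d)"
proof -
  obtain a b f v where 1: "B = a + b" "(W, f) \<in> dbar \<phi> (Suc q)" "(f, b) \<in> dbar_adj \<phi> (Suc q)"
    "(W, v) \<in> dbar_adj \<phi> q" "(v, a) \<in> dbar \<phi> q"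
    using W by (auto simp: complex_laplacian_def)
  let ?F = "L2_forms \<phi> (Suc q)"
  have vs: "W \<in> vecs ?F" "a \<in> vecs ?F" "b \<in> vecs ?F" "d \<in> vecs ?F" "f \<in> vecs (L2_forms \<phi> (Suc (Suc q)))" "v \<in> vecs (L2_forms \<phi> q)"
    "D \<in> vecs (L2_forms \<phi> (Suc (Suc q)))" "S \<in> vecs (L2_forms \<phi> q)"
    using 1 D S by (auto simp: dbar_iff dbar_adj_iff)
  \<comment> \<open>The bound for the energy of W: the equation paired with W leaves (d, W) and
    \<mu> times the squared norm of W.\<close>
  define \<epsilon> where "\<epsilon> = sqrt (fsq (Suc q) W * fsq (Suc q) d) + cmod \<mu> * fsq (Suc q) W"
  have M0: "M \<ge> 0" using S(2) fsq_nonneg order_trans by blast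
  have Bd: "B = d + (\<lambda>z. \<mu> *s W z)" by (simp add: d)
  have "ip ?F W b = ip (L2_forms \<phi> (Suc (Suc q))) f f" using 1(2,3) by (simp add: dbar_adj_iff)
  then have fb: "ip ?F b W = of_real (fsq (Suc (Suc q)) f)"
    unfolding ip_cnj[where v = b] using ip_self[OF vs(5)] by simp
  have va: "ip ?F a W = of_real (fsq q v)" using 1(4,5) ip_self[OF vs(6)] by (simp add: dbar_adj_iff)
  have "ip ?F B W = of_real (fsq (Suc (Suc q)) f + fsq q v)"
    unfolding 1(1) by (simp add: ip_add_left vs fb va)
  moreover have "ip ?F B W = ip ?F d W + \<mu> * of_real (fsq (Suc q) W)"
    unfolding Bd by (simp add: ip_add_left vs vecs_scale ip_scale_left ip_self)
  ultimately have "cmod (of_real (fsq (Suc (Suc q)) f + fsq q v)) = cmod (ip ?F d W + \<mu> * of_real (fsq (Suc q) W))"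
    by simp
  also have "\<dots> \<le> cmod (ip ?F d W) + cmod (\<mu> * of_real (fsq (Suc q) W))" by (rule norm_triangle_ineq)
  also have "\<dots> \<le> \<epsilon>"
    unfolding \<epsilon>_def norm_mult norm_of_real using ip_bound[OF vs(4,1)] fsq_nonneg[of "Suc q" W]
    by (simp add: mult.commute)
  finally have sum: "fsq (Suc (Suc q)) f + fsq q v \<le> \<epsilon>"
    unfolding norm_of_real by simp
  then have le: "fsq (Suc (Suc q)) f \<le> \<epsilon>" "fsq q v \<le> \<epsilon>"
    using fsq_nonneg[of "Suc (Suc q)" f] fsq_nonneg[of q v] by linarith+
  have "ip (L2_forms \<phi> (Suc (Suc q))) D f = ip ?F d b" using D(1) 1(3) by (simp add: dbar_adj_iff)
  then have "cmod (ip ?F b d) = cmod (ip (L2_forms \<phi> (Suc (Suc q))) D f)"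
    unfolding ip_cnj[where v = b] by simp
  also have "\<dots> \<le> sqrt (M * \<epsilon>)"
    using D(2) le M0 fsq_nonneg by (intro order_trans[OF ip_bound[OF vs(7,5)]] real_sqrt_le_mono mult_mono) auto
  finally have bd: "cmod (ip ?F b d) \<le> sqrt (\<epsilon> * M)" by (simp add: mult.commute)
  have "ip ?F a d = ip (L2_forms \<phi> q) v S" using S(1) 1(5) by (simp add: dbar_adj_iff)
  then have "cmod (ip ?F a d) = cmod (ip (L2_forms \<phi> q) v S)" by simp
  also have "\<dots> \<le> sqrt (\<epsilon> * M)"
    using S(2) le fsq_nonneg order_trans[OF fsq_nonneg le(2)]
    by (intro order_trans[OF ip_bound[OF vs(6,8)]] real_sqrt_le_mono mult_mono) auto
  finally have ad: "cmod (ip ?F a d) \<le> sqrt (\<epsilon> * M)" .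
  \<comment> \<open>The first two pairings are rewritten as (v, S) and (b, d), the latter being the
    conjugate of (D, f); both are products of energies. The third is small because W is.\<close>
  have "of_real (fsq (Suc q) d) = ip ?F a d + ip ?F b d - \<mu> * ip ?F W d"
    unfolding ip_self[OF vs(4), symmetric]
    by (subst d) (simp add: 1(1) ip_diff_left ip_add_left ip_scale_left vs vecs_add vecs_scale)
  then have "cmod (of_real (fsq (Suc q) d)) \<le> cmod (ip ?F a d) + cmod (ip ?F b d) + cmod (\<mu> * ip ?F W d)"
    by (metis norm_triangle_le_diff norm_triangle_ineq add_mono order_refl)
  also have "\<dots> \<le> sqrt (\<epsilon> * M) + sqrt (\<epsilon> * M) + cmod \<mu> * sqrt (fsq (Suc q) W * fsq (Suc q) d)"
    unfolding norm_mult by (intro add_mono mult_left_mono ip_bound vs ad bd) auto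
  finally show ?thesis unfolding norm_of_real \<epsilon>_def[symmetric] using fsq_nonneg[of "Suc q" d] by simp
qed

theorem compact_resolvent_imp_local_energy:
  assumes q: "1 \<le> q" "q \<le> CARD('n)" and comp: "compact_resolvent (L2_forms \<phi> q) (complex_laplacian \<phi> q)"
  shows "filterlim local_energy at_top at_infinity"
proof (rule ccontr)
  assume "\<not> filterlim local_energy at_top at_infinity"
  then obtain Z where Z: "\<not> eventually (\<lambda>z. Z \<le> local_energy z) at_infinity"
    by (auto simp: filterlim_at_top)
  then have "\<forall>b. \<exists>z. norm z \<ge> b \<and> local_energy z \<le> Z"
    unfolding eventually_at_infinity by (meson linear)
  then obtain pick where pick: "\<And>b. norm (pick b) \<ge> b" "\<And>b. local_energy (pick b) \<le> Z" by metis
  \<comment> \<open>Each centre exceeds the previous one in norm by at least 3, so the unit balls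
    around them are pairwise disjoint.\<close>
  define z where "z = rec_nat (pick 0) (\<lambda>k p. pick (norm p + 3))"
  have zS: "z (Suc k) = pick (norm (z k) + 3)" for k by (simp add: z_def)
  have zZ: "local_energy (z k) \<le> Z" for k by (cases k) (auto simp: z_def pick)
  have zn: "norm (z l) \<ge> norm (z k) + 3" if "k < l" for k l
    using that
  proof (induction l)
    case (Suc l)
    have s: "norm (z (Suc l)) \<ge> norm (z l) + 3" unfolding zS by (rule pick)
    show ?case
    proof (cases "k = l")
      case False
      then show ?thesis using Suc s by simp
    qed (use s in simp)
  qed simp
  obtain N K where N: "N > 0" and K: "K \<ge> 0" and loc: "\<And>c0. \<exists>G. cc_smooth G \<and> (\<forall>x. x \<notin> ball c0 1 \<longrightarrow> G x = 0) \<and> nsq G = N \<and>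
    (\<forall>b\<in>Basis. nsq (cov b G) \<le> K * (1 + local_energy c0))"
    using local_test_function by blast
  define P where "P k G \<longleftrightarrow> cc_smooth G \<and> (\<forall>x. x \<notin> ball (z k) 1 \<longrightarrow> G x = 0) \<and> nsq G = N \<and>
    (\<forall>b\<in>Basis. nsq (cov b G) \<le> K * (1 + local_energy (z k)))" for k G
  have "\<exists>G. P k G" for k unfolding P_def by (rule loc)
  then obtain G where PG: "\<And>k. P k (G k)" by metis
  have G: "cc_smooth (G k)" "\<And>x. x \<notin> ball (z k) 1 \<Longrightarrow> G k x = 0" "nsq (G k) = N" for k
    using PG[of k] by (auto simp: P_def)
  have GM: "nsq (cov b (G k)) \<le> K * (1 + Z)" if "b \<in> Basis" for b k
  proof -
    have "nsq (cov b (G k)) \<le> K * (1 + local_energy (z k))" using PG[of k] that by (simp add: P_def)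
    also have "\<dots> \<le> K * (1 + Z)" using zZ K by (intro mult_left_mono) auto
    finally show ?thesis .
  qed
  define d where "d k l x = G k x - G l x" for k l x
  have dc: "cc_smooth (d k l)" for k l unfolding d_def[abs_def] by (intro cc_smooth_diff G)
  have dN: "nsq (d k l) = 2 * N" if "k < l" for k l
  proof -
    have disj: "G k x = 0 \<or> G l x = 0" for x
    proof (rule ccontr)
      assume "\<not> (G k x = 0 \<or> G l x = 0)"
      then have "x \<in> ball (z k) 1" "x \<in> ball (z l) 1" using G(2) by blast+
      then have "dist (z l) (z k) < 2" using dist_triangle_less_add[of "z l" x 1 "z k" 1] by (simp add: dist_commute)
      then show False using zn[OF that] norm_triangle_ineq2[of "z l" "z k"] by (simp add: dist_norm)
    qed
    have "(cmod (d k l x))\<^sup>2 = (cmod (G k x))\<^sup>2 + (cmod (G l x))\<^sup>2" for x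
      using disj[of x] by (auto simp: d_def)
    then have "nsq (d k l) = nsq (G k) + nsq (G l)"
      using cc_smooth_L2f[OF G(1)] by (simp add: nsq_def L2f_def)
    then show ?thesis by (simp add: G(3))
  qed
  \<comment> \<open>The factor 4 comes from nsq (a - b) \<le> 2 nsq a + 2 nsq b applied to the two
    covariant derivatives.\<close>
  define M where "M = 4 * (K * (1 + Z))"
  have dM: "nsq (cov b (d k l)) \<le> M" if b: "b \<in> Basis" for b k l
  proof -
    have "cov b (d k l) = (\<lambda>x. cov b (G k) x - cov b (G l) x)"
      unfolding d_def[abs_def] using cov_diff[OF cc_smoothD[OF G(1)] cc_smoothD[OF G(1)]] by blast
    then have "nsq (cov b (d k l)) \<le> 2 * nsq (cov b (G k)) + 2 * nsq (cov b (G l))"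
      using nsq_diff_le[OF cc_smooth_L2f[OF cc_smooth_cov[OF G(1) b]] cc_smooth_L2f[OF cc_smooth_cov[OF G(1) b]]] by simp
    also have "\<dots> \<le> 2 * (K * (1 + Z)) + 2 * (K * (1 + Z))" by (intro add_mono mult_left_mono GM b) auto
    finally show ?thesis by (simp add: M_def)
  qed
  \<comment> \<open>Since q \<ge> 1, the Laplacian has both of its summands; q \<le> n provides a
    multiindex for the single nonzero coefficient.\<close>
  obtain p where p: "q = Suc p" using q(1) by (cases q) auto
  obtain J0 :: "'n set" where J0: "card J0 = Suc p"
    using obtain_subset_with_card_n[OF q(2)] p by metis
  let ?F = "L2_forms \<phi> (Suc p)"
  define e where "e g = mkform (Suc p) (\<lambda>J. if J = J0 then g else (\<lambda>z. 0))" for g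
  have ev: "e g \<in> vecs ?F" if "cc_smooth g" for g
    unfolding e_def by (intro mkform_vecs) (simp add: cc_smooth_L2f that L2f_zero)
  have eN: "fsq (Suc p) (e g) = nsq g" for g
  proof -
    have "fsq (Suc p) (e g) = (\<Sum>J | card J = Suc p. if J = J0 then nsq g else 0)"
      unfolding fsq_def e_def cf_mkform by (rule sum.cong) (auto simp: nsq_def)
    then show ?thesis using J0 by simp
  qed
  have ed: "e (d k l) = e (G k) - e (G l)" for k l
    by (simp add: e_def mkform_def d_def fun_eq_iff vec_eq_iff algebra_simps)
  \<comment> \<open>A crude bound: all multiindices are counted, and each coefficient is a sum of n
    terms with factors of modulus at most 1.\<close>
  define M' where "M' = real (card (UNIV :: 'n set set)) * ((real CARD('n))\<^sup>2 * M)"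
  have D: "\<exists>D. (e (d k l), D) \<in> dbar \<phi> (Suc p) \<and> fsq (Suc (Suc p)) D \<le> M'" for k l
  proof -
    have "fsq (Suc (Suc p)) (mkform (Suc (Suc p)) (\<lambda>J z. \<Sum>j\<in>UNIV. wedge_coeff j J0 J * dbarN j (d k l) z)) \<le> M'"
      unfolding M'_def by (rule fsq_mkform_le[OF dbarN_L2f[OF dc] nsq_dbar_le(2)[OF dc dM] cmod_wedge_coeff_le])
    then show ?thesis using dbar_single[OF J0 dc] unfolding e_def by blast
  qed
  have S: "\<exists>S. (e (d k l), S) \<in> dbar_adj \<phi> p \<and> fsq p S \<le> M'" for k l
  proof -
    have "fsq p (mkform p (\<lambda>J z. \<Sum>j\<in>UNIV. wedge_coeff j J J0 * (- dbarT j (d k l) z))) \<le> M'"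
      unfolding M'_def
      by (rule fsq_mkform_le[OF L2f_minus[OF dbarT_L2f[OF dc]] _ cmod_wedge_coeff_le])
         (use nsq_dbar_le(1)[OF dc dM] in \<open>simp add: nsq_minus\<close>)
    then show ?thesis using dbar_adj_single[OF J0 dc] unfolding e_def by blast
  qed
  obtain \<mu> where c: "compact_op ?F (Defs.resolvent ?F (complex_laplacian \<phi> (Suc p)) \<mu>)"
    using comp unfolding compact_resolvent_iff p by blast
  then have "\<exists>w. (e (G k), w) \<in> Defs.resolvent ?F (complex_laplacian \<phi> (Suc p)) \<mu>" for k
    using ev[OF G(1)] by (auto simp: compact_op_def bounded_op_def)
  then obtain w where w: "\<And>k. (e (G k), w k) \<in> Defs.resolvent ?F (complex_laplacian \<phi> (Suc p)) \<mu>" by metis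
  have "\<forall>k. (e (G k), w k) \<in> Defs.resolvent ?F (complex_laplacian \<phi> (Suc p)) \<mu> \<and> hnorm ?F (e (G k)) \<le> sqrt N"
    using w by (simp add: hnorm_forms eN G(3))
  then obtain r v where r: "strict_mono r" "v \<in> vecs ?F" "(\<lambda>k. hnorm ?F (w (r k) - v)) \<longlonglongrightarrow> 0"
    using c[unfolded compact_op_def, THEN conjunct2, rule_format, of "\<lambda>k. e (G k)" w "sqrt N"] by blast
  have "\<exists>B. (w k, B) \<in> complex_laplacian \<phi> (Suc p) \<and> e (G k) = B - (\<lambda>z. \<mu> *s w k z)" for k
    using w[of k] unfolding Defs.resolvent_def scale_forms by auto
  then obtain B where B: "\<And>k. (w k, B k) \<in> complex_laplacian \<phi> (Suc p)" "\<And>k. e (G k) = B k - (\<lambda>z. \<mu> *s w k z)" by metis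
  have wv: "w k \<in> vecs ?F" for k
    using B(1)[of k] by (auto simp: complex_laplacian_def dbar_iff)
  \<comment> \<open>Consecutive members of the subsequence suffice: W k tends to 0, whereas the
    difference of the two forms keeps the squared norm 2 N.\<close>
  define W where "W k = w (r k) - w (r (Suc k))" for k
  define x where "x k = fsq (Suc p) (W k)" for k
  \<comment> \<open>The estimate is applied to the difference of two test forms, whose squared norm
    2 N and energy bound M' are fixed; the right side depends on k only through x k and vanishes in
    the limit.\<close>
  have est: "2 * N \<le> 2 * sqrt ((sqrt (x k * (2 * N)) + cmod \<mu> * x k) * M') + cmod \<mu> * sqrt (x k * (2 * N))" for k
  proof -
    have rk: "r k < r (Suc k)" using r(1) by (simp add: strict_mono_def)
    let ?d = "d (r k) (r (Suc k))"
    have WB: "(W k, B (r k) - B (r (Suc k))) \<in> complex_laplacian \<phi> (Suc p)"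
      unfolding W_def by (intro laplacian_diff B)
    have eq: "e ?d = (B (r k) - B (r (Suc k))) - (\<lambda>z. \<mu> *s W k z)"
      unfolding ed B(2) W_def by (simp add: fun_eq_iff vec_eq_iff algebra_simps)
    obtain D' where D': "(e ?d, D') \<in> dbar \<phi> (Suc p)" "fsq (Suc (Suc p)) D' \<le> M'" using D by blast
    obtain S' where S': "(e ?d, S') \<in> dbar_adj \<phi> p" "fsq p S' \<le> M'" using S by blast
    show ?thesis
      using resolvent_estimate[OF WB eq D' S'] unfolding eN dN[OF rk] x_def .
  qed
  have x0: "x \<longlonglongrightarrow> 0"
  proof (rule tendsto_sandwich[OF always_eventually always_eventually tendsto_const])
    let ?h = "\<lambda>k. (hnorm ?F (w (r k) - v))\<^sup>2"
    have hh: "?h k = fsq (Suc p) (w (r k) - v)" for k by (simp add: hnorm_forms fsq_nonneg)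
    show "\<forall>k. 0 \<le> x k" by (simp add: x_def fsq_nonneg)
    show "\<forall>k. x k \<le> 2 * ?h k + 2 * ?h (Suc k)"
    proof
      fix k
      have "W k = (w (r k) - v) - (w (r (Suc k)) - v)" by (simp add: W_def)
      then show "x k \<le> 2 * ?h k + 2 * ?h (Suc k)"
        unfolding x_def hh using fsq_diff_le[OF vecs_diff[OF wv r(2)] vecs_diff[OF wv r(2)]] by simp
    qed
    have "(\<lambda>k. 2 * ?h k + 2 * ?h (Suc k)) \<longlonglongrightarrow> 2 * 0\<^sup>2 + 2 * 0\<^sup>2"
      by (intro tendsto_intros r(3) LIMSEQ_Suc)
    then show "(\<lambda>k. 2 * ?h k + 2 * ?h (Suc k)) \<longlonglongrightarrow> 0" by simp
  qed
  have "(\<lambda>k. 2 * sqrt ((sqrt (x k * (2 * N)) + cmod \<mu> * x k) * M') + cmod \<mu> * sqrt (x k * (2 * N))) \<longlonglongrightarrow>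
      2 * sqrt ((sqrt (0 * (2 * N)) + cmod \<mu> * 0) * M') + cmod \<mu> * sqrt (0 * (2 * N))"
    by (intro tendsto_intros x0)
  then have "2 * N \<le> 2 * sqrt ((sqrt (0 * (2 * N)) + cmod \<mu> * 0) * M') + cmod \<mu> * sqrt (0 * (2 * N))"
    by (rule LIMSEQ_le_const) (use est in blast)
  then show False using N by simp
qed

end

theorem theorem4p1:
  fixes \<phi> :: "(complex, 'n::{finite,linorder}) vec \<Rightarrow> real"
  assumes "smooth \<phi>" and "plurisubharmonic \<phi>"
  shows "(compact_resolvent (L2_forms \<phi> CARD('n)) (complex_laplacian \<phi> CARD('n)) \<longleftrightarrow>
          compact_resolvent L2_functions (magnetic_schroedinger \<phi> (\<lambda>z. 2 * tr_hessian \<phi> z))) \<and>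
         ((\<exists>q. 1 \<le> q \<and> q \<le> CARD('n) \<and>
            compact_resolvent (L2_forms \<phi> q) (complex_laplacian \<phi> q)) \<longrightarrow>
          filterlim (\<lambda>z. LINT w:ball z 1|lborel. (tr_hessian \<phi> w)\<^sup>2) at_top at_infinity)"
proof -
  interpret psh_form \<phi> by unfold_locales (rule assms)+
  show ?thesis
    using compact_resolvent_top_iff compact_resolvent_imp_local_energy
    unfolding local_energy_def[abs_def] by blast
qed

end
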